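(* Let $t$ be a positive integer. Then as $n\to\infty$, the random variable $\widehat N^{\mathcal{DD}}_{t,2n}$ is asymptotically normally distributed with mean \[ \widehat\mu_{t,2n}=\frac{\sqrt{3n}}{\pi}+\frac{3}{2\pi^2}-\frac t4+\frac14-\frac{\delta_{2|t}}{8}+O\left(n^{-\frac12}\right) \] and variance \[ \widehat\sigma^2_{t,2n}=\frac{(\pi^2-6)}{2\pi^3}\sqrt{3n}-\frac{9}{\pi^4}+\frac{3}{4\pi^2}+\frac{\delta_{2|t}}{32}+O\left(n^{-\frac12}\right). \]
   Context: $\delta_{2|t}$ is $1$ if $t$ is even and $0$ if $t$ is odd. $\widehat N^{\mathcal{DD}}_{t,2n}$ is the random variable taking the value $\widehat n_t(\lambda\lambda)$ when $\lambda\lambda$ is chosen uniformly at random from the (finite) set of doubled distinct partitions of $2n$. "Asymptotically normally distributed with mean $\widehat\mu_{t,2n}$ and variance $\widehat\sigma_{t,2n}^2$" means: the mean and variance of $\widehat N^{\mathcal{DD}}_{t,2n}$ satisfy the stated asymptotic expansions as $n\to\infty$, and $(\widehat N^{\mathcal{DD}}_{t,2n}-\widehat\mu_{t,2n})/\widehat\sigma_{t,2n}$ converges in distribution to the standard normal distribution. A partition is a finite weakly decreasing sequence of positive integers; $|\lambda|$ is the sum of its parts. The hook of a box in a Young diagram consists of the box itself and all boxes to its right in the same row or below it in the same column; a $t$-hook is a hook with exactly $t$ boxes. $\widehat n_t(\lambda)$ denotes the number of $t$-hooks of $\lambda$ above the main diagonal, i.e. the number of boxes $(i,j)$ (row $i$,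 column $j$) with $j>i$ whose hook has exactly $t$ boxes. A strict partition is a partition into distinct parts. For a strict partition $\lambda=(\lambda_1>\dots>\lambda_\ell)$, the doubled distinct partition $\lambda\lambda$ is obtained from the shifted Young diagram of $\lambda$ (row $i$ moved right by $i-1$ boxes) by adding $\lambda_i$ boxes to the $(i-1)$-st column for each $i$; equivalently, $\lambda\lambda$ is the partition of $2|\lambda|$ with Frobenius symbol $\begin{pmatrix}\lambda_1&\cdots&\lambda_\ell\\ \lambda_1-1&\cdots&\lambda_\ell-1\end{pmatrix}$ (the Frobenius symbol of $\mu$ with Durfee square of side $s$ has top row $\mu_i-i$ and bottom row $\mu'_i-i$, $1\le i\le s$, where $\mu'$ is the conjugate partition). E.g. $\lambda=(5,4,1)$ gives $\lambda\lambda=(6,6,4,2,2)$. $\mathcal{DD}$ is the set of all doubled distinct partitions. *)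

theory Defs
  imports "HOL-Probability.Probability" "HOL-Library.Landau_Symbols"
begin

section \<open>Partitions, Young diagrams and hooks\<close>

definition is_partition :: "nat list \<Rightarrow> bool" where
  "is_partition \<mu> \<longleftrightarrow> sorted_wrt (\<ge>) \<mu> \<and> 0 \<notin> set \<mu>"

definition is_strict_partition :: "nat list \<Rightarrow> bool" where
  "is_strict_partition \<alpha> \<longleftrightarrow> is_partition \<alpha> \<and> distinct \<alpha>"

text \<open>Rows and columns are numbered from \<open>0\<close>, so the part usually written \<open>\<mu>\<^sub>i\<close> is \<open>\<mu> ! (i - 1)\<close>.\<close>

definition young_diagram :: "nat list \<Rightarrow> (nat \<times> nat) set" where
  "young_diagram \<mu> = {(i, j). i < length \<mu> \<and> j < \<mu> ! i}"

definition hook :: "nat list \<Rightarrow> nat \<Rightarrow> nat \<Rightarrow> (nat \<times> nat) set" where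
  "hook \<mu> i j = {(i', j') \<in> young_diagram \<mu>. (i' = i \<and> j \<le> j') \<or> (j' = j \<and> i \<le> i')}"

definition num_hooks_above :: "nat \<Rightarrow> nat list \<Rightarrow> nat" where
  "num_hooks_above t \<mu> = card {(i, j) \<in> young_diagram \<mu>. i < j \<and> card (hook \<mu> i j) = t}"


section \<open>Doubled distinct partitions\<close>

definition conjugate_part :: "nat list \<Rightarrow> nat \<Rightarrow> nat" where
  "conjugate_part \<mu> j = card {i. (i, j) \<in> young_diagram \<mu>}"

definition durfee :: "nat list \<Rightarrow> nat" where
  "durfee \<mu> = (GREATEST s. {..<s} \<times> {..<s} \<subseteq> young_diagram \<mu>)"

text \<open>Since rows and columns are numbered from \<open>0\<close>, the entries \<open>\<mu>\<^sub>i - i\<close> and \<open>\<mu>'\<^sub>i - i\<close> become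
  \<open>\<mu> ! i - (i + 1)\<close> and \<open>conjugate_part \<mu> i - (i + 1)\<close>. For \<open>i < durfee \<mu>\<close> the subtraction on
  natural numbers does not truncate.\<close>

definition frobenius :: "nat list \<Rightarrow> nat list \<times> nat list" where
  "frobenius \<mu> = (map (\<lambda>i. \<mu> ! i - (i + 1)) [0..<durfee \<mu>],
                  map (\<lambda>i. conjugate_part \<mu> i - (i + 1)) [0..<durfee \<mu>])"

definition is_doubling :: "nat list \<Rightarrow> nat list \<Rightarrow> bool" where
  "is_doubling \<alpha> \<mu> \<longleftrightarrow> is_partition \<mu> \<and> frobenius \<mu> = (\<alpha>, map (\<lambda>x. x - 1) \<alpha>)"

definition doubled_distinct :: "nat list set" where
  "doubled_distinct = {\<mu>. \<exists>\<alpha>. is_strict_partition \<alpha> \<and> is_doubling \<alpha> \<mu>}"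

definition doubled_distinct_of :: "nat \<Rightarrow> nat list set" where
  "doubled_distinct_of m = {\<mu> \<in> doubled_distinct. sum_list \<mu> = m}"


section \<open>The uniform distribution on doubled distinct partitions of a given size\<close>

definition DD_unif :: "nat \<Rightarrow> nat list pmf" where
  "DD_unif m = pmf_of_set (doubled_distinct_of m)"

definition DD_mean :: "nat \<Rightarrow> nat \<Rightarrow> real" where
  "DD_mean t m = measure_pmf.expectation (DD_unif m) (\<lambda>\<mu>. real (num_hooks_above t \<mu>))"

definition DD_variance :: "nat \<Rightarrow> nat \<Rightarrow> real" where
  "DD_variance t m = measure_pmf.variance (DD_unif m) (\<lambda>\<mu>. real (num_hooks_above t \<mu>))"

text \<open>The lemmas below show that \<^const>\<open>pmf_of_set\<close> is applied to a finite, non-empty set whenever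
  \<open>m\<close> is even.\<close>

lemma conjugate_part_eq: "conjugate_part \<mu> j = length (filter (\<lambda>x. j < x) \<mu>)"
  by (simp add: conjugate_part_def young_diagram_def length_filter_conv_card)

lemma durfee_eqI:
  assumes "{..<s} \<times> {..<s} \<subseteq> young_diagram \<mu>" "(s, s) \<notin> young_diagram \<mu>"
  shows "durfee \<mu> = s"
  unfolding durfee_def
proof (rule Greatest_equality)
  fix s' assume *: "{..<s'} \<times> {..<s'} \<subseteq> young_diagram \<mu>"
  show "s' \<le> s"
  proof (rule ccontr)
    assume "\<not> s' \<le> s"
    then have "(s, s) \<in> {..<s'} \<times> {..<s'}" by auto
    with * assms(2) show False by blast
  qed
qed (fact assms(1))

lemma finite_doubled_distinct_of: "finite (doubled_distinct_of m)"
proof (rule finite_subset)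
  have len: "length \<mu> \<le> sum_list \<mu>" if "0 \<notin> set \<mu>" for \<mu> :: "nat list"
    using that by (induction \<mu>) auto
  show "doubled_distinct_of m \<subseteq> {xs. set xs \<subseteq> {..m} \<and> length xs \<le> m}"
  proof
    fix \<mu> assume "\<mu> \<in> doubled_distinct_of m"
    then have "0 \<notin> set \<mu>" "sum_list \<mu> = m"
      by (auto simp: doubled_distinct_of_def doubled_distinct_def is_doubling_def is_partition_def)
    then show "\<mu> \<in> {xs. set xs \<subseteq> {..m} \<and> length xs \<le> m}"
      using len[of \<mu>] member_le_sum_list[of _ \<mu>] by auto
  qed
  show "finite {xs. set xs \<subseteq> {..m} \<and> length xs \<le> m}"
    by (rule finite_lists_length_le) simp
qed

lemma doubled_distinct_of_nonempty: "doubled_distinct_of (2 * n) \<noteq> {}"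
proof (cases n)
  case 0
  have "durfee [] = 0" by (rule durfee_eqI) (auto simp: young_diagram_def)
  then have "is_doubling [] []" "is_strict_partition []"
    by (auto simp: is_doubling_def is_strict_partition_def is_partition_def frobenius_def)
  then have "[] \<in> doubled_distinct_of (2 * n)"
    using 0 by (auto simp: doubled_distinct_of_def doubled_distinct_def)
  then show ?thesis by blast
next
  case (Suc k)
  let ?\<mu> = "Suc n # replicate k (1::nat)"
  have "durfee ?\<mu> = 1"
    by (rule durfee_eqI) (auto simp: young_diagram_def nth_Cons split: nat.splits)
  moreover have "is_partition ?\<mu>"
    by (auto simp: is_partition_def sorted_wrt_iff_nth_less nth_Cons split: nat.splits)
  ultimately have "is_doubling [n] ?\<mu>"
    using Suc by (simp add: is_doubling_def frobenius_def conjugate_part_eq)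
  moreover have "is_strict_partition [n]"
    using Suc by (simp add: is_strict_partition_def is_partition_def)
  moreover have "sum_list ?\<mu> = 2 * n"
    using Suc by (simp add: sum_list_replicate)
  ultimately have "?\<mu> \<in> doubled_distinct_of (2 * n)"
    unfolding doubled_distinct_of_def doubled_distinct_def by blast
  then show ?thesis by blast
qed

lemma "is_doubling [5, 4, 1] [6, 6, 4, 2, 2]"
proof -
  have "durfee [6, 6, 4, 2, 2] = 3"
    by (rule durfee_eqI)
      (auto simp: young_diagram_def nth_Cons numeral_eq_Suc less_Suc_eq split: nat.splits)
  then show ?thesis
    by (simp add: is_doubling_def is_partition_def frobenius_def conjugate_part_eq numeral_3_eq_3
        eval_nat_numeral)
qed

end

theory Submission
  imports Defs "HOL-Complex_Analysis.Complex_Analysis" "HOL-Real_Asymp.Real_Asymp"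
begin

text \<open>The \<open>t\<close>-hooks above the diagonal of a doubled distinct partition correspond to the bars of length \<open>t\<close>
  of the underlying strict partition \<open>S\<close>. Reading \<open>S\<close> as beads on the integers turns these into pairs of
  a bead and a hole at distance \<open>t\<close>. Under the weight \<open>q\<close> to the size of \<open>S\<close> the beads are independent,
  so with \<open>P\<close> the generating function of strict partitions, the bar count has first moment \<open>P A\<close>,
  second factorial moment \<open>P (A\<^sup>2 - C)\<close> and probability generating function close to
  \<open>P exp ((w - 1) A - (w - 1)\<^sup>2 C / 2)\<close>, where \<open>A\<close> and \<open>C\<close> are rational functions of \<open>q\<close>.

  For \<open>q = exp (- z)\<close> one has \<open>log P = pi\<^sup>2 / (12 z) - ln 2 / 2 + z / 24 + O(z\<^sup>2)\<close>. On the circle through the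
  saddle point, \<open>z = \<eta> (1 + i s)\<close>, the integrand of the coefficient integral therefore becomes, exactly,
  the kernel \<open>exp (- \<nu> s\<^sup>2 / (1 + i s))\<close> times a slowly varying factor. Its moments in
  \<open>b = 1 / (1 + i s) - 1\<close> obey a recursion from integration by parts, which gives the mean and the
  variance up to \<open>O(1 / \<nu>)\<close>; the same integral with \<open>w = exp (i \<tau> / \<sigma>)\<close> gives the limit of the
  characteristic functions, and Levy's continuity theorem concludes.\<close>

section \<open>Hooks above the diagonal and bars\<close>

text \<open>The occupations of k and -k determine each other, so independence holds only after one
  position of each pair is discarded. The self-paired class of t / 2, present only for even t, is
  the source of the parity terms. Along a residue class the odds of a bead form a geometric sequence
  with ratio q^t; gap probabilities are then differences, their sums telescope, and this is why A
  and C are rational. The variance is of order \<nu>, arises from second moments of order \<nu>^2,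
  and is wanted up to O(1/\<nu>). The bar count is therefore centred at its mean at the saddle point
  and multiplied by \<eta>. The integrand of the second moment then has size s^2 + 1/\<nu>, and
  replacing P by its approximation costs only a relative error \<eta>^2. The term z/24 of log P is
  absorbed by shifting n to n + 1/24, which makes the kernel exact. There the same recursion over
  positions yields a product bound that loses a factor of the form exp (c sqrt |w - 1| / \<eta>),
  outweighed by the decay of |P| when w is close to 1.\<close>

definition strict_sets :: "nat \<Rightarrow> nat set set" where
  "strict_sets n = {S. finite S \<and> 0 \<notin> S \<and> \<Sum>S = n}"

text \<open>These are the \<open>t\<close>-bars of the strict partition with set of parts
  \<open>S\<close>. Since 0 is not a part, deleting a part equal to \<open>t\<close> is the case
  \<open>k = t\<close> of the first set. In the second set \<open>t < 2 * k\<close> selects the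
  larger of two parts with sum \<open>t\<close>, so that each pair counts once.\<close>

definition bar_count :: "nat \<Rightarrow> nat set \<Rightarrow> nat" where
  "bar_count t S = card {k \<in> S. t \<le> k \<and> k - t \<notin> S} + card {k \<in> S. k < t \<and> t < 2 * k \<and> t - k \<in> S}"

lemma down_closed_eq_lessThan:
  fixes A :: "nat set"
  assumes "finite A" "\<And>i j. j \<in> A \<Longrightarrow> i \<le> j \<Longrightarrow> i \<in> A"
  shows "A = {..<card A}"
proof (cases "A = {}")
  case False
  define m where "m = Max A"
  have "m \<in> A" using False assms(1) by (simp add: m_def)
  then have "A = {..m}" using assms(1) assms(2)[of m] by (auto simp: m_def)
  then show ?thesis by (metis card_atMost lessThan_Suc_atMost)
qed simp

text \<open>Row lengths decrease, so a column is an initial segment of the rows and its cardinality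
  is its length.\<close>

lemma young_diagram_iff_conjugate:
  assumes "is_partition \<mu>"
  shows "(i, j) \<in> young_diagram \<mu> \<longleftrightarrow> i < conjugate_part \<mu> j"
proof -
  let ?A = "{i. (i, j) \<in> young_diagram \<mu>}"
  have dec: "\<mu> ! b \<le> \<mu> ! a" if "a \<le> b" "b < length \<mu>" for a b
    using assms that unfolding is_partition_def
    by (cases "a = b") (auto simp: sorted_wrt_iff_nth_less)
  have "finite ?A" by (rule finite_subset[of _ "{..<length \<mu>}"]) (auto simp: young_diagram_def)
  moreover have "i \<in> ?A" if "j' \<in> ?A" "i \<le> j'" for i j'
    using that dec[of i j'] by (auto simp: young_diagram_def)
  ultimately have "?A = {..<card ?A}" by (rule down_closed_eq_lessThan)
  then show ?thesis by (metis (no_types, lifting) conjugate_part_def lessThan_iff mem_Collect_eq)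
qed

lemma young_diagram_down_closed:
  assumes "is_partition \<mu>" "(i', j') \<in> young_diagram \<mu>" "i \<le> i'" "j \<le> j'"
  shows "(i, j) \<in> young_diagram \<mu>"
proof -
  have "i < conjugate_part \<mu> j'" using assms young_diagram_iff_conjugate by (meson le_less_trans)
  then have "(i, j') \<in> young_diagram \<mu>" using assms young_diagram_iff_conjugate by blast
  then show ?thesis using assms by (auto simp: young_diagram_def)
qed

lemma conjugate_part_antimono: "j \<le> j' \<Longrightarrow> conjugate_part \<mu> j' \<le> conjugate_part \<mu> j"
  unfolding conjugate_part_def
  by (rule card_mono) (auto simp: young_diagram_def intro: finite_subset[of _ "{..<length \<mu>}"])

lemma card_hook:
  assumes "is_partition \<mu>" "(i, j) \<in> young_diagram \<mu>"
  shows "card (hook \<mu> i j) = (\<mu> ! i - j) + (conjugate_part \<mu> j - i) - 1"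
proof -
  have ij: "i < length \<mu>" "j < \<mu> ! i" using assms by (auto simp: young_diagram_def)
  have "hook \<mu> i j = {i} \<times> {j..<\<mu> ! i} \<union> {i<..<conjugate_part \<mu> j} \<times> {j}"
  proof (rule set_eqI)
    fix p :: "nat \<times> nat"
    obtain a b where p: "p = (a, b)" by (cases p)
    have "(a, j) \<in> young_diagram \<mu> \<longleftrightarrow> a < conjugate_part \<mu> j"
      by (rule young_diagram_iff_conjugate[OF assms(1)])
    moreover have "(i, b) \<in> young_diagram \<mu> \<longleftrightarrow> b < \<mu> ! i" using ij by (simp add: young_diagram_def)
    ultimately show "p \<in> hook \<mu> i j \<longleftrightarrow> p \<in> {i} \<times> {j..<\<mu> ! i} \<union> {i<..<conjugate_part \<mu> j} \<times> {j}"
      using assms(2) ij(2) unfolding p hook_def by (cases "a = i"; cases "b = j") auto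
  qed
  also have "card \<dots> = card ({i} \<times> {j..<\<mu> ! i}) + card ({i<..<conjugate_part \<mu> j} \<times> {j})"
    by (rule card_Un_disjoint) auto
  also have "... = (\<mu> ! i - j) + (conjugate_part \<mu> j - i) - 1"
    using assms young_diagram_iff_conjugate[OF assms(1), of i j] by (simp add: card_cartesian_product)
  finally show ?thesis .
qed

lemma durfee_props:
  assumes "is_partition \<mu>"
  shows "{..<durfee \<mu>} \<times> {..<durfee \<mu>} \<subseteq> young_diagram \<mu>" "(durfee \<mu>, durfee \<mu>) \<notin> young_diagram \<mu>"
proof -
  let ?P = "\<lambda>s. {..<s} \<times> {..<s} \<subseteq> young_diagram \<mu>"
  have bd: "s \<le> length \<mu>" if "?P s" for s
  proof (cases s)
    case (Suc k)
    then have "(k, k) \<in> young_diagram \<mu>" using that by auto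
    then show ?thesis using Suc by (auto simp: young_diagram_def)
  qed simp
  show 1: "?P (durfee \<mu>)" unfolding durfee_def
    by (rule GreatestI_nat[of ?P 0 "length \<mu>"]) (use bd in auto)
  show "(durfee \<mu>, durfee \<mu>) \<notin> young_diagram \<mu>"
  proof
    assume a: "(durfee \<mu>, durfee \<mu>) \<in> young_diagram \<mu>"
    have "?P (Suc (durfee \<mu>))"
    proof (rule subsetI, elim SigmaE, hypsubst)
      fix x y assume "x \<in> {..<Suc (durfee \<mu>)}" "y \<in> {..<Suc (durfee \<mu>)}"
      then show "(x, y) \<in> young_diagram \<mu>" using young_diagram_down_closed[OF assms a, of x y] by auto
    qed
    then have "Suc (durfee \<mu>) \<le> durfee \<mu>" unfolding durfee_def
      by (rule Greatest_le_nat[of ?P _ "length \<mu>"]) (use bd in auto)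
    then show False by simp
  qed
qed

section \<open>The shape of the doubling of a fixed strict partition\<close>

context
  fixes \<alpha> :: "nat list" and d :: nat
  assumes strict: "is_strict_partition \<alpha>"
  defines "d \<equiv> length \<alpha>"
begin

lemma strict_nth_less: "i < j \<Longrightarrow> j < d \<Longrightarrow> \<alpha> ! j < \<alpha> ! i"
  using strict unfolding is_strict_partition_def is_partition_def d_def
  by (auto simp: sorted_wrt_iff_nth_less nth_eq_iff_index_eq order_less_le)

lemma strict_nth_pos: "i < d \<Longrightarrow> 0 < \<alpha> ! i"
  using strict unfolding is_strict_partition_def is_partition_def d_def
  by (metis gr0I nth_mem)

text \<open>The parts drop by at least one at each index, which the added index compensates. The
  number \<open>\<alpha> ! i + i\<close> is the length of column \<open>i\<close> of the
  doubling.\<close>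

lemma strict_nth_add_antimono: "i \<le> j \<Longrightarrow> j < d \<Longrightarrow> \<alpha> ! j + j \<le> \<alpha> ! i + i"
proof (induction rule: dec_induct)
  case (step n)
  then show ?case using strict_nth_less[of n "Suc n"] by simp
qed simp

lemma strict_nth_add_ge: "i < d \<Longrightarrow> d \<le> \<alpha> ! i + i"
  using strict_nth_add_antimono[of i "d - 1"] strict_nth_pos[of "d - 1"] by fastforce

lemma strict_nth_inj: "i < d \<Longrightarrow> j < d \<Longrightarrow> \<alpha> ! i = \<alpha> ! j \<Longrightarrow> i = j"
  using strict_nth_less by (metis less_irrefl linorder_neqE_nat)

lemma strict_index_less_card_iff:
  "k < card {k. k < d \<and> m < \<alpha> ! k} \<longleftrightarrow> k < d \<and> m < \<alpha> ! k"
proof -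
  have "{k. k < d \<and> m < \<alpha> ! k} = {..<card {k. k < d \<and> m < \<alpha> ! k}}"
  proof (rule down_closed_eq_lessThan)
    show "i \<in> {k. k < d \<and> m < \<alpha> ! k}" if "j \<in> {k. k < d \<and> m < \<alpha> ! k}" "i \<le> j" for i j
      using that strict_nth_less[of i j] by (cases "i = j") auto
  qed simp
  then show ?thesis by blast
qed

text \<open>The diagram prescribed by the Frobenius symbol: arms fix the first \<open>d\<close>
  rows, legs fix the parts of the first \<open>d\<close> columns below the square. It is the normal
  form through which existence, uniqueness and size of the doubling are proved.\<close>

definition frobenius_diagram :: "(nat \<times> nat) set" where
  "frobenius_diagram = {(i, j). (i < d \<and> j < \<alpha> ! i + i + 1) \<or> (d \<le> i \<and> j < d \<and> i < \<alpha> ! j + j)}"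

text \<open>The truncated differences in \<open>frobenius\<close> can be inverted. For rows the
  entry \<open>\<alpha> ! i\<close> is positive. For columns the entry
  \<open>\<alpha> ! i - 1\<close> may be 0, and there the Durfee square guarantees
  \<open>i < conjugate_part \<mu> i\<close>. Beyond the first \<open>d\<close> rows and columns
  nothing is left, because \<open>(d, d)\<close> is not a box.\<close>

lemma doubling_facts:
  assumes "is_doubling \<alpha> \<mu>"
  shows "is_partition \<mu>" "durfee \<mu> = d"
    and "\<And>i. i < d \<Longrightarrow> \<mu> ! i = \<alpha> ! i + i + 1"
    and "\<And>i. i < d \<Longrightarrow> conjugate_part \<mu> i = \<alpha> ! i + i"
    and "young_diagram \<mu> = frobenius_diagram"
proof -
  show p: "is_partition \<mu>" using assms by (simp add: is_doubling_def)
  have fr: "map (\<lambda>i. \<mu> ! i - (i + 1)) [0..<durfee \<mu>] = \<alpha>"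
      "map (\<lambda>i. conjugate_part \<mu> i - (i + 1)) [0..<durfee \<mu>] = map (\<lambda>x. x - 1) \<alpha>"
    using assms by (auto simp: is_doubling_def frobenius_def)
  show dd: "durfee \<mu> = d" using arg_cong[OF fr(1), of length] by (simp add: d_def)
  show m: "\<mu> ! i = \<alpha> ! i + i + 1" if "i < d" for i
    using arg_cong[OF fr(1), of "\<lambda>l. l ! i"] strict_nth_pos[OF that] that dd by simp
  show c: "conjugate_part \<mu> i = \<alpha> ! i + i" if "i < d" for i
  proof -
    have "(i, i) \<in> young_diagram \<mu>" using durfee_props(1)[OF p] that dd by auto
    then have "i < conjugate_part \<mu> i" using young_diagram_iff_conjugate[OF p] by blast
    moreover have "conjugate_part \<mu> i - (i + 1) = \<alpha> ! i - 1"
      using arg_cong[OF fr(2), of "\<lambda>l. l ! i"] that dd by (simp add: d_def)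
    ultimately show ?thesis using strict_nth_pos[OF that] by linarith
  qed
  have len: "i < length \<mu>" if "i < d" for i
    using durfee_props(1)[OF p] that dd by (auto simp: young_diagram_def)
  have "(i, j) \<in> young_diagram \<mu> \<longleftrightarrow> (i, j) \<in> frobenius_diagram" for i j
  proof (cases "i < d")
    case True
    then show ?thesis using m len by (auto simp: young_diagram_def frobenius_diagram_def)
  next
    case False
    show ?thesis
    proof (cases "j < d")
      case True
      then show ?thesis using False c[of j] young_diagram_iff_conjugate[OF p, of i j]
        by (auto simp: frobenius_diagram_def)
    next
      case F2: False
      have "(i, j) \<notin> young_diagram \<mu>"
        using young_diagram_down_closed[OF p, of i j d d] durfee_props(2)[OF p] F2 False dd by auto
      then show ?thesis using False F2 by (auto simp: frobenius_diagram_def)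
    qed
  qed
  then show "young_diagram \<mu> = frobenius_diagram" by (simp add: set_eq_iff)
qed

text \<open>The hook of \<open>(i, j)\<close> has (\<alpha>_i + i + 1 - j) + (\<alpha>_j + j - i) -
  1 boxes, in which the indices cancel. These boxes are the bars formed by two parts with sum
  \<open>t\<close>.\<close>

lemma hooks_above_in_durfee:
  assumes "is_doubling \<alpha> \<mu>"
  shows "{(i, j) \<in> young_diagram \<mu>. i < j \<and> j < d \<and> card (hook \<mu> i j) = t}
    = {(i, j). i < j \<and> j < d \<and> \<alpha> ! i + \<alpha> ! j = t}" (is "?L = ?R")
proof -
  note F = doubling_facts[OF assms]
  have "(i, j) \<in> ?L \<longleftrightarrow> (i, j) \<in> ?R" for i j
  proof (cases "i < j \<and> j < d")
    case True
    have Y: "(i, j) \<in> young_diagram \<mu>" using durfee_props(1)[OF F(1)] F(2) True by auto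
    have "j < \<mu> ! i" using Y by (simp add: young_diagram_def)
    then have "card (hook \<mu> i j) = \<alpha> ! i + \<alpha> ! j"
      using card_hook[OF F(1) Y] F(3)[of i] F(4)[of j] True strict_nth_pos[of j] by simp
    then show ?thesis using True Y by simp
  qed auto
  then show ?thesis by (simp add: set_eq_iff)
qed

lemma card_hooks_above_in_durfee:
  "card {(i, j). i < j \<and> j < d \<and> \<alpha> ! i + \<alpha> ! j = t}
     = card {k \<in> set \<alpha>. k < t \<and> t < 2 * k \<and> t - k \<in> set \<alpha>}" (is "card ?L = card ?R")
proof -
  have "bij_betw (\<lambda>(i, j). \<alpha> ! i) ?L ?R"
  proof (rule bij_betw_imageI)
    show "inj_on (\<lambda>(i, j). \<alpha> ! i) ?L"
    proof (rule inj_onI)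
      fix p p' assume *: "p \<in> ?L" "p' \<in> ?L" "(\<lambda>(i, j). \<alpha> ! i) p = (\<lambda>(i, j). \<alpha> ! i) p'"
      then show "p = p'"
        using strict_nth_inj[of "fst p" "fst p'"] strict_nth_inj[of "snd p" "snd p'"]
        by (cases p; cases p') auto
    qed
    show "(\<lambda>(i, j). \<alpha> ! i) ` ?L = ?R"
    proof (rule subset_antisym; rule subsetI)
      fix k assume "k \<in> (\<lambda>(i, j). \<alpha> ! i) ` ?L"
      then obtain i j where *: "i < j" "j < d" "\<alpha> ! i + \<alpha> ! j = t" "k = \<alpha> ! i" by auto
      then have "t - k = \<alpha> ! j" by simp
      then show "k \<in> ?R" using * strict_nth_less[of i j] strict_nth_pos[of j]
        by (auto simp: d_def)
    next
      fix k assume k: "k \<in> ?R"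
      then obtain i j where ij: "i < d" "j < d" "k = \<alpha> ! i" "t - k = \<alpha> ! j"
        by (auto simp: in_set_conv_nth d_def)
      then have "\<alpha> ! j < \<alpha> ! i" using k by auto
      then have "i < j" using strict_nth_less[of j i] ij by (metis less_asym linorder_neqE_nat less_irrefl)
      then have "(i, j) \<in> ?L" using ij k by auto
      then show "k \<in> (\<lambda>(i, j). \<alpha> ! i) ` ?L" using ij by (auto intro!: image_eqI[of _ _ "(i, j)"])
    qed
  qed
  then show ?thesis by (rule bij_betw_same_card)
qed

text \<open>If column j to the right of the square has c boxes, its hook in row i has \<alpha>_i + c
  - j boxes. As j runs over these columns, j - c runs exactly once through the natural numbers that
  are not parts. So a \<open>t\<close>-hook here is a part k such that k - t is a natural number and
  not a part.\<close>

lemma card_hooks_right_of_durfee: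
  assumes "is_doubling \<alpha> \<mu>" "t > 0"
  shows "card {(i, j) \<in> young_diagram \<mu>. i < j \<and> \<not> j < d \<and> card (hook \<mu> i j) = t}
     = card {k \<in> set \<alpha>. t \<le> k \<and> k - t \<notin> set \<alpha>}" (is "card ?L = card ?R")
proof -
  note F = doubling_facts[OF assms(1)]
  define c where "c = conjugate_part \<mu>"
  have iff: "i < c j \<longleftrightarrow> i < d \<and> j < \<alpha> ! i + i + 1" if "d \<le> j" for i j
    using young_diagram_iff_conjugate[OF F(1), of i j] that unfolding F(5) c_def
    by (auto simp: frobenius_diagram_def)
  have cd: "c j \<le> d" if "d \<le> j" for j using iff[OF that, of d] by auto
  have L: "(i, j) \<in> ?L \<longleftrightarrow> d \<le> j \<and> i < c j \<and> \<alpha> ! i + c j = t + j" for i j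
  proof (cases "d \<le> j \<and> i < c j")
    case True
    then have Y: "(i, j) \<in> young_diagram \<mu>" using young_diagram_iff_conjugate[OF F(1)] by (simp add: c_def)
    have i: "i < d" "j < \<alpha> ! i + i + 1" using iff True by auto
    have "card (hook \<mu> i j) = (\<alpha> ! i + i + 1 - j) + (c j - i) - 1"
      using card_hook[OF F(1) Y] F(3)[OF i(1)] by (simp add: c_def)
    then show ?thesis using True Y i cd[of j] by auto
  next
    case False
    then show ?thesis using young_diagram_iff_conjugate[OF F(1), of i j] by (auto simp: c_def)
  qed
  have nin: "j - c j \<noteq> \<alpha> ! k" if "d \<le> j" "k < d" for j k
    using iff[OF that(1), of k] cd[OF that(1)] that by auto
  have "bij_betw (\<lambda>(i, j). \<alpha> ! i) ?L ?R"
  proof (rule bij_betw_imageI)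
    show "inj_on (\<lambda>(i, j). \<alpha> ! i) ?L"
    proof (rule inj_onI)
      fix p p' assume p: "p \<in> ?L" "p' \<in> ?L" "(\<lambda>(i, j). \<alpha> ! i) p = (\<lambda>(i, j). \<alpha> ! i) p'"
      obtain i j i' j' where pp: "p = (i, j)" "p' = (i', j')" by (metis surj_pair)
      have e: "\<alpha> ! i = \<alpha> ! i'" using p pp by simp
      have *: "d \<le> j \<and> i < c j \<and> \<alpha> ! i + c j = t + j" "d \<le> j' \<and> i' < c j' \<and> \<alpha> ! i' + c j' = t + j'"
        using p(1,2) L[of i j] L[of i' j'] unfolding pp by blast+
      then have "i = i'" using strict_nth_inj[of i i'] e iff by auto
      moreover have "j = j'"
        using * e conjugate_part_antimono[of j j' \<mu>] conjugate_part_antimono[of j' j \<mu>]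
        unfolding c_def[symmetric] by linarith
      ultimately show "p = p'" using pp by simp
    qed
    show "(\<lambda>(i, j). \<alpha> ! i) ` ?L = ?R"
    proof (rule subset_antisym; rule subsetI)
      fix k assume "k \<in> (\<lambda>(i, j). \<alpha> ! i) ` ?L"
      then obtain p where p: "p \<in> ?L" "k = (\<lambda>(i, j). \<alpha> ! i) p" by blast
      obtain i j where "p = (i, j)" by (cases p)
      then have "(i, j) \<in> ?L" and k: "k = \<alpha> ! i" using p by auto
      then have *: "d \<le> j" "i < c j" "\<alpha> ! i + c j = t + j" using L by auto
      have "i < d" using * iff by auto
      have "k - t = j - c j" "t \<le> k" using * k cd[of j] by auto
      then show "k \<in> ?R" using nin[OF *(1)] k \<open>i < d\<close> by (metis (mono_tags, lifting) in_set_conv_nth d_def mem_Collect_eq)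
    next
      fix k assume k: "k \<in> ?R"
      then obtain i where i: "i < d" "k = \<alpha> ! i" by (auto simp: in_set_conv_nth d_def)
      \<comment> \<open>The column belonging to the non-part \<open>m\<close>: it should meet
        exactly the \<open>b\<close> rows whose parts exceed \<open>m\<close>, and then
        \<open>j - b = m\<close> forces \<open>j = m + b\<close>.\<close>
      define m where "m = k - t"
      define b where "b = card {k. k < d \<and> m < \<alpha> ! k}"
      define j where "j = m + b"
      have m: "\<alpha> ! l \<noteq> m" if "l < d" for l
      proof
        assume "\<alpha> ! l = m"
        then have "k - t \<in> set \<alpha>" using that nth_mem[of l \<alpha>] unfolding m_def d_def by metis
        then show False using k by simp
      qed
      have b: "l < b \<longleftrightarrow> l < d \<and> m < \<alpha> ! l" for l
        unfolding b_def by (rule strict_index_less_card_iff)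
      have bd: "b \<le> d" using b[of d] by simp
      have gap: "\<alpha> ! l + l + 1 \<le> m + b" if "b \<le> l" "l < d" for l
        using strict_nth_add_antimono[of b l] that b[of b] m[of b] by auto
      have up: "m + b + 1 \<le> \<alpha> ! l + l + 1" if "l < b" for l
      proof -
        have *: "l \<le> b - 1" "b - 1 < d" "m < \<alpha> ! (b - 1)" using that b[of "b - 1"] by auto
        show ?thesis using strict_nth_add_antimono[OF *(1,2)] *(3) that by linarith
      qed
      have dj: "d \<le> j"
      proof (cases "b = d")
        case False
        then have "b \<le> d - 1" "d - 1 < d" using bd by auto
        then show ?thesis using gap[of "d - 1"] strict_nth_pos[of "d - 1"] unfolding j_def by linarith
      qed (simp add: j_def)
      have lcb: "l < c j \<longleftrightarrow> l < b" for l
      proof -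
        have "l < c j \<longleftrightarrow> l < d \<and> j < \<alpha> ! l + l + 1" using iff[OF dj] .
        also have "... \<longleftrightarrow> l < b"
        proof (cases "l < b")
          case True
          then show ?thesis using up[OF True] bd unfolding j_def by linarith
        next
          case False
          then show ?thesis using gap[of l] unfolding j_def by linarith
        qed
        finally show ?thesis .
      qed
      have cj: "c j = b"
        using lcb[of b] lcb[of "c j"] by simp
      have "m < \<alpha> ! i" using k i assms(2) by (auto simp: m_def)
      then have "i < c j" using b[of i] i cj by auto
      moreover have "\<alpha> ! i + c j = t + j" using cj k i by (auto simp: j_def m_def)
      ultimately have "d \<le> j \<and> i < c j \<and> \<alpha> ! i + c j = t + j" using dj by blast
      then have "(i, j) \<in> ?L" by (rule iffD2[OF L])
      then show "k \<in> (\<lambda>(i, j). \<alpha> ! i) ` ?L" using i by (intro image_eqI[of _ _ "(i, j)"]) simp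
    qed
  qed
  then show ?thesis by (rule bij_betw_same_card)
qed

lemma num_hooks_above_doubling:
  assumes "is_doubling \<alpha> \<mu>" "t > 0"
  shows "num_hooks_above t \<mu> = bar_count t (set \<alpha>)"
proof -
  let ?H = "\<lambda>P. {(i, j) \<in> young_diagram \<mu>. i < j \<and> P j \<and> card (hook \<mu> i j) = t}"
  have fin: "finite (young_diagram \<mu>)"
    by (rule finite_subset[of _ "Sigma {..<length \<mu>} (\<lambda>i. {..<\<mu> ! i})"]) (auto simp: young_diagram_def)
  have "num_hooks_above t \<mu> = card (?H (\<lambda>j. \<not> j < d) \<union> ?H (\<lambda>j. j < d))"
    unfolding num_hooks_above_def by (rule arg_cong[of _ _ card]) auto
  also have "... = card (?H (\<lambda>j. \<not> j < d)) + card (?H (\<lambda>j. j < d))"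
    by (rule card_Un_disjoint) (use fin in \<open>auto intro: finite_subset[OF _ fin]\<close>)
  finally show ?thesis
    using card_hooks_right_of_durfee[OF assms] hooks_above_in_durfee[OF assms(1)] card_hooks_above_in_durfee
    by (simp add: bar_count_def)
qed

lemma sum_lessThan_card: "(\<Sum>i<d. \<alpha> ! i) = \<Sum>(set \<alpha>)"
proof -
  have "distinct \<alpha>" using strict by (simp add: is_strict_partition_def)
  then have "\<Sum>(set \<alpha>) = sum_list \<alpha>" using distinct_sum_list_conv_Sum by metis
  then show ?thesis by (simp add: sum_list_sum_nth d_def atLeast0LessThan)
qed

text \<open>Counting the square with the rows, row i and column i together have 2 \<alpha>_i + (2 i
  + 1 - d) boxes, and the brackets sum to 0. The integers are used because single brackets are
  negative.\<close>

lemma card_frobenius_diagram: "card frobenius_diagram = 2 * \<Sum>(set \<alpha>)"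
proof -
  have eq: "frobenius_diagram = Sigma {..<d} (\<lambda>i. {..<\<alpha> ! i + i + 1})
     \<union> (\<lambda>(j, i). (i, j)) ` Sigma {..<d} (\<lambda>j. {d..<\<alpha> ! j + j})"
    by (auto simp: frobenius_diagram_def)
  have "card frobenius_diagram = card (Sigma {..<d} (\<lambda>i. {..<\<alpha> ! i + i + 1}))
     + card ((\<lambda>(j, i). (i, j)) ` Sigma {..<d} (\<lambda>j. {d..<\<alpha> ! j + j}))"
    unfolding eq by (rule card_Un_disjoint) auto
  also have "card ((\<lambda>(j, i). (i, j)) ` Sigma {..<d} (\<lambda>j. {d..<\<alpha> ! j + j}))
      = card (Sigma {..<d} (\<lambda>j. {d..<\<alpha> ! j + j}))"
    by (rule card_image) (auto simp: inj_on_def)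
  also have "card (Sigma {..<d} (\<lambda>i. {..<\<alpha> ! i + i + 1})) + \<dots>
     = (\<Sum>i<d. (\<alpha> ! i + i + 1) + (\<alpha> ! i + i - d))"
  proof -
    have "card (Sigma {..<d} (\<lambda>i. {..<\<alpha> ! i + i + 1})) = (\<Sum>i<d. \<alpha> ! i + i + 1)"
      "card (Sigma {..<d} (\<lambda>j. {d..<\<alpha> ! j + j})) = (\<Sum>i<d. \<alpha> ! i + i - d)"
      by (subst card_SigmaI; simp)+
    then show ?thesis by (simp only: sum.distrib)
  qed
  finally have "int (card frobenius_diagram) = (\<Sum>i<d. int ((\<alpha> ! i + i + 1) + (\<alpha> ! i + i - d)))"
    by simp
  also have "... = (\<Sum>i<d. 2 * int (\<alpha> ! i) + (2 * int i + 1 - int d))"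
  proof (rule sum.cong)
    fix i assume "i \<in> {..<d}"
    then have "d \<le> \<alpha> ! i + i" using strict_nth_add_ge by simp
    then show "int ((\<alpha> ! i + i + 1) + (\<alpha> ! i + i - d)) = 2 * int (\<alpha> ! i) + (2 * int i + 1 - int d)"
      by linarith
  qed simp
  also have "... = 2 * int (\<Sum>i<d. \<alpha> ! i) + (\<Sum>i<d. 2 * int i + 1 - int d)"
    by (simp add: sum.distrib sum_distrib_left)
  \<comment> \<open>One occurrence of \<open>d\<close> is generalised to \<open>e\<close>, so that
    the induction changes only the range of summation. For \<open>e = d\<close> the sum
    vanishes.\<close>
  also have "(\<Sum>i<d. 2 * int i + 1 - int e) = int d * (int d - int e)" for e
    by (induction d) (auto simp: algebra_simps)
  finally have "int (card frobenius_diagram) = 2 * int (\<Sum>(set \<alpha>))"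
    unfolding sum_lessThan_card by (simp del: of_nat_sum)
  then show ?thesis by linarith
qed

text \<open>A row below the square has as many boxes as there are columns reaching it. The number of
  rows is the length \<open>\<alpha> ! 0\<close> of the first column, or 0 for the empty
  partition.\<close>

lemma is_doubling_exists: "\<exists>\<mu>. is_doubling \<alpha> \<mu>"
proof -
  define R where "R i = (if i < d then \<alpha> ! i + i + 1 else card {j. j < d \<and> i < \<alpha> ! j + j})" for i
  define L where "L = (if d = 0 then 0 else \<alpha> ! 0)"
  define \<mu> where "\<mu> = map R [0..<L]"
  have leL: "\<alpha> ! j + j \<le> L" if "j < d" for j
    using strict_nth_add_antimono[of 0 j] that by (auto simp: L_def)
  have dL: "d \<le> L" using strict_nth_add_ge[of 0] by (cases "d = 0") (auto simp: L_def)
  have R2: "j < card {j. j < d \<and> i < \<alpha> ! j + j} \<longleftrightarrow> j < d \<and> i < \<alpha> ! j + j" for i j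
  proof -
    have "{j. j < d \<and> i < \<alpha> ! j + j} = {..<card {j. j < d \<and> i < \<alpha> ! j + j}}"
    proof (rule down_closed_eq_lessThan)
      fix a b assume "b \<in> {j. j < d \<and> i < \<alpha> ! j + j}" "a \<le> b"
      then show "a \<in> {j. j < d \<and> i < \<alpha> ! j + j}" using strict_nth_add_antimono[of a b] by auto
    qed simp
    then show ?thesis by blast
  qed
  have Y: "young_diagram \<mu> = frobenius_diagram"
  proof -
    have "(i, j) \<in> young_diagram \<mu> \<longleftrightarrow> (i, j) \<in> frobenius_diagram" for i j
      using R2[of j i] leL[of j] dL
      by (cases "i < d") (auto simp: young_diagram_def \<mu>_def frobenius_diagram_def R_def)
    then show ?thesis by (simp add: set_eq_iff)
  qed
  have rows: "j < R i \<longleftrightarrow> (i, j) \<in> frobenius_diagram" for i j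
    using R2[of j i] by (auto simp: R_def frobenius_diagram_def)
  have part: "is_partition \<mu>"
  proof -
    have "R b \<le> R a" if "a \<le> b" for a b
    proof -
      have "j < R a" if "j < R b" for j
        using that \<open>a \<le> b\<close> strict_nth_add_antimono[of a b] strict_nth_add_ge[of a] unfolding rows
        by (auto simp: frobenius_diagram_def)
      then show ?thesis by (meson leI less_irrefl)
    qed
    moreover have "0 < R i" if "i < L" for i
      using that unfolding rows by (auto simp: frobenius_diagram_def L_def split: if_splits)
    ultimately show ?thesis
      by (fastforce simp: is_partition_def \<mu>_def sorted_wrt_iff_nth_less)
  qed
  have dur: "durfee \<mu> = d"
    by (rule durfee_eqI) (use strict_nth_add_ge in \<open>fastforce simp: Y frobenius_diagram_def\<close>)+
  have c: "conjugate_part \<mu> i = \<alpha> ! i + i" if "i < d" for i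
  proof -
    have "{i'. (i', i) \<in> young_diagram \<mu>} = {..<\<alpha> ! i + i}"
    proof -
      have "i < \<alpha> ! k + k + 1" if "k < d" for k using strict_nth_add_ge[OF that] \<open>i < d\<close> by simp
      then show ?thesis using that strict_nth_add_ge[OF that]
        unfolding Y by (auto simp: frobenius_diagram_def not_less)
    qed
    then show ?thesis by (simp add: conjugate_part_def)
  qed
  have "frobenius \<mu> = (\<alpha>, map (\<lambda>x. x - 1) \<alpha>)"
    unfolding frobenius_def dur prod.inject
    using dL c by (auto intro!: nth_equalityI simp: d_def \<mu>_def R_def)
  then show ?thesis using part by (auto simp: is_doubling_def)
qed

end

section \<open>From doubled distinct partitions to finite sets of parts\<close>

lemma partition_eqI:
  assumes "is_partition \<mu>" "is_partition \<nu>" "young_diagram \<mu> = young_diagram \<nu>"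
  shows "\<mu> = \<nu>"
proof -
  have len: "length \<mu> = conjugate_part \<mu> 0" if "is_partition \<mu>" for \<mu>
  proof -
    have "filter (\<lambda>x. 0 < x) \<mu> = \<mu>" using that by (auto simp: is_partition_def filter_id_conv intro!: gr0I)
    then show ?thesis by (simp add: conjugate_part_eq)
  qed
  have l: "length \<mu> = length \<nu>"
    using len[OF assms(1)] len[OF assms(2)] assms(3) by (simp add: conjugate_part_def)
  show ?thesis
  proof (rule nth_equalityI[OF l])
    fix i assume i: "i < length \<mu>"
    have "j < \<mu> ! i \<longleftrightarrow> j < \<nu> ! i" for j
      using assms(3) i l by (auto simp: young_diagram_def set_eq_iff)
    then show "\<mu> ! i = \<nu> ! i" by (metis linorder_neqE_nat less_irrefl)
  qed
qed

lemma sum_list_eq_card_young_diagram: "sum_list \<mu> = card (young_diagram \<mu>)"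
proof -
  have "young_diagram \<mu> = Sigma {..<length \<mu>} (\<lambda>i. {..<\<mu> ! i})" by (auto simp: young_diagram_def)
  then show ?thesis by (simp add: sum_list_sum_nth atLeast0LessThan)
qed

lemma set_inj_strict:
  assumes "is_strict_partition \<alpha>" "is_strict_partition \<beta>" "set \<alpha> = set \<beta>"
  shows "\<alpha> = \<beta>"
proof -
  have "sorted (rev \<alpha>)" "distinct (rev \<alpha>)" if "is_strict_partition \<alpha>" for \<alpha>
    using that by (auto simp: is_strict_partition_def is_partition_def sorted_wrt_rev)
  then have "rev \<alpha> = rev \<beta>" using assms by (metis set_rev sorted_distinct_set_unique)
  then show ?thesis by simp
qed

text \<open>The top row of the Frobenius symbol recovers \<open>\<alpha>\<close>, and a strict
  partition is determined by its set of parts. The box count of the normal form turns size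
  \<open>2 * n\<close> into sum \<open>n\<close>.\<close>

lemma bij_betw_doubled_distinct:
  "bij_betw (\<lambda>\<mu>. set (fst (frobenius \<mu>))) (doubled_distinct_of (2 * n)) (strict_sets n)"
proof (rule bij_betw_imageI)
  have D: "\<exists>\<alpha>. is_strict_partition \<alpha> \<and> is_doubling \<alpha> \<mu> \<and> fst (frobenius \<mu>) = \<alpha> \<and> \<Sum>(set \<alpha>) = n"
    if \<mu>: "\<mu> \<in> doubled_distinct_of (2 * n)" for \<mu>
  proof -
    from \<mu> obtain \<alpha> where a: "is_strict_partition \<alpha>" "is_doubling \<alpha> \<mu>" "sum_list \<mu> = 2 * n"
      by (auto simp: doubled_distinct_of_def doubled_distinct_def)
    then have "2 * \<Sum>(set \<alpha>) = 2 * n"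
      using card_frobenius_diagram[OF a(1)] doubling_facts(5)[OF a(1,2)]
        sum_list_eq_card_young_diagram[of \<mu>] by simp
    then show ?thesis using a by (auto simp: is_doubling_def)
  qed
  show "inj_on (\<lambda>\<mu>. set (fst (frobenius \<mu>))) (doubled_distinct_of (2 * n))"
  proof (rule inj_onI)
    fix \<mu> \<nu> assume "\<mu> \<in> doubled_distinct_of (2 * n)" "\<nu> \<in> doubled_distinct_of (2 * n)"
      and e: "set (fst (frobenius \<mu>)) = set (fst (frobenius \<nu>))"
    then obtain \<alpha> \<beta> where a: "is_strict_partition \<alpha>" "is_doubling \<alpha> \<mu>" "fst (frobenius \<mu>) = \<alpha>"
      and b: "is_strict_partition \<beta>" "is_doubling \<beta> \<nu>" "fst (frobenius \<nu>) = \<beta>"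
      using D by metis
    have "\<alpha> = \<beta>" using set_inj_strict a b e by metis
    then show "\<mu> = \<nu>" using partition_eqI doubling_facts(1,5)[OF a(1,2)] doubling_facts(1,5)[OF b(1,2)]
      by metis
  qed
  show "(\<lambda>\<mu>. set (fst (frobenius \<mu>))) ` doubled_distinct_of (2 * n) = strict_sets n"
  proof (rule subset_antisym; rule subsetI)
    fix S assume "S \<in> (\<lambda>\<mu>. set (fst (frobenius \<mu>))) ` doubled_distinct_of (2 * n)"
    then obtain \<alpha> where "is_strict_partition \<alpha>" "S = set \<alpha>" "\<Sum>(set \<alpha>) = n" using D by auto
    then show "S \<in> strict_sets n"
      by (auto simp: strict_sets_def is_strict_partition_def is_partition_def)
  next
    fix S assume S: "S \<in> strict_sets n"
    define \<alpha> where "\<alpha> = rev (sorted_list_of_set S)"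
    have sa: "set \<alpha> = S" using S by (auto simp: \<alpha>_def strict_sets_def)
    have a: "is_strict_partition \<alpha>"
      using S by (auto simp: \<alpha>_def is_strict_partition_def is_partition_def sorted_wrt_rev strict_sets_def)
    obtain \<mu> where m: "is_doubling \<alpha> \<mu>" using is_doubling_exists[OF a] by blast
    have "sum_list \<mu> = 2 * n"
      using card_frobenius_diagram[OF a] doubling_facts(5)[OF a m] sum_list_eq_card_young_diagram[of \<mu>] S sa
      by (simp add: strict_sets_def)
    then have "\<mu> \<in> doubled_distinct_of (2 * n)"
      using a m by (auto simp: doubled_distinct_of_def doubled_distinct_def)
    moreover have "set (fst (frobenius \<mu>)) = S" using m sa by (auto simp: is_doubling_def)
    ultimately show "S \<in> (\<lambda>\<mu>. set (fst (frobenius \<mu>))) ` doubled_distinct_of (2 * n)" by blast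
  qed
qed

lemma num_hooks_above_eq_bar_count:
  assumes "\<mu> \<in> doubled_distinct" "t > 0"
  shows "num_hooks_above t \<mu> = bar_count t (set (fst (frobenius \<mu>)))"
proof -
  obtain \<alpha> where "is_strict_partition \<alpha>" "is_doubling \<alpha> \<mu>"
    using assms(1) by (auto simp: doubled_distinct_def)
  then show ?thesis using num_hooks_above_doubling[of \<alpha> \<mu> t] assms(2) by (auto simp: is_doubling_def)
qed

lemma finite_strict_sets: "finite (strict_sets n)"
  using bij_betw_finite[OF bij_betw_doubled_distinct] finite_doubled_distinct_of by blast

lemma card_strict_sets_pos: "card (strict_sets n) > 0"
  using bij_betw_same_card[OF bij_betw_doubled_distinct[of n]] doubled_distinct_of_nonempty[of n]
    finite_doubled_distinct_of[of "2 * n"] by (metis card_gt_0_iff)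

text \<open>Bijections carry uniform laws to uniform laws. From here on only the law of
  \<open>bar_count\<close> on \<open>strict_sets n\<close> is studied.\<close>

lemma map_pmf_DD_unif:
  assumes "t > 0"
  shows "map_pmf (num_hooks_above t) (DD_unif (2 * n)) = map_pmf (bar_count t) (pmf_of_set (strict_sets n))"
proof -
  have "map_pmf (num_hooks_above t) (DD_unif (2 * n))
      = map_pmf (\<lambda>\<mu>. bar_count t (set (fst (frobenius \<mu>)))) (DD_unif (2 * n))"
  proof (rule map_pmf_cong)
    fix \<mu> assume "\<mu> \<in> set_pmf (DD_unif (2 * n))"
    then have "\<mu> \<in> doubled_distinct"
      unfolding DD_unif_def set_pmf_of_set[OF doubled_distinct_of_nonempty finite_doubled_distinct_of]
      by (simp add: doubled_distinct_of_def)
    then show "num_hooks_above t \<mu> = bar_count t (set (fst (frobenius \<mu>)))"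
      by (rule num_hooks_above_eq_bar_count[OF _ assms])
  qed simp
  also have "... = map_pmf (bar_count t) (map_pmf (\<lambda>\<mu>. set (fst (frobenius \<mu>))) (DD_unif (2 * n)))"
    by (simp add: map_pmf_comp)
  also have "map_pmf (\<lambda>\<mu>. set (fst (frobenius \<mu>))) (DD_unif (2 * n)) = pmf_of_set (strict_sets n)"
    unfolding DD_unif_def
    by (rule map_pmf_of_set_bij_betw[OF bij_betw_doubled_distinct doubled_distinct_of_nonempty
          finite_doubled_distinct_of])
  finally show ?thesis .
qed

section \<open>Generating functions of gap statistics on a chain\<close>

definition gap_count :: "int \<Rightarrow> int set \<Rightarrow> int set \<Rightarrow> nat" where
  "gap_count t D X = card {k \<in> X. k - t \<in> D - X}"

text \<open>The test function \<open>f\<close> of the gap count is left arbitrary: constants give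
  the normalisation, n and n (n - 1) the moments, powers of w the generating function. Inserting a
  position acts on \<open>f\<close> by the difference operator, which is simple on each of
  these.\<close>

definition gap_gf :: "int \<Rightarrow> (int \<Rightarrow> complex) \<Rightarrow> (int \<Rightarrow> complex) \<Rightarrow> int set \<Rightarrow> (nat \<Rightarrow> complex) \<Rightarrow> complex" where
  "gap_gf t a b D f = (\<Sum>X\<in>Pow D. (\<Prod>k\<in>X. b k) * (\<Prod>k\<in>D - X. a k) * f (gap_count t D X))"

lemma gap_gf_insert:
  assumes D: "finite D" "k \<notin> D" "k + t \<notin> D" and "t > 0"
  shows "gap_gf t a b (insert k D) f = (a k + b k) * gap_gf t a b D f +
    (if k - t \<in> D then b k * a (k - t) * gap_gf t a b (D - {k - t}) (\<lambda>n. f (Suc n) - f n) else 0)"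
proof -
  define wt where "wt D X = (\<Prod>k\<in>X. b k) * (\<Prod>k\<in>D - X. a k)" for D X
  have fX: "finite X" if "X \<in> Pow D" for X using that D(1) finite_subset by auto
  have 1: "wt (insert k D) X * f (gap_count t (insert k D) X) = a k * (wt D X * f (gap_count t D X))"
    if X: "X \<in> Pow D" for X
  proof -
    have "insert k D - X = insert k (D - X)" "k \<notin> D - X" using X D by auto
    then have "wt (insert k D) X = a k * wt D X" using D by (simp add: wt_def)
    moreover have "{j \<in> X. j - t \<in> insert k D - X} = {j \<in> X. j - t \<in> D - X}"
      using X D by (force simp: algebra_simps)
    ultimately show ?thesis by (simp add: gap_count_def)
  qed
  have 2: "wt (insert k D) (insert k X) * f (gap_count t (insert k D) (insert k X))
      = b k * (wt D X * f (gap_count t D X)) +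
        b k * (if k - t \<in> D - X then wt D X * (f (Suc (gap_count t D X)) - f (gap_count t D X)) else 0)"
    if X: "X \<in> Pow D" for X
  proof -
    have "k \<notin> X" using X D by auto
    have "insert k D - insert k X = D - X" using X D by auto
    then have w: "wt (insert k D) (insert k X) = b k * wt D X" using fX[OF X] \<open>k \<notin> X\<close> by (simp add: wt_def)
    have "{j \<in> insert k X. j - t \<in> insert k D - insert k X}
       = (if k - t \<in> D - X then insert k {j \<in> X. j - t \<in> D - X} else {j \<in> X. j - t \<in> D - X})"
      using X D by (force simp: algebra_simps)
    then have "gap_count t (insert k D) (insert k X)
       = (if k - t \<in> D - X then Suc (gap_count t D X) else gap_count t D X)"
      using fX[OF X] \<open>k \<notin> X\<close> by (simp add: gap_count_def)
    then show ?thesis using w by (simp add: algebra_simps)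
  qed
  have 3: "(\<Sum>X\<in>Pow D. if k - t \<in> D - X then wt D X * (f (Suc (gap_count t D X)) - f (gap_count t D X)) else 0)
      = (if k - t \<in> D then a (k - t) * gap_gf t a b (D - {k - t}) (\<lambda>n. f (Suc n) - f n) else 0)"
  proof (cases "k - t \<in> D")
    case True
    let ?E = "D - {k - t}"
    have "(\<Sum>X\<in>Pow D. if k - t \<in> D - X then wt D X * (f (Suc (gap_count t D X)) - f (gap_count t D X)) else 0)
      = (\<Sum>X\<in>Pow ?E. wt D X * (f (Suc (gap_count t D X)) - f (gap_count t D X)))"
      using D(1) True by (intro sum.mono_neutral_cong_right) auto
    also have "... = (\<Sum>X\<in>Pow ?E. a (k - t) * (wt ?E X * (f (Suc (gap_count t ?E X)) - f (gap_count t ?E X))))"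
    proof (rule sum.cong)
      fix X assume X: "X \<in> Pow ?E"
      have "D - X = insert (k - t) (?E - X)" using X True by auto
      then have "wt D X = a (k - t) * wt ?E X" using D by (simp add: wt_def)
      moreover have "{j \<in> X. j - t \<in> D - X} = {j \<in> X. j - t \<in> ?E - X}" using X D by auto
      ultimately show "wt D X * (f (Suc (gap_count t D X)) - f (gap_count t D X))
        = a (k - t) * (wt ?E X * (f (Suc (gap_count t ?E X)) - f (gap_count t ?E X)))"
        by (simp add: gap_count_def)
    qed simp
    also have "... = a (k - t) * gap_gf t a b ?E (\<lambda>n. f (Suc n) - f n)"
      by (simp add: gap_gf_def wt_def sum_distrib_left mult.assoc)
    finally show ?thesis using True by simp
  qed auto
  have "gap_gf t a b (insert k D) f = (\<Sum>X\<in>Pow (insert k D). wt (insert k D) X * f (gap_count t (insert k D) X))"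
    by (simp add: gap_gf_def wt_def)
  also have "... = (\<Sum>X\<in>Pow D. wt (insert k D) X * f (gap_count t (insert k D) X))
     + (\<Sum>X\<in>insert k ` Pow D. wt (insert k D) X * f (gap_count t (insert k D) X))"
    unfolding Pow_insert using D by (intro sum.union_disjoint) auto
  also have "(\<Sum>X\<in>insert k ` Pow D. wt (insert k D) X * f (gap_count t (insert k D) X))
     = (\<Sum>X\<in>Pow D. wt (insert k D) (insert k X) * f (gap_count t (insert k D) (insert k X)))"
  proof (subst sum.reindex)
    show "inj_on (insert k) (Pow D)" using D(2) by (auto simp: inj_on_def)
  qed simp
  finally have "gap_gf t a b (insert k D) f = (\<Sum>X\<in>Pow D. a k * (wt D X * f (gap_count t D X)))
    + (\<Sum>X\<in>Pow D. b k * (wt D X * f (gap_count t D X)) +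
        b k * (if k - t \<in> D - X then wt D X * (f (Suc (gap_count t D X)) - f (gap_count t D X)) else 0))"
    using sum.cong[OF refl 1, of "Pow D"] sum.cong[OF refl 2, of "Pow D"] by simp
  also have "... = (a k + b k) * gap_gf t a b D f + b k * (\<Sum>X\<in>Pow D. if k - t \<in> D - X
      then wt D X * (f (Suc (gap_count t D X)) - f (gap_count t D X)) else 0)"
    by (simp add: sum.distrib gap_gf_def wt_def sum_distrib_left distrib_right mult.assoc)
  also note 3
  finally show ?thesis by (simp add: mult.assoc)
qed

text \<open>For powers of \<open>w\<close> the correction in \<open>gap_gf_insert\<close> carries a
  factor \<open>w - 1\<close>. By \<open>step\<close> it is at most \<open>\<delta> * m k\<close>
  times the factor of position \<open>k - t\<close>. This supplies exactly the factor missing in the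
  product over the window without \<open>k - t\<close>, so the product bound reproduces
  itself.\<close>

lemma norm_gap_gf_power_le:
  fixes a b :: "int \<Rightarrow> complex" and m :: "int \<Rightarrow> real"
  assumes "finite D" "t > 0" "\<delta> \<ge> 0" "\<And>k. m k \<ge> 0"
    and step: "\<And>k. cmod (w - 1) * cmod (b k) * cmod (a (k - t))
      \<le> \<delta> * m k * (cmod (a (k - t) + b (k - t)) + \<delta> * m (k - t))"
  shows "cmod (gap_gf t a b D (\<lambda>n. w ^ n)) \<le> (\<Prod>k\<in>D. cmod (a k + b k) + \<delta> * m k)"
  using assms(1)
proof (induction "card D" arbitrary: D rule: less_induct)
  case less
  let ?B = "\<lambda>D. \<Prod>k\<in>D. cmod (a k + b k) + \<delta> * m k"
  have nn: "cmod (a k + b k) + \<delta> * m k \<ge> 0" for k using assms by simp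
  show ?case
  proof (cases "D = {}")
    case False
    \<comment> \<open>The largest position is the one that may be removed, because
      \<open>k + t\<close> is then certainly not in the window.\<close>
    define k where "k = Max D"
    define E where "E = D - {k}"
    have k: "k \<in> D" "\<And>x. x \<in> D \<Longrightarrow> x \<le> k" using less.prems False by (auto simp: k_def)
    have D: "D = insert k E" and E: "finite E" "k \<notin> E" "k + t \<notin> E" "card E < card D"
      using k(1) k(2)[of "k + t"] less.prems assms(2)
      by (auto simp: E_def card_gt_0_iff intro!: card_Diff1_less simp del: card_Diff_insert card_Diff_singleton)
    have IE: "cmod (gap_gf t a b E (\<lambda>n. w ^ n)) \<le> ?B E" using less.hyps E by blast
    have fd: "gap_gf t a b F (\<lambda>n. w ^ Suc n - w ^ n) = (w - 1) * gap_gf t a b F (\<lambda>n. w ^ n)" for F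
      unfolding gap_gf_def sum_distrib_left by (rule sum.cong) (auto simp: algebra_simps)
    have "cmod (gap_gf t a b D (\<lambda>n. w ^ n)) \<le> cmod (a k + b k) * ?B E + \<delta> * m k * ?B E"
    proof (cases "k - t \<in> E")
      case True
      let ?F = "E - {k - t}"
      have "card ?F \<le> card E" using E by (simp add: card_mono)
      then have IF: "cmod (gap_gf t a b ?F (\<lambda>n. w ^ n)) \<le> ?B ?F" using less.hyps[of ?F] E by auto
      have BE: "?B E = (cmod (a (k - t) + b (k - t)) + \<delta> * m (k - t)) * ?B ?F"
        using E(1) True by (simp add: prod.remove)
      have "cmod (gap_gf t a b D (\<lambda>n. w ^ n)) = cmod ((a k + b k) * gap_gf t a b E (\<lambda>n. w ^ n) +
           b k * a (k - t) * ((w - 1) * gap_gf t a b ?F (\<lambda>n. w ^ n)))"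
        unfolding D gap_gf_insert[OF E(1-3) assms(2)] fd using True by simp
      also have "... \<le> cmod (a k + b k) * cmod (gap_gf t a b E (\<lambda>n. w ^ n)) +
           (cmod (w - 1) * cmod (b k) * cmod (a (k - t))) * cmod (gap_gf t a b ?F (\<lambda>n. w ^ n))"
        by (rule order.trans[OF norm_triangle_ineq]) (simp add: norm_mult mult_ac)
      also have "... \<le> cmod (a k + b k) * ?B E +
         (\<delta> * m k * (cmod (a (k - t) + b (k - t)) + \<delta> * m (k - t))) * ?B ?F"
        using IE by (intro add_mono mult_mono[OF step IF] mult_left_mono)
          (auto simp: assms intro!: mult_nonneg_nonneg add_nonneg_nonneg)
      also have "... = cmod (a k + b k) * ?B E + \<delta> * m k * ?B E" unfolding BE by (simp add: mult.assoc)
      finally show ?thesis .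
    next
      case False
      have "cmod (gap_gf t a b D (\<lambda>n. w ^ n)) = cmod (a k + b k) * cmod (gap_gf t a b E (\<lambda>n. w ^ n))"
        unfolding D gap_gf_insert[OF E(1-3) assms(2)] using False by (simp add: norm_mult)
      also have "... \<le> cmod (a k + b k) * ?B E" using IE by (intro mult_left_mono) auto
      also have "... \<le> cmod (a k + b k) * ?B E + \<delta> * m k * ?B E"
        using assms(3,4) nn by (simp add: prod_nonneg)
      finally show ?thesis .
    qed
    also have "... = ?B D" unfolding D using E by (simp add: distrib_right)
    finally show ?thesis .
  qed (simp add: gap_gf_def gap_count_def)
qed

section \<open>Moments when positions are occupied independently\<close>

context
  fixes t :: int and a b :: "int \<Rightarrow> complex"
  assumes t_pos: "t > 0" and nz: "\<And>k. a k + b k \<noteq> 0"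
begin

text \<open>For positive weights this is the probability of a bead at \<open>k\<close> and a hole at
  \<open>k - t\<close>, when positions are occupied independently with probability
  \<open>b k / (a k + b k)\<close>. Only the algebra of this interpretation is used for complex
  weights.\<close>

definition gap_weight :: "int \<Rightarrow> complex" where
  "gap_weight k = b k * a (k - t) / ((a k + b k) * (a (k - t) + b (k - t)))"

definition gap_exp :: "int set \<Rightarrow> (nat \<Rightarrow> complex) \<Rightarrow> complex" where
  "gap_exp D f = gap_gf t a b D f / (\<Prod>k\<in>D. a k + b k)"

definition gap_weight_on :: "int set \<Rightarrow> int \<Rightarrow> complex" where
  "gap_weight_on D k = (if k - t \<in> D then gap_weight k else 0)"

definition gap_sum1 :: "int set \<Rightarrow> complex" where
  "gap_sum1 D = (\<Sum>k\<in>D. gap_weight_on D k)"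

text \<open>The gaps at \<open>k\<close> and at \<open>k - t\<close> exclude each other, since
  \<open>k - t\<close> would have to be hole and bead at once; all other pairs of gaps are
  independent. The expected number of ordered pairs of distinct gaps is therefore the square of
  \<open>gap_sum1\<close> diminished by this sum.\<close>

definition gap_sum2 :: "int set \<Rightarrow> complex" where
  "gap_sum2 D = (\<Sum>k\<in>D. (gap_weight_on D k)\<^sup>2 + 2 * gap_weight_on D k * gap_weight_on D (k - t))"

lemma gap_exp_insert:
  assumes D: "finite D" "k \<notin> D" "k + t \<notin> D"
  shows "gap_exp (insert k D) f = gap_exp D f
    + gap_weight_on D k * gap_exp (D - {k - t}) (\<lambda>n. f (Suc n) - f n)"
proof (cases "k - t \<in> D")
  case True
  let ?N = "\<lambda>D. \<Prod>k\<in>D. a k + b k"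
  have N: "?N D = (a (k - t) + b (k - t)) * ?N (D - {k - t})" using D(1) True by (simp add: prod.remove)
  have n0: "?N (D - {k - t}) \<noteq> 0" using nz D by simp
  have *: "(x * y + z) / (x * (v * p)) = y / (v * p) + z / (x * v) / p"
    if "x \<noteq> 0" "v \<noteq> 0" "p \<noteq> 0" for x y z v p :: complex
    using that by (simp add: field_simps)
  have "gap_exp (insert k D) f = ((a k + b k) * gap_gf t a b D f
      + b k * a (k - t) * gap_gf t a b (D - {k - t}) (\<lambda>n. f (Suc n) - f n))
      / ((a k + b k) * ((a (k - t) + b (k - t)) * ?N (D - {k - t})))"
    unfolding gap_exp_def gap_gf_insert[OF D t_pos] using True D N by simp
  also have "... = gap_exp D f + gap_weight k * gap_exp (D - {k - t}) (\<lambda>n. f (Suc n) - f n)"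
    unfolding *[OF nz nz n0] gap_exp_def gap_weight_def N by (simp add: mult_ac)
  finally show ?thesis using True by (simp add: gap_weight_on_def)
next
  case False
  then show ?thesis
    unfolding gap_exp_def gap_gf_insert[OF D t_pos] gap_weight_on_def
    using D nz[of k] by simp
qed

lemma gap_weight_on_insert: "k + t \<notin> D \<Longrightarrow> j \<in> insert k D \<Longrightarrow> gap_weight_on (insert k D) j = gap_weight_on D j"
  using t_pos by (auto simp: gap_weight_on_def)

lemma gap_weight_on_insert_shift:
  "\<forall>x\<in>D. x < k \<Longrightarrow> j \<in> insert k D \<Longrightarrow> gap_weight_on (insert k D) (j - t) = gap_weight_on D (j - t)"
  using t_pos by (fastforce simp: gap_weight_on_def)

lemma gap_sum1_insert:
  assumes "finite D" "k \<notin> D" "k + t \<notin> D"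
  shows "gap_sum1 (insert k D) = gap_sum1 D + gap_weight_on D k"
  unfolding gap_sum1_def using assms gap_weight_on_insert[OF assms(3)] by (simp cong: sum.cong)

lemma gap_sum2_insert:
  assumes "finite D" "\<forall>x\<in>D. x < k"
  shows "gap_sum2 (insert k D) = gap_sum2 D
    + ((gap_weight_on D k)\<^sup>2 + 2 * gap_weight_on D k * gap_weight_on D (k - t))"
proof -
  have "k \<notin> D" "k + t \<notin> D" using assms t_pos by fastforce+
  then show ?thesis
    unfolding gap_sum2_def using assms gap_weight_on_insert[of k D] gap_weight_on_insert_shift[of D k]
    by (simp cong: sum.cong)
qed

lemma gap_exp_1: "finite D \<Longrightarrow> gap_exp D (\<lambda>_. c) = c"
proof (induction rule: finite_linorder_max_induct)
  case (insert k D)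
  have "gap_exp F (\<lambda>_. 0) = 0" for F by (simp add: gap_exp_def gap_gf_def)
  moreover have "k \<notin> D" "k + t \<notin> D" using insert.hyps t_pos by fastforce+
  ultimately show ?case using gap_exp_insert[of D k "\<lambda>_. c"] insert by simp
qed (simp add: gap_exp_def gap_gf_def)

lemma gap_exp_of_nat: "finite D \<Longrightarrow> gap_exp D of_nat = gap_sum1 D"
proof (induction rule: finite_linorder_max_induct)
  case (insert k D)
  have "k \<notin> D" "k + t \<notin> D" using insert.hyps t_pos by fastforce+
  then show ?case using gap_exp_insert[of D k of_nat] insert gap_exp_1[of "D - {k - t}" 1]
    by (simp add: gap_sum1_insert)
qed (simp add: gap_exp_def gap_gf_def gap_sum1_def gap_count_def)

lemma gap_exp_factorial2:
  "finite D \<Longrightarrow> gap_exp D (\<lambda>n. of_nat n * (of_nat n - 1)) = (gap_sum1 D)\<^sup>2 - gap_sum2 D"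
proof (induction rule: finite_linorder_max_induct)
  case (insert k D)
  have kD: "k \<notin> D" "k + t \<notin> D" using insert.hyps t_pos by fastforce+
  let ?E = "D - {k - t}"
  have df: "(\<lambda>n. of_nat (Suc n) * (of_nat (Suc n) - 1) - of_nat n * (of_nat n - 1)) = (\<lambda>n. 2 * of_nat n :: complex)"
    by (auto simp: algebra_simps)
  have lin: "gap_exp ?E (\<lambda>n. 2 * of_nat n) = 2 * gap_exp ?E of_nat"
    by (simp add: gap_exp_def gap_gf_def sum_distrib_left mult_ac)
  \<comment> \<open>Deleting \<open>k - t\<close> from \<open>D\<close> loses only the gap with bead
    at \<open>k - t\<close>; the gap in which \<open>k - t\<close> is the hole has its bead at
    \<open>k\<close>, outside \<open>D\<close>.\<close>
  have "gap_weight_on D k * gap_sum1 ?E = gap_weight_on D k * (gap_sum1 D - gap_weight_on D (k - t))"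
  proof (cases "k - t \<in> D")
    case True
    have "gap_sum1 D = gap_sum1 (insert (k - t) ?E)" using True by (simp add: insert_absorb)
    also have "... = gap_sum1 ?E + gap_weight_on ?E (k - t)"
      by (rule gap_sum1_insert) (use insert kD in auto)
    also have "gap_weight_on ?E (k - t) = gap_weight_on D (k - t)"
      using t_pos by (auto simp: gap_weight_on_def)
    finally show ?thesis by simp
  qed (simp add: gap_weight_on_def)
  then show ?case
    unfolding gap_exp_insert[OF insert.hyps(1) kD] df lin insert.IH
      gap_sum1_insert[OF insert.hyps(1) kD] gap_sum2_insert[OF insert.hyps(1,2)]
  proof -
    assume *: "gap_weight_on D k * gap_sum1 ?E = gap_weight_on D k * (gap_sum1 D - gap_weight_on D (k - t))"
    have "gap_weight_on D k * (2 * gap_exp ?E of_nat) = 2 * (gap_weight_on D k * (gap_sum1 D - gap_weight_on D (k - t)))"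
      unfolding gap_exp_of_nat[OF finite_Diff[OF insert.hyps(1)]] *[symmetric] by simp
    then show "(gap_sum1 D)\<^sup>2 - gap_sum2 D + gap_weight_on D k * (2 * gap_exp ?E of_nat) =
      (gap_sum1 D + gap_weight_on D k)\<^sup>2 - (gap_sum2 D + ((gap_weight_on D k)\<^sup>2 + 2 * gap_weight_on D k * gap_weight_on D (k - t)))"
      by (simp add: algebra_simps power2_eq_square)
  qed
qed (simp add: gap_exp_def gap_gf_def gap_sum1_def gap_sum2_def gap_count_def)

text \<open>Removing the upper end \<open>j\<close> of a chain gives the exact relation \<delta>_j =
  (w - 1) g_j / (1 + \<delta>_(j - t)) with g the gap weight, a continued fraction. The three bounds
  are its expansions to first, second and third order; each of the later two uses the earlier ones
  at j - t. Each bound keeps the factor \<open>cmod (gap_weight j)\<close>, so that the errors can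
  be summed over a window of any size.\<close>

lemma gap_exp_power_ratio:
  fixes w :: complex
  assumes "finite D" "\<And>k. k \<in> D \<Longrightarrow> cmod (gap_weight k) \<le> M" "cmod (w - 1) * M \<le> 1/4" "M \<ge> 0"
    and "j \<in> D" "j + t \<notin> D"
  shows "\<exists>\<delta>. gap_exp D (\<lambda>n. w ^ n) = (1 + \<delta>) * gap_exp (D - {j}) (\<lambda>n. w ^ n)
     \<and> cmod \<delta> \<le> 2 * (cmod (w - 1) * cmod (gap_weight j))
     \<and> cmod (\<delta> - (w - 1) * gap_weight_on D j) \<le> 4 * (cmod (w - 1) * cmod (gap_weight j)) * (cmod (w - 1) * M)
     \<and> cmod (\<delta> - (w - 1) * gap_weight_on D j + (w - 1)\<^sup>2 * gap_weight_on D j * gap_weight_on D (j - t))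
        \<le> 12 * (cmod (w - 1) * cmod (gap_weight j)) * (cmod (w - 1) * M)\<^sup>2"
  using assms(1,2,5,6)
proof (induction "card D" arbitrary: D j rule: less_induct)
  case less
  let ?e = "w - 1" and ?D = "D - {j}"
  let ?\<phi> = "\<lambda>D. gap_exp D (\<lambda>n. w ^ n)"
  have fd: "gap_exp F (\<lambda>n. w ^ Suc n - w ^ n) = ?e * ?\<phi> F" for F
  proof -
    have "gap_gf t a b F (\<lambda>n. w ^ Suc n - w ^ n) = ?e * gap_gf t a b F (\<lambda>n. w ^ n)"
      unfolding gap_gf_def sum_distrib_left by (rule sum.cong) (auto simp: algebra_simps)
    then show ?thesis by (simp add: gap_exp_def)
  qed
  have ins: "?\<phi> D = ?\<phi> ?D + gap_weight_on ?D j * (?e * ?\<phi> (?D - {j - t}))"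
    using gap_exp_insert[of ?D j "\<lambda>n. w ^ n"] less.prems fd by (simp add: insert_absorb)
  have on: "gap_weight_on ?D j = gap_weight_on D j" using t_pos by (auto simp: gap_weight_on_def)
  have nn: "cmod ?e * cmod (gap_weight j) \<ge> 0" "cmod ?e * M \<ge> 0" using assms(4) by auto
  show ?case
  proof (cases "j - t \<in> D")
    case False
    then have "gap_weight_on D j = 0" by (simp add: gap_weight_on_def)
    then show ?thesis using ins on nn by (intro exI[of _ 0]) auto
  next
    case True
    have Aj: "gap_weight_on D j = gap_weight j" using True by (simp add: gap_weight_on_def)
    have lt: "card ?D < card D" using less.prems by (meson card_Diff1_less)
    have pr: "finite ?D" "j - t \<in> ?D" "j - t + t \<notin> ?D" using less.prems True t_pos by auto
    have "\<And>k. k \<in> ?D \<Longrightarrow> cmod (gap_weight k) \<le> M" using less.prems by auto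
    from less.hyps[OF lt pr(1) this pr(2,3)] obtain \<delta> where
      d: "?\<phi> ?D = (1 + \<delta>) * ?\<phi> (?D - {j - t})"
      and d1: "cmod \<delta> \<le> 2 * (cmod ?e * cmod (gap_weight (j - t)))"
      and d2: "cmod (\<delta> - ?e * gap_weight_on ?D (j - t)) \<le> 4 * (cmod ?e * cmod (gap_weight (j - t))) * (cmod ?e * M)"
      by blast
    have on2: "gap_weight_on ?D (j - t) = gap_weight_on D (j - t)" using t_pos by (auto simp: gap_weight_on_def)
    have M1: "cmod ?e * cmod (gap_weight (j - t)) \<le> cmod ?e * M"
      using less.prems(2)[OF True] by (intro mult_left_mono) auto
    have dM: "cmod \<delta> \<le> 2 * (cmod ?e * M)" using d1 M1 by linarith
    have dh: "cmod \<delta> \<le> 1/2" using dM assms(3) by linarith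
    have "cmod 1 - cmod \<delta> \<le> cmod (1 + \<delta>)" by (metis norm_diff_ineq)
    then have half: "cmod (1 + \<delta>) \<ge> 1/2" using dh by simp
    then have n0: "1 + \<delta> \<noteq> 0" by auto
    define \<delta>' where "\<delta>' = ?e * gap_weight j / (1 + \<delta>)"
    have inv2: "1 / cmod (1 + \<delta>) \<le> 2" using half by (simp add: divide_simps)
    have "?\<phi> D = (1 + \<delta>') * ?\<phi> ?D"
      unfolding ins on Aj d \<delta>'_def using n0 by (simp add: field_simps)
    moreover have "cmod \<delta>' \<le> 2 * (cmod ?e * cmod (gap_weight j))"
    proof -
      have "cmod \<delta>' = (cmod ?e * cmod (gap_weight j)) * (1 / cmod (1 + \<delta>))"
        by (simp add: \<delta>'_def norm_mult norm_divide)
      also have "... \<le> (cmod ?e * cmod (gap_weight j)) * 2" by (rule mult_left_mono[OF inv2 nn(1)])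
      finally show ?thesis by simp
    qed
    moreover have "cmod (\<delta>' - ?e * gap_weight_on D j)
        \<le> 4 * (cmod ?e * cmod (gap_weight j)) * (cmod ?e * M)"
    proof -
      have "\<delta>' - ?e * gap_weight_on D j = - (?e * gap_weight j) * (\<delta> / (1 + \<delta>))"
        unfolding \<delta>'_def Aj using n0 by (simp add: field_simps)
      then have "cmod (\<delta>' - ?e * gap_weight_on D j) = (cmod ?e * cmod (gap_weight j)) * (cmod \<delta> * (1 / cmod (1 + \<delta>)))"
        by (simp add: norm_mult norm_divide)
      also have "... \<le> (cmod ?e * cmod (gap_weight j)) * ((2 * (cmod ?e * M)) * 2)"
        using dM inv2 nn by (intro mult_left_mono mult_mono) auto
      finally show ?thesis by (simp add: mult_ac)
    qed
    moreover have "cmod (\<delta>' - ?e * gap_weight_on D j + ?e\<^sup>2 * gap_weight_on D j * gap_weight_on D (j - t))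
        \<le> 12 * (cmod ?e * cmod (gap_weight j)) * (cmod ?e * M)\<^sup>2"
    proof -
      have "\<delta>' - ?e * gap_weight_on D j + ?e\<^sup>2 * gap_weight_on D j * gap_weight_on D (j - t)
        = (?e * gap_weight j) * (\<delta> * \<delta> / (1 + \<delta>) - (\<delta> - ?e * gap_weight_on D (j - t)))"
        unfolding \<delta>'_def Aj using n0 by (simp add: field_simps power2_eq_square)
      also have "cmod ... = (cmod ?e * cmod (gap_weight j)) * cmod (\<delta> * \<delta> / (1 + \<delta>) - (\<delta> - ?e * gap_weight_on D (j - t)))"
        by (simp add: norm_mult)
      also have "... \<le> (cmod ?e * cmod (gap_weight j)) * (12 * (cmod ?e * M)\<^sup>2)"
      proof (rule mult_left_mono[OF _ nn(1)])
        have "cmod (\<delta> * \<delta> / (1 + \<delta>)) = cmod \<delta> * cmod \<delta> * (1 / cmod (1 + \<delta>))"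
          by (simp add: norm_mult norm_divide)
        also have "... \<le> (2 * (cmod ?e * M)) * (2 * (cmod ?e * M)) * 2"
          using dM inv2 nn assms(4) by (intro mult_mono mult_nonneg_nonneg) auto
        finally have "cmod (\<delta> * \<delta> / (1 + \<delta>)) \<le> 8 * (cmod ?e * M)\<^sup>2" by (simp add: power2_eq_square)
        moreover have "cmod (\<delta> - ?e * gap_weight_on D (j - t)) \<le> 4 * (cmod ?e * M)\<^sup>2"
        proof -
          have "4 * (cmod ?e * cmod (gap_weight (j - t))) * (cmod ?e * M) \<le> 4 * (cmod ?e * M) * (cmod ?e * M)"
            using M1 nn by (intro mult_right_mono) auto
          then show ?thesis using d2 unfolding on2 by (simp add: power2_eq_square mult.assoc)
        qed
        ultimately show "cmod (\<delta> * \<delta> / (1 + \<delta>) - (\<delta> - ?e * gap_weight_on D (j - t))) \<le> 12 * (cmod ?e * M)\<^sup>2"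
          using norm_triangle_ineq4[of "\<delta> * \<delta> / (1 + \<delta>)" "\<delta> - ?e * gap_weight_on D (j - t)"] by linarith
      qed
      finally show ?thesis by (simp add: mult_ac)
    qed
    ultimately show ?thesis by blast
  qed
qed

lemma norm_Ln_1_plus_minus_le:
  fixes \<delta> :: complex
  assumes "cmod \<delta> \<le> 1/2"
  shows "cmod (Ln (1 + \<delta>) - \<delta> + \<delta>\<^sup>2 / 2) \<le> cmod \<delta> ^ 3"
proof -
  have "(\<lambda>n. - ((- \<delta>) ^ n) / of_nat n) sums Ln (1 + \<delta>)" using assms by (intro Ln_series') auto
  from sums_split_initial_segment[OF this, of 3]
  have s: "(\<lambda>n. - ((- \<delta>) ^ (n + 3)) / of_nat (n + 3)) sums (Ln (1 + \<delta>) - \<delta> + \<delta>\<^sup>2 / 2)"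
    by (simp add: numeral_3_eq_3 power2_eq_square diff_diff_eq2 diff_add_eq)
  have g: "(\<lambda>n. cmod \<delta> ^ 3 / 2 * (1 / 2) ^ n) sums (cmod \<delta> ^ 3 / 2 * 2)"
    using geometric_sums[of "1 / 2 :: real"] by (intro sums_mult) auto
  have "cmod (- ((- \<delta>) ^ (n + 3)) / of_nat (n + 3)) \<le> cmod \<delta> ^ 3 / 2 * (1 / 2) ^ n" for n
  proof -
    have "cmod (of_nat (n + 3)) = real (n + 3)" by (rule norm_of_nat)
    then have "cmod (- ((- \<delta>) ^ (n + 3)) / of_nat (n + 3)) = cmod \<delta> ^ 3 * cmod \<delta> ^ n / real (n + 3)"
      by (simp add: norm_divide norm_power norm_mult power_add mult.commute del: of_nat_add)
    also have "... \<le> cmod \<delta> ^ 3 * (1 / 2) ^ n / 2"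
      using assms by (intro frac_le mult_left_mono power_mono) auto
    finally show ?thesis by (simp add: mult_ac)
  qed
  then show ?thesis using norm_sums_le[OF s g] by simp
qed

text \<open>Positions are added from below and the values Ln (1 + \<delta>) summed. With g and g'
  the weights at k and k - t, such a value is (w - 1) g - (w - 1)^2 (g^2 + 2 g g') / 2 up to third
  order, which are the summands of \<open>gap_sum1\<close> and \<open>gap_sum2\<close>. The constant
  40 leaves room over the 8 + 12 + 6 obtained from the three error terms.\<close>

lemma gap_exp_power:
  fixes w :: complex
  assumes "finite D" "\<And>k. cmod (gap_weight k) \<le> M" "cmod (w - 1) * M \<le> 1/4"
  shows "\<exists>R. gap_exp D (\<lambda>n. w ^ n) = exp ((w - 1) * gap_sum1 D - (w - 1)\<^sup>2 * gap_sum2 D / 2 + R)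
     \<and> cmod R \<le> 40 * cmod (w - 1) ^ 3 * M\<^sup>2 * (\<Sum>k\<in>D. cmod (gap_weight k))"
  using assms(1)
proof (induction rule: finite_linorder_max_induct)
  case empty
  then show ?case
    by (intro exI[of _ 0]) (simp add: gap_exp_def gap_gf_def gap_sum1_def gap_sum2_def gap_count_def)
next
  case (insert k D)
  let ?e = "w - 1"
  have M0: "M \<ge> 0" using assms(2)[of 0] norm_ge_zero order.trans by blast
  have kD: "k \<notin> D" "k + t \<notin> D" using insert.hyps t_pos by fastforce+
  obtain R where R: "gap_exp D (\<lambda>n. w ^ n) = exp (?e * gap_sum1 D - ?e\<^sup>2 * gap_sum2 D / 2 + R)"
    "cmod R \<le> 40 * cmod ?e ^ 3 * M\<^sup>2 * (\<Sum>k\<in>D. cmod (gap_weight k))" using insert.IH by blast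
  have "k + t \<notin> insert k D" using kD t_pos by auto
  then obtain \<delta> where d: "gap_exp (insert k D) (\<lambda>n. w ^ n) = (1 + \<delta>) * gap_exp D (\<lambda>n. w ^ n)"
    and d1: "cmod \<delta> \<le> 2 * (cmod ?e * cmod (gap_weight k))"
    and d2: "cmod (\<delta> - ?e * gap_weight_on D k) \<le> 4 * (cmod ?e * cmod (gap_weight k)) * (cmod ?e * M)"
    and d3: "cmod (\<delta> - ?e * gap_weight_on D k + ?e\<^sup>2 * gap_weight_on D k * gap_weight_on D (k - t))
        \<le> 12 * (cmod ?e * cmod (gap_weight k)) * (cmod ?e * M)\<^sup>2"
    using gap_exp_power_ratio[OF _ assms(2) assms(3) M0, of "insert k D" k] insert.hyps(1) kD(1)
    unfolding gap_weight_on_insert[OF kD(2) insertI1] gap_weight_on_insert_shift[OF insert.hyps(2) insertI1]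
      Diff_insert_absorb[OF kD(1)]
    by blast
  define x where "x = cmod ?e * cmod (gap_weight k)"
  define y where "y = cmod ?e * M"
  have xy: "0 \<le> x" "x \<le> y" "y \<le> 1/4"
    using assms(2)[of k] assms(3) by (auto simp: x_def y_def intro!: mult_left_mono)
  let ?A = "gap_weight_on D k" and ?B = "gap_weight_on D (k - t)"
  have Ax: "cmod (?e * ?A) \<le> x" by (auto simp: x_def gap_weight_on_def norm_mult)
  have dx: "cmod \<delta> \<le> 2 * x" using d1 by (simp add: x_def)
  have dh: "cmod \<delta> \<le> 1/2" using dx xy by linarith
  have n0: "1 + \<delta> \<noteq> 0"
  proof
    assume "1 + \<delta> = 0"
    then have "\<delta> = -1" by (simp add: eq_neg_iff_add_eq_0 add.commute)
    then show False using dh by simp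
  qed
  define r where "r = Ln (1 + \<delta>) - (?e * ?A - ?e\<^sup>2 * (?A\<^sup>2 + 2 * ?A * ?B) / 2)"
  have xyy: "x * y\<^sup>2 \<ge> 0" "x ^ 2 \<le> y ^ 2" using xy by (auto intro: power_mono)
  have r: "cmod r \<le> 40 * x * y\<^sup>2"
  proof -
    have "r = (Ln (1 + \<delta>) - \<delta> + \<delta>\<^sup>2 / 2) + (\<delta> - ?e * ?A + ?e\<^sup>2 * ?A * ?B)
        - (\<delta> - ?e * ?A) * (\<delta> + ?e * ?A) / 2"
      by (simp add: r_def field_simps power2_eq_square)
    moreover have "cmod (u + v - z) \<le> cmod u + cmod v + cmod z" for u v z
      using norm_triangle_ineq4[of "u + v" z] norm_triangle_ineq[of u v] by linarith
    ultimately have "cmod r \<le> cmod (Ln (1 + \<delta>) - \<delta> + \<delta>\<^sup>2 / 2) + cmod (\<delta> - ?e * ?A + ?e\<^sup>2 * ?A * ?B)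
        + cmod ((\<delta> - ?e * ?A) * (\<delta> + ?e * ?A) / 2)"
      by (simp only:)
    moreover have "cmod (Ln (1 + \<delta>) - \<delta> + \<delta>\<^sup>2 / 2) \<le> 8 * x * y\<^sup>2"
    proof -
      have "cmod \<delta> ^ 3 \<le> (2 * x) ^ 3" using dx by (intro power_mono) auto
      also have "... = 8 * x * x\<^sup>2" by (simp add: power2_eq_square power3_eq_cube)
      also have "... \<le> 8 * x * y\<^sup>2" using xyy xy by (intro mult_left_mono) auto
      finally show ?thesis using norm_Ln_1_plus_minus_le[OF dh] by linarith
    qed
    moreover have "cmod (\<delta> - ?e * ?A + ?e\<^sup>2 * ?A * ?B) \<le> 12 * x * y\<^sup>2"
      using d3 by (simp add: x_def y_def)
    moreover have "cmod ((\<delta> - ?e * ?A) * (\<delta> + ?e * ?A) / 2) \<le> 6 * x * y\<^sup>2"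
    proof -
      have "cmod (\<delta> + ?e * ?A) \<le> 3 * y" using norm_triangle_ineq[of \<delta> "?e * ?A"] Ax dx xy by linarith
      moreover have "cmod (\<delta> - ?e * ?A) \<le> 4 * x * y" using d2 by (simp add: x_def y_def)
      ultimately have "cmod (\<delta> - ?e * ?A) * cmod (\<delta> + ?e * ?A) \<le> (4 * x * y) * (3 * y)"
        using xy by (intro mult_mono) auto
      then show ?thesis by (simp add: norm_mult norm_divide power2_eq_square)
    qed
    ultimately show ?thesis using xyy by linarith
  qed
  have "gap_exp (insert k D) (\<lambda>n. w ^ n) = exp (Ln (1 + \<delta>)) * exp (?e * gap_sum1 D - ?e\<^sup>2 * gap_sum2 D / 2 + R)"
    using d R(1) n0 by simp
  also have "... = exp (?e * gap_sum1 (insert k D) - ?e\<^sup>2 * gap_sum2 (insert k D) / 2 + (R + r))"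
    unfolding gap_sum1_insert[OF insert.hyps(1) kD] gap_sum2_insert[OF insert.hyps(1,2)] r_def
    unfolding exp_add[symmetric] by (rule arg_cong[of _ _ exp]) (simp add: field_simps)
  finally have 1: "gap_exp (insert k D) (\<lambda>n. w ^ n)
     = exp (?e * gap_sum1 (insert k D) - ?e\<^sup>2 * gap_sum2 (insert k D) / 2 + (R + r))" .
  have "cmod (R + r) \<le> 40 * cmod ?e ^ 3 * M\<^sup>2 * (\<Sum>k\<in>D. cmod (gap_weight k)) + 40 * x * y\<^sup>2"
    using R(2) r norm_triangle_ineq[of R r] by linarith
  also have "... = 40 * cmod ?e ^ 3 * M\<^sup>2 * (\<Sum>k\<in>insert k D. cmod (gap_weight k))"
    using insert.hyps(1) kD by (simp add: x_def y_def algebra_simps power2_eq_square power3_eq_cube)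
  finally show ?case using 1 by blast
qed

end

section \<open>Beads\<close>

text \<open>A strict partition \<open>S\<close> is encoded by a set of beads on the integers: a positive \<open>k\<close> is occupied
  iff \<open>k \<in> S\<close>, a negative \<open>k\<close> iff \<open>- k \<notin> S\<close>. One residue class out of each pair \<open>r\<close>, \<open>- r\<close> modulo
  \<open>t\<close> suffices; the classes of \<open>0\<close> and \<open>t / 2\<close> are their own partners and are cut at \<open>0\<close>.\<close>

definition bead_positions :: "nat \<Rightarrow> nat \<Rightarrow> int set" where
  "bead_positions t J = {k. 2 * (k mod int t) \<le> int t \<and>
     (k mod int t = 0 \<or> 2 * (k mod int t) = int t \<longrightarrow> 0 \<le> k) \<and> - int (J * t) \<le> k \<and> k < int (J * t)}"

definition bead_sizes :: "nat \<Rightarrow> nat \<Rightarrow> nat set" where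
  "bead_sizes t J = (\<lambda>k. nat \<bar>k\<bar>) ` (bead_positions t J - {0})"

definition beads :: "nat \<Rightarrow> nat \<Rightarrow> nat set \<Rightarrow> int set" where
  "beads t J S = {k \<in> bead_positions t J. (k > 0 \<and> nat k \<in> S) \<or> (k < 0 \<and> nat (- k) \<notin> S)}"

definition hole_weight :: "complex \<Rightarrow> int \<Rightarrow> complex" where
  "hole_weight q k = (if k < 0 then q ^ nat (- k) else 1)"

text \<open>Parts are beads at positive and holes at negative positions, so these carry the powers
  of \<open>q\<close>. The weight 0 at position 0 forces a hole there, which makes a part equal to
  \<open>t\<close> count as a bar.\<close>

definition bead_weight :: "complex \<Rightarrow> int \<Rightarrow> complex" where
  "bead_weight q k = (if k > 0 then q ^ nat k else if k = 0 then 0 else 1)"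

abbreviation "b_gf t q \<equiv> gap_gf (int t) (hole_weight q) (bead_weight q)"
abbreviation "b_exp t q \<equiv> gap_exp (int t) (hole_weight q) (bead_weight q)"
abbreviation "b_sum1 t q \<equiv> gap_sum1 (int t) (hole_weight q) (bead_weight q)"
abbreviation "b_sum2 t q \<equiv> gap_sum2 (int t) (hole_weight q) (bead_weight q)"
abbreviation "b_weight t q \<equiv> gap_weight (int t) (hole_weight q) (bead_weight q)"
abbreviation "b_weight_on t q \<equiv> gap_weight_on (int t) (hole_weight q) (bead_weight q)"

lemma finite_bead_positions: "finite (bead_positions t J)"
  by (rule finite_subset[of _ "{- int (J * t)..<int (J * t)}"]) (auto simp: bead_positions_def)

lemma finite_bead_sizes: "finite (bead_sizes t J)"
  by (simp add: bead_sizes_def finite_bead_positions)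

lemma zero_notin_bead_sizes: "0 \<notin> bead_sizes t J"
  by (auto simp: bead_sizes_def)

lemma uminus_mod_cases:
  fixes k t :: int assumes "t > 0"
  shows "(- k) mod t = (if k mod t = 0 then 0 else t - k mod t)"
  using assms by (simp add: zmod_zminus1_eq_if)

text \<open>The residues of k and -k add up to 0 or t. Both are at most t / 2 only in the classes of
  0 and t / 2, and in these the negative positions have been cut away.\<close>

lemma bead_positions_uminus:
  assumes "t > 0" "k \<in> bead_positions t J" "- k \<in> bead_positions t J"
  shows "k = 0"
proof -
  define r where "r = k mod int t"
  have r: "2 * r \<le> int t" "r = 0 \<or> 2 * r = int t \<longrightarrow> 0 \<le> k"
    using assms(2) unfolding bead_positions_def r_def mem_Collect_eq by metis+
  have r': "2 * ((- k) mod int t) \<le> int t" "(- k) mod int t = 0 \<or> 2 * ((- k) mod int t) = int t \<longrightarrow> 0 \<le> - k"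
    using assms(3) unfolding bead_positions_def mem_Collect_eq by metis+
  have m: "(- k) mod int t = (if r = 0 then 0 else int t - r)"
    using uminus_mod_cases[of "int t" k] assms(1) by (simp add: r_def)
  show ?thesis using r r' unfolding m by (cases "r = 0") auto
qed

lemma bead_sizes_cases:
  assumes "t > 0" "0 < m" "m < J * t"
  shows "m \<in> bead_sizes t J"
proof -
  have r: "0 \<le> int m mod int t" "int m mod int t < int t" using assms(1) by auto
  have b: "int m < int J * int t" using assms(3) by (metis of_nat_less_iff of_nat_mult)
  show ?thesis
  proof (cases "2 * (int m mod int t) \<le> int t")
    case True
    then have "int m \<in> bead_positions t J - {0}" using assms b by (auto simp: bead_positions_def)
    then show ?thesis unfolding bead_sizes_def by (intro image_eqI[of _ _ "int m"]) auto
  next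
    case False
    then have "- int m \<in> bead_positions t J - {0}"
      using assms b r by (auto simp: bead_positions_def uminus_mod_cases)
    then show ?thesis unfolding bead_sizes_def by (intro image_eqI[of _ _ "- int m"]) auto
  qed
qed

lemma inj_on_bead_sizes:
  assumes "t > 0"
  shows "inj_on (\<lambda>k. nat \<bar>k\<bar>) (bead_positions t J - {0})"
proof (rule inj_onI)
  fix x y assume *: "x \<in> bead_positions t J - {0}" "y \<in> bead_positions t J - {0}" "nat \<bar>x\<bar> = nat \<bar>y\<bar>"
  then have "x = y \<or> x = - y" by auto
  then show "x = y" using * bead_positions_uminus[OF assms, of y J] by auto
qed

lemma bij_betw_beads:
  assumes "t > 0"
  shows "bij_betw (beads t J) (Pow (bead_sizes t J)) (Pow (bead_positions t J - {0}))"
proof (rule bij_betw_byWitness[where f' = "\<lambda>X. {m \<in> bead_sizes t J. int m \<in> X \<or> (- int m \<in> bead_positions t J - X)}"])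
  let ?K = "bead_positions t J"
  have U: "m \<in> bead_sizes t J \<longleftrightarrow> m > 0 \<and> (int m \<in> ?K \<or> - int m \<in> ?K)" for m
  proof
    assume "m \<in> bead_sizes t J"
    then obtain k where "k \<in> ?K" "k \<noteq> 0" "m = nat \<bar>k\<bar>" by (auto simp: bead_sizes_def)
    then show "m > 0 \<and> (int m \<in> ?K \<or> - int m \<in> ?K)" by (cases "k > 0") auto
  next
    assume m: "m > 0 \<and> (int m \<in> ?K \<or> - int m \<in> ?K)"
    show "m \<in> bead_sizes t J"
    proof (cases "int m \<in> ?K")
      case True
      then show ?thesis using m unfolding bead_sizes_def by (intro image_eqI[of _ _ "int m"]) auto
    next
      case False
      then show ?thesis using m unfolding bead_sizes_def by (intro image_eqI[of _ _ "- int m"]) auto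
    qed
  qed
  have excl: "\<not> (int m \<in> ?K \<and> - int m \<in> ?K)" if "m > 0" for m
    using bead_positions_uminus[OF assms, of "int m" J] that by auto
  show "\<forall>S\<in>Pow (bead_sizes t J). {m \<in> bead_sizes t J. int m \<in> beads t J S \<or> (- int m \<in> ?K - beads t J S)} = S"
  proof
    fix S assume S: "S \<in> Pow (bead_sizes t J)"
    show "{m \<in> bead_sizes t J. int m \<in> beads t J S \<or> (- int m \<in> ?K - beads t J S)} = S"
      (is "?L = S")
    proof (rule set_eqI)
      fix m
      show "m \<in> ?L \<longleftrightarrow> m \<in> S"
        using S U[of m] excl[of m] by (auto simp: beads_def)
    qed
  qed
  show "\<forall>X\<in>Pow (?K - {0}). beads t J {m \<in> bead_sizes t J. int m \<in> X \<or> (- int m \<in> ?K - X)} = X"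
  proof
    fix X assume X: "X \<in> Pow (?K - {0})"
    show "beads t J {m \<in> bead_sizes t J. int m \<in> X \<or> (- int m \<in> ?K - X)} = X" (is "?L = X")
    proof (rule set_eqI)
      fix k
      have ex: "\<not> (k \<in> ?K \<and> - k \<in> ?K)" if "k \<noteq> 0" using bead_positions_uminus[OF assms, of k J] that by auto
      consider "k > 0" | "k = 0" | "k < 0" by linarith
      then show "k \<in> ?L \<longleftrightarrow> k \<in> X"
      proof cases
        case 1
        then have e: "int (nat k) = k" "nat k > 0" by auto
        show ?thesis using 1 e X U[of "nat k"] ex unfolding beads_def by auto
      next
        case 3
        then have e: "int (nat (- k)) = - k" "nat (- k) > 0" by auto
        show ?thesis using 3 e X U[of "nat (- k)"] ex unfolding beads_def by auto
      qed (use X in \<open>auto simp: beads_def\<close>)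
    qed
  qed
qed (auto simp: beads_def)

lemma bead_weight_prod:
  assumes t: "t > 0" and S: "S \<subseteq> bead_sizes t J"
  shows "(\<Prod>k\<in>beads t J S. bead_weight q k) * (\<Prod>k\<in>bead_positions t J - beads t J S. hole_weight q k) = q ^ \<Sum>S"
proof -
  let ?K = "bead_positions t J"
  have fin: "finite ?K" by (rule finite_bead_positions)
  have sub: "beads t J S \<subseteq> ?K" by (auto simp: beads_def)
  define c where "c k = (if k \<in> beads t J S then bead_weight q k else hole_weight q k)" for k
  have "(\<Prod>k\<in>beads t J S. bead_weight q k) * (\<Prod>k\<in>?K - beads t J S. hole_weight q k)
    = (\<Prod>k\<in>beads t J S. c k) * (\<Prod>k\<in>?K - beads t J S. c k)"
    by (simp add: c_def)
  also have "... = (\<Prod>k\<in>?K. c k)"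
    using prod.subset_diff[OF sub fin, of c] by (simp add: mult.commute)
  also have "... = (\<Prod>k\<in>?K - {0}. c k)"
    by (rule prod.mono_neutral_right) (use fin in \<open>auto simp: c_def hole_weight_def beads_def\<close>)
  also have "... = (\<Prod>k\<in>?K - {0}. if nat \<bar>k\<bar> \<in> S then q ^ nat \<bar>k\<bar> else 1)"
    by (rule prod.cong) (auto simp: c_def hole_weight_def bead_weight_def beads_def)
  also have "... = (\<Prod>m\<in>bead_sizes t J. if m \<in> S then q ^ m else 1)"
    unfolding bead_sizes_def by (subst prod.reindex[OF inj_on_bead_sizes[OF t]]) simp
  also have "... = (\<Prod>m\<in>S. q ^ m)"
    using S finite_bead_sizes by (simp add: prod.inter_restrict[symmetric] Int_absorb1)
  also have "... = q ^ \<Sum>S" by (simp add: power_sum)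
  finally show ?thesis .
qed

text \<open>A gap (k, k - t) is translated according to signs. For k \<ge> t the part k shrinks by
  t. For k < 0 the hole says that t - k is a part and the bead says that -k is none. For 0 < k < t
  both k and t - k are parts, and t - k is the larger one because the residue k lies below t /
  2.\<close>

lemma gap_count_beads:
  assumes t: "t > 0" and S: "S \<subseteq> bead_sizes t J"
  shows "gap_count (int t) (bead_positions t J) (beads t J S) = bar_count t S"
proof -
  let ?K = "bead_positions t J" and ?t = "int t"
  let ?G = "{k \<in> beads t J S. k - ?t \<in> ?K - beads t J S}"
  let ?B1 = "{m \<in> S. t \<le> m \<and> m - t \<notin> S}" and ?B2 = "{m \<in> S. m < t \<and> t < 2 * m \<and> t - m \<in> S}"
  have fS: "finite S" using S finite_bead_sizes finite_subset by blast
  have z: "0 \<notin> S" using S zero_notin_bead_sizes by blast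
  have sh: "(k - ?t) mod ?t = k mod ?t" "(?t - k) mod ?t = (- k) mod ?t" for k
    by (simp, metis add_uminus_conv_diff mod_add_self1)
  \<comment> \<open>The part to which the bar belongs, the larger part in the case of a
    pair.\<close>
  define \<psi> where "\<psi> k = (if ?t \<le> k then nat k else nat (?t - k))" for k :: int
  have "bij_betw \<psi> ?G (?B1 \<union> ?B2)"
  proof (rule bij_betw_imageI)
    show "inj_on \<psi> ?G"
    proof (rule inj_onI)
      fix x y assume x: "x \<in> ?G" and y: "y \<in> ?G" and e: "\<psi> x = \<psi> y"
      have K: "x \<in> ?K" "y \<in> ?K" "x - ?t \<in> ?K" "y - ?t \<in> ?K" using x y by (auto simp: beads_def)
      have m: False if "u = ?t - v" "u \<ge> ?t" "v < ?t" "u \<in> ?K" "v \<in> ?K" "v - ?t \<in> ?K" for u v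
        using bead_positions_uminus[OF t, of u J] that t by auto
      have tp: "?t > 0" using t by simp
      consider "?t \<le> x" "?t \<le> y" | "?t \<le> x" "y < ?t" | "x < ?t" "?t \<le> y" | "x < ?t" "y < ?t" by linarith
      then show "x = y"
      proof cases
        case 1
        then show ?thesis using e tp unfolding \<psi>_def by simp
      next
        case 2
        then have "x = ?t - y" using e tp unfolding \<psi>_def by simp
        then show ?thesis using m[of x y] 2 K by blast
      next
        case 3
        then have "y = ?t - x" using e tp unfolding \<psi>_def by simp
        then show ?thesis using m[of y x] 3 K by blast
      next
        case 4
        then show ?thesis using e tp unfolding \<psi>_def by simp
      qed
    qed
    show "\<psi> ` ?G = ?B1 \<union> ?B2"
    proof (rule subset_antisym; rule subsetI)
      fix m assume "m \<in> \<psi> ` ?G"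
      then obtain k where k: "k \<in> ?G" "m = \<psi> k" by blast
      have K: "k \<in> ?K" "k - ?t \<in> ?K" using k by (auto simp: beads_def)
      consider "?t \<le> k" | "0 < k" "k < ?t" | "k < 0"
      proof -
        assume "?t \<le> k \<Longrightarrow> thesis" "0 < k \<Longrightarrow> k < ?t \<Longrightarrow> thesis" "k < 0 \<Longrightarrow> thesis"
        moreover have "k \<noteq> 0" using k(1) by (auto simp: beads_def)
        ultimately show thesis by linarith
      qed
      then show "m \<in> ?B1 \<union> ?B2"
      proof cases
        case 1
        have "nat (k - ?t) = nat k - t" by simp
        then show ?thesis using k K z 1 t by (cases "k = ?t") (auto simp: \<psi>_def beads_def nat_diff_distrib)
      next
        case 2
        then have "k mod ?t = k" by simp
        moreover have "(k - ?t) mod ?t = k" using 2 by simp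
        ultimately have "2 * k < ?t" using K 2 unfolding bead_positions_def by auto
        moreover have "nat k \<in> S" "nat (?t - k) \<in> S" using k(1) K 2 by (auto simp: beads_def)
        moreover have "t - nat (?t - k) = nat k" using 2 by (simp add: nat_diff_distrib)
        ultimately show ?thesis using k(2) 2 by (auto simp: \<psi>_def)
      next
        case 3
        then have "nat (- k) \<notin> S" "nat (?t - k) \<in> S" using k(1) K t by (auto simp: beads_def)
        moreover have "nat (?t - k) - t = nat (- k)" "t \<le> nat (?t - k)" using 3 by auto
        ultimately show ?thesis using k(2) 3 t by (auto simp: \<psi>_def)
      qed
    next
      fix m assume m: "m \<in> ?B1 \<union> ?B2"
      then have "m \<in> S" by auto
      then obtain k where k: "k \<in> ?K" "k \<noteq> 0" "m = nat \<bar>k\<bar>" using S by (auto simp: bead_sizes_def)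
      have r: "0 \<le> int m mod ?t" "int m mod ?t < ?t" using t by auto
      show "m \<in> \<psi> ` ?G"
      proof (cases "k > 0")
        case True
        then have e: "k = int m" using k by auto
        have "m \<notin> ?B2"
        proof
          assume "m \<in> ?B2"
          then show False using k(1) e by (auto simp: bead_positions_def)
        qed
        then have b: "t \<le> m" "m - t \<notin> S" using m by auto
        have "k - ?t \<in> ?K" using k(1) b e unfolding bead_positions_def by (auto simp: sh)
        moreover have "nat (k - ?t) = m - t" using e by auto
        ultimately have "k \<in> ?G" using k(1) e b \<open>m \<in> S\<close> True by (auto simp: beads_def)
        then show ?thesis using b e by (intro image_eqI[of _ _ k]) (auto simp: \<psi>_def)
      next
        case False
        then have e: "k = - int m" using k by auto
        have nz: "k mod ?t \<noteq> 0" "2 * (k mod ?t) < ?t" using k(1) False k(2) unfolding bead_positions_def by auto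
        have rr: "0 \<le> k mod ?t" using t by simp
        have mm: "(?t - int m) mod ?t = k mod ?t" using e by (simp add: sh)
        let ?k = "?t - int m"
        have mt: "m \<noteq> t" using nz(1) e by auto
        have Jt: "int m \<le> int J * ?t" using k(1) e unfolding bead_positions_def by auto
        have "J \<noteq> 0"
        proof
          assume "J = 0"
          then show False using Jt k(2) e by simp
        qed
        then have Jt2: "?t \<le> int J * ?t" using mult_right_mono[of 1 "int J" ?t] by simp
        have kK: "?k \<in> ?K"
          using nz mt Jt Jt2 k(2) e False unfolding bead_positions_def mem_Collect_eq mm by simp
        have k2: "?k - ?t = k" using e by simp
        have "nat (- (?k - ?t)) = m" using e by simp
        then have notin: "?k - ?t \<in> ?K - beads t J S" using k(1) \<open>m \<in> S\<close> False k2 by (auto simp: beads_def)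
        have "?k \<in> beads t J S"
        proof (cases "m < t")
          case True
          then have "m \<in> ?B2" using m by auto
          then have "t - m \<in> S" by auto
          moreover have "nat ?k = t - m" by auto
          ultimately show ?thesis using kK True by (auto simp: beads_def)
        next
          case False
          then have "m - t \<notin> S" "t < m" using m mt by auto
          moreover have "nat (- ?k) = m - t" by auto
          ultimately show ?thesis using kK by (auto simp: beads_def)
        qed
        then have kG: "?k \<in> ?G" using notin by blast
        have "m > 0" using k(2) e by simp
        then have "m = \<psi> ?k" by (simp add: \<psi>_def)
        then show ?thesis using kG by (rule image_eqI)
      qed
    qed
  qed
  then have "card ?G = card (?B1 \<union> ?B2)" by (rule bij_betw_same_card)
  also have "... = card ?B1 + card ?B2" by (rule card_Un_disjoint) (use fS in auto)
  finally show ?thesis by (simp add: gap_count_def bar_count_def)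
qed

lemma gap_gf_beads:
  assumes "t > 0"
  shows "b_gf t q (bead_positions t J) f
    = (\<Sum>S\<in>Pow (bead_sizes t J). q ^ \<Sum>S * f (bar_count t S))"
proof -
  let ?K = "bead_positions t J"
  let ?T = "\<lambda>X. (\<Prod>k\<in>X. bead_weight q k) * (\<Prod>k\<in>?K - X. hole_weight q k) * f (gap_count (int t) ?K X)"
  have "b_gf t q ?K f = (\<Sum>X\<in>Pow (?K - {0}). ?T X)"
    unfolding gap_gf_def
  proof (rule sum.mono_neutral_right)
    show "finite (Pow ?K)" using finite_bead_positions by simp
    show "\<forall>X\<in>Pow ?K - Pow (?K - {0}). ?T X = 0"
    proof
      fix X assume "X \<in> Pow ?K - Pow (?K - {0})"
      then have "0 \<in> X" "finite X" using finite_bead_positions finite_subset by auto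
      then have "(\<Prod>k\<in>X. bead_weight q k) = 0" by (auto simp: prod_zero_iff bead_weight_def intro!: bexI[of _ 0])
      then show "?T X = 0" by simp
    qed
  qed auto
  also have "... = (\<Sum>S\<in>Pow (bead_sizes t J). ?T (beads t J S))"
    by (rule sum.reindex_bij_betw[OF bij_betw_beads[OF assms], symmetric])
  also have "... = (\<Sum>S\<in>Pow (bead_sizes t J). q ^ \<Sum>S * f (bar_count t S))"
  proof (rule sum.cong)
    fix S assume "S \<in> Pow (bead_sizes t J)"
    then have "S \<subseteq> bead_sizes t J" by simp
    from bead_weight_prod[OF assms this, of q] gap_count_beads[OF assms this]
    show "?T (beads t J S) = q ^ \<Sum>S * f (bar_count t S)" by simp
  qed simp
  finally show ?thesis .
qed

section \<open>Generating functions over all strict partitions\<close>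

definition strict_sum :: "(nat set \<Rightarrow> complex) \<Rightarrow> nat \<Rightarrow> complex" where
  "strict_sum g n = (\<Sum>S\<in>strict_sets n. g S)"

abbreviation "bar_sum1 t \<equiv> strict_sum (\<lambda>S. of_nat (bar_count t S))"
abbreviation "bar_sum2 t \<equiv> strict_sum (\<lambda>S. of_nat (bar_count t S) * (of_nat (bar_count t S) - 1))"
abbreviation "bar_gf t w \<equiv> strict_sum (\<lambda>S. w ^ bar_count t S)"
abbreviation "strict_count n \<equiv> of_nat (card (strict_sets n))"

definition strict_gf :: "complex \<Rightarrow> complex" where
  "strict_gf q = (\<Sum>n. strict_count n * q ^ n)"

lemma prod_1_plus_power:
  fixes q :: "'a :: comm_semiring_1"
  assumes "finite A"
  shows "(\<Prod>k\<in>A. 1 + q ^ k) = (\<Sum>S\<in>Pow A. q ^ \<Sum>S)"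
  using assms
proof (induction A)
  case (insert k A)
  have "(\<Sum>S\<in>Pow (insert k A). q ^ \<Sum>S) = (\<Sum>S\<in>Pow A. q ^ \<Sum>S) + (\<Sum>S\<in>insert k ` Pow A. q ^ \<Sum>S)"
    unfolding Pow_insert using insert by (intro sum.union_disjoint) auto
  also have "(\<Sum>S\<in>insert k ` Pow A. q ^ \<Sum>S) = (\<Sum>S\<in>Pow A. q ^ \<Sum>(insert k S))"
    using insert by (subst sum.reindex) (auto simp: inj_on_def)
  also have "... = (\<Sum>S\<in>Pow A. q ^ k * q ^ \<Sum>S)"
  proof (rule sum.cong)
    fix S assume "S \<in> Pow A"
    then have "finite S" "k \<notin> S" using insert finite_subset by auto
    then show "q ^ \<Sum>(insert k S) = q ^ k * q ^ \<Sum>S" by (simp add: power_add)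
  qed simp
  finally show ?case using insert by (simp add: distrib_right sum_distrib_left[symmetric])
qed simp

lemma card_le_of_strict_sets: "S \<in> strict_sets n \<Longrightarrow> card S \<le> n"
proof -
  assume "S \<in> strict_sets n"
  then have S: "0 \<notin> S" "\<Sum>S = n" by (auto simp: strict_sets_def)
  have "(\<Sum>k\<in>S. 1) \<le> (\<Sum>k\<in>S. k)"
  proof (rule sum_mono)
    fix k assume "k \<in> S"
    then show "1 \<le> k" using S by (cases k) auto
  qed
  then show ?thesis using S by simp
qed

lemma bar_count_le:
  assumes "S \<in> strict_sets n"
  shows "bar_count t S \<le> 2 * n"
proof -
  have "finite S" using assms by (simp add: strict_sets_def)
  then have "bar_count t S \<le> card S + card S"
    unfolding bar_count_def by (intro add_mono card_mono) auto
  then show ?thesis using card_le_of_strict_sets[OF assms] by simp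
qed

lemma strict_sets_subset: "S \<in> strict_sets n \<Longrightarrow> S \<subseteq> {1..n}"
proof
  fix k assume S: "S \<in> strict_sets n" and k: "k \<in> S"
  then have "k \<le> \<Sum>S" by (intro member_le_sum) (auto simp: strict_sets_def)
  moreover have "k \<noteq> 0" using S k by (metis (no_types, lifting) mem_Collect_eq strict_sets_def)
  ultimately show "k \<in> {1..n}" using S by (auto simp: strict_sets_def)
qed

text \<open>Partial sums are dominated by the finite products of 1 + r^k, and these stay below the
  exponential of a geometric series.\<close>

lemma summable_card_strict_sets:
  fixes r :: real
  assumes "0 \<le> r" "r < 1"
  shows "summable (\<lambda>n. strict_count n * r ^ n)"
proof (rule summableI_nonneg_bounded)
  fix N :: nat
  have "(\<Sum>n<N. strict_count n * r ^ n) = (\<Sum>n<N. \<Sum>S\<in>strict_sets n. r ^ \<Sum>S)"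
    by (rule sum.cong) (auto simp: strict_sets_def)
  also have "... = (\<Sum>S\<in>(\<Union>n<N. strict_sets n). r ^ \<Sum>S)"
    by (rule sum.UNION_disjoint[symmetric]) (auto simp: finite_strict_sets, auto simp: strict_sets_def)
  also have "... \<le> (\<Sum>S\<in>Pow {1..N}. r ^ \<Sum>S)"
  proof (rule sum_mono2)
    show "(\<Union>n<N. strict_sets n) \<subseteq> Pow {1..N}" using strict_sets_subset by fastforce
  qed (use assms in auto)
  also have "... = (\<Prod>k\<in>{1..N}. 1 + r ^ k)" by (simp add: prod_1_plus_power)
  also have "... \<le> (\<Prod>k\<in>{1..N}. exp (r ^ k))"
    using assms by (intro prod_mono) auto
  also have "... = exp (\<Sum>k\<in>{1..N}. r ^ k)" by (simp add: exp_sum)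
  also have "... \<le> exp (\<Sum>k. r ^ k)"
    using assms by (auto intro!: sum_le_suminf summable_geometric)
  finally show "(\<Sum>n<N. strict_count n * r ^ n) \<le> exp (\<Sum>k. r ^ k)" .
qed (use assms in auto)

text \<open>The factor (2 n + 1)^2 dominates every statistic in use, because the bar count is at
  most 2 n. It is absorbed by enlarging r to some s < 1.\<close>

lemma summable_card_strict_sets_quadratic:
  fixes r :: real
  assumes "0 \<le> r" "r < 1"
  shows "summable (\<lambda>n. strict_count n * (2 * real n + 1)\<^sup>2 * r ^ n)"
proof -
  define s where "s = (r + 1) / 2"
  have s: "r < s" "0 < s" "s < 1" using assms by (auto simp: s_def)
  \<comment> \<open>The square of \<open>x ^ n\<close> is \<open>(r / s) ^ n\<close>, so it suffices
    that (2 n + 1) x^n is bounded.\<close>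
  define x where "x = sqrt (r / s)"
  have x: "0 \<le> x" "x < 1" "x\<^sup>2 = r / s" using s assms by (auto simp: x_def)
  have "(\<lambda>n. 2 * (real n * x ^ n) + x ^ n) \<longlonglongrightarrow> 2 * 0 + 0"
    using x by (intro tendsto_intros lim_n_over_pown powser_times_n_limit_0) (auto intro: LIMSEQ_power_zero)
  then have "Bseq (\<lambda>n. 2 * (real n * x ^ n) + x ^ n)" by (intro convergent_imp_Bseq convergentI)
  then obtain B where B: "\<And>n. \<bar>2 * (real n * x ^ n) + x ^ n\<bar> \<le> B" by (auto simp: Bseq_def)
  have le: "(2 * real n + 1)\<^sup>2 * r ^ n \<le> B\<^sup>2 * s ^ n" for n
  proof -
    have "(2 * real n + 1)\<^sup>2 * r ^ n = ((2 * (real n * x ^ n) + x ^ n))\<^sup>2 * s ^ n"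
    proof -
      have "r ^ n = (x ^ n)\<^sup>2 * s ^ n"
        using x(3) s by (simp add: power_mult[symmetric] mult.commute[of n 2] power_mult power_divide)
      then show ?thesis by (simp add: power2_eq_square algebra_simps)
    qed
    also have "... \<le> B\<^sup>2 * s ^ n"
    proof (rule mult_right_mono)
      have "\<bar>2 * (real n * x ^ n) + x ^ n\<bar>\<^sup>2 \<le> B\<^sup>2" using B by (intro power_mono) auto
      then show "(2 * (real n * x ^ n) + x ^ n)\<^sup>2 \<le> B\<^sup>2" by simp
    qed (use s in simp)
    finally show ?thesis .
  qed
  have "summable (\<lambda>n. B\<^sup>2 * (strict_count n * s ^ n))"
    using s by (intro summable_mult summable_card_strict_sets) auto
  then show ?thesis
  proof (rule summable_comparison_test'[where N = 0])
    fix n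
    have "strict_count n * ((2 * real n + 1)\<^sup>2 * r ^ n) \<le> strict_count n * (B\<^sup>2 * s ^ n)"
      using le by (intro mult_left_mono) auto
    then show "norm (strict_count n * (2 * real n + 1)\<^sup>2 * r ^ n) \<le> B\<^sup>2 * (strict_count n * s ^ n)"
      using assms by (simp add: mult_ac)
  qed
qed

lemma norm_strict_sum_le:
  assumes "\<And>S. S \<in> strict_sets n \<Longrightarrow> cmod (g S) \<le> (2 * real n + 1)\<^sup>2"
  shows "cmod (strict_sum g n) \<le> strict_count n * (2 * real n + 1)\<^sup>2"
  unfolding strict_sum_def using sum_norm_bound[of "strict_sets n" g] assms by simp

lemma summable_strict_sum:
  assumes "\<And>n S. S \<in> strict_sets n \<Longrightarrow> cmod (g S) \<le> (2 * real n + 1)\<^sup>2" "0 \<le> r" "r < 1"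
  shows "summable (\<lambda>n. cmod (strict_sum g n) * r ^ n)"
  by (rule summable_comparison_test'[OF summable_card_strict_sets_quadratic[OF assms(2,3)], of 0])
    (use assms norm_strict_sum_le[OF assms(1)] in \<open>auto simp: abs_mult intro!: mult_right_mono\<close>)

lemma sum_Pow_eq_suminf:
  assumes "finite U" "0 \<notin> U"
  shows "(\<Sum>S\<in>Pow U. q ^ \<Sum>S * g S) = (\<Sum>n. (\<Sum>S\<in>strict_sets n \<inter> Pow U. g S) * (q :: complex) ^ n)"
proof -
  have le: "\<Sum>S \<le> \<Sum>U" if "S \<subseteq> U" for S using that assms(1) by (intro sum_mono2) auto
  have st: "S \<in> strict_sets n \<longleftrightarrow> \<Sum>S = n" if "S \<subseteq> U" for S n
    using that assms finite_subset by (auto simp: strict_sets_def)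
  have "(\<Sum>n. (\<Sum>S\<in>strict_sets n \<inter> Pow U. g S) * q ^ n) = (\<Sum>n\<le>\<Sum>U. (\<Sum>S\<in>strict_sets n \<inter> Pow U. g S) * q ^ n)"
  proof (rule suminf_finite)
    fix n assume "n \<notin> {..\<Sum>U}"
    then have "strict_sets n \<inter> Pow U = {}" using le st by fastforce
    then show "(\<Sum>S\<in>strict_sets n \<inter> Pow U. g S) * q ^ n = 0" by simp
  qed simp
  also have "... = (\<Sum>n\<le>\<Sum>U. \<Sum>S\<in>{S. S \<in> Pow U \<and> \<Sum>S = n}. q ^ \<Sum>S * g S)"
  proof (rule sum.cong)
    fix n
    have "strict_sets n \<inter> Pow U = {S. S \<in> Pow U \<and> \<Sum>S = n}" using st by auto
    then show "(\<Sum>S\<in>strict_sets n \<inter> Pow U. g S) * q ^ n = (\<Sum>S\<in>{S. S \<in> Pow U \<and> \<Sum>S = n}. q ^ \<Sum>S * g S)"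
      by (simp add: sum_distrib_left mult.commute)
  qed simp
  also have "... = (\<Sum>S\<in>Pow U. q ^ \<Sum>S * g S)"
    by (rule sum.group) (use assms le in auto)
  finally show ?thesis by simp
qed

text \<open>Tannery's theorem in the index of the coefficients: as soon as \<open>U J\<close>
  contains 1, ..., n, the coefficient of q^n no longer changes, and the quadratic bound dominates
  uniformly in \<open>J\<close>.\<close>

lemma tendsto_sum_Pow:
  assumes U: "\<And>J. finite (U J)" "\<And>J. 0 \<notin> U J" "\<And>m J. 0 < m \<Longrightarrow> m < J \<Longrightarrow> m \<in> U J"
    and g: "\<And>n S. S \<in> strict_sets n \<Longrightarrow> cmod (g S) \<le> (2 * real n + 1)\<^sup>2" and q: "cmod q < 1"
  shows "(\<lambda>J. \<Sum>S\<in>Pow (U J). q ^ \<Sum>S * g S) \<longlonglongrightarrow> (\<Sum>n. strict_sum g n * q ^ n)"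
proof -
  have "eventually (\<lambda>n. summable (\<lambda>k. norm ((\<Sum>S\<in>strict_sets k \<inter> Pow (U n). g S) * q ^ k))) sequentially \<and>
           summable (\<lambda>n. norm (strict_sum g n * q ^ n)) \<and>
           ((\<lambda>n. suminf (\<lambda>k. (\<Sum>S\<in>strict_sets k \<inter> Pow (U n). g S) * q ^ k)) \<longlongrightarrow> (\<Sum>n. strict_sum g n * q ^ n)) sequentially"
  proof (rule tannerys_theorem)
    fix k
    have "eventually (\<lambda>J. (\<Sum>S\<in>strict_sets k \<inter> Pow (U J). g S) * q ^ k = strict_sum g k * q ^ k) sequentially"
      using eventually_gt_at_top[of k]
    proof eventually_elim
      case (elim J)
      have "{1..k} \<subseteq> U J" using U(3)[of _ J] elim by auto
      then have "strict_sets k \<subseteq> Pow (U J)" using strict_sets_subset by blast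
      then have "strict_sets k \<inter> Pow (U J) = strict_sets k" by blast
      then show ?case by (simp add: strict_sum_def)
    qed
    then show "(\<lambda>J. (\<Sum>S\<in>strict_sets k \<inter> Pow (U J). g S) * q ^ k) \<longlonglongrightarrow> strict_sum g k * q ^ k"
      by (rule tendsto_eventually)
  next
    have "cmod ((\<Sum>S\<in>strict_sets k \<inter> Pow (U J). g S) * q ^ k)
        \<le> real (card (strict_sets k)) * (2 * real k + 1)\<^sup>2 * cmod q ^ k" for k J
    proof -
      have "cmod (\<Sum>S\<in>strict_sets k \<inter> Pow (U J). g S) \<le> real (card (strict_sets k \<inter> Pow (U J))) * (2 * real k + 1)\<^sup>2"
        using g by (intro sum_norm_bound) auto
      also have "... \<le> real (card (strict_sets k)) * (2 * real k + 1)\<^sup>2"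
        by (intro mult_right_mono) (auto intro!: card_mono simp: finite_strict_sets)
      finally show ?thesis by (simp add: norm_mult norm_power mult_right_mono)
    qed
    then show "\<forall>\<^sub>F (k, J) in sequentially \<times>\<^sub>F sequentially. norm ((\<Sum>S\<in>strict_sets k \<inter> Pow (U J). g S) * q ^ k)
        \<le> real (card (strict_sets k)) * (2 * real k + 1)\<^sup>2 * cmod q ^ k"
      by (intro always_eventually) auto
    show "summable (\<lambda>k. real (card (strict_sets k)) * (2 * real k + 1)\<^sup>2 * cmod q ^ k)"
      using q by (intro summable_card_strict_sets_quadratic) auto
  qed simp
  then show ?thesis by (simp add: sum_Pow_eq_suminf[OF U(1,2)])
qed

lemma strict_sum_1: "strict_sum (\<lambda>_. 1) n = strict_count n"
  by (simp add: strict_sum_def)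

lemma one_le_quadratic: "1 \<le> (2 * real n + 1)\<^sup>2"
  by (simp add: power2_eq_square algebra_simps)

lemma tendsto_prod_strict_gf:
  assumes "cmod q < 1"
  shows "(\<lambda>N. \<Prod>k=1..N. 1 + q ^ k) \<longlonglongrightarrow> strict_gf q"
  using tendsto_sum_Pow[of "\<lambda>N. {1..N}" "\<lambda>_. 1" q] assms one_le_quadratic
  by (simp add: prod_1_plus_power strict_sum_1 strict_gf_def)

lemma tendsto_gap_gf:
  assumes "t > 0" "cmod q < 1"
    and "\<And>n S. S \<in> strict_sets n \<Longrightarrow> cmod (f (bar_count t S)) \<le> (2 * real n + 1)\<^sup>2"
  shows "(\<lambda>J. b_gf t q (bead_positions t J) f)
    \<longlonglongrightarrow> (\<Sum>n. strict_sum (\<lambda>S. f (bar_count t S)) n * q ^ n)"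
  unfolding gap_gf_beads[OF assms(1)]
proof (rule tendsto_sum_Pow[OF finite_bead_sizes zero_notin_bead_sizes _ assms(3,2)])
  fix m J :: nat assume "0 < m" "m < J"
  moreover have "J * 1 \<le> J * t" using assms(1) by (intro mult_left_mono) auto
  ultimately show "m \<in> bead_sizes t J" by (intro bead_sizes_cases[OF assms(1)]) linarith+
qed

lemma hole_plus_bead: "hole_weight q k + bead_weight q k = (if k = 0 then 1 else 1 + q ^ nat \<bar>k\<bar>)"
  by (auto simp: hole_weight_def bead_weight_def)

lemma norm_power_less_1:
  fixes q :: complex
  assumes "cmod q < 1" "m > 0"
  shows "cmod (q ^ m) < 1"
  using assms by (simp add: norm_power power_less_one_iff)

lemma one_plus_power_neq_0:
  fixes q :: complex
  assumes "cmod q < 1" "m > 0"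
  shows "1 + q ^ m \<noteq> 0" "1 - q ^ m \<noteq> 0"
proof -
  have *: "cmod (q ^ m) \<noteq> 1" using norm_power_less_1[OF assms] by simp
  show "1 + q ^ m \<noteq> 0"
  proof
    assume "1 + q ^ m = 0"
    then have "q ^ m = - 1" by (simp add: eq_neg_iff_add_eq_0 add.commute)
    then show False using * by simp
  qed
  show "1 - q ^ m \<noteq> 0" using * by auto
qed

lemma hole_plus_bead_neq_0:
  assumes "cmod q < 1"
  shows "hole_weight q k + bead_weight q k \<noteq> 0"
  using one_plus_power_neq_0(1)[OF assms, of "nat \<bar>k\<bar>"] by (simp add: hole_plus_bead)

lemma norm_exp_minus_1_le:
  fixes z :: complex
  assumes "cmod z \<le> 1"
  shows "cmod (exp z - 1) \<le> 3 * cmod z"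
proof -
  have "cmod (exp z - exp 0) \<le> 3 * cmod (z - 0)"
  proof (rule field_differentiable_bound[of "cball 0 1" exp exp])
    show "cmod (exp x) \<le> 3" if "x \<in> cball 0 1" for x
      using norm_exp[of x] that exp_le by (smt (verit) dist_0_norm exp_le_cancel_iff mem_cball)
  qed (use assms in \<open>auto intro: DERIV_subset[OF DERIV_exp]\<close>)
  then show ?thesis by simp
qed

section \<open>Limits as the window of positions grows\<close>

context
  fixes t :: nat and q :: complex
  assumes t_pos: "t > 0" and q: "cmod q < 1"
begin

abbreviation "bead_exp \<equiv> b_exp t q"
abbreviation "bead_sum1 J \<equiv> b_sum1 t q (bead_positions t J)"
abbreviation "bead_sum2 J \<equiv> b_sum2 t q (bead_positions t J)"
abbreviation "bead_norm J \<equiv> (\<Prod>k\<in>bead_positions t J. hole_weight q k + bead_weight q k)"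

lemma nz_beads: "\<And>k. hole_weight q k + bead_weight q k \<noteq> 0"
  using hole_plus_bead_neq_0[OF q] .

lemma bead_gf_eq:
  "b_gf t q (bead_positions t J) f = bead_norm J * bead_exp (bead_positions t J) f"
  using nz_beads finite_bead_positions t_pos by (simp add: gap_exp_def[of "int t", OF _ nz_beads])

text \<open>The test function 1 turns the normalising product into the generating function of strict
  partitions. This avoids rearranging an infinite product over positions.\<close>

lemma tendsto_bead_norm: "bead_norm \<longlonglongrightarrow> strict_gf q"
proof -
  have "(\<lambda>J. b_gf t q (bead_positions t J) (\<lambda>_. 1))
     \<longlonglongrightarrow> (\<Sum>n. strict_sum (\<lambda>S. 1) n * q ^ n)"
    by (rule tendsto_gap_gf[OF t_pos q]) (simp add: one_le_quadratic)
  then show ?thesis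
    unfolding bead_gf_eq using gap_exp_1[of "int t", OF _ nz_beads finite_bead_positions] t_pos
    by (simp add: strict_sum_1 strict_gf_def)
qed

lemma suminf_bar_count:
  assumes "bead_sum1 \<longlonglongrightarrow> A"
  shows "(\<Sum>n. bar_sum1 t n * q ^ n) = strict_gf q * A"
proof (rule LIMSEQ_unique)
  show "(\<lambda>J. b_gf t q (bead_positions t J) of_nat)
     \<longlonglongrightarrow> (\<Sum>n. bar_sum1 t n * q ^ n)"
  proof (rule tendsto_gap_gf[OF t_pos q])
    fix n S assume "S \<in> strict_sets n"
    then have "real (bar_count t S) \<le> 2 * real n" using bar_count_le[of S n t] by linarith
    also have "... \<le> (2 * real n + 1)\<^sup>2" by (simp add: power2_eq_square algebra_simps)
    finally show "cmod (of_nat (bar_count t S)) \<le> (2 * real n + 1)\<^sup>2" by simp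
  qed
  show "(\<lambda>J. b_gf t q (bead_positions t J) of_nat) \<longlonglongrightarrow> strict_gf q * A"
    unfolding bead_gf_eq using gap_exp_of_nat[of "int t", OF _ nz_beads finite_bead_positions] t_pos
      tendsto_mult[OF tendsto_bead_norm assms] by simp
qed

lemma suminf_bar_count_factorial2:
  assumes "bead_sum1 \<longlonglongrightarrow> A" "bead_sum2 \<longlonglongrightarrow> C"
  shows "(\<Sum>n. bar_sum2 t n * q ^ n) = strict_gf q * (A\<^sup>2 - C)"
proof (rule LIMSEQ_unique)
  show "(\<lambda>J. b_gf t q (bead_positions t J) (\<lambda>n. of_nat n * (of_nat n - 1)))
     \<longlonglongrightarrow> (\<Sum>n. bar_sum2 t n * q ^ n)"
  proof (rule tendsto_gap_gf[OF t_pos q])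
    fix n S assume S: "S \<in> strict_sets n"
    define b where "b = real (bar_count t S)"
    have b: "0 \<le> b" "b \<le> 2 * real n" using bar_count_le[OF S, of t] by (auto simp: b_def)
    have "of_nat (bar_count t S) * (of_nat (bar_count t S) - 1) = complex_of_real (b * (b - 1))"
      by (simp add: b_def)
    then have "cmod (of_nat (bar_count t S) * (of_nat (bar_count t S) - 1)) = b * \<bar>b - 1\<bar>"
      using b(1) by (simp only: norm_of_real abs_mult abs_of_nonneg)
    also have "... \<le> (2 * real n + 1) * (2 * real n + 1)" using b by (intro mult_mono) auto
    finally show "cmod (of_nat (bar_count t S) * (of_nat (bar_count t S) - 1)) \<le> (2 * real n + 1)\<^sup>2"
      by (simp add: power2_eq_square)
  qed
  show "(\<lambda>J. b_gf t q (bead_positions t J) (\<lambda>n. of_nat n * (of_nat n - 1)))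
     \<longlonglongrightarrow> strict_gf q * (A\<^sup>2 - C)"
    unfolding bead_gf_eq using gap_exp_factorial2[of "int t", OF _ nz_beads finite_bead_positions] t_pos assms
    by (auto intro!: tendsto_intros tendsto_bead_norm)
qed

lemma tendsto_bead_norm_power:
  assumes "cmod w = 1"
  shows "(\<lambda>J. bead_norm J * bead_exp (bead_positions t J) (\<lambda>n. w ^ n))
    \<longlonglongrightarrow> (\<Sum>n. bar_gf t w n * q ^ n)"
  unfolding bead_gf_eq[symmetric]
  by (rule tendsto_gap_gf[OF t_pos q]) (use assms one_le_quadratic in \<open>simp add: norm_power\<close>)

text \<open>On each finite window the exponential form holds up to a factor exp R, and the bound
  \<open>B\<close> on the sums of weights makes the bound on R independent of the window. The
  relative error therefore survives the limit.\<close>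

lemma norm_suminf_power_diff_le:
  assumes w: "cmod w = 1" and A: "bead_sum1 \<longlonglongrightarrow> A" and C: "bead_sum2 \<longlonglongrightarrow> C"
    and M: "\<And>k. cmod (b_weight t q k) \<le> M" "cmod (w - 1) * M \<le> 1/4"
    and B: "\<And>J. (\<Sum>k\<in>bead_positions t J. cmod (b_weight t q k)) \<le> B"
    and small: "40 * cmod (w - 1) ^ 3 * M\<^sup>2 * B \<le> 1"
  shows "cmod ((\<Sum>n. bar_gf t w n * q ^ n)
      - strict_gf q * exp ((w - 1) * A - (w - 1)\<^sup>2 * C / 2))
    \<le> cmod (strict_gf q * exp ((w - 1) * A - (w - 1)\<^sup>2 * C / 2)) * (3 * (40 * cmod (w - 1) ^ 3 * M\<^sup>2 * B))"
proof -
  let ?E = "\<lambda>J. bead_norm J * exp ((w - 1) * bead_sum1 J - (w - 1)\<^sup>2 * bead_sum2 J / 2)"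
  let ?Z = "\<lambda>J. bead_norm J * bead_exp (bead_positions t J) (\<lambda>n. w ^ n)"
  define \<kappa> where "\<kappa> = 40 * cmod (w - 1) ^ 3 * M\<^sup>2 * B"
  have tE: "?E \<longlonglongrightarrow> strict_gf q * exp ((w - 1) * A - (w - 1)\<^sup>2 * C / 2)"
    by (intro tendsto_intros tendsto_bead_norm A C) simp
  have "cmod (?Z J - ?E J) \<le> cmod (?E J) * (3 * \<kappa>)" for J
  proof -
    obtain R where R: "bead_exp (bead_positions t J) (\<lambda>n. w ^ n)
         = exp ((w - 1) * bead_sum1 J - (w - 1)\<^sup>2 * bead_sum2 J / 2 + R)"
      and "cmod R \<le> 40 * cmod (w - 1) ^ 3 * M\<^sup>2 * (\<Sum>k\<in>bead_positions t J. cmod (b_weight t q k))"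
      using gap_exp_power[of "int t", OF _ nz_beads finite_bead_positions M] t_pos by auto
    note this(2)
    also have "... \<le> \<kappa>" unfolding \<kappa>_def by (intro mult_left_mono B) simp
    finally have Rk: "cmod R \<le> \<kappa>" .
    have "cmod (exp R - 1) \<le> 3 * cmod R"
      using norm_exp_minus_1_le[of R] Rk small unfolding \<kappa>_def by linarith
    then have e: "cmod (exp R - 1) \<le> 3 * \<kappa>" using Rk by linarith
    have "?Z J - ?E J = ?E J * (exp R - 1)" unfolding R exp_add right_diff_distrib mult_1_right by (simp only: mult.assoc)
    then have "cmod (?Z J - ?E J) = cmod (?E J) * cmod (exp R - 1)" by (simp only: norm_mult)
    also have "... \<le> cmod (?E J) * (3 * \<kappa>)" using e by (rule mult_left_mono) simp
    finally show ?thesis .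
  qed
  then show ?thesis unfolding \<kappa>_def[symmetric]
    by (intro LIMSEQ_le[OF tendsto_norm[OF tendsto_diff[OF tendsto_bead_norm_power[OF w] tE]]
          tendsto_mult[OF tendsto_norm[OF tE] tendsto_const]]) auto
qed

end

section \<open>Telescoping sums along a chain\<close>

text \<open>Here \<open>p i\<close> is the occupation probability of the i-th position of a chain,
  so \<open>p (Suc i) * (1 - p i)\<close> is a gap probability. The second argument of
  \<open>H\<close> is the preceding gap probability, with value 0 where the chain begins.\<close>

definition chain_sum :: "(complex \<Rightarrow> complex \<Rightarrow> complex) \<Rightarrow> (nat \<Rightarrow> complex) \<Rightarrow> nat \<Rightarrow> complex" where
  "chain_sum H p N = (\<Sum>i<N. H (p (Suc i) * (1 - p i)) (if i = 0 then 0 else p i * (1 - p (i - 1))))"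

text \<open>A discrete antiderivative of the summand of \<open>chain_sum2\<close>. It comes from
  expanding the summand, with w, u, v the probabilities at three successive positions from the top,
  and replacing the products u v and w v by linear terms; \<open>chain_step\<close> allows this with
  ratio x for neighbours and x^2 for positions two apart.\<close>

definition chain_potential :: "complex \<Rightarrow> complex \<Rightarrow> complex \<Rightarrow> complex" where
  "chain_potential x u v = (x / (1 - x))\<^sup>2 * (u\<^sup>2 - 2 * u + 2 * (x / (1 - x)) * v - 2 * (x\<^sup>2 / (1 - x\<^sup>2)) * (u + v))"

text \<open>The hypothesis says that the odds of \<open>u\<close> are \<open>x\<close> times the
  odds of \<open>v\<close>. The gap probability is then a multiple of the difference
  \<open>v - u\<close>, which is why sums along a chain telescope.\<close>

lemma chain_step:
  fixes x u v :: complex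
  assumes "x \<noteq> 1" "u * (1 - v) = x * v * (1 - u)"
  shows "u * (1 - v) = x / (1 - x) * (v - u)"
proof -
  have "(1 - x) * (u * (1 - v)) = u * (1 - v) - x * (u * (1 - v))" by (simp add: algebra_simps)
  also have "... = x * v * (1 - u) - x * (u * (1 - v))" by (simp only: assms(2))
  also have "... = x * (v - u)" by (simp add: algebra_simps)
  finally show ?thesis using assms(1) by (simp add: field_simps)
qed

lemma chain_potential_step:
  fixes x u v w :: complex
  assumes x: "x \<noteq> 1" "x\<^sup>2 \<noteq> 1" and uv: "u * (1 - v) = x * v * (1 - u)" and wu: "w * (1 - u) = x * u * (1 - w)"
    and wv: "w * (1 - v) = x\<^sup>2 * v * (1 - w)"
  shows "(w * (1 - u))\<^sup>2 + 2 * (w * (1 - u)) * (u * (1 - v)) = chain_potential x w u - chain_potential x u v"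
proof -
  define c where "c = x / (1 - x)"
  define d where "d = x\<^sup>2 / (1 - x\<^sup>2)"
  have 1: "u * (1 - v) = c * (v - u)" unfolding c_def by (rule chain_step[OF x(1) uv])
  have 2: "w * (1 - u) = c * (u - w)" unfolding c_def by (rule chain_step[OF x(1) wu])
  have 3: "w * (1 - v) = d * (v - w)" unfolding d_def by (rule chain_step[OF x(2) wv])
  have uv': "u * v = u - c * (v - u)" using 1 by (simp add: algebra_simps)
  have wv': "w * v = w - d * (v - w)" using 3 by (simp add: algebra_simps)
  have "(w * (1 - u))\<^sup>2 + 2 * (w * (1 - u)) * (u * (1 - v)) = c\<^sup>2 * ((u - w)\<^sup>2 + 2 * (u - w) * (v - u))"
    unfolding 1 2 by (simp add: power2_eq_square algebra_simps)
  also have "... = c\<^sup>2 * (w\<^sup>2 - u\<^sup>2 + 2 * (u * v) - 2 * (w * v))" by (simp add: power2_eq_square algebra_simps)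
  also have "... = chain_potential x w u - chain_potential x u v"
    unfolding uv' wv' chain_potential_def c_def[symmetric] d_def[symmetric] by (simp add: algebra_simps)
  finally show ?thesis .
qed

abbreviation "chain_sum1 \<equiv> chain_sum (\<lambda>a _. a)"
abbreviation "chain_sum2 \<equiv> chain_sum (\<lambda>a b. a\<^sup>2 + 2 * a * b)"

lemma chain_sum1_eq:
  assumes x: "x \<noteq> 1" and p: "\<And>i. i < N \<Longrightarrow> p (Suc i) * (1 - p i) = x * p i * (1 - p (Suc i))"
  shows "chain_sum1 p N = x / (1 - x) * (p 0 - p N)"
  using p
proof (induction N)
  case (Suc N)
  have "chain_sum1 p (Suc N) = chain_sum1 p N + p (Suc N) * (1 - p N)" by (simp add: chain_sum_def)
  also have "... = x / (1 - x) * (p 0 - p N) + x / (1 - x) * (p N - p (Suc N))"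
    using Suc.IH Suc.prems chain_step[OF x Suc.prems[of N]] by simp
  finally show ?case by (simp only: distrib_left[symmetric]) simp
qed (simp add: chain_sum_def)

text \<open>The first gap of a chain has no predecessor, so its cross term is missing and its square
  stands apart from the telescoping part.\<close>

lemma chain_sum2_eq:
  assumes x: "x \<noteq> 1" "x\<^sup>2 \<noteq> 1" and p: "\<And>i. p (Suc i) * (1 - p i) = x * p i * (1 - p (Suc i))"
    and p2: "\<And>i. p (Suc (Suc i)) * (1 - p i) = x\<^sup>2 * p i * (1 - p (Suc (Suc i)))"
  shows "chain_sum2 p (Suc N) = (p 1 * (1 - p 0))\<^sup>2 + chain_potential x (p (Suc N)) (p N) - chain_potential x (p 1) (p 0)"
proof (induction N)
  case (Suc N)
  have "chain_sum2 p (Suc (Suc N)) = chain_sum2 p (Suc N) + ((p (Suc (Suc N)) * (1 - p (Suc N)))\<^sup>2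
      + 2 * (p (Suc (Suc N)) * (1 - p (Suc N))) * (p (Suc N) * (1 - p N)))"
    by (simp add: chain_sum_def)
  then show ?case unfolding Suc chain_potential_step[OF x p p p2] by simp
qed (simp add: chain_sum_def)

text \<open>In the chain through position 0 the first probability is 0 and the odds relation fails
  for the first step. Its terms are split off, so that the relation can be used from the next
  position on.\<close>

lemma chain_sum_Suc_shift:
  assumes "p 0 = 0"
  shows "chain_sum1 p (Suc N) = p 1 + chain_sum1 (\<lambda>i. p (Suc i)) N"
    and "chain_sum2 p (Suc (Suc N)) = (p 1)\<^sup>2 + 2 * (p 2 * (1 - p 1)) * p 1 + chain_sum2 (\<lambda>i. p (Suc i)) (Suc N)"
proof -
  show "chain_sum1 p (Suc N) = p 1 + chain_sum1 (\<lambda>i. p (Suc i)) N"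
    unfolding chain_sum_def sum.lessThan_Suc_shift using assms by simp
  show "chain_sum2 p (Suc (Suc N)) = (p 1)\<^sup>2 + 2 * (p 2 * (1 - p 1)) * p 1 + chain_sum2 (\<lambda>i. p (Suc i)) (Suc N)"
    unfolding chain_sum_def sum.lessThan_Suc_shift using assms by (simp add: numeral_2_eq_2)
qed

lemma tendsto_chain_potential:
  assumes "(u \<longlongrightarrow> a) F" "(v \<longlongrightarrow> b) F"
  shows "((\<lambda>n. chain_potential x (u n) (v n)) \<longlongrightarrow> chain_potential x a b) F"
  unfolding chain_potential_def by (intro tendsto_intros assms)

section \<open>Residue classes of positions and their occupation probabilities\<close>

lemma sum_bead_positions:
  assumes t: "t > 0"
  shows "(\<Sum>k\<in>bead_positions t J. F k) = (\<Sum>j\<in>{0..<int J}. F (j * int t))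
    + (if even t then \<Sum>j\<in>{0..<int J}. F (int (t div 2) + j * int t) else 0)
    + (\<Sum>r\<in>{1..(t - 1) div 2}. \<Sum>j\<in>{- int J..<int J}. (F (int r + j * int t) :: complex))"
proof -
  define I where "I r = (if r = 0 \<or> 2 * r = t then {0..<int J} else {- int J..<int J})" for r
  define \<psi> where "\<psi> = (\<lambda>(r, j). int r + j * int t)"
  have bij: "bij_betw \<psi> (Sigma {0..t div 2} I) (bead_positions t J)"
  proof (rule bij_betw_byWitness[where f' = "\<lambda>k. (nat (k mod int t), k div int t)"])
    have m: "\<psi> (r, j) mod int t = int r" "\<psi> (r, j) div int t = j" if "r \<le> t div 2" for r j
      using that t by (auto simp: \<psi>_def)
    show "\<forall>a\<in>Sigma {0..t div 2} I. (nat (\<psi> a mod int t), \<psi> a div int t) = a"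
      using m by auto
    show "\<forall>k\<in>bead_positions t J. \<psi> (nat (k mod int t), k div int t) = k"
      using t by (auto simp: \<psi>_def mod_mult_div_eq)
    show "\<psi> ` Sigma {0..t div 2} I \<subseteq> bead_positions t J"
    proof clarify
      fix r j assume r: "r \<in> {0..t div 2}" and j: "j \<in> I r"
      have jb: "- int J \<le> j" "j + 1 \<le> int J" using j by (auto simp: I_def split: if_splits)
      have "(j + 1) * int t \<le> int J * int t" "- int J * int t \<le> j * int t"
        using jb t by (intro mult_right_mono; simp)+
      then have b: "- int (J * t) \<le> \<psi> (r, j)" "\<psi> (r, j) < int (J * t)"
        using r t by (auto simp: \<psi>_def algebra_simps)
      have "0 \<le> j * int t" if "r = 0 \<or> 2 * r = t" using that j by (auto simp: I_def)
      then have "0 \<le> \<psi> (r, j)" if "r = 0 \<or> 2 * r = t" using that by (auto simp: \<psi>_def)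
      then show "\<psi> (r, j) \<in> bead_positions t J"
        using b r m(1)[of r j] unfolding bead_positions_def by auto
    qed
    show "(\<lambda>k. (nat (k mod int t), k div int t)) ` bead_positions t J \<subseteq> Sigma {0..t div 2} I"
    proof (rule image_subsetI)
      fix k assume k: "k \<in> bead_positions t J"
      define r j where "r = k mod int t" and "j = k div int t"
      have r: "0 \<le> r" "2 * r \<le> int t" "r = 0 \<or> 2 * r = int t \<longrightarrow> 0 \<le> k" and kb: "- int (J * t) \<le> k" "k < int (J * t)"
        using k t unfolding bead_positions_def r_def mem_Collect_eq by (metis pos_mod_sign of_nat_0_less_iff)+
      have kj: "k = j * int t + r" "r < int t"
        using t div_mult_mod_eq[of k "int t"] unfolding r_def j_def by (metis, metis pos_mod_bound of_nat_0_less_iff)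
      have "- int J \<le> j"
      proof (rule ccontr)
        assume "\<not> - int J \<le> j"
        then have "(j + 1) * int t \<le> - int J * int t" by (intro mult_right_mono) auto
        then show False using kb kj by (simp add: algebra_simps)
      qed
      moreover have "j < int J"
      proof (rule ccontr)
        assume "\<not> j < int J"
        then have "int J * int t \<le> j * int t" by (intro mult_right_mono) auto
        then show False using kb kj r(1) unfolding of_nat_mult by linarith
      qed
      moreover have "0 \<le> j" if "0 \<le> k"
      proof (rule ccontr)
        assume "\<not> 0 \<le> j"
        then have "(j + 1) * int t \<le> 0 * int t" by (intro mult_right_mono) auto
        then show False using that kj by (simp add: algebra_simps)
      qed
      ultimately have "j \<in> I (nat r)" using r unfolding I_def by auto
      then show "(nat (k mod int t), k div int t) \<in> Sigma {0..t div 2} I"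
      proof -
        have "nat r \<le> t div 2" using r by linarith
        then show ?thesis using \<open>j \<in> I (nat r)\<close> by (simp add: r_def[symmetric] j_def[symmetric])
      qed
    qed
  qed
  have fin: "finite (I r)" for r by (simp add: I_def)
  have "(\<Sum>k\<in>bead_positions t J. F k) = (\<Sum>a\<in>Sigma {0..t div 2} I. F (\<psi> a))"
    by (rule sum.reindex_bij_betw[OF bij, symmetric])
  also have "... = (\<Sum>r\<in>{0..t div 2}. \<Sum>j\<in>I r. F (int r + j * int t))"
    using fin by (subst sum.Sigma) (auto simp: \<psi>_def case_prod_beta)
  also have "{0..t div 2} = insert 0 ((if even t then {t div 2} else {}) \<union> {1..(t - 1) div 2})"
    using t by (auto elim!: evenE oddE)
  also have "(\<Sum>r\<in>insert 0 ((if even t then {t div 2} else {}) \<union> {1..(t - 1) div 2}). \<Sum>j\<in>I r. F (int r + j * int t))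
    = (\<Sum>j\<in>{0..<int J}. F (j * int t)) + ((\<Sum>r\<in>(if even t then {t div 2} else {}). \<Sum>j\<in>I r. F (int r + j * int t))
       + (\<Sum>r\<in>{1..(t - 1) div 2}. \<Sum>j\<in>I r. F (int r + j * int t)))"
  proof -
    let ?X = "if even t then {t div 2} else {}"
    have d: "?X \<inter> {1..(t - 1) div 2} = {}" "0 \<notin> ?X \<union> {1..(t - 1) div 2}"
      using t by (auto elim!: evenE)
    have "finite ?X" by simp
    then show ?thesis
      using sum.union_disjoint[OF _ _ d(1), of "\<lambda>r. \<Sum>j\<in>I r. F (int r + j * int t)"] d(2)
      by (simp add: I_def)
  qed
  also have "(\<Sum>r\<in>{1..(t - 1) div 2}. \<Sum>j\<in>I r. F (int r + j * int t))
      = (\<Sum>r\<in>{1..(t - 1) div 2}. \<Sum>j\<in>{- int J..<int J}. F (int r + j * int t))"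
    by (rule sum.cong) (use t in \<open>auto simp: I_def\<close>)
  also have "(\<Sum>r\<in>(if even t then {t div 2} else {}). \<Sum>j\<in>I r. F (int r + j * int t))
      = (if even t then \<Sum>j\<in>{0..<int J}. F (int (t div 2) + j * int t) else 0)"
    by (auto simp: I_def)
  finally show ?thesis by (simp add: add.assoc)
qed

definition bead_prob :: "complex \<Rightarrow> int \<Rightarrow> complex" where
  "bead_prob q k = bead_weight q k / (hole_weight q k + bead_weight q k)"

lemma one_minus_bead_prob:
  assumes "cmod q < 1"
  shows "1 - bead_prob q k = hole_weight q k / (hole_weight q k + bead_weight q k)"
  using hole_plus_bead_neq_0[OF assms, of k] by (simp add: bead_prob_def field_simps)

text \<open>At every non-zero position k, of either sign, the odds of a bead are formally q^k, so a
  shift by s multiplies them by q^s. The shifts t and 2 t serve neighbours in a chain and positions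
  two apart.\<close>

lemma bead_prob_relation:
  assumes q: "cmod q < 1" and k: "k \<noteq> 0" "k - int s \<noteq> 0"
  shows "bead_prob q k * (1 - bead_prob q (k - int s)) = q ^ s * bead_prob q (k - int s) * (1 - bead_prob q k)"
proof -
  have "bead_weight q k * hole_weight q (k - int s) = q ^ s * bead_weight q (k - int s) * hole_weight q k"
  proof -
    consider "k > 0" "k - int s > 0" | "k > 0" "k - int s < 0" | "k < 0" "k - int s < 0" using k by linarith
    then show ?thesis
    proof cases
      case 1
      then have "nat k = s + nat (k - int s)" by linarith
      then show ?thesis using 1 by (simp add: bead_weight_def hole_weight_def power_add)
    next
      case 2
      then have "s = nat k + nat (int s - k)" by linarith
      then have "q ^ s = q ^ nat k * q ^ nat (int s - k)" by (metis power_add)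
      then show ?thesis using 2 by (simp add: bead_weight_def hole_weight_def)
    next
      case 3
      then have "nat (int s - k) = s + nat (- k)" by linarith
      then show ?thesis using 3 by (simp add: bead_weight_def hole_weight_def power_add)
    qed
  qed
  then show ?thesis
    unfolding one_minus_bead_prob[OF q] unfolding bead_prob_def
    using hole_plus_bead_neq_0[OF q] by (simp add: field_simps)
qed

lemma bead_prob_pos: "k > 0 \<Longrightarrow> bead_prob q k = q ^ nat k / (1 + q ^ nat k)"
  by (simp add: bead_prob_def hole_weight_def bead_weight_def)

lemma bead_prob_neg: "k < 0 \<Longrightarrow> bead_prob q k = 1 / (q ^ nat (- k) + 1)"
  by (simp add: bead_prob_def hole_weight_def bead_weight_def)

lemma filterlim_nat_shift:
  assumes "t > 0"
  shows "filterlim (\<lambda>J. nat (int J * int t + r)) at_top sequentially"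
proof (rule filterlim_at_top_mono)
  show "filterlim (\<lambda>J. nat (int J + r)) at_top sequentially"
    unfolding filterlim_at_top
  proof
    fix Z :: nat
    show "\<forall>\<^sub>F J in sequentially. Z \<le> nat (int J + r)"
      using eventually_ge_at_top[of "Z + nat (- r)"] by eventually_elim linarith
  qed
  show "\<forall>\<^sub>F J in sequentially. nat (int J + r) \<le> nat (int J * int t + r)"
  proof (intro always_eventually allI)
    fix J
    have "int J * 1 \<le> int J * int t" using assms by (intro mult_left_mono) auto
    then show "nat (int J + r) \<le> nat (int J * int t + r)" by linarith
  qed
qed

context
  fixes t :: nat and q :: complex
  assumes t_pos: "t > 0" and q: "cmod q < 1"
begin

lemma tendsto_power_shift: "(\<lambda>J. q ^ nat (int J * int t + r)) \<longlonglongrightarrow> 0"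
  by (rule filterlim_compose[OF _ filterlim_nat_shift[OF t_pos]]) (simp add: LIMSEQ_power_zero q)

lemma tendsto_bead_prob_at_top: "(\<lambda>J. bead_prob q (r + int J * int t)) \<longlonglongrightarrow> 0"
proof (rule Lim_transform_eventually)
  show "(\<lambda>J. q ^ nat (int J * int t + r) / (1 + q ^ nat (int J * int t + r))) \<longlonglongrightarrow> 0"
    using tendsto_divide[OF tendsto_power_shift tendsto_add[OF tendsto_const tendsto_power_shift], of 1 r r] by simp
  have "\<forall>\<^sub>F J in sequentially. 1 \<le> nat (int J * int t + r)"
    using filterlim_nat_shift[OF t_pos, of r] by (simp add: filterlim_at_top)
  then show "\<forall>\<^sub>F J in sequentially. q ^ nat (int J * int t + r) / (1 + q ^ nat (int J * int t + r)) = bead_prob q (r + int J * int t)"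
    by eventually_elim (subst bead_prob_pos, auto simp: add.commute)
qed

lemma tendsto_bead_prob_at_bot: "(\<lambda>J. bead_prob q (r - int J * int t)) \<longlonglongrightarrow> 1"
proof (rule Lim_transform_eventually)
  show "(\<lambda>J. 1 / (q ^ nat (int J * int t + (- r)) + 1)) \<longlonglongrightarrow> 1"
    using tendsto_divide[OF tendsto_const[of 1] tendsto_add[OF tendsto_power_shift[of "- r"] tendsto_const[of 1]]] by simp
  have "\<forall>\<^sub>F J in sequentially. 1 \<le> nat (int J * int t + (- r))"
    using filterlim_nat_shift[OF t_pos, of "- r"] by (simp add: filterlim_at_top)
  then show "\<forall>\<^sub>F J in sequentially. 1 / (q ^ nat (int J * int t + (- r)) + 1) = bead_prob q (r - int J * int t)"
    by eventually_elim (subst bead_prob_neg, auto)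
qed

lemma int_t_pos: "0 < int t" using t_pos by simp

lemma gap_weight_bead:
  "b_weight t q k = bead_prob q k * (1 - bead_prob q (k - int t))"
  unfolding gap_weight_def[OF int_t_pos hole_plus_bead_neq_0[OF q]] one_minus_bead_prob[OF q]
  unfolding bead_prob_def by simp

definition chain :: "int \<Rightarrow> nat \<Rightarrow> complex" where
  "chain k0 i = bead_prob q (k0 + int i * int t)"

text \<open>A segment of n positions has n - 1 gaps: at its lowest position the hole k - t lies
  outside the window, so the weights at k and k - t are both 0 and \<open>H 0 0 = 0\<close> removes
  the term.\<close>

lemma sum_gap_weight_on_segment:
  fixes H :: "complex \<Rightarrow> complex \<Rightarrow> complex" and j0 j1 :: int
  assumes H: "H 0 0 = 0" and "j0 \<le> j1"
    and mem: "\<And>j. k0 + j * int t \<in> bead_positions t J \<longleftrightarrow> j0 \<le> j \<and> j < j1"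
  shows "(\<Sum>j\<in>{j0..<j1}. H (b_weight_on t q (bead_positions t J) (k0 + j * int t))
      (b_weight_on t q (bead_positions t J) (k0 + j * int t - int t)))
    = chain_sum H (chain (k0 + j0 * int t)) (nat (j1 - j0) - 1)"
proof -
  let ?W = "b_weight_on t q (bead_positions t J)"
  let ?p = "chain (k0 + j0 * int t)"
  have W: "?W (k0 + (j0 + int i) * int t) = (if 1 \<le> i \<and> i \<le> nat (j1 - j0) then ?p i * (1 - ?p (i - 1)) else 0)" for i
  proof -
    have e: "k0 + (j0 + int i) * int t - int t = k0 + (j0 + int i - 1) * int t" by (simp add: algebra_simps)
    have "?W (k0 + (j0 + int i) * int t) = (if j0 \<le> j0 + int i - 1 \<and> j0 + int i - 1 < j1
        then b_weight t q (k0 + (j0 + int i) * int t) else 0)"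
      unfolding gap_weight_on_def[OF int_t_pos hole_plus_bead_neq_0[OF q]] e mem by simp
    also have "... = (if 1 \<le> i \<and> i \<le> nat (j1 - j0) then ?p i * (1 - ?p (i - 1)) else 0)"
      unfolding gap_weight_bead e chain_def by (auto simp: of_nat_diff algebra_simps)
    finally show ?thesis .
  qed
  define n where "n = nat (j1 - j0)"
  have Wneg: "?W (k0 + j0 * int t - int t) = 0"
  proof -
    have "k0 + j0 * int t - int t - int t = k0 + (j0 - 2) * int t" by (simp add: algebra_simps)
    then show ?thesis
      unfolding gap_weight_on_def[OF int_t_pos hole_plus_bead_neq_0[OF q]] by (simp only: mem) simp
  qed
  have "(\<Sum>j\<in>{j0..<j1}. H (?W (k0 + j * int t)) (?W (k0 + j * int t - int t)))
     = (\<Sum>i<n. H (?W (k0 + (j0 + int i) * int t)) (?W (k0 + (j0 + int i) * int t - int t)))"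
    by (rule sum.reindex_bij_witness[where i = "\<lambda>i. j0 + int i" and j = "\<lambda>j. nat (j - j0)"])
      (auto simp: n_def)
  also have "... = chain_sum H ?p (n - 1)"
  proof (cases n)
    case (Suc m)
    have s: "k0 + (j0 + int (Suc i)) * int t - int t = k0 + (j0 + int i) * int t" for i by (simp add: algebra_simps)
    have "(\<Sum>i<n. H (?W (k0 + (j0 + int i) * int t)) (?W (k0 + (j0 + int i) * int t - int t)))
      = H 0 0 + (\<Sum>i<m. H (?W (k0 + (j0 + int (Suc i)) * int t)) (?W (k0 + (j0 + int i) * int t)))"
      unfolding Suc sum.lessThan_Suc_shift s using W[of 0] Wneg by simp
    also have "... = chain_sum H ?p m"
      unfolding chain_sum_def H add_0_left
    proof (rule sum.cong)
      fix i assume "i \<in> {..<m}"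
      then have "i < nat (j1 - j0)" "Suc i \<le> nat (j1 - j0)" using Suc n_def by auto
      then show "H (?W (k0 + (j0 + int (Suc i)) * int t)) (?W (k0 + (j0 + int i) * int t))
        = H (?p (Suc i) * (1 - ?p i)) (if i = 0 then 0 else ?p i * (1 - ?p (i - 1)))"
        unfolding W by auto
    qed simp
    finally show ?thesis using Suc by simp
  qed (simp add: chain_sum_def)
  finally show ?thesis by (simp add: n_def)
qed

lemma sum_gap_weight_on_bead_positions:
  fixes H :: "complex \<Rightarrow> complex \<Rightarrow> complex"
  assumes H: "H 0 0 = 0"
  shows "(\<Sum>k\<in>bead_positions t J. H (b_weight_on t q (bead_positions t J) k)
      (b_weight_on t q (bead_positions t J) (k - int t)))
    = chain_sum H (chain 0) (J - 1) + (if even t then chain_sum H (chain (int (t div 2))) (J - 1) else 0)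
      + (\<Sum>r\<in>{1..(t - 1) div 2}. chain_sum H (chain (int r - int J * int t)) (2 * J - 1))"
proof -
  have mem: "int r + j * int t \<in> bead_positions t J \<longleftrightarrow> (if r = 0 \<or> 2 * r = t then 0 else - int J) \<le> j \<and> j < int J"
    if r: "2 * r \<le> t" for r j
  proof -
    have m: "(int r + j * int t) mod int t = int r" using r t_pos by simp
    have rt: "int r < int t" using r t_pos by linarith
    have a: "- int (J * t) \<le> int r + j * int t \<longleftrightarrow> - int J \<le> j"
    proof
      assume "- int J \<le> j"
      then have "- int J * int t \<le> j * int t" by (intro mult_right_mono) auto
      then show "- int (J * t) \<le> int r + j * int t" by simp
    next
      assume *: "- int (J * t) \<le> int r + j * int t"
      show "- int J \<le> j"
      proof (rule ccontr)
        assume "\<not> - int J \<le> j"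
        then have "(j + 1) * int t \<le> - int J * int t" by (intro mult_right_mono) auto
        then show False using * rt by (simp add: algebra_simps)
      qed
    qed
    have b: "int r + j * int t < int (J * t) \<longleftrightarrow> j < int J"
    proof
      assume "j < int J"
      then have "(j + 1) * int t \<le> int J * int t" by (intro mult_right_mono) auto
      then show "int r + j * int t < int (J * t)" using rt by (simp add: algebra_simps)
    next
      assume *: "int r + j * int t < int (J * t)"
      show "j < int J"
      proof (rule ccontr)
        assume "\<not> j < int J"
        then have "int J * int t \<le> j * int t" by (intro mult_right_mono) auto
        then show False using * by simp
      qed
    qed
    have c: "0 \<le> int r + j * int t \<longleftrightarrow> 0 \<le> j"
    proof
      assume *: "0 \<le> int r + j * int t"
      show "0 \<le> j"
      proof (rule ccontr)
        assume "\<not> 0 \<le> j"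
        then have "(j + 1) * int t \<le> 0 * int t" by (intro mult_right_mono) auto
        then show False using * rt by (simp add: algebra_simps)
      qed
    qed simp
    have e: "int r = 0 \<longleftrightarrow> r = 0" "2 * int r = int t \<longleftrightarrow> 2 * r = t" "2 * int r \<le> int t \<longleftrightarrow> 2 * r \<le> t" by auto
    show ?thesis unfolding bead_positions_def mem_Collect_eq m a b c e using r by auto
  qed
  let ?W = "b_weight_on t q (bead_positions t J)"
  note S = sum_gap_weight_on_segment[of H _ _ _ J, OF H]
  have 1: "(\<Sum>j\<in>{0..<int J}. H (?W (j * int t)) (?W (j * int t - int t))) = chain_sum H (chain 0) (J - 1)"
    using S[of 0 "int J" 0] mem[of 0] by simp
  have 2: "(\<Sum>j\<in>{0..<int J}. H (?W (int (t div 2) + j * int t)) (?W (int (t div 2) + j * int t - int t)))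
     = chain_sum H (chain (int (t div 2))) (J - 1)" if "even t"
    using S[of 0 "int J" "int (t div 2)"] mem[of "t div 2"] that by simp
  have 3: "(\<Sum>j\<in>{- int J..<int J}. H (?W (int r + j * int t)) (?W (int r + j * int t - int t)))
     = chain_sum H (chain (int r - int J * int t)) (2 * J - 1)" if "r \<in> {1..(t - 1) div 2}" for r
  proof -
    have "2 * r \<le> t" "r \<noteq> 0" "2 * r \<noteq> t" using that t_pos by auto
    moreover have "nat (int J + int J) = 2 * J" by simp
    ultimately show ?thesis using S[of "- int J" "int J" "int r"] mem[of r] by simp
  qed
  have 4: "(\<Sum>r\<in>{1..(t - 1) div 2}. \<Sum>j\<in>{- int J..<int J}.
      H (?W (int r + j * int t)) (?W (int r + j * int t - int t)))
     = (\<Sum>r\<in>{1..(t - 1) div 2}. chain_sum H (chain (int r - int J * int t)) (2 * J - 1))"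
    by (rule sum.cong[OF refl 3])
  show ?thesis
    unfolding sum_bead_positions[OF t_pos] 1 4 using 2 by (cases "even t") simp_all
qed

end

text \<open>One summand for each kind of chain: the \<open>(t - 1) div 2\<close> paired residues,
  the class of 0, and for even \<open>t\<close> the class of t / 2. The last one is a rational
  function of \<open>q ^ (t div 2)\<close>, because its positions are odd multiples of t /
  2.\<close>

definition hook_mean :: "nat \<Rightarrow> complex \<Rightarrow> complex" where
  "hook_mean t q = of_nat ((t - 1) div 2) * (q ^ t / (1 - q ^ t)) + q ^ t / (1 - (q ^ t)\<^sup>2) +
     (if even t then (q ^ (t div 2)) ^ 3 / ((1 - q ^ (t div 2)) * (1 + q ^ (t div 2))\<^sup>2) else 0)"

definition hook_corr :: "nat \<Rightarrow> complex \<Rightarrow> complex" where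
  "hook_corr t q = of_nat ((t - 1) div 2) * ((q ^ t)\<^sup>2 / (1 - (q ^ t)\<^sup>2)) + (q ^ t)\<^sup>2 / (1 - (q ^ t) ^ 4) +
     (if even t then (q ^ (t div 2)) ^ 6 * (1 + 2 * (q ^ (t div 2))\<^sup>2 + (q ^ (t div 2)) ^ 3) /
        ((1 - q ^ (t div 2)) * (1 + q ^ (t div 2)) ^ 3 * (1 + (q ^ (t div 2))\<^sup>2) * (1 + (q ^ (t div 2)) ^ 3)) else 0)"

lemma chain_potential_0_0 [simp]: "chain_potential x 0 0 = 0"
  by (simp add: chain_potential_def)

lemma tendsto_chain_sum:
  assumes x: "x \<noteq> 1" "x\<^sup>2 \<noteq> 1" and p: "\<And>i. p (Suc i) * (1 - p i) = x * p i * (1 - p (Suc i))"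
    and p2: "\<And>i. p (Suc (Suc i)) * (1 - p i) = x\<^sup>2 * p i * (1 - p (Suc (Suc i)))" and lim: "p \<longlonglongrightarrow> 0"
  shows "chain_sum1 p \<longlonglongrightarrow> x / (1 - x) * p 0"
    and "chain_sum2 p \<longlonglongrightarrow> (p 1 * (1 - p 0))\<^sup>2 - chain_potential x (p 1) (p 0)"
proof -
  have "(\<lambda>N. x / (1 - x) * (p 0 - p N)) \<longlonglongrightarrow> x / (1 - x) * (p 0 - 0)" by (intro tendsto_intros lim)
  moreover have "chain_sum1 p = (\<lambda>N. x / (1 - x) * (p 0 - p N))" using chain_sum1_eq[OF x(1)] p by blast
  ultimately show "chain_sum1 p \<longlonglongrightarrow> x / (1 - x) * p 0" by simp
  have "(\<lambda>N. (p 1 * (1 - p 0))\<^sup>2 + chain_potential x (p (Suc N)) (p N) - chain_potential x (p 1) (p 0))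
     \<longlonglongrightarrow> (p 1 * (1 - p 0))\<^sup>2 + chain_potential x 0 0 - chain_potential x (p 1) (p 0)"
    by (intro tendsto_intros tendsto_chain_potential lim LIMSEQ_Suc)
  moreover have "chain_sum2 p (Suc N) = (p 1 * (1 - p 0))\<^sup>2 + chain_potential x (p (Suc N)) (p N) - chain_potential x (p 1) (p 0)" for N
    by (rule chain_sum2_eq[OF x]) (rule p p2)+
  ultimately have "(\<lambda>N. chain_sum2 p (Suc N)) \<longlonglongrightarrow> (p 1 * (1 - p 0))\<^sup>2 - chain_potential x (p 1) (p 0)"
    by simp
  then show "chain_sum2 p \<longlonglongrightarrow> (p 1 * (1 - p 0))\<^sup>2 - chain_potential x (p 1) (p 0)"
    by (rule LIMSEQ_imp_Suc)
qed

text \<open>A chain of a paired residue is infinite in both directions and its probabilities fall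
  from 1 to 0. The upper end contributes the potential at (0, 0), which is 0, and the lower end the
  one at (1, 1).\<close>

lemma chain_value_pair:
  fixes x :: complex
  assumes "1 - x \<noteq> 0" "1 + x \<noteq> 0"
  shows "- chain_potential x 1 1 = x\<^sup>2 / (1 - x\<^sup>2)"
proof -
  have "1 - x\<^sup>2 = (1 - x) * (1 + x)" by (simp add: power2_eq_square algebra_simps)
  then show ?thesis using assms unfolding chain_potential_def \<open>1 - x\<^sup>2 = (1 - x) * (1 + x)\<close>
    by (simp add: divide_simps) algebra
qed

text \<open>Here \<open>x\<close> is \<open>q ^ t\<close>, and \<open>u\<close> and \<open>v\<close>
  are the probabilities at positions t and 2 t. The leading terms are those split off at position
  0.\<close>

lemma chain_value_zero:
  fixes x :: complex
  assumes "1 - x \<noteq> 0" "1 + x \<noteq> 0" "1 + x\<^sup>2 \<noteq> 0"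
  defines "u \<equiv> x / (1 + x)" and "v \<equiv> x\<^sup>2 / (1 + x\<^sup>2)"
  shows "u + x / (1 - x) * u = x / (1 - x\<^sup>2)"
    and "u\<^sup>2 + 2 * (v * (1 - u)) * u + ((v * (1 - u))\<^sup>2 - chain_potential x v u) = x\<^sup>2 / (1 - x ^ 4)"
proof -
  have e: "1 - x\<^sup>2 = (1 - x) * (1 + x)" "1 - x ^ 4 = (1 - x) * (1 + x) * (1 + x\<^sup>2)"
    by (simp_all add: power2_eq_square power4_eq_xxxx algebra_simps)
  show "u + x / (1 - x) * u = x / (1 - x\<^sup>2)"   proof -
    have "u + x / (1 - x) * u = u * (1 + x / (1 - x))" by (simp add: algebra_simps)
    also have "1 + x / (1 - x) = 1 / (1 - x)" using assms(1) by (simp add: divide_simps)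
    finally show ?thesis unfolding e u_def by (simp add: mult.commute)
  qed
  show "u\<^sup>2 + 2 * (v * (1 - u)) * u + ((v * (1 - u))\<^sup>2 - chain_potential x v u) = x\<^sup>2 / (1 - x ^ 4)"
    unfolding chain_potential_def e u_def v_def using assms(1-3)
    by (simp add: divide_simps) algebra
qed

text \<open>With \<open>y\<close> equal to \<open>q ^ (t div 2)\<close>, the numbers
  \<open>u\<close> and \<open>v\<close> are the probabilities at t / 2 and 3 t / 2, the first two
  positions of the chain.\<close>

lemma chain_value_half:
  fixes y :: complex
  assumes "1 - y \<noteq> 0" "1 + y \<noteq> 0" "1 + y\<^sup>2 \<noteq> 0" "1 + y ^ 3 \<noteq> 0"
  defines "u \<equiv> y / (1 + y)" and "v \<equiv> y ^ 3 / (1 + y ^ 3)"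
  shows "y\<^sup>2 / (1 - y\<^sup>2) * u = y ^ 3 / ((1 - y) * (1 + y)\<^sup>2)"
    and "(v * (1 - u))\<^sup>2 - chain_potential (y\<^sup>2) v u =
      y ^ 6 * (1 + 2 * y\<^sup>2 + y ^ 3) / ((1 - y) * (1 + y) ^ 3 * (1 + y\<^sup>2) * (1 + y ^ 3))"
proof -
  have e: "1 - y\<^sup>2 = (1 - y) * (1 + y)" "1 - (y\<^sup>2)\<^sup>2 = (1 - y) * (1 + y) * (1 + y\<^sup>2)"
    by (simp_all add: power2_eq_square algebra_simps)
  show "y\<^sup>2 / (1 - y\<^sup>2) * u = y ^ 3 / ((1 - y) * (1 + y)\<^sup>2)" unfolding e u_def using assms(1,2)
    by (simp add: field_simps power2_eq_square power3_eq_cube)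
  show "(v * (1 - u))\<^sup>2 - chain_potential (y\<^sup>2) v u =
      y ^ 6 * (1 + 2 * y\<^sup>2 + y ^ 3) / ((1 - y) * (1 + y) ^ 3 * (1 + y\<^sup>2) * (1 + y ^ 3))"
    unfolding chain_potential_def e u_def v_def using assms(1-4)
    by (simp add: divide_simps) algebra
qed

lemma sum_power_abs_le:
  fixes r :: real
  assumes "0 \<le> r" "r < 1" "finite D"
  shows "(\<Sum>k\<in>D. r ^ nat \<bar>k\<bar>) \<le> 2 / (1 - r)"
proof -
  have part: "(\<Sum>k\<in>E. r ^ nat \<bar>k\<bar>) \<le> 1 / (1 - r)" if "finite E" "inj_on (\<lambda>k. nat \<bar>k\<bar>) E" for E :: "int set"
  proof -
    have "(\<Sum>k\<in>E. r ^ nat \<bar>k\<bar>) = (\<Sum>m\<in>(\<lambda>k. nat \<bar>k\<bar>) ` E. r ^ m)" using that by (simp add: sum.reindex)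
    also have "... \<le> (\<Sum>m. r ^ m)" using that assms by (intro sum_le_suminf summable_geometric) auto
    finally show ?thesis using assms by (simp add: suminf_geometric)
  qed
  have "(\<Sum>k\<in>D. r ^ nat \<bar>k\<bar>) = (\<Sum>k\<in>{k \<in> D. 0 \<le> k}. r ^ nat \<bar>k\<bar>) + (\<Sum>k\<in>{k \<in> D. k < 0}. r ^ nat \<bar>k\<bar>)"
    using assms(3) by (subst sum.union_disjoint[symmetric]) (auto intro: sum.cong)
  also have "... \<le> 1 / (1 - r) + 1 / (1 - r)"
    using assms(3) by (intro add_mono part) (auto simp: inj_on_def)
  finally show ?thesis by simp
qed

text \<open>With s = |q|^m and u = s - Re (q^m) one has |1 + q^m|^2 = (1 + s)^2 - 2 u, and (1 + s)^2
  \<le> 4 turns this into a decay exp (- u / 4). The perturbation by \<delta> fits into the same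
  form because exp (u / 4) \<le> 2.\<close>

lemma norm_one_plus_power_le:
  fixes q :: complex
  assumes "cmod q \<le> 1" "\<delta> \<ge> 0"
  shows "cmod (1 + q ^ m) + \<delta> * cmod q ^ m
    \<le> (1 + cmod q ^ m) * exp (2 * \<delta> * cmod q ^ m - (cmod q ^ m - Re (q ^ m)) / 4)"
proof -
  define s where "s = cmod q ^ m"
  define u where "u = s - Re (q ^ m)"
  have s: "0 \<le> s" "s \<le> 1" using assms by (auto simp: s_def power_le_one)
  have sq: "cmod (q ^ m) = s" by (simp add: s_def norm_power)
  have u: "0 \<le> u" "u \<le> 2 * s"
    using complex_Re_le_cmod[of "q ^ m"] abs_Re_le_cmod[of "q ^ m"] unfolding u_def sq by linarith+
  have "(cmod (1 + q ^ m))\<^sup>2 = (1 + Re (q ^ m))\<^sup>2 + (Im (q ^ m))\<^sup>2" by (simp add: cmod_power2)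
  also have "... = 1 + 2 * Re (q ^ m) + (cmod (q ^ m))\<^sup>2" unfolding cmod_power2 by (simp add: power2_eq_square algebra_simps)
  also have "... = (1 + s)\<^sup>2 - 2 * u" unfolding sq u_def by (simp add: power2_eq_square algebra_simps)
  also have "... \<le> (1 + s)\<^sup>2 - (1 + s)\<^sup>2 * (u / 2)"
  proof -
    have "(1 + s)\<^sup>2 \<le> 2\<^sup>2" using s by (intro power_mono) auto
    then have "(1 + s)\<^sup>2 * (u / 2) \<le> 4 * (u / 2)" using u by (intro mult_right_mono) auto
    then show ?thesis by simp
  qed
  also have "... = (1 + s)\<^sup>2 * (1 + (- (u / 2)))" by (simp add: algebra_simps)
  also have "... \<le> (1 + s)\<^sup>2 * exp (- (u / 2))" by (intro mult_left_mono exp_ge_add_one_self) auto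
  also have "... = ((1 + s) * exp (- (u / 4)))\<^sup>2" by (simp add: power_mult_distrib exp_double[symmetric])
  finally have 1: "cmod (1 + q ^ m) \<le> (1 + s) * exp (- (u / 4))"
    using s by (simp add: power2_le_iff_abs_le)
  have "exp (u / 4) \<le> 2"
  proof -
    have "exp (u / 4) \<le> exp (1 / 2)" using u s by simp
    also have "... \<le> 1 + 2 * (1 / 2)" using exp_bound_lemma[of "1 / 2 :: real"] by simp
    finally show ?thesis by simp
  qed
  then have "\<delta> * s * (exp (u / 4) * exp (- (u / 4))) \<le> \<delta> * s * (2 * exp (- (u / 4)))"
    using assms s by (intro mult_left_mono mult_right_mono) auto
  then have 2: "\<delta> * s \<le> 2 * \<delta> * s * exp (- (u / 4))" by (simp add: exp_minus field_simps)
  have "cmod (1 + q ^ m) + \<delta> * s \<le> (1 + s) * exp (- (u / 4)) + (1 + s) * (2 * \<delta> * s * exp (- (u / 4)))"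
  proof -
    have "1 * (2 * \<delta> * s * exp (- (u / 4))) \<le> (1 + s) * (2 * \<delta> * s * exp (- (u / 4)))"
      using s assms by (intro mult_right_mono) auto
    then show ?thesis using 1 2 by linarith
  qed
  also have "... = (1 + s) * exp (- (u / 4)) * (1 + 2 * \<delta> * s)" by (simp add: algebra_simps)
  also have "... \<le> (1 + s) * exp (- (u / 4)) * exp (2 * \<delta> * s)"
    using s by (intro mult_left_mono exp_ge_add_one_self) auto
  also have "... = (1 + s) * exp (2 * \<delta> * s - u / 4)"
    by (simp only: mult.assoc exp_add[symmetric]) (simp add: add.commute)
  finally show ?thesis by (simp add: s_def u_def)
qed

context
  fixes t :: nat and q :: complex
  assumes t_pos: "t > 0" and q: "cmod q < 1"
begin

lemma chain_relations:
  assumes "\<And>i. k0 + int i * int t \<noteq> 0"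
  shows "chain t q k0 (Suc i) * (1 - chain t q k0 i) = q ^ t * chain t q k0 i * (1 - chain t q k0 (Suc i))"
    and "chain t q k0 (Suc (Suc i)) * (1 - chain t q k0 i) = (q ^ t)\<^sup>2 * chain t q k0 i * (1 - chain t q k0 (Suc (Suc i)))"
proof -
  have e: "k0 + int (Suc i) * int t - int t = k0 + int i * int t"
    "k0 + int (Suc (Suc i)) * int t - int (2 * t) = k0 + int i * int t" by (simp_all add: algebra_simps)
  show "chain t q k0 (Suc i) * (1 - chain t q k0 i) = q ^ t * chain t q k0 i * (1 - chain t q k0 (Suc i))"
    using bead_prob_relation[OF q, of "k0 + int (Suc i) * int t" t] assms[of i] assms[of "Suc i"]
    unfolding e chain_def[OF t_pos q] by blast
  have "(q ^ t)\<^sup>2 = q ^ (2 * t)" by (simp add: power_mult[symmetric] mult.commute)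
  then show "chain t q k0 (Suc (Suc i)) * (1 - chain t q k0 i) = (q ^ t)\<^sup>2 * chain t q k0 i * (1 - chain t q k0 (Suc (Suc i)))"
    using bead_prob_relation[OF q, of "k0 + int (Suc (Suc i)) * int t" "2 * t"] assms[of i] assms[of "Suc (Suc i)"]
    unfolding e chain_def[OF t_pos q] by metis
qed

lemma q_power_neq: "q ^ t \<noteq> 1" "(q ^ t)\<^sup>2 \<noteq> 1" "1 - q ^ t \<noteq> 0" "1 + q ^ t \<noteq> 0" "1 + (q ^ t)\<^sup>2 \<noteq> 0"
  using one_plus_power_neq_0[OF q, of t] one_plus_power_neq_0[OF q, of "t * 2"] t_pos
  by (auto simp: power_mult)

lemma tendsto_chain_zero:
  "(\<lambda>J. chain_sum1 (chain t q 0) (J - 1)) \<longlonglongrightarrow> q ^ t / (1 - (q ^ t)\<^sup>2)"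
  "(\<lambda>J. chain_sum2 (chain t q 0) (J - 1)) \<longlonglongrightarrow> (q ^ t)\<^sup>2 / (1 - (q ^ t) ^ 4)"
proof -
  let ?x = "q ^ t"
  have sh: "chain t q 0 (Suc i) = chain t q (int t) i" for i
    by (simp add: chain_def[OF t_pos q] algebra_simps)
  have 0: "chain t q 0 0 = 0" by (simp add: chain_def[OF t_pos q] bead_prob_def bead_weight_def)
  have ne: "int t + int i * int t \<noteq> 0" for i using t_pos by (simp add: add_pos_nonneg less_imp_neq[symmetric])
  have lim: "chain t q (int t) \<longlonglongrightarrow> 0"
    using tendsto_bead_prob_at_top[OF t_pos q, of "int t"] by (simp add: chain_def[OF t_pos q, abs_def])
  have n2: "nat (2 * int t) = t * 2" by simp
  have v: "chain t q (int t) 0 = ?x / (1 + ?x)" "chain t q (int t) 1 = ?x\<^sup>2 / (1 + ?x\<^sup>2)"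
    using t_pos by (simp_all add: chain_def[OF t_pos q] bead_prob_pos n2 power_mult del: nat_mult_distrib)
  note T = tendsto_chain_sum[OF q_power_neq(1,2) chain_relations[OF ne] lim]
  note V = chain_value_zero[OF q_power_neq(3-5)]
  have "(\<lambda>N. chain_sum1 (chain t q 0) (Suc N)) \<longlonglongrightarrow> ?x / (1 - ?x\<^sup>2)"
    unfolding chain_sum_Suc_shift(1)[of "chain t q 0", OF 0] sh
    using tendsto_add[OF tendsto_const T(1), of "chain t q 0 1"] V(1) sh[of 0] v by simp
  then show "(\<lambda>J. chain_sum1 (chain t q 0) (J - 1)) \<longlonglongrightarrow> ?x / (1 - ?x\<^sup>2)"
    by - (rule LIMSEQ_offset[of _ 2], simp)
  have s2: "chain t q 0 1 = ?x / (1 + ?x)" "chain t q 0 2 = ?x\<^sup>2 / (1 + ?x\<^sup>2)"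
    using sh[of 0] sh[of 1] v by (simp_all add: numeral_2_eq_2)
  have "(\<lambda>N. (chain t q 0 1)\<^sup>2 + 2 * (chain t q 0 2 * (1 - chain t q 0 1)) * chain t q 0 1 + chain_sum2 (chain t q (int t)) (Suc N))
     \<longlonglongrightarrow> (chain t q 0 1)\<^sup>2 + 2 * (chain t q 0 2 * (1 - chain t q 0 1)) * chain t q 0 1
        + ((chain t q (int t) 1 * (1 - chain t q (int t) 0))\<^sup>2 - chain_potential ?x (chain t q (int t) 1) (chain t q (int t) 0))"
    by (rule tendsto_add[OF tendsto_const LIMSEQ_Suc[OF T(2)]])
  then have "(\<lambda>N. chain_sum2 (chain t q 0) (Suc (Suc N))) \<longlonglongrightarrow> ?x\<^sup>2 / (1 - ?x ^ 4)"
    unfolding chain_sum_Suc_shift(2)[of "chain t q 0", OF 0] sh v s2 V(2) .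
  then show "(\<lambda>J. chain_sum2 (chain t q 0) (J - 1)) \<longlonglongrightarrow> ?x\<^sup>2 / (1 - ?x ^ 4)"
    by - (rule LIMSEQ_offset[of _ 3], simp add: numeral_2_eq_2)
qed

lemma tendsto_chain_half:
  assumes "even t"
  defines "y \<equiv> q ^ (t div 2)"
  shows "(\<lambda>J. chain_sum1 (chain t q (int (t div 2))) (J - 1)) \<longlonglongrightarrow> y ^ 3 / ((1 - y) * (1 + y)\<^sup>2)"
    and "(\<lambda>J. chain_sum2 (chain t q (int (t div 2))) (J - 1))
      \<longlonglongrightarrow> y ^ 6 * (1 + 2 * y\<^sup>2 + y ^ 3) / ((1 - y) * (1 + y) ^ 3 * (1 + y\<^sup>2) * (1 + y ^ 3))"
proof -
  let ?h = "t div 2"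
  have h: "t = ?h * 2" "0 < ?h" using assms t_pos by auto
  have x: "q ^ t = y\<^sup>2" by (subst h(1)) (simp add: y_def power_mult)
  have ny: "1 - y \<noteq> 0" "1 + y \<noteq> 0" "1 + y\<^sup>2 \<noteq> 0" "1 + y ^ 3 \<noteq> 0"
    using one_plus_power_neq_0[OF q, of ?h] one_plus_power_neq_0(1)[OF q, of "?h * 2"]
      one_plus_power_neq_0(1)[OF q, of "?h * 3"] h(2) by (simp_all add: y_def power_mult)
  have ne: "int ?h + int i * int t \<noteq> 0" for i using h(2) by (simp add: add_pos_nonneg less_imp_neq[symmetric])
  have lim: "chain t q (int ?h) \<longlonglongrightarrow> 0"
    using tendsto_bead_prob_at_top[OF t_pos q, of "int ?h"] by (simp add: chain_def[OF t_pos q, abs_def])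
  have "nat (int ?h + int t) = ?h * 3" using h(1) by linarith
  then have v: "chain t q (int ?h) 0 = y / (1 + y)" "chain t q (int ?h) 1 = y ^ 3 / (1 + y ^ 3)"
    using h(2) by (simp_all add: chain_def[OF t_pos q] bead_prob_pos y_def power_mult)
  note T = tendsto_chain_sum[OF q_power_neq(1,2) chain_relations[OF ne] lim]
  note V = chain_value_half[OF ny]
  have "chain_sum1 (chain t q (int ?h)) \<longlonglongrightarrow> y ^ 3 / ((1 - y) * (1 + y)\<^sup>2)"
    using T(1) unfolding v x V(1) .
  then show "(\<lambda>J. chain_sum1 (chain t q (int (t div 2))) (J - 1)) \<longlonglongrightarrow> y ^ 3 / ((1 - y) * (1 + y)\<^sup>2)"
    by - (rule LIMSEQ_offset[of _ 1], simp)
  have "chain_sum2 (chain t q (int ?h)) \<longlonglongrightarrow> y ^ 6 * (1 + 2 * y\<^sup>2 + y ^ 3) / ((1 - y) * (1 + y) ^ 3 * (1 + y\<^sup>2) * (1 + y ^ 3))"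
    using T(2) unfolding v x V(2) .
  then show "(\<lambda>J. chain_sum2 (chain t q (int (t div 2))) (J - 1))
      \<longlonglongrightarrow> y ^ 6 * (1 + 2 * y\<^sup>2 + y ^ 3) / ((1 - y) * (1 + y) ^ 3 * (1 + y\<^sup>2) * (1 + y ^ 3))"
    by - (rule LIMSEQ_offset[of _ 1], simp)
qed

lemma tendsto_chain_pair:
  assumes r: "r \<in> {1..(t - 1) div 2}"
  shows "(\<lambda>J. chain_sum1 (chain t q (int r - int J * int t)) (2 * J - 1)) \<longlonglongrightarrow> q ^ t / (1 - q ^ t)"
    and "(\<lambda>J. chain_sum2 (chain t q (int r - int J * int t)) (2 * J - 1)) \<longlonglongrightarrow> (q ^ t)\<^sup>2 / (1 - (q ^ t)\<^sup>2)"
proof -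
  let ?x = "q ^ t" and ?p = "\<lambda>J. chain t q (int r - int J * int t)"
  have rt: "0 < r" "r < t" using r t_pos by auto
  have ne: "int r - int J * int t + int i * int t \<noteq> 0" for i J
  proof
    assume "int r - int J * int t + int i * int t = 0"
    then have "int r = (int J - int i) * int t" by (simp add: algebra_simps)
    then have "int t dvd int r" by (metis dvd_triv_right)
    then show False using rt by (simp add: dvd_imp_le nat_dvd_not_less)
  qed
  note R = chain_relations[OF ne]
  have e: "(r0 :: int) - int J * int t + int (2 * J + 1) * int t = r0 + int t + int J * int t"
      "(r0 :: int) - int J * int t + int (2 * J) * int t = r0 + int J * int t" for J r0 by (simp_all add: algebra_simps)
  \<comment> \<open>At \<open>Suc J\<close> the length \<open>2 * J - 1\<close> becomes
    \<open>2 * J + 1\<close>, which keeps truncated subtraction away from the telescoped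
    formulas.\<close>
  have p0: "(\<lambda>J. ?p (Suc J) 0) \<longlonglongrightarrow> 1"
    using LIMSEQ_Suc[OF tendsto_bead_prob_at_bot[OF t_pos q, of "int r"]] by (simp add: chain_def[OF t_pos q])
  have "(\<lambda>J. bead_prob q (int r - int J * int t)) \<longlonglongrightarrow> 1" by (rule tendsto_bead_prob_at_bot[OF t_pos q])
  moreover have "?p (Suc J) 1 = bead_prob q (int r - int J * int t)" for J
    by (simp add: chain_def[OF t_pos q] algebra_simps)
  ultimately have p1: "(\<lambda>J. ?p (Suc J) 1) \<longlonglongrightarrow> 1" by simp
  have "?p (Suc J) (2 * J + 1) = bead_prob q (int r + int J * int t)" for J
    by (simp add: chain_def[OF t_pos q] algebra_simps)
  then have pN: "(\<lambda>J. ?p (Suc J) (2 * J + 1)) \<longlonglongrightarrow> 0"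
    using tendsto_bead_prob_at_top[OF t_pos q, of "int r"] by simp
  have "?p (Suc J) (2 * J) = bead_prob q ((int r - int t) + int J * int t)" for J
    by (simp add: chain_def[OF t_pos q] algebra_simps)
  then have pN': "(\<lambda>J. ?p (Suc J) (2 * J)) \<longlonglongrightarrow> 0"
    using tendsto_bead_prob_at_top[OF t_pos q, of "int r - int t"] by simp
  have "(\<lambda>J. ?x / (1 - ?x) * (?p (Suc J) 0 - ?p (Suc J) (2 * J + 1))) \<longlonglongrightarrow> ?x / (1 - ?x) * (1 - 0)"
    by (intro tendsto_intros p0 pN)
  moreover have "chain_sum1 (?p (Suc J)) (2 * J + 1) = ?x / (1 - ?x) * (?p (Suc J) 0 - ?p (Suc J) (2 * J + 1))" for J
    by (rule chain_sum1_eq[OF q_power_neq(1)]) (rule R(1))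
  ultimately have "(\<lambda>J. chain_sum1 (?p (Suc J)) (2 * J + 1)) \<longlonglongrightarrow> ?x / (1 - ?x)" by simp
  then have "(\<lambda>J. chain_sum1 (?p (Suc J)) (2 * Suc J - 1)) \<longlonglongrightarrow> ?x / (1 - ?x)" by simp
  then show "(\<lambda>J. chain_sum1 (?p J) (2 * J - 1)) \<longlonglongrightarrow> ?x / (1 - ?x)" by (rule LIMSEQ_imp_Suc)
  have "(\<lambda>J. (?p (Suc J) 1 * (1 - ?p (Suc J) 0))\<^sup>2 + chain_potential ?x (?p (Suc J) (2 * J + 1)) (?p (Suc J) (2 * J))
      - chain_potential ?x (?p (Suc J) 1) (?p (Suc J) 0))
     \<longlonglongrightarrow> (1 * (1 - 1))\<^sup>2 + chain_potential ?x 0 0 - chain_potential ?x 1 1"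
    by (intro tendsto_intros tendsto_chain_potential p0 p1 pN pN')
  moreover have "chain_sum2 (?p (Suc J)) (Suc (2 * J)) = (?p (Suc J) 1 * (1 - ?p (Suc J) 0))\<^sup>2
      + chain_potential ?x (?p (Suc J) (2 * J + 1)) (?p (Suc J) (2 * J)) - chain_potential ?x (?p (Suc J) 1) (?p (Suc J) 0)" for J
    unfolding Suc_eq_plus1[of "2 * J", symmetric] by (rule chain_sum2_eq[OF q_power_neq(1,2)]) (rule R)+
  ultimately have "(\<lambda>J. chain_sum2 (?p (Suc J)) (Suc (2 * J))) \<longlonglongrightarrow> - chain_potential ?x 1 1"
    by simp
  then have "(\<lambda>J. chain_sum2 (?p (Suc J)) (2 * Suc J - 1)) \<longlonglongrightarrow> ?x\<^sup>2 / (1 - ?x\<^sup>2)"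
    unfolding chain_value_pair[OF q_power_neq(3,4)] by simp
  then show "(\<lambda>J. chain_sum2 (?p J) (2 * J - 1)) \<longlonglongrightarrow> ?x\<^sup>2 / (1 - ?x\<^sup>2)" by (rule LIMSEQ_imp_Suc)
qed

lemma tendsto_bead_sum1:
  "(\<lambda>J. b_sum1 t q (bead_positions t J)) \<longlonglongrightarrow> hook_mean t q"
proof -
  have half: "(\<lambda>J. if even t then chain_sum1 (chain t q (int (t div 2))) (J - 1) else 0)
    \<longlonglongrightarrow> (if even t then (q ^ (t div 2)) ^ 3 / ((1 - q ^ (t div 2)) * (1 + q ^ (t div 2))\<^sup>2) else 0)"
    using tendsto_chain_half(1) by (cases "even t") simp_all
  have "(\<lambda>J. chain_sum1 (chain t q 0) (J - 1) + (if even t then chain_sum1 (chain t q (int (t div 2))) (J - 1) else 0)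
      + (\<Sum>r\<in>{1..(t - 1) div 2}. chain_sum1 (chain t q (int r - int J * int t)) (2 * J - 1)))
    \<longlonglongrightarrow> q ^ t / (1 - (q ^ t)\<^sup>2) + (if even t then (q ^ (t div 2)) ^ 3 / ((1 - q ^ (t div 2)) * (1 + q ^ (t div 2))\<^sup>2) else 0)
      + (\<Sum>r\<in>{1..(t - 1) div 2}. q ^ t / (1 - q ^ t))"
    by (intro tendsto_add tendsto_sum tendsto_chain_zero tendsto_chain_pair half)
  then show ?thesis
    using sum_gap_weight_on_bead_positions[OF t_pos q, of "\<lambda>a _. a"]
    by (simp add: gap_sum1_def[of "int t", OF _ hole_plus_bead_neq_0[OF q]] t_pos hook_mean_def add_ac)
qed

lemma tendsto_bead_sum2:
  "(\<lambda>J. b_sum2 t q (bead_positions t J)) \<longlonglongrightarrow> hook_corr t q"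
proof -
  have half: "(\<lambda>J. if even t then chain_sum2 (chain t q (int (t div 2))) (J - 1) else 0)
    \<longlonglongrightarrow> (if even t then (q ^ (t div 2)) ^ 6 * (1 + 2 * (q ^ (t div 2))\<^sup>2 + (q ^ (t div 2)) ^ 3) /
        ((1 - q ^ (t div 2)) * (1 + q ^ (t div 2)) ^ 3 * (1 + (q ^ (t div 2))\<^sup>2) * (1 + (q ^ (t div 2)) ^ 3)) else 0)"
    using tendsto_chain_half(2) by (cases "even t") simp_all
  have "(\<lambda>J. chain_sum2 (chain t q 0) (J - 1) + (if even t then chain_sum2 (chain t q (int (t div 2))) (J - 1) else 0)
      + (\<Sum>r\<in>{1..(t - 1) div 2}. chain_sum2 (chain t q (int r - int J * int t)) (2 * J - 1)))
    \<longlonglongrightarrow> (q ^ t)\<^sup>2 / (1 - (q ^ t) ^ 4) + (if even t then (q ^ (t div 2)) ^ 6 * (1 + 2 * (q ^ (t div 2))\<^sup>2 + (q ^ (t div 2)) ^ 3) /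
        ((1 - q ^ (t div 2)) * (1 + q ^ (t div 2)) ^ 3 * (1 + (q ^ (t div 2))\<^sup>2) * (1 + (q ^ (t div 2)) ^ 3)) else 0)
      + (\<Sum>r\<in>{1..(t - 1) div 2}. (q ^ t)\<^sup>2 / (1 - (q ^ t)\<^sup>2))"
    by (intro tendsto_add tendsto_sum tendsto_chain_zero tendsto_chain_pair half)
  then show ?thesis
    using sum_gap_weight_on_bead_positions[OF t_pos q, of "\<lambda>a b. a\<^sup>2 + 2 * a * b"]
    by (simp add: gap_sum2_def[of "int t", OF _ hole_plus_bead_neq_0[OF q]] t_pos hook_corr_def add_ac)
qed

section \<open>Estimates for the generating function with a weight for each bar\<close>

lemma norm_gap_weight_bead_le:
  assumes c: "0 < c" "c \<le> 1" "\<And>m. m > 0 \<Longrightarrow> c \<le> cmod (1 + q ^ m)"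
  shows "cmod (b_weight t q k) \<le> cmod q ^ nat \<bar>k\<bar> / c\<^sup>2"
proof -
  have den: "c \<le> cmod (hole_weight q k + bead_weight q k)" for k using c by (auto simp: hole_plus_bead)
  have num: "cmod (bead_weight q k * hole_weight q (k - int t)) \<le> cmod q ^ nat \<bar>k\<bar>"
  proof -
    have "cmod (q ^ n) \<le> 1" for n using q by (simp add: norm_power power_le_one)
    moreover have "cmod q ^ nat (int t - k) \<le> cmod q ^ nat (- k)" using q by (intro power_decreasing) auto
    ultimately show ?thesis
      by (auto simp: bead_weight_def hole_weight_def norm_mult norm_power mult_left_le)
  qed
  have "c\<^sup>2 \<le> cmod (hole_weight q k + bead_weight q k) * cmod (hole_weight q (k - int t) + bead_weight q (k - int t))"
    unfolding power2_eq_square using den c by (intro mult_mono) auto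
  moreover have "0 < int t" using t_pos by simp
  ultimately show ?thesis
    unfolding gap_weight_def[OF \<open>0 < int t\<close> hole_plus_bead_neq_0[OF q]] norm_divide
      norm_mult[of "hole_weight q k + bead_weight q k"]
    using num c by (intro frac_le) auto
qed

text \<open>The estimate is meant for points where all 1 + q^m stay away from 0 by \<open>c\<close>.
  The gap weights are then at most |q|^|k| / c^2 and their sum is of order 1 / (1 - |q|). The
  relative error is cubic in w - 1 and so remains small even when |w - 1| is of order sqrt (1 -
  |q|).\<close>

lemma norm_bar_count_gf_diff_le:
  assumes w: "cmod w = 1" and c: "0 < c" "c \<le> 1" "\<And>m. m > 0 \<Longrightarrow> c \<le> cmod (1 + q ^ m)"
    and small: "cmod (w - 1) / c\<^sup>2 \<le> 1/4" "80 * cmod (w - 1) ^ 3 / (c ^ 6 * (1 - cmod q)) \<le> 1"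
  shows "cmod ((\<Sum>n. bar_gf t w n * q ^ n)
      - strict_gf q * exp ((w - 1) * hook_mean t q - (w - 1)\<^sup>2 * hook_corr t q / 2))
    \<le> cmod (strict_gf q * exp ((w - 1) * hook_mean t q - (w - 1)\<^sup>2 * hook_corr t q / 2))
       * (240 * cmod (w - 1) ^ 3 / (c ^ 6 * (1 - cmod q)))"
proof -
  let ?g = "b_weight t q"
  define B where "B = 2 / (1 - cmod q) / c\<^sup>2"
  have B: "(\<Sum>k\<in>bead_positions t J. cmod (?g k)) \<le> B" for J
  proof -
    have "(\<Sum>k\<in>bead_positions t J. cmod (?g k)) \<le> (\<Sum>k\<in>bead_positions t J. cmod q ^ nat \<bar>k\<bar> / c\<^sup>2)"
      by (intro sum_mono norm_gap_weight_bead_le[OF c])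
    also have "... = (\<Sum>k\<in>bead_positions t J. cmod q ^ nat \<bar>k\<bar>) / c\<^sup>2" by (simp add: sum_divide_distrib)
    also have "... \<le> B" unfolding B_def using q by (intro divide_right_mono sum_power_abs_le finite_bead_positions) auto
    finally show ?thesis .
  qed
  have M: "cmod (?g k) \<le> 1 / c\<^sup>2" for k
  proof -
    have "cmod q ^ nat \<bar>k\<bar> / c\<^sup>2 \<le> 1 / c\<^sup>2" using q by (intro divide_right_mono power_le_one) auto
    then show ?thesis using norm_gap_weight_bead_le[OF c, of k] by linarith
  qed
  have e: "40 * cmod (w - 1) ^ 3 * (1 / c\<^sup>2)\<^sup>2 * B = 80 * cmod (w - 1) ^ 3 / (c ^ 6 * (1 - cmod q))"
    using c q unfolding B_def by (simp add: field_simps power2_eq_square eval_nat_numeral)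
  have "cmod (w - 1) * (1 / c\<^sup>2) \<le> 1/4" using small(1) by simp
  from norm_suminf_power_diff_le[OF t_pos q w tendsto_bead_sum1 tendsto_bead_sum2 M this B] small(2)
  show ?thesis unfolding e by simp
qed

text \<open>Without a lower bound for all |1 + q^m|, two cases are needed for v = k - t. If |q|^|v|
  \<le> 1/2, or v = 0, then the factor of v has norm at least 1/2 and \<delta> alone suffices.
  Otherwise \<delta>^2 |q|^|v| already exceeds |w - 1|; this case dictates the square root in
  \<delta>.\<close>

lemma gap_step_bound:
  assumes q0: "q \<noteq> 0" and w: "cmod (w - 1) \<le> 1"
  defines "\<delta> \<equiv> 2 * sqrt (cmod (w - 1))"
  shows "cmod (w - 1) * cmod (bead_weight q k) * cmod (hole_weight q (k - int t))
      \<le> \<delta> * cmod q ^ nat \<bar>k\<bar> * (cmod (hole_weight q (k - int t) + bead_weight q (k - int t)) + \<delta> * cmod q ^ nat \<bar>k - int t\<bar>)"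
proof -
  define e where "e = cmod (w - 1)"
  define v where "v = k - int t"
  define m where "m = (\<lambda>k::int. cmod q ^ nat \<bar>k\<bar>)"
  define s where "s = cmod (hole_weight q v + bead_weight q v)"
  have e: "0 \<le> e" "e \<le> 1" using w by (auto simp: e_def)
  have d2: "\<delta> * \<delta> = 4 * e" using e by (simp add: \<delta>_def e_def)
  have d1: "2 * e \<le> \<delta>"
  proof -
    have "e = sqrt e * sqrt e" using e by simp
    also have "... \<le> sqrt e * 1" using e by (intro mult_left_mono) auto
    finally show ?thesis by (simp add: \<delta>_def e_def)
  qed
  have d0: "0 \<le> \<delta>" by (simp add: \<delta>_def)
  have m: "0 < m j" "m j \<le> 1" for j using q q0 by (auto simp: m_def power_le_one)
  have s0: "0 \<le> s" by (simp add: s_def)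
  have half: "1 / 2 \<le> s" if "v = 0 \<or> m v \<le> 1 / 2"
  proof (cases "v = 0")
    case False
    have "cmod 1 - cmod (q ^ nat \<bar>v\<bar>) \<le> cmod (1 + q ^ nat \<bar>v\<bar>)" by (metis norm_diff_ineq)
    then show ?thesis using False that by (simp add: s_def hole_plus_bead m_def norm_power)
  qed (simp add: s_def hole_plus_bead)
  have key: "e \<le> \<delta> * (s + \<delta> * m v)"
  proof (cases "v = 0 \<or> m v \<le> 1 / 2")
    case True
    have "\<delta> * (1 / 2) \<le> \<delta> * (s + \<delta> * m v)"
      using half[OF True] d0 m(1)[of v] by (intro mult_left_mono) (auto intro: add_increasing2)
    then show ?thesis using d1 by linarith
  next
    case False
    have "\<delta> * \<delta> * (1 / 2) \<le> \<delta> * \<delta> * m v" using False d0 by (intro mult_left_mono) auto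
    moreover have "0 \<le> \<delta> * s" using d0 s0 by simp
    moreover have "\<delta> * (s + \<delta> * m v) = \<delta> * s + \<delta> * \<delta> * m v" by (simp add: algebra_simps)
    ultimately show ?thesis using d2 e by linarith
  qed
  have "e * cmod (bead_weight q k) * cmod (hole_weight q v) \<le> \<delta> * m k * (s + \<delta> * m v)"
  proof -
    consider "k = 0" | "k > 0" "v \<ge> 0" | "k > 0" "v < 0" | "k < 0" "v < 0" using t_pos by (force simp: v_def)
    then show ?thesis
    proof cases
      case 1
      then show ?thesis using d0 m(1)[of k] m(1)[of v] s0 by (simp add: bead_weight_def)
    next
      case 2
      have "e * cmod (bead_weight q k) * cmod (hole_weight q v) = m k * e"
        using 2 by (simp add: bead_weight_def hole_weight_def m_def norm_power)
      also have "... \<le> m k * (\<delta> * (s + \<delta> * m v))" using key m(1)[of k] by (intro mult_left_mono) auto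
      finally show ?thesis by (simp add: mult_ac)
    next
      case 3
      have "e * cmod (bead_weight q k) * cmod (hole_weight q v) = e * (m k * m v)"
        using 3 by (simp add: bead_weight_def hole_weight_def m_def norm_power)
      also have "... \<le> 4 * e * (m k * m v)" using e m(1)[of k] m(1)[of v] by (intro mult_right_mono) auto
      also have "... = \<delta> * m k * (\<delta> * m v)" unfolding d2[symmetric] by (simp add: mult_ac)
      also have "... \<le> \<delta> * m k * (s + \<delta> * m v)" using d0 m(1)[of k] s0 by (intro mult_left_mono) auto
      finally show ?thesis .
    next
      case 4
      have "cmod q ^ nat \<bar>v\<bar> \<le> cmod q ^ nat \<bar>k\<bar>" using q 4 t_pos by (intro power_decreasing) (auto simp: v_def)
      then have mm: "m v \<le> m k" by (simp add: m_def)
      have "e * cmod (bead_weight q k) * cmod (hole_weight q v) = m v * e"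
        using 4 by (simp add: bead_weight_def hole_weight_def m_def norm_power)
      also have "... \<le> m k * (\<delta> * (s + \<delta> * m v))" using key mm m(1)[of v] e by (intro mult_mono) auto
      finally show ?thesis by (simp add: mult_ac)
    qed
  qed
  then show ?thesis by (simp add: e_def v_def m_def s_def)
qed

text \<open>The comparison is with the positive real point r = |q|. Each factor 1 + q^m gains exp (-
  u / 4) with u = r^m - Re (q^m), and these u sum to a difference of two geometric series. The
  factor 1 + \<delta> is due to position 0, where hole and bead weights sum to 1.\<close>

lemma norm_bar_count_gf_le:
  assumes q0: "q \<noteq> 0" and w: "cmod w = 1" "cmod (w - 1) \<le> 1"
  defines "\<delta> \<equiv> 2 * sqrt (cmod (w - 1))" and "r \<equiv> cmod q"
  shows "cmod (\<Sum>n. bar_gf t w n * q ^ n)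
    \<le> (1 + \<delta>) * cmod (strict_gf (of_real r)) * exp (2 * \<delta> * (r / (1 - r)) - (r / (1 - r) - Re (q / (1 - q))) / 4)"
proof -
  have r: "0 < r" "r < 1" using q q0 by (auto simp: r_def)
  have d0: "0 \<le> \<delta>" by (simp add: \<delta>_def)
  let ?Z = "\<lambda>J. b_gf t q (bead_positions t J) (\<lambda>n. w ^ n)"
  let ?u = "\<lambda>m. r ^ m - Re (q ^ m)"
  have u0: "0 \<le> ?u m" for m using complex_Re_le_cmod[of "q ^ m"] by (simp add: r_def norm_power)
  have cr: "cmod (of_real r) < 1" using r by simp
  let ?N = "\<lambda>J. cmod (\<Prod>k\<in>bead_positions t J. hole_weight (of_real r) k + bead_weight (of_real r) k)"
  define G where "G J = (1 + \<delta>) * ?N J * exp (2 * \<delta> * (r / (1 - r)) - (\<Sum>m=1..<J. ?u m) / 4)" for J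
  have ZG: "cmod (?Z J) \<le> G J" for J
  proof -
    let ?K = "bead_positions t J"
    have "cmod (?Z J) \<le> (\<Prod>k\<in>?K. cmod (hole_weight q k + bead_weight q k) + \<delta> * cmod q ^ nat \<bar>k\<bar>)"
      unfolding \<delta>_def
      by (rule norm_gap_gf_power_le) (use t_pos finite_bead_positions gap_step_bound[OF q0 w(2)] in auto)
    also have "... \<le> (\<Prod>k\<in>?K. (if k = 0 then 1 + \<delta> else 1) * (cmod (hole_weight (of_real r) k + bead_weight (of_real r) k)
        * (if k = 0 then 1 else exp (2 * \<delta> * r ^ nat \<bar>k\<bar> - ?u (nat \<bar>k\<bar>) / 4))))"
    proof (rule prod_mono, safe)
      fix k
      show "0 \<le> cmod (hole_weight q k + bead_weight q k) + \<delta> * cmod q ^ nat \<bar>k\<bar>" using d0 by simp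
      have "cmod (1 + of_real r ^ nat \<bar>k\<bar>) = 1 + r ^ nat \<bar>k\<bar>"
      proof -
        have "1 + of_real r ^ nat \<bar>k\<bar> = complex_of_real (1 + r ^ nat \<bar>k\<bar>)" by simp
        then have "cmod (1 + of_real r ^ nat \<bar>k\<bar>) = \<bar>1 + r ^ nat \<bar>k\<bar>\<bar>" by (simp only: norm_of_real)
        then show ?thesis using r by simp
      qed
      then show "cmod (hole_weight q k + bead_weight q k) + \<delta> * cmod q ^ nat \<bar>k\<bar> \<le>
        (if k = 0 then 1 + \<delta> else 1) * (cmod (hole_weight (of_real r) k + bead_weight (of_real r) k)
        * (if k = 0 then 1 else exp (2 * \<delta> * r ^ nat \<bar>k\<bar> - ?u (nat \<bar>k\<bar>) / 4)))"
        using norm_one_plus_power_le[of q \<delta> "nat \<bar>k\<bar>"] q d0 by (simp add: hole_plus_bead r_def)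
    qed
    also have "... = (\<Prod>k\<in>?K. if k = 0 then 1 + \<delta> else 1) * (?N J *
        (\<Prod>k\<in>?K. if k = 0 then 1 else exp (2 * \<delta> * r ^ nat \<bar>k\<bar> - ?u (nat \<bar>k\<bar>) / 4)))"
      by (simp only: prod.distrib prod_norm)
    also have "(\<Prod>k\<in>?K. if k = 0 then 1 else exp (2 * \<delta> * r ^ nat \<bar>k\<bar> - ?u (nat \<bar>k\<bar>) / 4))
       = (\<Prod>k\<in>?K - {0}. exp (2 * \<delta> * r ^ nat \<bar>k\<bar> - ?u (nat \<bar>k\<bar>) / 4))"
      by (rule prod.mono_neutral_cong_right) (use finite_bead_positions in auto)
    also have "... = (\<Prod>m\<in>bead_sizes t J. exp (2 * \<delta> * r ^ m - ?u m / 4))"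
      unfolding bead_sizes_def by (subst prod.reindex[OF inj_on_bead_sizes[OF t_pos]]) simp
    also have "... = exp (2 * \<delta> * (\<Sum>m\<in>bead_sizes t J. r ^ m) - (\<Sum>m\<in>bead_sizes t J. ?u m) / 4)"
      unfolding exp_sum[OF finite_bead_sizes, symmetric] sum_distrib_left sum_divide_distrib sum_subtractf[symmetric] by simp
    also have "(\<Prod>k\<in>?K. if k = 0 then 1 + \<delta> else 1) * (?N J * exp (2 * \<delta> * (\<Sum>m\<in>bead_sizes t J. r ^ m) - (\<Sum>m\<in>bead_sizes t J. ?u m) / 4))
       \<le> (1 + \<delta>) * (?N J * exp (2 * \<delta> * (r / (1 - r)) - (\<Sum>m=1..<J. ?u m) / 4))"
    proof (intro mult_mono mult_left_mono)
      show "(\<Prod>k\<in>?K. if k = 0 then 1 + \<delta> else 1) \<le> 1 + \<delta>"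
        using finite_bead_positions[of t J] d0 by (simp add: prod.delta)
      have s1: "(\<Sum>m\<in>bead_sizes t J. r ^ m) \<le> r / (1 - r)"
      proof -
        have "(\<Sum>m\<in>insert 0 (bead_sizes t J). r ^ m) \<le> (\<Sum>m. r ^ m)"
          using r finite_bead_sizes by (intro sum_le_suminf summable_geometric) auto
        then have "1 + (\<Sum>m\<in>bead_sizes t J. r ^ m) \<le> 1 / (1 - r)"
          using r finite_bead_sizes zero_notin_bead_sizes by (simp add: suminf_geometric)
        then show ?thesis using r by (simp add: field_simps)
      qed
      have s2: "(\<Sum>m=1..<J. ?u m) \<le> (\<Sum>m\<in>bead_sizes t J. ?u m)"
      proof (rule sum_mono2[OF finite_bead_sizes])
        have "J * 1 \<le> J * t" using t_pos by (intro mult_left_mono) auto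
        then have Jt: "J \<le> J * t" by (simp only: mult_1_right)
        show "{1..<J} \<subseteq> bead_sizes t J"
        proof
          fix m assume "m \<in> {1..<J}"
          then have "0 < m" "m < J" by auto
          then show "m \<in> bead_sizes t J" using Jt by (intro bead_sizes_cases[OF t_pos]) linarith+
        qed
      qed (use u0 in auto)
      show "exp (2 * \<delta> * (\<Sum>m\<in>bead_sizes t J. r ^ m) - (\<Sum>m\<in>bead_sizes t J. ?u m) / 4)
         \<le> exp (2 * \<delta> * (r / (1 - r)) - (\<Sum>m=1..<J. ?u m) / 4)"
        using s2 mult_left_mono[OF s1, of "2 * \<delta>"] d0 by simp
    qed (use d0 in auto)
    finally show ?thesis by (simp add: G_def mult_ac)
  qed
  have "(\<lambda>m. ?u (Suc m)) sums (r / (1 - r) - Re (q / (1 - q)))"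
  proof -
    have "(\<lambda>m. r * r ^ m) sums (r * (1 / (1 - r)))" using r by (intro sums_mult geometric_sums) auto
    moreover have "(\<lambda>m. q * q ^ m) sums (q * (1 / (1 - q)))" using q by (intro sums_mult geometric_sums) auto
    ultimately show ?thesis using sums_diff[OF _ sums_Re] by fastforce
  qed
  then have "(\<lambda>N. \<Sum>m<N. ?u (Suc m)) \<longlonglongrightarrow> r / (1 - r) - Re (q / (1 - q))" by (simp add: sums_def)
  moreover have "(\<Sum>m=1..<Suc N. ?u m) = (\<Sum>m<N. ?u (Suc m))" for N
    by (simp add: sum.shift_bounds_Suc_ivl atLeast0LessThan[symmetric] del: sum.op_ivl_Suc)
  ultimately have lim: "(\<lambda>J. \<Sum>m=1..<J. ?u m) \<longlonglongrightarrow> r / (1 - r) - Re (q / (1 - q))"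
    by (intro LIMSEQ_imp_Suc[of "\<lambda>J. \<Sum>m=1..<J. ?u m"]) (simp only:)
  have "G \<longlonglongrightarrow> (1 + \<delta>) * cmod (strict_gf (of_real r)) * exp (2 * \<delta> * (r / (1 - r)) - (r / (1 - r) - Re (q / (1 - q))) / 4)"
    unfolding G_def by (intro tendsto_intros lim tendsto_norm tendsto_bead_norm[OF t_pos cr]) simp
  moreover have "?Z \<longlonglongrightarrow> (\<Sum>n. bar_gf t w n * q ^ n)"
    by (rule tendsto_gap_gf[OF t_pos q]) (use w one_le_quadratic in \<open>simp add: norm_power\<close>)
  ultimately show ?thesis
    by (intro LIMSEQ_le[OF tendsto_norm]) (use ZG in auto)
qed

end

section \<open>Asymptotics of the generating function of strict partitions\<close>

text \<open>The dilogarithm at - v. The term for \<open>n = 0\<close> is a division by zero and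
  hence 0.\<close>

definition dilog_alt :: "complex \<Rightarrow> complex" where
  "dilog_alt v = (\<Sum>n. (- 1) ^ n / of_nat n ^ 2 * v ^ n)"

lemma summable_inverse_squares_norm: "summable (\<lambda>n. 1 / (real n)\<^sup>2)"
  using sums_summable[OF inverse_squares_sums] by (subst summable_Suc_iff[symmetric]) (simp add: add.commute)

lemma dilog_alt_term_bound: "cmod v \<le> 1 \<Longrightarrow> cmod ((- 1) ^ n / of_nat n ^ 2 * v ^ n) \<le> 1 / (real n)\<^sup>2"
  by (auto simp: norm_mult norm_divide norm_power power_le_one divide_right_mono)

lemma summable_dilog_alt: "cmod v \<le> 1 \<Longrightarrow> summable (\<lambda>n. (- 1) ^ n / of_nat n ^ 2 * v ^ n)"
  by (rule summable_comparison_test'[OF summable_inverse_squares_norm, of 0]) (use dilog_alt_term_bound in auto)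

text \<open>Uniform convergence holds on the closed disc. Continuity up to v = 1, where the
  differentiated series is no longer absolutely convergent, is what the first summation step from u
  = 0 relies on.\<close>

lemma continuous_on_dilog_alt: "continuous_on (cball 0 1) dilog_alt"
proof -
  have U: "uniform_limit (cball 0 1) (\<lambda>N v. \<Sum>n<N. (- 1) ^ n / of_nat n ^ 2 * v ^ n) dilog_alt sequentially"
    unfolding dilog_alt_def[abs_def]
    by (rule Weierstrass_m_test[OF _ summable_inverse_squares_norm]) (use dilog_alt_term_bound in auto)
  have C: "continuous_on (cball 0 1) (\<lambda>v. \<Sum>n<N. c n * v ^ n)" for c :: "nat \<Rightarrow> complex" and N
    by (intro continuous_intros)
  show ?thesis by (rule uniform_limit_theorem[OF always_eventually[OF allI[OF C]] U]) simp
qed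

lemma DERIV_dilog_alt:
  assumes "cmod v < 1"
  shows "(dilog_alt has_field_derivative (\<Sum>n. diffs (\<lambda>n. (- 1) ^ n / of_nat n ^ 2) n * v ^ n)) (at v)"
  unfolding dilog_alt_def[abs_def]
  by (rule termdiffs_strong'[of 1], rule summable_dilog_alt) (use assms in auto)

lemma dilog_alt_diffs:
  assumes "cmod v < 1"
  shows "v * (\<Sum>n. diffs (\<lambda>n. (- 1) ^ n / of_nat n ^ 2) n * v ^ n) = - Ln (1 + v)"
proof -
  have "(\<lambda>n. - ((- v) ^ n) / of_nat n) sums Ln (1 + v)" by (rule Ln_series'[OF assms])
  then have "(\<lambda>n. - (- ((- v) ^ Suc n) / of_nat (Suc n))) sums (- Ln (1 + v))"
    by (intro sums_minus) (subst sums_Suc_iff, simp)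
  moreover have "- (- ((- v) ^ Suc n) / of_nat (Suc n)) = v * (diffs (\<lambda>n. (- 1) ^ n / of_nat n ^ 2) n * v ^ n)" for n
  proof -
    have "(- v) ^ Suc n = (- 1) ^ Suc n * (v * v ^ n)" by (simp add: power_minus[of v])
    moreover have "diffs (\<lambda>n. (- 1) ^ n / of_nat n ^ 2) n = (- 1) ^ Suc n / (of_nat (Suc n) :: complex)"
      by (simp add: diffs_def power2_eq_square del: of_nat_Suc)
    ultimately show ?thesis by (simp add: mult_ac del: of_nat_Suc)
  qed
  ultimately have "(\<lambda>n. v * (diffs (\<lambda>n. (- 1) ^ n / of_nat n ^ 2) n * v ^ n)) sums (- Ln (1 + v))" by simp
  moreover have "summable (\<lambda>n. diffs (\<lambda>n. (- 1) ^ n / of_nat n ^ 2) n * v ^ n)"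
    by (rule termdiff_converges[of _ 1], use assms in simp, rule summable_dilog_alt) simp
  ultimately show ?thesis by (simp add: suminf_mult sums_iff)
qed

lemma dilog_alt_0: "dilog_alt 0 = 0"
  using powser_zero[of "\<lambda>n. (- 1) ^ n / of_nat n ^ 2 :: complex"] by (simp add: dilog_alt_def)

text \<open>The alternating series is twice the even terms of the series of inverse squares minus
  the whole series, which is pi^2 / 12 - pi^2 / 6.\<close>

lemma dilog_alt_1: "dilog_alt 1 = - of_real (pi\<^sup>2 / 12)"
proof -
  define a :: "nat \<Rightarrow> real" where "a n = 1 / (real n)\<^sup>2" for n
  have a: "a sums (pi\<^sup>2 / 6)"
    by (rule sums_Suc_imp) (use inverse_squares_sums in \<open>simp_all add: a_def add.commute\<close>)
  have "(\<lambda>n. a n / 4) sums (pi\<^sup>2 / 6 / 4)" by (rule sums_divide[OF a])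
  from sums_if[OF sums_zero this]
  have "(\<lambda>n. 2 * (if even n then a (n div 2) / 4 else 0) - a n) sums (2 * (0 + pi\<^sup>2 / 6 / 4) - pi\<^sup>2 / 6)"
    by (intro sums_diff sums_mult a)
  moreover have "2 * (if even n then a (n div 2) / 4 else 0) - a n = (- 1) ^ n / (real n)\<^sup>2" for n
    by (auto simp: a_def elim!: evenE oddE simp: power_mult_distrib)
  ultimately have "(\<lambda>n. (- 1) ^ n / (real n)\<^sup>2) sums (- (pi\<^sup>2 / 12))" by simp
  then have "(\<lambda>n. complex_of_real ((- 1) ^ n / (real n)\<^sup>2)) sums of_real (- (pi\<^sup>2 / 12))" by (rule sums_of_real)
  then show ?thesis by (simp add: dilog_alt_def sums_iff)
qed

text \<open>Successive derivatives of u \<mapsto> \<open>dilog_alt (exp (- u))\<close>. Index 1 is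
  the summand Ln (1 + exp (- u)) of log P and index 0 is its antiderivative; the indexed family is
  the form in which Taylor's theorem is applied.\<close>

definition em_fun :: "nat \<Rightarrow> complex \<Rightarrow> complex" where
  "em_fun i u = (let v = exp (- u) in
     if i = 0 then dilog_alt v else if i = 1 then Ln (1 + v) else if i = 2 then - v / (1 + v)
     else if i = 3 then v / (1 + v)\<^sup>2 else - v * (1 - v) / (1 + v) ^ 3)"

lemma em_fun_simps:
  "em_fun 0 u = dilog_alt (exp (- u))"
  "em_fun (Suc 0) u = Ln (1 + exp (- u))"
  "em_fun (Suc (Suc 0)) u = - exp (- u) / (1 + exp (- u))"
  "em_fun (Suc (Suc (Suc 0))) u = exp (- u) / (1 + exp (- u))\<^sup>2"
  "em_fun (Suc (Suc (Suc (Suc 0)))) u = - exp (- u) * (1 - exp (- u)) / (1 + exp (- u)) ^ 3"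
  by (simp_all add: em_fun_def Let_def)

lemma one_plus_exp_not_nonpos:
  assumes "Re u > 0"
  shows "1 + exp (- u) \<notin> \<real>\<^sub>\<le>\<^sub>0" "1 + exp (- u) \<noteq> 0"
proof -
  have "Re (1 + exp (- u)) > 0"
    using assms abs_Re_le_cmod[of "exp (- u)"] exp_less_one_iff[of "- Re u"]
    by (simp del: Re_exp exp_less_one_iff)
  then show "1 + exp (- u) \<notin> \<real>\<^sub>\<le>\<^sub>0" "1 + exp (- u) \<noteq> 0"
    by (auto simp: complex_nonpos_Reals_iff simp del: Re_exp plus_complex.sel)
qed

lemma DERIV_em_fun:
  assumes "Re u > 0" "i \<le> 3"
  shows "(em_fun i has_field_derivative em_fun (Suc i) u) (at u)"
proof -
  note nz = one_plus_exp_not_nonpos[OF assms(1)]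
  have d: "((\<lambda>u. exp (- u)) has_field_derivative - exp (- u)) (at u)"
    by (auto intro!: derivative_eq_intros)
  consider "i = 0" | "i = 1" | "i = 2" | "i = 3" using assms(2) by linarith
  then show ?thesis
  proof cases
    case 1
    have "((\<lambda>u. dilog_alt (exp (- u))) has_field_derivative
       (\<Sum>n. diffs (\<lambda>n. (- 1) ^ n / of_nat n ^ 2) n * exp (- u) ^ n) * (- exp (- u))) (at u)"
      by (rule DERIV_chain2[OF DERIV_dilog_alt d]) (use assms(1) in simp)
    moreover have "(\<Sum>n. diffs (\<lambda>n. (- 1) ^ n / of_nat n ^ 2) n * exp (- u) ^ n) * (- exp (- u)) = Ln (1 + exp (- u))"
      using dilog_alt_diffs[of "exp (- u)"] assms(1) by (simp add: mult.commute)
    ultimately show ?thesis unfolding 1 by (simp add: em_fun_simps[abs_def])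
  next
    case 2
    have "((\<lambda>u. Ln (1 + exp (- u))) has_field_derivative (- exp (- u) / (1 + exp (- u)))) (at u)"
      using nz by (auto intro!: derivative_eq_intros d simp: divide_simps)
    then show ?thesis unfolding 2 by (simp add: em_fun_simps[abs_def])
  next
    case 3
    have "((\<lambda>u. - exp (- u) / (1 + exp (- u))) has_field_derivative (exp (- u) / (1 + exp (- u))\<^sup>2)) (at u)"
    proof -
      have "((\<lambda>u. - exp (- u) / (1 + exp (- u))) has_field_derivative
        ((exp (- u) * (1 + exp (- u)) - (- exp (- u)) * (- exp (- u))) / ((1 + exp (- u)) * (1 + exp (- u))))) (at u)"
        using nz by (auto intro!: derivative_eq_intros d) (metis minus_divide_left minus_diff_eq)
      then show ?thesis by (simp add: power2_eq_square algebra_simps)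
    qed
    then show ?thesis unfolding 3 by (simp add: em_fun_simps[abs_def] numeral_2_eq_2)
  next
    case 4
    have "((\<lambda>u. exp (- u) / (1 + exp (- u))\<^sup>2) has_field_derivative (- exp (- u) * (1 - exp (- u)) / (1 + exp (- u)) ^ 3)) (at u)"
    proof -
      have D: "((\<lambda>u. exp (- u) / (1 + exp (- u))\<^sup>2) has_field_derivative
        (((- exp (- u)) * (1 + exp (- u))\<^sup>2 - exp (- u) * (2 * (1 + exp (- u)) * (- exp (- u)))) / ((1 + exp (- u))\<^sup>2 * (1 + exp (- u))\<^sup>2))) (at u)"
      proof (rule DERIV_divide[OF d])
        show "((\<lambda>u. (1 + exp (- u))\<^sup>2) has_field_derivative 2 * (1 + exp (- u)) * (- exp (- u))) (at u)"
          using DERIV_power[OF DERIV_add[OF DERIV_const[of 1] d], of 2] by (simp add: algebra_simps)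
      qed (use nz in simp)
      have A: "((- v) * (1 + v)\<^sup>2 - v * (2 * (1 + v) * (- v))) / ((1 + v)\<^sup>2 * (1 + v)\<^sup>2) = - v * (1 - v) / (1 + v) ^ 3"
        if "1 + v \<noteq> 0" for v :: complex
      proof -
        have "(- v) * (1 + v)\<^sup>2 - v * (2 * (1 + v) * (- v)) = (1 + v) * (- v * (1 - v))"
          by (simp add: power2_eq_square algebra_simps)
        moreover have "(1 + v)\<^sup>2 * (1 + v)\<^sup>2 = (1 + v) * (1 + v) ^ 3"
          by (simp add: power2_eq_square power3_eq_cube)
        ultimately show ?thesis using that by simp
      qed
      show ?thesis using D unfolding A[OF nz(2)] .
    qed
    then show ?thesis unfolding 4 by (simp add: em_fun_simps[abs_def] numeral_3_eq_3)
  qed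
qed

text \<open>A convex cone containing all positive multiples of the points z = \<eta> (1 + i s) with
  \<bar>s\<bar> \<le> 1.\<close>

definition sector :: "complex set" where
  "sector = {u. 0 < Re u \<and> \<bar>Im u\<bar> \<le> Re u}"

lemma sector_scale: "u \<in> sector \<Longrightarrow> x > 0 \<Longrightarrow> of_real x * u \<in> sector"
  by (auto simp: sector_def abs_mult)

lemma norm_sector_le: "u \<in> sector \<Longrightarrow> cmod u \<le> 2 * Re u"
  using cmod_le[of u] by (auto simp: sector_def)

text \<open>Either the imaginary part is at most pi / 2 in size and exp (- u) has non-negative real
  part, or Re u > 1 and exp (- u) has norm at most 1/2.\<close>

lemma one_plus_exp_sector_ge:
  assumes "u \<in> sector"
  shows "1 / 2 \<le> cmod (1 + exp (- u))"
proof (cases "\<bar>Im u\<bar> \<le> pi / 2")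
  case True
  then have "0 \<le> cos (Im u)" by (intro cos_ge_zero) auto
  then have "1 \<le> Re (1 + exp (- u))" by (simp add: Re_exp)
  then show ?thesis using complex_Re_le_cmod[of "1 + exp (- u)"] by linarith
next
  case False
  then have "1 < Re u" using assms pi_gt3 by (auto simp: sector_def)
  then have "exp (- Re u) \<le> exp (- 1)" by simp
  also have "... \<le> 1 / 2" using exp_ge_add_one_self[of "1 :: real"] by (simp add: exp_minus divide_simps)
  finally have "cmod (exp (- u)) \<le> 1 / 2" by simp
  then show ?thesis using norm_diff_ineq[of 1 "exp (- u)"] by simp
qed

lemma norm_em_fun_4_le:
  assumes "u \<in> sector"
  shows "cmod (em_fun (Suc (Suc (Suc (Suc 0)))) u) \<le> 16 * exp (- Re u)"
proof -
  have "cmod (1 - exp (- u)) \<le> 2"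
  proof -
    have "exp (- Re u) \<le> 1" using assms by (simp add: sector_def)
    moreover have "cmod (exp (- u)) = exp (- Re u)" by simp
    ultimately show ?thesis using norm_triangle_ineq4[of 1 "exp (- u)"] unfolding norm_one by linarith
  qed
  moreover have "(1 / 2) ^ 3 \<le> cmod (1 + exp (- u)) ^ 3"
    by (rule power_mono[OF one_plus_exp_sector_ge[OF assms]]) simp
  ultimately have "exp (- Re u) * cmod (1 - exp (- u)) / cmod (1 + exp (- u)) ^ 3 \<le> exp (- Re u) * 2 / (1 / 2) ^ 3"
    by (intro frac_le mult_left_mono) auto
  then show ?thesis by (simp add: em_fun_simps norm_mult norm_divide norm_power power3_eq_cube)
qed

text \<open>The error of one Euler-Maclaurin step for Ln (1 + exp (- x)) from \<open>u\<close> to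
  \<open>w\<close>: the integral, minus the trapezoidal value, plus one twelfth of the squared step
  times the difference of the derivatives at the ends.\<close>

definition em_error :: "complex \<Rightarrow> complex \<Rightarrow> complex" where
  "em_error u w = dilog_alt (exp (- w)) - dilog_alt (exp (- u))
    - (w - u) * (Ln (1 + exp (- u)) + Ln (1 + exp (- w))) / 2
    + (w - u)\<^sup>2 * (exp (- u) / (1 + exp (- u)) - exp (- w) / (1 + exp (- w))) / 12"

lemma convex_sector: "convex sector"
proof -
  have "sector = {u. 0 < Re u} \<inter> ({u. Im u - Re u \<le> 0} \<inter> {u. - Im u - Re u \<le> 0})" by (auto simp: sector_def abs_le_iff)
  then have eq: "sector = {u. Re u > 0} \<inter> ({u. Im u - Re u \<le> 0} \<inter> {u. - Im u - Re u \<le> 0})" by simp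
  have c2: "convex {u :: complex. Im u - Re u \<le> 0}"
    using convex_halfspace_le[of "Complex (- 1) 1" 0] by (simp add: inner_complex_def algebra_simps)
  have c3: "convex {u :: complex. - Im u - Re u \<le> 0}"
    using convex_halfspace_le[of "Complex (- 1) (- 1)" 0] by (simp add: inner_complex_def algebra_simps)
  show ?thesis unfolding eq by (intro convex_Int convex_halfspace_Re_gt c2 c3)
qed

text \<open>Taylor polynomials at \<open>u\<close> of degree 3, 2 and 1 for the antiderivative, the
  function and its derivative cancel in this combination. The remainders give (1/6 + 1/4 + 1/12) *
  16 = 8. A fourth power is enough: the exponential sums over n to order 1/\<eta>, and after
  division by z an error of order \<eta>^2 is left.\<close>

lemma norm_em_error_le:
  assumes u: "u \<in> sector" and w: "w \<in> sector" and le: "Re u \<le> Re w"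
  shows "cmod (em_error u w) \<le> 8 * exp (- Re u) * cmod (w - u) ^ 4"
proof -
  let ?S = "sector \<inter> {x. Re u \<le> Re x}"
  have conv: "convex ?S" by (intro convex_Int convex_sector convex_halfspace_Re_ge)
  have wS: "u \<in> ?S" "w \<in> ?S" using u w le by auto
  have B: "cmod (em_fun (Suc (Suc (Suc (Suc 0)))) x) \<le> 16 * exp (- Re u)" if "x \<in> ?S" for x
  proof -
    have "16 * exp (- Re x) \<le> 16 * exp (- Re u)" using that by simp
    then show ?thesis using norm_em_fun_4_le[of x] that order.trans by blast
  qed
  have D: "(em_fun i has_field_derivative em_fun (Suc i) x) (at x within ?S)" if "x \<in> ?S" "i \<le> 3" for i x
    using DERIV_em_fun[of x i] that by (auto simp: sector_def intro: has_field_derivative_at_within)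
  define d where "d = w - u"
  have T0: "cmod (em_fun 0 w - (\<Sum>i\<le>Suc (Suc (Suc 0)). em_fun i u * (w - u) ^ i / fact i))
      \<le> 16 * exp (- Re u) * cmod (w - u) ^ Suc (Suc (Suc (Suc 0))) / fact (Suc (Suc (Suc 0)))"
    by (rule complex_Taylor[where f = em_fun, OF conv D B wS]) auto
  have T1: "cmod (em_fun (Suc 0) w - (\<Sum>i\<le>Suc (Suc 0). em_fun (Suc i) u * (w - u) ^ i / fact i))
      \<le> 16 * exp (- Re u) * cmod (w - u) ^ Suc (Suc (Suc 0)) / fact (Suc (Suc 0))"
    by (rule complex_Taylor[where f = "\<lambda>i. em_fun (Suc i)", OF conv D B wS]) auto
  have T2: "cmod (em_fun (Suc (Suc 0)) w - (\<Sum>i\<le>Suc 0. em_fun (Suc (Suc i)) u * (w - u) ^ i / fact i))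
      \<le> 16 * exp (- Re u) * cmod (w - u) ^ Suc (Suc 0) / fact (Suc 0)"
    by (rule complex_Taylor[where f = "\<lambda>i. em_fun (Suc (Suc i))", OF conv D B wS]) auto
  define F where "F = (\<lambda>i. em_fun i u)"
  define R0 where "R0 = em_fun 0 w - (F 0 + F 1 * d + F 2 * d ^ 2 / 2 + F 3 * d ^ 3 / 6)"
  define R1 where "R1 = em_fun 1 w - (F 1 + F 2 * d + F 3 * d ^ 2 / 2)"
  define R2 where "R2 = em_fun 2 w - (F 2 + F 3 * d)"
  define E where "E = 16 * exp (- Re u)"
  have r0: "cmod R0 \<le> E * cmod d ^ 4 / 6"
    using T0 by (simp add: R0_def F_def d_def E_def numeral_2_eq_2 numeral_3_eq_3 eval_nat_numeral algebra_simps)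
  have r1: "cmod R1 \<le> E * cmod d ^ 3 / 2"
    using T1 by (simp add: R1_def F_def d_def E_def numeral_2_eq_2 numeral_3_eq_3 eval_nat_numeral algebra_simps)
  have r2: "cmod R2 \<le> E * cmod d ^ 2"
    using T2 by (simp add: R2_def F_def d_def E_def numeral_2_eq_2 numeral_3_eq_3 eval_nat_numeral algebra_simps)
  have "em_error u w = R0 - d * R1 / 2 + d\<^sup>2 * R2 / 12"
  proof -
    have e: "em_error u w = em_fun 0 w - F 0 - d * (F 1 + em_fun 1 w) / 2 + d\<^sup>2 * (em_fun 2 w - F 2) / 12"
      by (simp add: em_error_def F_def d_def em_fun_simps numeral_2_eq_2 algebra_simps)
    show ?thesis unfolding e R0_def R1_def R2_def by (simp add: field_simps power2_eq_square power3_eq_cube)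
  qed
  also have "cmod ... \<le> cmod R0 + cmod (d * R1 / 2) + cmod (d\<^sup>2 * R2 / 12)"
    using norm_triangle_ineq[of "R0 - d * R1 / 2" "d\<^sup>2 * R2 / 12"] norm_triangle_ineq4[of R0 "d * R1 / 2"] by linarith
  also have "... \<le> E * cmod d ^ 4 / 6 + E * cmod d ^ 4 / 4 + E * cmod d ^ 4 / 12"
  proof (intro add_mono r0)
    have "cmod d * cmod R1 \<le> cmod d * (E * cmod d ^ 3 / 2)" by (rule mult_left_mono[OF r1]) simp
    then show "cmod (d * R1 / 2) \<le> E * cmod d ^ 4 / 4"
      by (simp add: norm_mult norm_divide power3_eq_cube power4_eq_xxxx mult_ac)
    have "cmod d ^ 2 * cmod R2 \<le> cmod d ^ 2 * (E * cmod d ^ 2)" by (rule mult_left_mono[OF r2]) simp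
    then show "cmod (d\<^sup>2 * R2 / 12) \<le> E * cmod d ^ 4 / 12"
      by (simp add: norm_mult norm_divide norm_power power2_eq_square power4_eq_xxxx mult_ac)
  qed
  finally show ?thesis by (simp add: E_def d_def)
qed

text \<open>The series of \<open>dilog_alt\<close> is differentiated only inside the unit disc, so
  the Taylor argument cannot start at 0. The bound holds at points x w with x > 0 and passes to x =
  0 by continuity.\<close>

lemma em_error_at_0:
  assumes w: "w \<in> sector"
  shows "cmod (em_error 0 w) \<le> 8 * cmod w ^ 4"
proof -
  let ?F = "at_right (0::real)"
  have t: "((\<lambda>x. complex_of_real x * w) \<longlongrightarrow> 0 * w) ?F"
    by (intro tendsto_intros tendsto_of_real[where a = 0, simplified] tendsto_ident_at)
  then have t0: "((\<lambda>x. complex_of_real x * w) \<longlongrightarrow> 0) ?F" by simp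
  have ex: "((\<lambda>x. exp (- (complex_of_real x * w))) \<longlongrightarrow> exp (- 0)) ?F" by (intro tendsto_intros t0)
  have "((\<lambda>x. dilog_alt (exp (- (complex_of_real x * w)))) \<longlongrightarrow> dilog_alt 1) ?F"
  proof (rule continuous_on_tendsto_compose[OF continuous_on_dilog_alt])
    show "((\<lambda>x. exp (- (complex_of_real x * w))) \<longlongrightarrow> 1) ?F" using ex by simp
    show "\<forall>\<^sub>F x in ?F. exp (- (complex_of_real x * w)) \<in> cball 0 1"
      using eventually_at_right_less[of 0] by eventually_elim (use w in \<open>auto simp: sector_def\<close>)
  qed simp
  then have "((\<lambda>x. em_error (of_real x * w) w) \<longlongrightarrow> em_error 0 w) ?F"
    unfolding em_error_def by (auto intro!: tendsto_eq_intros t0 ex[simplified] simp: complex_nonpos_Reals_iff)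
  then have l: "((\<lambda>x. cmod (em_error (of_real x * w) w)) \<longlongrightarrow> cmod (em_error 0 w)) ?F" by (rule tendsto_norm)
  have r: "((\<lambda>x. 8 * cmod (w - of_real x * w) ^ 4) \<longlongrightarrow> 8 * cmod (w - 0) ^ 4) ?F" by (intro tendsto_intros t0)
  have "cmod (em_error 0 w) \<le> 8 * cmod (w - 0) ^ 4"
  proof (rule tendsto_le[OF _ r l])
    have "\<forall>\<^sub>F x in ?F. x < 1" by (rule eventually_at_right_real[of 0 1, THEN eventually_mono]) auto
    then show "\<forall>\<^sub>F x in ?F. cmod (em_error (of_real x * w) w) \<le> 8 * cmod (w - of_real x * w) ^ 4"
      using eventually_at_right_less[of 0]
    proof eventually_elim
      case (elim x)
      have c: "of_real x * w \<in> sector" using sector_scale[OF w] elim by simp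
      have "x * Re w \<le> 1 * Re w" using elim w by (intro mult_right_mono) (auto simp: sector_def)
      then have "cmod (em_error (of_real x * w) w) \<le> 8 * exp (- Re (of_real x * w)) * cmod (w - of_real x * w) ^ 4"
        by (intro norm_em_error_le c w) simp
      also have "... \<le> 8 * 1 * cmod (w - of_real x * w) ^ 4"
        using c by (intro mult_right_mono mult_left_mono) (auto simp: sector_def)
      finally show ?case by simp
    qed
  qed simp
  then show ?thesis by simp
qed

text \<open>The contributions of the end point 0 to the Euler-Maclaurin sum: the full integral, half
  of the term ln 2 at n = 0, and the derivative correction z/12 times 1/2.\<close>

definition log_P_approx :: "complex \<Rightarrow> complex" where
  "log_P_approx z = of_real (pi\<^sup>2 / 12) / z - of_real (ln 2 / 2) + z / 24"

text \<open>The errors of the steps from n z to (n + 1) z telescope to partial sums of log P and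
  boundary terms, and the boundary terms at N z tend to 0. The limit is taken after exponentiation,
  so that no branch of log P has to be chosen.\<close>

lemma strict_gf_asymp:
  assumes z: "z \<in> sector" and small: "Re z \<le> 1 / 100"
  shows "cmod (strict_gf (exp (- z)) / exp (log_P_approx z) - 1) \<le> 800 * (Re z)\<^sup>2"
proof -
  define \<eta> where "\<eta> = Re z"
  have \<eta>: "0 < \<eta>" "\<eta> \<le> 1 / 100" using z small by (auto simp: sector_def \<eta>_def)
  have z0: "z \<noteq> 0" using z by (auto simp: sector_def)
  define k where "k n = of_nat n * z" for n
  define f where "f n = Ln (1 + exp (- k n))" for n
  define h where "h n = exp (- k n) / (1 + exp (- k n))" for n
  have kc: "k n \<in> sector" if "n > 0" for n using sector_scale[OF z, of "real n"] that by (simp add: k_def)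
  have err: "cmod (em_error (k n) (k (Suc n))) \<le> 8 * cmod z ^ 4 * exp (- \<eta>) ^ n" for n
  proof (cases "n = 0")
    case True
    then show ?thesis using em_error_at_0[OF kc[of 1]] by (simp add: k_def)
  next
    case False
    have "Re (k n) \<le> Re (k (Suc n))" using \<eta> by (simp add: k_def \<eta>_def algebra_simps)
    from norm_em_error_le[OF kc kc this] False
    have "cmod (em_error (k n) (k (Suc n))) \<le> 8 * exp (- Re (k n)) * cmod (k (Suc n) - k n) ^ 4" by simp
    moreover have "k (Suc n) - k n = z" by (simp add: k_def algebra_simps)
    moreover have "exp (- Re (k n)) = exp (- \<eta>) ^ n" by (simp add: k_def \<eta>_def exp_of_nat_mult[symmetric])
    ultimately show ?thesis by (simp add: mult_ac)
  qed
  define \<kappa> where "\<kappa> = 256 * \<eta>\<^sup>2"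
  have sum_err: "cmod (\<Sum>n<N. em_error (k n) (k (Suc n))) \<le> cmod z * \<kappa>" for N
  proof -
    have "cmod (\<Sum>n<N. em_error (k n) (k (Suc n))) \<le> (\<Sum>n<N. 8 * cmod z ^ 4 * exp (- \<eta>) ^ n)"
      by (rule sum_norm_le) (use err in auto)
    also have "... = 8 * cmod z ^ 4 * (\<Sum>n<N. exp (- \<eta>) ^ n)" by (simp add: sum_distrib_left)
    also have "(\<Sum>n<N. exp (- \<eta>) ^ n) \<le> (\<Sum>n. exp (- \<eta>) ^ n)"
      using \<eta> by (intro sum_le_suminf summable_geometric) auto
    also have "... = 1 / (1 - exp (- \<eta>))" using \<eta> by (intro suminf_geometric) auto
    also have "... \<le> 2 / \<eta>"
    proof -
      have "exp (- \<eta>) \<le> 1 - \<eta> / 2"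
      proof -
        have "1 + \<eta> \<le> exp \<eta>" by (rule exp_ge_add_one_self)
        then have "1 \<le> (1 - \<eta> / 2) * exp \<eta>"
        proof -
          have "(1 - \<eta> / 2) * (1 + \<eta>) \<le> (1 - \<eta> / 2) * exp \<eta>"
            using \<eta> by (intro mult_left_mono) (auto simp: exp_ge_add_one_self)
          moreover have "1 \<le> (1 - \<eta> / 2) * (1 + \<eta>)"
          proof -
            have "\<eta> * \<eta> \<le> \<eta> * 1" using \<eta> by (intro mult_left_mono) auto
            then show ?thesis by (simp add: field_simps)
          qed
          ultimately show ?thesis by linarith
        qed
        then show ?thesis by (simp add: exp_minus field_simps)
      qed
      then have "\<eta> / 2 \<le> 1 - exp (- \<eta>)" by linarith
      then have "1 / (1 - exp (- \<eta>)) \<le> 1 / (\<eta> / 2)" using \<eta> by (intro divide_left_mono mult_pos_pos) auto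
      then show ?thesis by simp
    qed
    finally have "cmod (\<Sum>n<N. em_error (k n) (k (Suc n))) \<le> 8 * cmod z ^ 4 * (2 / \<eta>)"
      by (simp add: mult_left_mono)
    also have "... = cmod z * (16 * cmod z ^ 3 / \<eta>)" by (simp add: power3_eq_cube power4_eq_xxxx)
    also have "... \<le> cmod z * \<kappa>"
    proof (rule mult_left_mono)
      have "cmod z ^ 3 \<le> (2 * \<eta>) ^ 3" using norm_sector_le[OF z] by (intro power_mono) (auto simp: \<eta>_def)
      then have "16 * cmod z ^ 3 / \<eta> \<le> 16 * (2 * \<eta>) ^ 3 / \<eta>" using \<eta> by (intro divide_right_mono mult_left_mono) auto
      also have "... = 128 * \<eta>\<^sup>2" using \<eta> by (simp add: power3_eq_cube power2_eq_square)
      also have "... \<le> \<kappa>" by (simp add: \<kappa>_def)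
      finally show "16 * cmod z ^ 3 / \<eta> \<le> \<kappa>" .
    qed simp
    finally show ?thesis .
  qed
  have tele: "(\<Sum>n<N. em_error (k n) (k (Suc n))) = dilog_alt (exp (- k N)) - dilog_alt 1
     - z * ((\<Sum>n=1..N. f n) + f 0 / 2 - f N / 2) + z\<^sup>2 * (h 0 - h N) / 12" for N
  proof (induction N)
    case (Suc N)
    have "k (Suc N) - k N = z" by (simp add: k_def algebra_simps)
    then have em: "em_error (k N) (k (Suc N)) = dilog_alt (exp (- k (Suc N))) - dilog_alt (exp (- k N))
      - z * (f N + f (Suc N)) / 2 + z\<^sup>2 * (h N - h (Suc N)) / 12"
      by (simp add: em_error_def f_def h_def)
    show ?case unfolding sum.lessThan_Suc Suc.IH em by (simp add: field_simps)
  qed (simp add: k_def)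
  define rm where "rm N = dilog_alt (exp (- k N)) + z * f N / 2 - z\<^sup>2 * h N / 12" for N
  have v: "(\<lambda>N. exp (- k N)) \<longlonglongrightarrow> 0"
  proof -
    have "exp (- k N) = exp (- z) ^ N" for N by (simp add: k_def exp_of_nat_mult[symmetric])
    then show ?thesis using z by (simp add: sector_def LIMSEQ_power_zero)
  qed
  have dl: "(\<lambda>N. dilog_alt (exp (- k N))) \<longlonglongrightarrow> dilog_alt 0"
  proof (rule continuous_on_tendsto_compose[OF continuous_on_dilog_alt v])
    have "cmod (exp (- k N)) \<le> 1" for N using z by (simp add: k_def sector_def)
    then show "\<forall>\<^sub>F N in sequentially. exp (- k N) \<in> cball 0 1" by (intro always_eventually) simp
  qed simp
  have fl: "f \<longlonglongrightarrow> Ln (1 + 0)"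
    unfolding f_def by (intro tendsto_Ln tendsto_add tendsto_const v) simp
  have hl: "h \<longlonglongrightarrow> 0 / (1 + 0)"
    unfolding h_def by (intro tendsto_divide tendsto_add tendsto_const v) simp
  have "rm \<longlonglongrightarrow> dilog_alt 0 + z * Ln (1 + 0) / 2 - z\<^sup>2 * (0 / (1 + 0)) / 12"
    unfolding rm_def by (intro tendsto_intros dl fl hl) simp_all
  then have rm0: "rm \<longlonglongrightarrow> 0" by (simp add: dilog_alt_0)
  have f0: "f 0 = of_real (ln 2)" using Ln_of_real[of 2] by (simp add: f_def k_def)
  have h0: "h 0 = 1 / 2" by (simp add: h_def k_def)
  have main: "(\<Sum>n=1..N. f n) - log_P_approx z - rm N / z = - (\<Sum>n<N. em_error (k n) (k (Suc n))) / z" for N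
    unfolding tele dilog_alt_1 f0 h0 rm_def log_P_approx_def using z0
    by (simp add: field_simps power2_eq_square)
  have nk: "cmod (exp ((\<Sum>n=1..N. f n) - log_P_approx z - rm N / z) - 1) \<le> 3 * \<kappa>" for N
  proof -
    have "cmod ((\<Sum>n=1..N. f n) - log_P_approx z - rm N / z) \<le> \<kappa>"
      unfolding main using sum_err[of N] z0 by (simp add: norm_divide divide_simps mult.commute)
    moreover have "\<kappa> \<le> 1"
    proof -
      have "\<eta>\<^sup>2 \<le> (1 / 100)\<^sup>2" using \<eta> by (intro power_mono) auto
      then show ?thesis by (simp add: \<kappa>_def power2_eq_square)
    qed
    ultimately show ?thesis using norm_exp_minus_1_le[of "(\<Sum>n=1..N. f n) - log_P_approx z - rm N / z"] by linarith
  qed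
  have P: "exp (\<Sum>n=1..N. f n) = (\<Prod>n=1..N. 1 + exp (- z) ^ n)" for N
  proof -
    have "exp (f n) = 1 + exp (- z) ^ n" if "n \<in> {1..N}" for n
    proof -
      have "1 + exp (- k n) \<noteq> 0" using one_plus_exp_not_nonpos(2) kc[of n] that by (auto simp: sector_def)
      then show ?thesis by (simp add: f_def k_def exp_of_nat_mult[symmetric])
    qed
    then show ?thesis by (simp add: exp_sum)
  qed
  have "(\<lambda>N. exp (\<Sum>n=1..N. f n) / exp (log_P_approx z) / exp (rm N / z)) \<longlonglongrightarrow> strict_gf (exp (- z)) / exp (log_P_approx z) / exp (0 / z)"
    unfolding P by (intro tendsto_intros tendsto_prod_strict_gf rm0) (use z z0 in \<open>auto simp: sector_def\<close>)
  then have "(\<lambda>N. exp ((\<Sum>n=1..N. f n) - log_P_approx z - rm N / z)) \<longlonglongrightarrow> strict_gf (exp (- z)) / exp (log_P_approx z)"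
    by (simp add: exp_diff)
  then have "(\<lambda>N. cmod (exp ((\<Sum>n=1..N. f n) - log_P_approx z - rm N / z) - 1)) \<longlonglongrightarrow> cmod (strict_gf (exp (- z)) / exp (log_P_approx z) - 1)"
    by (intro tendsto_intros)
  then have "cmod (strict_gf (exp (- z)) / exp (log_P_approx z) - 1) \<le> 3 * \<kappa>"
    by (rule LIMSEQ_le_const2) (use nk in auto)
  also have "... \<le> 800 * \<eta>\<^sup>2" by (simp add: \<kappa>_def)
  finally show ?thesis by (simp add: \<eta>_def)
qed

section \<open>Expansions at the dominant singularity\<close>

text \<open>The remainder \<open>K\<close> is kept holomorphic because two things are drawn from it:
  its value at 0, for the constants, and a Lipschitz bound, for the variation of \<open>F\<close>
  along the arc.\<close>

definition pole_expansion :: "(complex \<Rightarrow> complex) \<Rightarrow> complex \<Rightarrow> complex \<Rightarrow> bool" where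
  "pole_expansion F a b \<longleftrightarrow> (\<exists>K \<rho>. \<rho> > 0 \<and> K holomorphic_on ball 0 \<rho> \<and> K 0 = b \<and> (\<forall>z. 0 < cmod z \<and> cmod z < \<rho> \<longrightarrow> F z = a / z + K z))"

lemma pole_expansionE:
  assumes "pole_expansion F a b"
  obtains C \<rho> where "\<rho> > 0" "C \<ge> 0"
    "\<And>z w. 0 < cmod z \<Longrightarrow> cmod z < \<rho> \<Longrightarrow> 0 < cmod w \<Longrightarrow> cmod w < \<rho> \<Longrightarrow> cmod ((F z - a / z) - (F w - a / w)) \<le> C * cmod (z - w)"
    "\<And>z. 0 < cmod z \<Longrightarrow> cmod z < \<rho> \<Longrightarrow> cmod (F z - a / z - b) \<le> C * cmod z"
proof -
  obtain K \<rho> where K: "\<rho> > 0" "K holomorphic_on ball 0 \<rho>" "K 0 = b" "\<And>z. 0 < cmod z \<Longrightarrow> cmod z < \<rho> \<Longrightarrow> F z = a / z + K z"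
    using assms unfolding pole_expansion_def by metis
  let ?C = "cball (0::complex) (\<rho> / 2)"
  have sub: "?C \<subseteq> ball 0 \<rho>" using K(1) by auto
  have "continuous_on ?C (deriv K)"
    by (rule continuous_on_subset[OF holomorphic_on_imp_continuous_on[OF holomorphic_deriv[OF K(2) open_ball]] sub])
  then have "bounded (deriv K ` ?C)" by (intro compact_imp_bounded compact_continuous_image compact_cball)
  then obtain C where C: "C > 0" "\<And>u. u \<in> ?C \<Longrightarrow> cmod (deriv K u) \<le> C" by (auto simp: bounded_pos)
  have Lip: "cmod (K z - K w) \<le> C * cmod (z - w)" if "z \<in> ?C" "w \<in> ?C" for z w
  proof (rule field_differentiable_bound[of ?C K "deriv K"])
    fix x assume "x \<in> ?C"
    then show "(K has_field_derivative deriv K x) (at x within ?C)"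
      using holomorphic_derivI[OF K(2) open_ball] sub by (meson has_field_derivative_at_within subsetD)
  qed (use that C in auto)
  show ?thesis
  proof (rule that[of "\<rho> / 2" C])
    fix z assume z: "0 < cmod z" "cmod z < \<rho> / 2"
    then show "cmod (F z - a / z - b) \<le> C * cmod z" using Lip[of z 0] K by simp
    fix w assume "0 < cmod w" "cmod w < \<rho> / 2"
    then show "cmod ((F z - a / z) - (F w - a / w)) \<le> C * cmod (z - w)" using Lip[of z w] z K by simp
  qed (use K C in auto)
qed

lemma pole_expansion_add:
  assumes "pole_expansion F a b" "pole_expansion G a' b'"
  shows "pole_expansion (\<lambda>z. F z + G z) (a + a') (b + b')"
proof -
  obtain K \<rho> where K: "\<rho> > 0" "K holomorphic_on ball 0 \<rho>" "K 0 = b" "\<And>z. 0 < cmod z \<Longrightarrow> cmod z < \<rho> \<Longrightarrow> F z = a / z + K z"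
    using assms(1) unfolding pole_expansion_def by metis
  obtain K' \<rho>' where K': "\<rho>' > 0" "K' holomorphic_on ball 0 \<rho>'" "K' 0 = b'" "\<And>z. 0 < cmod z \<Longrightarrow> cmod z < \<rho>' \<Longrightarrow> G z = a' / z + K' z"
    using assms(2) unfolding pole_expansion_def by metis
  have "(\<lambda>z. K z + K' z) holomorphic_on ball 0 (min \<rho> \<rho>')"
    by (intro holomorphic_on_add holomorphic_on_subset[OF K(2)] holomorphic_on_subset[OF K'(2)]) auto
  then show ?thesis unfolding pole_expansion_def using K(1,3,4) K'(1,3,4)
    by (intro exI[of _ "\<lambda>z. K z + K' z"] exI[of _ "min \<rho> \<rho>'"]) (simp add: add_divide_distrib)
qed

lemma pole_expansion_cmult:
  assumes "pole_expansion F a b"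
  shows "pole_expansion (\<lambda>z. k * F z) (k * a) (k * b)"
proof -
  obtain K \<rho> where K: "\<rho> > 0" "K holomorphic_on ball 0 \<rho>" "K 0 = b" "\<And>z. 0 < cmod z \<Longrightarrow> cmod z < \<rho> \<Longrightarrow> F z = a / z + K z"
    using assms unfolding pole_expansion_def by metis
  then show ?thesis unfolding pole_expansion_def
    by (intro exI[of _ "\<lambda>z. k * K z"] exI[of _ \<rho>]) (auto intro: holomorphic_intros simp: distrib_left)
qed

lemma pole_expansion_scale:
  assumes "pole_expansion F a b" "c > 0"
  shows "pole_expansion (\<lambda>z. F (of_real c * z)) (a / of_real c) b"
proof -
  obtain K \<rho> where K: "\<rho> > 0" "K holomorphic_on ball 0 \<rho>" "K 0 = b" "\<And>z. 0 < cmod z \<Longrightarrow> cmod z < \<rho> \<Longrightarrow> F z = a / z + K z"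
    using assms(1) unfolding pole_expansion_def by metis
  have "(\<lambda>z. K (of_real c * z)) holomorphic_on ball 0 (\<rho> / c)"
    by (rule holomorphic_on_compose_gen[OF _ K(2), unfolded o_def])
       (use assms(2) in \<open>auto intro!: holomorphic_intros simp: norm_mult field_simps\<close>)
  moreover have "F (of_real c * z) = a / of_real c / z + K (of_real c * z)" if z: "0 < cmod z" "cmod z < \<rho> / c" for z
  proof -
    have "0 < cmod (of_real c * z)" "cmod (of_real c * z) < \<rho>" using z assms(2) by (auto simp: norm_mult field_simps)
    from K(4)[OF this] show ?thesis by simp
  qed
  ultimately show ?thesis unfolding pole_expansion_def using K(1,3) assms(2)
    by (intro exI[of _ "\<lambda>z. K (of_real c * z)"] exI[of _ "\<rho> / c"]) auto
qed

text \<open>Existence of the expansion follows from removable singularities: first of (1 - exp (-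
  u)) / u, then of the difference quotient of H. The constant \<open>b\<close> is identified by the
  limit along the positive real axis, a problem of real asymptotics.\<close>

lemma pole_expansion_holomorphic:
  fixes N :: "complex \<Rightarrow> complex" and f :: "real \<Rightarrow> real"
  assumes hol: "(\<lambda>u. N (exp (- u))) holomorphic_on ball 0 \<rho>" and \<rho>: "0 < \<rho>" "\<rho> \<le> 1"
    and f: "\<And>x. x > 0 \<Longrightarrow> N (exp (- of_real x)) / (1 - exp (- of_real x)) = of_real (f x)"
    and lim: "((\<lambda>x. f x - a / x) \<longlongrightarrow> b) (at_right 0)" and a: "N 1 = of_real a"
  shows "pole_expansion (\<lambda>u. N (exp (- u)) / (1 - exp (- u))) (of_real a) (of_real b)"
proof -
  let ?B = "ball (0::complex) \<rho>"
  have int0: "0 \<in> interior ?B" using \<rho> by simp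
  define E where "E = (\<lambda>u::complex. 1 - exp (- u))"
  define g where "g = (\<lambda>u. if u = 0 then deriv E 0 else (E u - E 0) / (u - 0))"
  have "E holomorphic_on ?B" unfolding E_def by (intro holomorphic_intros)
  then have gh: "g holomorphic_on ?B" unfolding g_def by (rule pole_lemma[OF _ int0])
  have "(E has_field_derivative 1) (at 0)" unfolding E_def by (auto intro!: derivative_eq_intros)
  then have g0: "g 0 = 1" by (simp add: g_def DERIV_imp_deriv)
  have gu: "g u = (1 - exp (- u)) / u" if "u \<noteq> 0" for u using that by (simp add: g_def E_def)
  \<comment> \<open>In a disc of radius below pi the exponential is injective, so the denominator
    vanishes only at 0.\<close>
  have Enz: "1 - exp (- u) \<noteq> 0" if "u \<in> ?B" "u \<noteq> 0" for u
  proof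
    assume "1 - exp (- u) = 0"
    then have "exp (- u) = exp 0" by simp
    moreover have "cmod u < pi" using that(1) \<rho> pi_gt3 by simp
    ultimately have "- u = 0" using inj_onD[OF inj_on_exp_pi[of 0], of "- u" 0] by simp
    then show False using that(2) by simp
  qed
  have gnz: "g u \<noteq> 0" if "u \<in> ?B" for u using g0 gu[of u] Enz[OF that] by (cases "u = 0") auto
  define H where "H = (\<lambda>u. N (exp (- u)) / g u)"
  have Hh: "H holomorphic_on ?B" unfolding H_def by (intro holomorphic_on_divide hol gh gnz)
  define K where "K = (\<lambda>u. if u = 0 then deriv H 0 else (H u - H 0) / (u - 0))"
  have Kh: "K holomorphic_on ?B" unfolding K_def by (rule pole_lemma[OF Hh int0])
  have H0: "H 0 = of_real a" by (simp add: H_def g0 a)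
  have FK: "N (exp (- u)) / (1 - exp (- u)) - of_real a / u = K u" if "u \<in> ?B" "u \<noteq> 0" for u
    using that Enz[OF that] by (simp add: K_def H_def H0[unfolded H_def] gu g0 a field_simps)
  have K0: "K 0 = of_real b"
  proof -
    have "isCont K 0"
      using Kh \<rho> by (meson centre_in_ball continuous_on_interior holomorphic_on_imp_continuous_on int0)
    then have "((\<lambda>x. K (of_real x)) \<longlongrightarrow> K 0) (at_right 0)"
      by (rule isCont_tendsto_compose) (auto intro!: tendsto_eq_intros)
    moreover have "((\<lambda>x. K (of_real x)) \<longlongrightarrow> of_real b) (at_right 0)"
    proof (rule Lim_transform_eventually)
      show "((\<lambda>x. complex_of_real (f x - a / x)) \<longlongrightarrow> of_real b) (at_right 0)" by (rule tendsto_of_real[OF lim])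
      have "\<forall>\<^sub>F x in at_right 0. x \<in> {0<..<\<rho>}" by (rule eventually_at_right_real[OF \<rho>(1)])
      then show "\<forall>\<^sub>F x in at_right 0. complex_of_real (f x - a / x) = K (of_real x)"
      proof eventually_elim
        case (elim x)
        then have "complex_of_real x \<in> ?B" "complex_of_real x \<noteq> 0" by auto
        from FK[OF this] f[of x] elim show ?case by simp
      qed
    qed
    ultimately show ?thesis by (rule tendsto_unique[rotated]) simp
  qed
  have "N (exp (- z)) / (1 - exp (- z)) = of_real a / z + K z" if "0 < cmod z" "cmod z < \<rho>" for z
    using FK[of z] that by (simp add: diff_eq_eq add.commute)
  then show ?thesis unfolding pole_expansion_def using Kh K0 \<rho>(1) by blast
qed

text \<open>The factors 1 + v^k with k \<le> 3 are the denominators other than 1 - v that occur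
  below. The radius 1/4 keeps the imaginary part of k u below 1, so that exp (- k u) has positive
  real part.\<close>

lemma one_plus_exp_small_neq_0:
  assumes "u \<in> ball (0::complex) (1 / 4)" "k \<le> 3"
  shows "1 + exp (- u) ^ k \<noteq> 0"
proof -
  have "cmod (of_nat k * u) \<le> 3 * (1 / 4)"
    unfolding norm_mult norm_of_nat using assms by (intro mult_mono) auto
  then have "\<bar>Im (- (of_nat k * u))\<bar> < 1" using abs_Im_le_cmod[of "- (of_nat k * u)"] by simp
  then have "0 < cos (Im (- (of_nat k * u)))" using pi_gt3 by (intro cos_gt_zero_pi) auto
  then have "0 < Re (exp (- (of_nat k * u)))" by (simp add: Re_exp)
  moreover have "exp (- u) ^ k = exp (- (of_nat k * u))" by (simp add: exp_of_nat_mult[symmetric])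
  ultimately have "0 < Re (1 + exp (- u) ^ k)" by simp
  then show ?thesis by (metis less_irrefl zero_complex.simps(1))
qed

section \<open>Pole expansions of the elementary summands\<close>

lemma pole_expansion_T1: "pole_expansion (\<lambda>u. exp (- u) / (1 - exp (- u))) 1 (- 1 / 2)"
proof -
  have "pole_expansion (\<lambda>u. (\<lambda>v. v) (exp (- u)) / (1 - exp (- u))) (of_real 1) (of_real (- 1 / 2))"
  proof (rule pole_expansion_holomorphic[where \<rho> = "1/4" and f = "\<lambda>x. exp (- x) / (1 - exp (- x))"])
    show "((\<lambda>x::real. exp (- x) / (1 - exp (- x)) - 1 / x) \<longlongrightarrow> - 1 / 2) (at_right 0)" by real_asymp
  qed (auto intro!: holomorphic_intros simp: exp_of_real[symmetric])
  then show ?thesis by simp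
qed

lemma pole_expansion_T2: "pole_expansion (\<lambda>u. exp (- u) / (1 - (exp (- u))\<^sup>2)) (1 / 2) 0"
proof -
  have "pole_expansion (\<lambda>u. (\<lambda>v. v / (1 + v ^ 1)) (exp (- u)) / (1 - exp (- u))) (of_real (1 / 2)) (of_real 0)"
  proof (rule pole_expansion_holomorphic[where \<rho> = "1/4" and f = "\<lambda>x. exp (- x) / (1 + exp (- x)) / (1 - exp (- x))"])
    show "((\<lambda>x::real. exp (- x) / (1 + exp (- x)) / (1 - exp (- x)) - (1 / 2) / x) \<longlongrightarrow> 0) (at_right 0)" by real_asymp
    show "(\<lambda>u. exp (- u) / (1 + exp (- u) ^ 1)) holomorphic_on ball 0 (1 / 4)"
      by (intro holomorphic_intros one_plus_exp_small_neq_0) auto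
  qed (auto simp: exp_of_real[symmetric])
  moreover have e: "v / (1 + v ^ 1) / (1 - v) = v / (1 - v\<^sup>2)" for v :: complex
  proof -
    have "(1 + v ^ 1) * (1 - v) = 1 - v\<^sup>2" by (simp add: power2_eq_square algebra_simps)
    then show ?thesis by (simp only: divide_divide_eq_left)
  qed
  ultimately show ?thesis unfolding e by simp
qed

lemma pole_expansion_T3:
  "pole_expansion (\<lambda>u. exp (- u) ^ 3 / ((1 - exp (- u)) * (1 + exp (- u))\<^sup>2)) (1 / 4) (- 3 / 8)"
proof -
  have "pole_expansion (\<lambda>u. (\<lambda>v. v ^ 3 / (1 + v ^ 1)\<^sup>2) (exp (- u)) / (1 - exp (- u))) (of_real (1 / 4)) (of_real (- 3 / 8))"
  proof (rule pole_expansion_holomorphic[where \<rho> = "1/4" and f = "\<lambda>x. exp (- x) ^ 3 / (1 + exp (- x))\<^sup>2 / (1 - exp (- x))"])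
    show "((\<lambda>x::real. exp (- x) ^ 3 / (1 + exp (- x))\<^sup>2 / (1 - exp (- x)) - (1 / 4) / x) \<longlongrightarrow> - 3 / 8) (at_right 0)" by real_asymp
    show "(\<lambda>u. exp (- u) ^ 3 / (1 + exp (- u) ^ 1)\<^sup>2) holomorphic_on ball 0 (1 / 4)"
      using one_plus_exp_small_neq_0[of _ 1] by (intro holomorphic_intros) auto
  qed (auto simp: exp_of_real[symmetric])
  then show ?thesis by (simp add: mult_ac)
qed

lemma pole_expansion_T5:
  "pole_expansion (\<lambda>u. exp (- u) ^ 6 * (1 + 2 * (exp (- u))\<^sup>2 + exp (- u) ^ 3) /
     ((1 - exp (- u)) * (1 + exp (- u)) ^ 3 * (1 + (exp (- u))\<^sup>2) * (1 + exp (- u) ^ 3))) (1 / 8) (- 13 / 32)"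
proof -
  define h where "h = (\<lambda>v::complex. v ^ 6 * (1 + 2 * v\<^sup>2 + v ^ 3) / ((1 + v ^ 1) ^ 3 * (1 + v ^ 2) * (1 + v ^ 3)))"
  have "pole_expansion (\<lambda>u. h (exp (- u)) / (1 - exp (- u))) (of_real (1 / 8)) (of_real (- 13 / 32))"
  proof (rule pole_expansion_holomorphic[where \<rho> = "1/4" and
      f = "\<lambda>x. exp (- x) ^ 6 * (1 + 2 * (exp (- x))\<^sup>2 + exp (- x) ^ 3) / ((1 + exp (- x)) ^ 3 * (1 + exp (- x) ^ 2) * (1 + exp (- x) ^ 3)) / (1 - exp (- x))"])
    show "((\<lambda>x::real. exp (- x) ^ 6 * (1 + 2 * (exp (- x))\<^sup>2 + exp (- x) ^ 3) / ((1 + exp (- x)) ^ 3 * (1 + exp (- x) ^ 2) * (1 + exp (- x) ^ 3)) / (1 - exp (- x))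
       - (1 / 8) / x) \<longlongrightarrow> - 13 / 32) (at_right 0)" by real_asymp
    show "(\<lambda>u. h (exp (- u))) holomorphic_on ball 0 (1 / 4)"
      unfolding h_def using one_plus_exp_small_neq_0[of _ 1] one_plus_exp_small_neq_0[of _ 2] one_plus_exp_small_neq_0[of _ 3]
      by (intro holomorphic_intros) auto
  qed (auto simp: exp_of_real[symmetric] h_def)
  then show ?thesis by (simp add: h_def mult_ac)
qed

lemma exp_power_eq: "exp (- z) ^ m = exp (- (of_real (real m) * (z :: complex)))"
  by (simp add: exp_of_nat_mult[symmetric])

text \<open>Each summand is an elementary function at t z or at (t div 2) z. Scaling divides its
  residue by t or t div 2 and leaves its constant unchanged. The residues add up to 1/2 for every t,
  and the constants produce the dependence on t and its parity.\<close>

lemma pole_expansion_hook_mean: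
  assumes t: "t > 0"
  shows "pole_expansion (\<lambda>z. hook_mean t (exp (- z))) (1 / 2)
    (- of_nat t / 4 + 1 / 4 - (if even t then 1 / 8 else 0))"
proof -
  have rt: "real t > 0" using t by simp
  note 1 = pole_expansion_cmult[OF pole_expansion_scale[OF pole_expansion_T1 rt], of "of_nat ((t - 1) div 2)"]
  note 12 = pole_expansion_add[OF 1 pole_expansion_scale[OF pole_expansion_T2 rt]]
  show ?thesis
  proof (cases "even t")
    case True
    then obtain m where m: "t = 2 * m" "m > 0" using t by (auto elim!: evenE)
    then have rm: "real (t div 2) > 0" by simp
    have e: "(t - 1) div 2 = m - 1" "t div 2 = m" using m by auto
    have d: "complex_of_nat (m - 1) = of_nat m - 1" using m by (simp add: of_nat_diff)
    note E = pole_expansion_add[OF 12 pole_expansion_scale[OF pole_expansion_T3 rm]]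
    have "of_nat ((t - 1) div 2) * (1 / of_real (real t)) + 1 / 2 / of_real (real t) + 1 / 4 / of_real (real (t div 2)) = (1 / 2 :: complex)"
      unfolding e d using m by (simp add: field_simps)
    moreover have "of_nat ((t - 1) div 2) * (- 1 / 2) + 0 + - 3 / 8 = (- of_nat t / 4 + 1 / 4 - (if even t then 1 / 8 else 0) :: complex)"
      using True unfolding e d by (simp add: m(1) field_simps)
    ultimately show ?thesis using E True unfolding hook_mean_def exp_power_eq by (simp only: if_True)
  next
    case False
    then obtain m where m: "t = 2 * m + 1" by (auto elim!: oddE)
    have e: "(t - 1) div 2 = m" using m by simp
    have "of_nat ((t - 1) div 2) * (1 / of_real (real t)) + 1 / 2 / of_real (real t) = (1 / 2 :: complex)"
    proof -
      define T where "T = complex_of_real (real t)"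
      have "T \<noteq> 0" using t by (simp add: T_def)
      moreover have "of_nat m = (T - 1) / 2" by (simp add: T_def m)
      ultimately have T: "T \<noteq> 0" "of_nat m = (T - 1) / 2" by auto
      show ?thesis unfolding e T_def[symmetric] T(2) using T(1) by (simp add: field_simps)
    qed
    moreover have "of_nat ((t - 1) div 2) * (- 1 / 2) + 0 = (- of_nat t / 4 + 1 / 4 - (if even t then 1 / 8 else 0) :: complex)"
      using False unfolding e by (simp add: m field_simps)
    ultimately show ?thesis using 12 False unfolding hook_mean_def exp_power_eq by (simp only: if_False add_0_right)
  qed
qed

text \<open>With first moment A and second factorial moment A^2 - C, the difference A - C is the
  variance of the bar count at fixed q. The constants of A and C have the same part linear in t, so
  only the parity of t survives; 1/32 is 5/32 - 1/8.\<close>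

lemma pole_expansion_hook_mean_minus_corr:
  assumes t: "t > 0"
  shows "pole_expansion (\<lambda>z. hook_mean t (exp (- z)) - hook_corr t (exp (- z))) (1 / 4) (if even t then 1 / 32 else 0)"
proof -
  have rt: "real t > 0" "real (t * 2) > 0" using t by simp_all
  have q2: "exp (- z) ^ (t * 2) = (exp (- z) ^ t)\<^sup>2" for z :: complex by (simp add: power_mult)
  have q4: "((exp (- z) ^ t)\<^sup>2)\<^sup>2 = (exp (- z) ^ t) ^ 4" for z :: complex by (simp add: power_mult[symmetric] mult.commute)
  have M: "pole_expansion (\<lambda>z. hook_mean t (exp (- z))) (1 / 2) (- of_nat t / 4 + 1 / 4 - (if even t then 1 / 8 else 0))"
    by (rule pole_expansion_hook_mean[OF t])
  note 1 = pole_expansion_cmult[OF pole_expansion_scale[OF pole_expansion_T1 rt(2)], of "of_nat ((t - 1) div 2)"]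
  note 12 = pole_expansion_add[OF 1 pole_expansion_scale[OF pole_expansion_T2 rt(2)]]
  have C: "pole_expansion (\<lambda>z. hook_corr t (exp (- z))) (1 / 4) (- of_nat t / 4 + 1 / 4 - (if even t then 5 / 32 else 0))"
  proof (cases "even t")
    case True
    then obtain m where m: "t = 2 * m" "m > 0" using t by (auto elim!: evenE)
    then have rm: "real (t div 2) > 0" by simp
    have e: "(t - 1) div 2 = m - 1" "t div 2 = m" using m by auto
    have d: "complex_of_nat (m - 1) = of_nat m - 1" using m by (simp add: of_nat_diff)
    note E = pole_expansion_add[OF 12 pole_expansion_scale[OF pole_expansion_T5 rm]]
    have "of_nat ((t - 1) div 2) * (1 / of_real (real (t * 2))) + 1 / 2 / of_real (real (t * 2)) + 1 / 8 / of_real (real (t div 2)) = (1 / 4 :: complex)"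
      unfolding e d using m by (simp add: field_simps)
    moreover have "of_nat ((t - 1) div 2) * (- 1 / 2) + 0 + - 13 / 32 = (- of_nat t / 4 + 1 / 4 - (if even t then 5 / 32 else 0) :: complex)"
      using True unfolding e d by (simp add: m(1) field_simps)
    ultimately show ?thesis using E True unfolding hook_corr_def exp_power_eq[symmetric] q2 q4 by (simp only: if_True)
  next
    case False
    then obtain m where m: "t = 2 * m + 1" by (auto elim!: oddE)
    have e: "(t - 1) div 2 = m" using m by simp
    have "of_nat ((t - 1) div 2) * (1 / of_real (real (t * 2))) + 1 / 2 / of_real (real (t * 2)) = (1 / 4 :: complex)"
    proof -
      define T where "T = complex_of_real (real t)"
      have "T \<noteq> 0" using t by (simp add: T_def)
      moreover have "of_nat m = (T - 1) / 2" by (simp add: T_def m)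
      moreover have "complex_of_real (real (t * 2)) = 2 * T" by (simp add: T_def)
      ultimately have T: "T \<noteq> 0" "of_nat m = (T - 1) / 2" "complex_of_real (real (t * 2)) = 2 * T" by auto
      show ?thesis unfolding e T(2,3) using T(1) by (simp add: field_simps)
    qed
    moreover have "of_nat ((t - 1) div 2) * (- 1 / 2) + 0 = (- of_nat t / 4 + 1 / 4 - (if even t then 5 / 32 else 0) :: complex)"
      using False unfolding e by (simp add: m field_simps)
    ultimately show ?thesis using 12 False unfolding hook_corr_def exp_power_eq[symmetric] q2 q4 by (simp only: if_False add_0_right)
  qed
  have eq: "1 / 2 + - 1 * (1 / 4) = (1 / 4 :: complex)"
    "(- of_nat t / 4 + 1 / 4 - (if even t then 1 / 8 else 0)) + - 1 * (- of_nat t / 4 + 1 / 4 - (if even t then 5 / 32 else 0))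
      = (if even t then 1 / 32 else 0 :: complex)"
    by (simp_all add: field_simps)
  have "pole_expansion (\<lambda>z. hook_mean t (exp (- z)) + - 1 * hook_corr t (exp (- z))) (1 / 4) (if even t then 1 / 32 else 0)"
    using pole_expansion_add[OF M pole_expansion_cmult[OF C, of "- 1"]] unfolding eq .
  then show ?thesis by simp
qed

text \<open>A crude bound on the whole circle, where the poles at other roots of unity are also
  felt. A power of 1 / (1 - |q|) is harmless against the exponential decay of P on the minor
  arcs.\<close>

lemma norm_hook_mean_corr_le:
  assumes t: "t > 0" and q: "cmod q < 1"
  shows "cmod (hook_mean t q) \<le> (real t + 6) / (1 - cmod q) ^ 6"
    and "cmod (hook_corr t q) \<le> (real t + 6) / (1 - cmod q) ^ 6"
proof -
  define r where "r = 1 - cmod q"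
  have r: "0 < r" "r \<le> 1" using q by (auto simp: r_def)
  have pw: "cmod (q ^ m) \<le> 1" "r \<le> cmod (1 - q ^ m)" "r \<le> cmod (1 + q ^ m)" if "m > 0" for m
  proof -
    have "cmod q ^ m \<le> cmod q ^ 1" using q that by (intro power_decreasing) auto
    then have le: "cmod (q ^ m) \<le> 1 - r" by (simp add: norm_power r_def)
    then show "cmod (q ^ m) \<le> 1" using r by simp
    show "r \<le> cmod (1 - q ^ m)" using norm_triangle_ineq2[of 1 "q ^ m"] le by simp
    show "r \<le> cmod (1 + q ^ m)" using norm_diff_ineq[of 1 "q ^ m"] le by simp
  qed
  have rp: "1 / r ^ k \<le> 1 / r ^ 6" if "k \<le> 6" for k
    using r that by (intro divide_left_mono power_decreasing) auto
  have bound: "cmod (u / v) \<le> c / r ^ 6" if "cmod u \<le> c" "r ^ k \<le> cmod v" "k \<le> 6" for u v c k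
  proof -
    have c0: "0 \<le> c" using that(1) norm_ge_zero[of u] by linarith
    have "cmod (u / v) \<le> c / r ^ k" unfolding norm_divide using that r c0 by (intro frac_le) auto
    also have "... = c * (1 / r ^ k)" by simp
    also have "... \<le> c * (1 / r ^ 6)" using rp[OF that(3)] c0 by (intro mult_left_mono)
    finally show ?thesis by simp
  qed
  have t2: "q ^ (t * 2) = (q ^ t)\<^sup>2" "q ^ (t * 4) = (q ^ t) ^ 4" by (simp_all add: power_mult)
  let ?m = "(t - 1) div 2" and ?y = "q ^ (t div 2)"
  have mt: "real ?m \<le> real t" by simp
  have A1: "cmod (of_nat ?m * (q ^ t / (1 - q ^ t))) \<le> real t * (1 / r ^ 6)"
    unfolding norm_mult norm_of_nat using mt r bound[of "q ^ t" 1 1 "1 - q ^ t"] pw[of t] t by (intro mult_mono) auto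
  have A2: "cmod (q ^ t / (1 - (q ^ t)\<^sup>2)) \<le> 1 / r ^ 6"
    using bound[of "q ^ t" 1 1 "1 - q ^ (t * 2)"] pw(1)[of t] pw(2)[of "t * 2"] t by (simp add: t2)
  have C1: "cmod (of_nat ?m * ((q ^ t)\<^sup>2 / (1 - (q ^ t)\<^sup>2))) \<le> real t * (1 / r ^ 6)"
    unfolding norm_mult norm_of_nat using mt r bound[of "q ^ (t * 2)" 1 1 "1 - q ^ (t * 2)"] pw[of "t * 2"] t
    by (intro mult_mono) (auto simp: t2)
  have C2: "cmod ((q ^ t)\<^sup>2 / (1 - (q ^ t) ^ 4)) \<le> 1 / r ^ 6"
    using bound[of "q ^ (t * 2)" 1 1 "1 - q ^ (t * 4)"] pw(1)[of "t * 2"] pw(2)[of "t * 4"] t by (simp add: t2)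
  have A3: "cmod (if even t then ?y ^ 3 / ((1 - ?y) * (1 + ?y)\<^sup>2) else 0) \<le> 1 / r ^ 6"
  proof (cases "even t")
    case True
    then have h: "t div 2 > 0" using t by auto
    have "r ^ 3 \<le> cmod ((1 - ?y) * (1 + ?y)\<^sup>2)"
    proof -
      have "r * r ^ 2 \<le> cmod (1 - ?y) * cmod (1 + ?y) ^ 2"
        using pw[OF h] r by (intro mult_mono power_mono) auto
      then show ?thesis by (simp add: norm_mult norm_power power2_eq_square power3_eq_cube)
    qed
    then have "cmod (?y ^ 3 / ((1 - ?y) * (1 + ?y)\<^sup>2)) \<le> 1 / r ^ 6"
      by (intro bound[of _ _ 3]) (use pw(1)[OF h] in \<open>auto simp: norm_power power_le_one\<close>)
    then show ?thesis using True by simp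
  qed (use r in auto)
  have C3: "cmod (if even t then ?y ^ 6 * (1 + 2 * ?y\<^sup>2 + ?y ^ 3) / ((1 - ?y) * (1 + ?y) ^ 3 * (1 + ?y\<^sup>2) * (1 + ?y ^ 3)) else 0) \<le> 4 / r ^ 6"
  proof (cases "even t")
    case True
    then have h: "t div 2 > 0" using t by auto
    have y: "cmod ?y \<le> 1" "?y\<^sup>2 = q ^ (t div 2 * 2)" "?y ^ 3 = q ^ (t div 2 * 3)" using pw(1)[OF h] by (simp_all add: power_mult)
    have den: "r ^ 6 \<le> cmod ((1 - ?y) * (1 + ?y) ^ 3 * (1 + ?y\<^sup>2) * (1 + ?y ^ 3))"
    proof -
      have "r * r ^ 3 * r * r \<le> cmod (1 - ?y) * cmod (1 + ?y) ^ 3 * cmod (1 + ?y\<^sup>2) * cmod (1 + ?y ^ 3)"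
        using pw(2,3)[OF h] pw(3)[of "t div 2 * 2"] pw(3)[of "t div 2 * 3"] r h y(2,3)
        by (intro mult_mono power_mono mult_nonneg_nonneg) auto
      then show ?thesis by (simp add: norm_mult norm_power eval_nat_numeral mult_ac)
    qed
    have num: "cmod (?y ^ 6 * (1 + 2 * ?y\<^sup>2 + ?y ^ 3)) \<le> 4"
    proof -
      have "cmod (1 + 2 * ?y\<^sup>2 + ?y ^ 3) \<le> cmod 1 + cmod (2 * ?y\<^sup>2) + cmod (?y ^ 3)"
        by (meson norm_triangle_ineq add_right_mono order.trans)
      also have "... \<le> 1 + 2 * 1 + 1"
        using y(1) by (intro add_mono) (auto simp: norm_mult norm_power power_le_one)
      finally have "cmod (1 + 2 * ?y\<^sup>2 + ?y ^ 3) \<le> 4" by simp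
      moreover have "cmod (?y ^ 6) \<le> 1" using y(1) by (auto simp: norm_power power_le_one)
      ultimately have "cmod (?y ^ 6) * cmod (1 + 2 * ?y\<^sup>2 + ?y ^ 3) \<le> 1 * 4" by (intro mult_mono) auto
      then show ?thesis by (simp only: norm_mult)
    qed
    show ?thesis using bound[OF num den] True by simp
  qed (use r in auto)
  have tri: "cmod (u + v + w) \<le> cmod u + cmod v + cmod w" for u v w
    by (meson norm_triangle_ineq add_right_mono order.trans)
  have r6: "1 / r ^ 6 \<ge> 0" using r by simp
  have "cmod (hook_mean t q) \<le> real t * (1 / r ^ 6) + 1 / r ^ 6 + 1 / r ^ 6"
    unfolding hook_mean_def using tri A1 A2 A3 by (meson add_mono order.trans)
  also have "... = (real t + 2) / r ^ 6" by (simp add: add_divide_distrib)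
  also have "... \<le> (real t + 6) / r ^ 6" using r by (intro divide_right_mono) auto
  finally show "cmod (hook_mean t q) \<le> (real t + 6) / (1 - cmod q) ^ 6" by (simp add: r_def)
  have "cmod (hook_corr t q) \<le> real t * (1 / r ^ 6) + 1 / r ^ 6 + 4 / r ^ 6"
    unfolding hook_corr_def using tri C1 C2 C3 by (meson add_mono order.trans)
  also have "... = (real t + 5) / r ^ 6" by (simp add: add_divide_distrib)
  also have "... \<le> (real t + 6) / r ^ 6" using r by (intro divide_right_mono) auto
  finally show "cmod (hook_corr t q) \<le> (real t + 6) / (1 - cmod q) ^ 6" by (simp add: r_def)
qed

section \<open>The saddle point kernel\<close>

text \<open>For z = \<eta> (1 + i s) one has 1/z = (1 + b)/\<eta>, so the pole parts of A and of A -
  C are linear in b. The derivative of b and the logarithmic derivative of \<open>kernel\<close> are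
  polynomials in b as well, which closes the recursion for the moments.\<close>

definition kern_b :: "real \<Rightarrow> complex" where
  "kern_b s = 1 / (1 + \<i> * of_real s) - 1"

definition kernel :: "real \<Rightarrow> real \<Rightarrow> complex" where
  "kernel \<nu> s = exp (- of_real \<nu> * (of_real s)\<^sup>2 / (1 + \<i> * of_real s))"

definition kmom :: "real \<Rightarrow> nat \<Rightarrow> complex" where
  "kmom \<nu> m = integral {-1..1} (\<lambda>s. kernel \<nu> s * kern_b s ^ m)"

lemma one_plus_is_neq_0 [simp]: "1 + \<i> * complex_of_real s \<noteq> 0"
  by (simp add: complex_eq_iff)

lemma norm_one_plus_is_ge: "1 \<le> cmod (1 + \<i> * complex_of_real s)"
  using complex_Re_le_cmod[of "1 + \<i> * complex_of_real s"] by simp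

lemma continuous_on_kernel [continuous_intros]: "continuous_on A (kernel \<nu>)"
  unfolding kernel_def[abs_def] by (intro continuous_intros) auto

lemma continuous_on_kern_b [continuous_intros]: "continuous_on A kern_b"
  unfolding kern_b_def[abs_def] by (intro continuous_intros) auto

lemma norm_kernel_le:
  assumes "\<nu> \<ge> 0" "\<bar>s\<bar> \<le> 1"
  shows "cmod (kernel \<nu> s) \<le> exp (- (\<nu> * s\<^sup>2) / 2)"
proof -
  have "1 / (1 + \<i> * complex_of_real s) = Complex (1 / (1 + s\<^sup>2)) (- s / (1 + s\<^sup>2))"
    by (simp add: complex_eq_iff Re_divide Im_divide power2_eq_square)
  then have "Re (- of_real \<nu> * (of_real s)\<^sup>2 * (1 / (1 + \<i> * of_real s))) = - (\<nu> * s\<^sup>2) / (1 + s\<^sup>2)"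
    by (simp add: power2_eq_square)
  then have "cmod (kernel \<nu> s) = exp (- (\<nu> * s\<^sup>2) / (1 + s\<^sup>2))" by (simp add: kernel_def)
  also have "... \<le> exp (- (\<nu> * s\<^sup>2) / 2)"
  proof -
    have "s\<^sup>2 \<le> 1" using assms(2) by (simp add: abs_square_le_1)
    then have "(\<nu> * s\<^sup>2) / 2 \<le> (\<nu> * s\<^sup>2) / (1 + s\<^sup>2)" using assms(1)
      by (intro divide_left_mono mult_pos_pos) (auto intro: add_pos_nonneg)
    then show ?thesis by simp
  qed
  finally show ?thesis .
qed

lemma norm_kern_b_le: "cmod (kern_b s) \<le> \<bar>s\<bar>"
proof -
  have "kern_b s = - \<i> * of_real s / (1 + \<i> * of_real s)" by (simp add: kern_b_def field_simps)
  then have "cmod (kern_b s) = \<bar>s\<bar> / cmod (1 + \<i> * of_real s)" by (simp add: norm_divide norm_mult)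
  also have "... \<le> \<bar>s\<bar> / 1" by (intro divide_left_mono norm_one_plus_is_ge) (use norm_one_plus_is_ge[of s] in auto)
  finally show ?thesis by simp
qed

lemma power_le_fact_exp:
  fixes y :: real
  assumes "y \<ge> 0"
  shows "y ^ k \<le> fact k * exp y"
proof -
  have "(\<lambda>n. y ^ n / fact n) sums exp y" using exp_converges[of y] by (simp add: divide_inverse mult.commute)
  then have "sum (\<lambda>n. y ^ n / fact n) {k} \<le> exp y"
    using assms sum_le_suminf[of "\<lambda>n. y ^ n / fact n" "{k}"] by (auto simp: sums_iff)
  then show ?thesis by (simp add: field_simps)
qed

text \<open>Powers times a Gaussian are traded for 1 / (1 + x^2), whose integral is an arctangent;
  the value of the constant is immaterial.\<close>

lemma power_gauss_le:
  fixes x :: real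
  assumes "x \<ge> 0"
  shows "x ^ m * exp (- x\<^sup>2 / 2) \<le> (2 * 2 ^ (m + 2) * fact (m + 2)) / (1 + x\<^sup>2)"
proof -
  let ?C = "2 * 2 ^ (m + 2) * fact (m + 2) :: real"
  have "x ^ m * (1 + x\<^sup>2) \<le> ?C * exp (x\<^sup>2 / 2)"
  proof (cases "x \<le> 1")
    case True
    have "x ^ m * (1 + x\<^sup>2) \<le> 1 * (1 + 1)" using assms True by (intro mult_mono add_mono power_le_one) auto
    also have "... \<le> ?C * 1"
    proof -
      have "(1::real) \<le> 2 ^ (m + 2)" "(1::real) \<le> fact (m + 2)" by (rule one_le_power, simp, rule fact_ge_1)
      then have "1 * 1 \<le> 2 ^ (m + 2) * (fact (m + 2) :: real)" by (intro mult_mono) auto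
      then have "2 * (1 * 1) \<le> 2 * (2 ^ (m + 2) * (fact (m + 2) :: real))" by (rule mult_left_mono) simp
      then show ?thesis by (simp only: mult_1 mult_1_right one_add_one mult.assoc)
    qed
    also have "... \<le> ?C * exp (x\<^sup>2 / 2)" by (intro mult_left_mono) auto
    finally show ?thesis .
  next
    case False
    then have x: "1 \<le> x" by simp
    have "1 + x\<^sup>2 \<le> 2 * x\<^sup>2" using one_le_power[OF x, of 2] by simp
    then have "x ^ m * (1 + x\<^sup>2) \<le> x ^ m * (2 * x\<^sup>2)" using x by (intro mult_left_mono) auto
    also have "... = 2 * x ^ (m + 2)" by (simp add: power_add power2_eq_square)
    also have "... \<le> 2 * x ^ (2 * (m + 2))" using x by (intro mult_left_mono power_increasing) auto
    also have "... = 2 * 2 ^ (m + 2) * (x\<^sup>2 / 2) ^ (m + 2)"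
      unfolding power_mult power_divide by simp
    also have "... \<le> 2 * 2 ^ (m + 2) * (fact (m + 2) * exp (x\<^sup>2 / 2))"
      by (intro mult_left_mono power_le_fact_exp) auto
    finally show ?thesis by simp
  qed
  then have "x ^ m * (1 + x\<^sup>2) * exp (- x\<^sup>2 / 2) \<le> ?C * exp (x\<^sup>2 / 2) * exp (- x\<^sup>2 / 2)" by (intro mult_right_mono) auto
  also have "... = ?C" by (simp add: exp_add[symmetric])
  finally have "x ^ m * exp (- x\<^sup>2 / 2) * (1 + x\<^sup>2) \<le> ?C" by (simp only: mult_ac)
  moreover have "0 < 1 + x\<^sup>2" by (simp add: add_pos_nonneg)
  ultimately show ?thesis by (simp add: pos_le_divide_eq)
qed

lemma integral_inverse_one_plus_square_le:
  assumes "\<nu> > 0"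
  shows "(\<lambda>s. 1 / (1 + \<nu> * s\<^sup>2)) integrable_on {-1..1::real}"
    and "integral {-1..1} (\<lambda>s. 1 / (1 + \<nu> * s\<^sup>2)) \<le> pi / sqrt \<nu>"
proof -
  have "((\<lambda>s. 1 / (1 + \<nu> * s\<^sup>2)) has_integral (arctan (sqrt \<nu> * 1) / sqrt \<nu> - arctan (sqrt \<nu> * (- 1)) / sqrt \<nu>)) {-1..1}"
  proof (rule fundamental_theorem_of_calculus)
    fix x :: real
    have "((\<lambda>s. arctan (sqrt \<nu> * s) / sqrt \<nu>) has_real_derivative inverse (1 + (sqrt \<nu> * x)\<^sup>2) * sqrt \<nu> / sqrt \<nu>) (at x)"
    proof (rule DERIV_cdivide[OF DERIV_chain2[OF DERIV_arctan]])
      show "((\<lambda>s. sqrt \<nu> * s) has_real_derivative sqrt \<nu>) (at x)" by (auto intro!: derivative_eq_intros)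
    qed
    then have "((\<lambda>s. arctan (sqrt \<nu> * s) / sqrt \<nu>) has_real_derivative 1 / (1 + \<nu> * x\<^sup>2)) (at x)"
      using assms by (simp add: power_mult_distrib inverse_eq_divide)
    then show "((\<lambda>s. arctan (sqrt \<nu> * s) / sqrt \<nu>) has_vector_derivative 1 / (1 + \<nu> * x\<^sup>2)) (at x within {-1..1})"
      by (simp add: has_real_derivative_iff_has_vector_derivative has_vector_derivative_at_within)
  qed simp
  then have h: "((\<lambda>s. 1 / (1 + \<nu> * s\<^sup>2)) has_integral (2 * arctan (sqrt \<nu>) / sqrt \<nu>)) {-1..1}"
    by (simp add: arctan_minus)
  then show "(\<lambda>s. 1 / (1 + \<nu> * s\<^sup>2)) integrable_on {-1..1::real}" by blast
  have "2 * arctan (sqrt \<nu>) \<le> pi" using arctan_ubound[of "sqrt \<nu>"] by simp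
  then show "integral {-1..1} (\<lambda>s. 1 / (1 + \<nu> * s\<^sup>2)) \<le> pi / sqrt \<nu>"
    using integral_unique[OF h] assms by (simp add: divide_right_mono)
qed

definition kmom_const :: "nat \<Rightarrow> real" where
  "kmom_const m = 2 * 2 ^ (m + 2) * fact (m + 2) * pi"

text \<open>Under the kernel s lives on the scale 1 / sqrt \<nu>, so both terms bounding
  \<open>F\<close> count as \<nu>^(-m/2). The width of the peak contributes one more factor 1 / sqrt
  \<nu>.\<close>

lemma norm_integral_kernel_le:
  fixes F :: "real \<Rightarrow> complex"
  assumes \<nu>: "\<nu> > 0" and F: "continuous_on {-1..1} F"
    and le: "\<And>s. s \<in> {-1..1} \<Longrightarrow> cmod (F s) \<le> c * \<bar>s\<bar> ^ m + d / sqrt \<nu> ^ m"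
    and c: "c \<ge> 0" "d \<ge> 0"
  shows "cmod (integral {-1..1} (\<lambda>s. kernel \<nu> s * F s)) \<le> (c * kmom_const m + d * kmom_const 0) / sqrt \<nu> ^ (m + 1)"
proof -
  define C where "C m = 2 * 2 ^ (m + 2) * (fact (m + 2) :: real)" for m :: nat
  define D where "D = (c * C m + d * C 0) / sqrt \<nu> ^ m"
  note I = integral_inverse_one_plus_square_le[OF \<nu>]
  have gauss: "exp (- (\<nu> * s\<^sup>2) / 2) * \<bar>s\<bar> ^ j \<le> C j / sqrt \<nu> ^ j * (1 / (1 + \<nu> * s\<^sup>2))" for s j
  proof -
    have "exp (- (\<nu> * s\<^sup>2) / 2) * \<bar>s\<bar> ^ j = 1 / sqrt \<nu> ^ j * ((sqrt \<nu> * \<bar>s\<bar>) ^ j * exp (- (sqrt \<nu> * \<bar>s\<bar>)\<^sup>2 / 2))"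
      using \<nu> by (simp add: power_mult_distrib)
    also have "... \<le> 1 / sqrt \<nu> ^ j * (C j / (1 + (sqrt \<nu> * \<bar>s\<bar>)\<^sup>2))"
      unfolding C_def using \<nu> by (intro mult_left_mono power_gauss_le) auto
    finally show ?thesis using \<nu> by (simp add: power_mult_distrib)
  qed
  have "cmod (integral {-1..1} (\<lambda>s. kernel \<nu> s * F s)) \<le> integral {-1..1} (\<lambda>s. D * (1 / (1 + \<nu> * s\<^sup>2)))"
  proof (rule Henstock_Kurzweil_Integration.integral_norm_bound_integral)
    show "(\<lambda>s. kernel \<nu> s * F s) integrable_on {-1..1}"
      by (intro integrable_continuous_interval continuous_intros F)
    show "(\<lambda>s. D * (1 / (1 + \<nu> * s\<^sup>2))) integrable_on {-1..1}"
      by (intro integrable_on_mult_right I(1))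
    fix s :: real assume s: "s \<in> {-1..1}"
    have "cmod (kernel \<nu> s * F s) \<le> exp (- (\<nu> * s\<^sup>2) / 2) * (c * \<bar>s\<bar> ^ m + d / sqrt \<nu> ^ m)"
      unfolding norm_mult using norm_kernel_le[of \<nu> s] \<nu> s le[OF s] by (intro mult_mono) auto
    also have "... = c * (exp (- (\<nu> * s\<^sup>2) / 2) * \<bar>s\<bar> ^ m) + d / sqrt \<nu> ^ m * (exp (- (\<nu> * s\<^sup>2) / 2) * \<bar>s\<bar> ^ 0)"
      by (simp add: algebra_simps)
    also have "... \<le> c * (C m / sqrt \<nu> ^ m * (1 / (1 + \<nu> * s\<^sup>2))) + d / sqrt \<nu> ^ m * (C 0 / sqrt \<nu> ^ 0 * (1 / (1 + \<nu> * s\<^sup>2)))"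
      using \<nu> c by (intro add_mono mult_left_mono gauss) auto
    also have "... = D * (1 / (1 + \<nu> * s\<^sup>2))" by (simp add: D_def add_divide_distrib distrib_right)
    finally show "cmod (kernel \<nu> s * F s) \<le> D * (1 / (1 + \<nu> * s\<^sup>2))" .
  qed
  also have "... = D * integral {-1..1} (\<lambda>s. 1 / (1 + \<nu> * s\<^sup>2))" by (rule integral_mult_right)
  also have "... \<le> D * (pi / sqrt \<nu>)" using I(2) \<nu> c by (intro mult_left_mono) (auto simp: D_def C_def)
  also have "... = (c * kmom_const m + d * kmom_const 0) / sqrt \<nu> ^ (m + 1)"
  proof -
    have "kmom_const j = C j * pi" for j by (simp add: C_def kmom_const_def)
    then show ?thesis using \<nu> by (simp add: D_def field_simps)
  qed
  finally show ?thesis .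
qed

lemma norm_kmom_le:
  assumes "\<nu> > 0"
  shows "cmod (kmom \<nu> m) \<le> kmom_const m / sqrt \<nu> ^ (m + 1)"
  unfolding kmom_def using norm_integral_kernel_le[OF assms, of "\<lambda>s. kern_b s ^ m" 1 m 0]
  by (simp add: continuous_intros norm_power power_mono norm_kern_b_le)

text \<open>Integrates the derivative of the kernel times b^m, using b' = - i (1 + b)^2 and the
  logarithmic derivative - i \<nu> (b^2 + 2 b) of the kernel. The boundary terms at s = 1 and s = -1
  are exponentially small. For \<open>m = 0\<close> the truncated index \<open>m - 1\<close> meets
  the coefficient 0.\<close>

lemma kmom_recursion:
  assumes \<nu>: "\<nu> > 0"
  shows "cmod (of_real \<nu> * (kmom \<nu> (m + 2) + 2 * kmom \<nu> (m + 1))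
    + of_nat m * (kmom \<nu> (m - 1) + 2 * kmom \<nu> m + kmom \<nu> (m + 1))) \<le> 2 * exp (- \<nu> / 2)"
proof -
  let ?G = "\<lambda>s. kernel \<nu> s * kern_b s ^ m"
  let ?f = "\<lambda>k s. kernel \<nu> s * kern_b s ^ k"
  define G' where "G' s = - \<i> * (of_real \<nu> * (?f (m + 2) s + 2 * ?f (m + 1) s)
     + of_nat m * (?f (m - 1) s + 2 * ?f m s + ?f (m + 1) s))" for s
  have vd: "(?G has_vector_derivative G' s) (at s within {-1..1})" for s
  proof -
    let ?w = "complex_of_real s"
    have nz: "1 + \<i> * ?w \<noteq> 0" by simp
    have db: "((\<lambda>w. 1 / (1 + \<i> * w) - 1) has_field_derivative (- \<i> * (1 + kern_b s)\<^sup>2)) (at ?w)"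
      using nz by (auto intro!: derivative_eq_intros simp: kern_b_def power2_eq_square field_simps)
    have dK: "((\<lambda>w. exp (- of_real \<nu> * w\<^sup>2 / (1 + \<i> * w))) has_field_derivative
       (kernel \<nu> s * (- \<i> * of_real \<nu> * ((kern_b s)\<^sup>2 + 2 * kern_b s)))) (at ?w)"
    proof -
      have d: "((\<lambda>w. - of_real \<nu> * w\<^sup>2 / (1 + \<i> * w)) has_field_derivative
        ((- of_real \<nu> * (2 * ?w)) * (1 + \<i> * ?w) - (- of_real \<nu> * ?w\<^sup>2) * \<i>) / ((1 + \<i> * ?w) * (1 + \<i> * ?w))) (at ?w)"
        using nz by (auto intro!: derivative_eq_intros) (simp add: minus_divide_left mult_ac)
      have "((- of_real \<nu> * (2 * ?w)) * (1 + \<i> * ?w) - (- of_real \<nu> * ?w\<^sup>2) * \<i>) / ((1 + \<i> * ?w) * (1 + \<i> * ?w))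
         = - \<i> * of_real \<nu> * ((kern_b s)\<^sup>2 + 2 * kern_b s)"
      proof -
        have b: "(kern_b s)\<^sup>2 + 2 * kern_b s = 1 / ((1 + \<i> * ?w) * (1 + \<i> * ?w)) - 1"
          by (simp add: kern_b_def power2_eq_square algebra_simps)
        have "- \<i> * of_real \<nu> * (1 - (1 + \<i> * ?w) * (1 + \<i> * ?w)) = (- of_real \<nu> * (2 * ?w)) * (1 + \<i> * ?w) - (- of_real \<nu> * ?w\<^sup>2) * \<i>"
          by (simp add: power2_eq_square algebra_simps)
        moreover have "1 / ((1 + \<i> * ?w) * (1 + \<i> * ?w)) - 1 = (1 - (1 + \<i> * ?w) * (1 + \<i> * ?w)) / ((1 + \<i> * ?w) * (1 + \<i> * ?w))"
          using nz by (simp add: diff_divide_distrib)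
        ultimately show ?thesis unfolding b by simp
      qed
      then show ?thesis using DERIV_chain2[OF DERIV_exp d] by (simp add: kernel_def)
    qed
    have "((\<lambda>w. exp (- of_real \<nu> * w\<^sup>2 / (1 + \<i> * w)) * (1 / (1 + \<i> * w) - 1) ^ m) has_field_derivative G' s) (at ?w)"
    proof (rule DERIV_cong[OF DERIV_mult[OF dK DERIV_power[OF db]]])
      show "kernel \<nu> s * (- \<i> * of_real \<nu> * ((kern_b s)\<^sup>2 + 2 * kern_b s)) * (1 / (1 + \<i> * ?w) - 1) ^ m +
        of_nat m * (- \<i> * (1 + kern_b s)\<^sup>2 * (1 / (1 + \<i> * ?w) - 1) ^ (m - Suc 0)) * exp (- of_real \<nu> * ?w\<^sup>2 / (1 + \<i> * ?w)) = G' s"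
        unfolding kern_b_def[symmetric] kernel_def[symmetric] G'_def
        by (cases m) (simp_all add: power2_eq_square algebra_simps)
    qed
    then have "((\<lambda>x. exp (- of_real \<nu> * (of_real x)\<^sup>2 / (1 + \<i> * of_real x)) * (1 / (1 + \<i> * of_real x) - 1) ^ m)
       has_vector_derivative G' s) (at s within {-1..1})"
      by (rule has_vector_derivative_real_field)
    then show ?thesis by (simp add: kernel_def kern_b_def)
  qed
  have i: "(?f k has_integral kmom \<nu> k) {-1..1}" for k
    unfolding kmom_def by (intro integrable_integral integrable_continuous_interval continuous_intros)
  have "(G' has_integral (?G 1 - ?G (- 1))) {-1..1}" by (rule fundamental_theorem_of_calculus[OF _ vd]) simp
  moreover have "(G' has_integral (- \<i> * (of_real \<nu> * (kmom \<nu> (m + 2) + 2 * kmom \<nu> (m + 1))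
     + of_nat m * (kmom \<nu> (m - 1) + 2 * kmom \<nu> m + kmom \<nu> (m + 1))))) {-1..1}"
    unfolding G'_def by (intro has_integral_mult_right has_integral_add i)
  ultimately have "- \<i> * (of_real \<nu> * (kmom \<nu> (m + 2) + 2 * kmom \<nu> (m + 1))
     + of_nat m * (kmom \<nu> (m - 1) + 2 * kmom \<nu> m + kmom \<nu> (m + 1))) = ?G 1 - ?G (- 1)"
    by (rule has_integral_unique[symmetric])
  then have "cmod (of_real \<nu> * (kmom \<nu> (m + 2) + 2 * kmom \<nu> (m + 1))
     + of_nat m * (kmom \<nu> (m - 1) + 2 * kmom \<nu> m + kmom \<nu> (m + 1))) = cmod (?G 1 - ?G (- 1))"
    by (metis norm_mult norm_minus_cancel norm_ii mult_1)
  also have "... \<le> cmod (?G 1) + cmod (?G (- 1))" by (rule norm_triangle_ineq4)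
  also have "... \<le> exp (- \<nu> / 2) * 1 + exp (- \<nu> / 2) * 1"
    unfolding norm_mult norm_power
    using norm_kernel_le[of \<nu> 1] norm_kernel_le[of \<nu> "- 1"] norm_kern_b_le[of 1] norm_kern_b_le[of "- 1"] \<nu>
    by (intro add_mono mult_mono power_le_one) auto
  finally show ?thesis by simp
qed

section \<open>Laplace's method for the kernel\<close>

lemma integrable_inverse_one_plus_square_UNIV: "(\<lambda>v::real. 1 / (1 + v\<^sup>2)) integrable_on UNIV"
proof -
  have "set_integrable lborel UNIV (\<lambda>x::real. inverse (1 + x\<^sup>2))"
    using integrable_inverse_1_plus_square by (simp add: einterval_def)
  then show ?thesis using set_borel_integral_eq_integral(1) by (simp add: inverse_eq_divide)
qed

lemma exp_gauss_linear_le: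
  fixes v c :: real
  shows "exp (- v\<^sup>2 / 2 + c * \<bar>v\<bar>) \<le> 4 * exp (c\<^sup>2) / (1 + v\<^sup>2)"
proof -
  have "0 \<le> (c - \<bar>v\<bar> / 2)\<^sup>2" by simp
  then have "c * \<bar>v\<bar> \<le> c\<^sup>2 + v\<^sup>2 / 4" by (simp add: power2_eq_square algebra_simps)
  then have "exp (- v\<^sup>2 / 2 + c * \<bar>v\<bar>) \<le> exp (c\<^sup>2 + - (v\<^sup>2 / 4))" by simp
  also have "... = exp (c\<^sup>2) * exp (- (v\<^sup>2 / 4))" by (rule exp_add)
  also have "exp (- (v\<^sup>2 / 4)) \<le> 4 / (1 + v\<^sup>2)"
  proof -
    have "1 + v\<^sup>2 \<le> 4 * (1 + v\<^sup>2 / 4)" by simp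
    also have "... \<le> 4 * exp (v\<^sup>2 / 4)" by (intro mult_left_mono exp_ge_add_one_self) simp
    finally have "(1 + v\<^sup>2) * exp (- (v\<^sup>2 / 4)) \<le> 4 * exp (v\<^sup>2 / 4) * exp (- (v\<^sup>2 / 4))" by (rule mult_right_mono) simp
    then have "exp (- (v\<^sup>2 / 4)) * (1 + v\<^sup>2) \<le> 4" by (simp add: exp_minus field_simps)
    moreover have "0 < 1 + v\<^sup>2" by (simp add: add_pos_nonneg)
    ultimately show ?thesis by (simp add: pos_le_divide_eq)
  qed
  finally show ?thesis by (simp add: mult.commute mult_left_mono)
qed

lemma laplace_limit_all:
  fixes \<nu> :: "nat \<Rightarrow> real" and F :: "nat \<Rightarrow> real \<Rightarrow> complex"
  assumes \<nu>: "filterlim \<nu> at_top sequentially" "\<And>n. \<nu> n > 0" and cont: "\<And>n. continuous_on {-1..1} (F n)"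
    and bound: "\<And>n s. s \<in> {-1..1} \<Longrightarrow> cmod (F n s) \<le> M * exp (c * (sqrt (\<nu> n) * \<bar>s\<bar>))" and M: "M \<ge> 0"
    and lim: "\<And>v. (\<lambda>n. F n (v / sqrt (\<nu> n))) \<longlonglongrightarrow> G v"
  shows "(\<lambda>n. of_real (sqrt (\<nu> n)) * integral {-1..1} (\<lambda>s. kernel (\<nu> n) s * F n s))
    \<longlonglongrightarrow> integral UNIV (\<lambda>v. of_real (exp (- v\<^sup>2)) * G v)"
proof -
  define I where "I n = {- sqrt (\<nu> n)..sqrt (\<nu> n)}" for n
  define f where "f n v = (if v \<in> I n then kernel (\<nu> n) (v / sqrt (\<nu> n)) * F n (v / sqrt (\<nu> n)) else 0)" for n v
  have sq: "sqrt (\<nu> n) > 0" for n using \<nu>(2) by simp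
  have scale: "(f n has_integral (of_real (sqrt (\<nu> n)) * integral {-1..1} (\<lambda>s. kernel (\<nu> n) s * F n s))) UNIV" for n
  proof -
    have "((\<lambda>s. kernel (\<nu> n) s * F n s) has_integral integral {-1..1} (\<lambda>s. kernel (\<nu> n) s * F n s)) {-1..1}"
      by (intro integrable_integral integrable_continuous_interval continuous_intros cont)
    from has_integral_stretch_real[OF this, of "1 / sqrt (\<nu> n)"] sq[of n]
    have "((\<lambda>v. kernel (\<nu> n) (v / sqrt (\<nu> n)) * F n (v / sqrt (\<nu> n))) has_integral
       (sqrt (\<nu> n) *\<^sub>R integral {-1..1} (\<lambda>s. kernel (\<nu> n) s * F n s))) ((\<lambda>x. x / (1 / sqrt (\<nu> n))) ` {-1..1})"
      by simp
    moreover have "(\<lambda>x. x / (1 / sqrt (\<nu> n))) ` {-1..1} = I n"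
      using sq[of n] image_mult_atLeastAtMost[of "sqrt (\<nu> n)" "-1" 1] by (simp add: I_def mult.commute)
    ultimately show ?thesis unfolding f_def by (simp add: has_integral_restrict_UNIV scaleR_conv_of_real)
  qed
  have fb: "cmod (f n v) \<le> M * (4 * exp (c\<^sup>2)) * (1 / (1 + v\<^sup>2))" for n v
  proof (cases "v \<in> I n")
    case True
    define s where "s = v / sqrt (\<nu> n)"
    have s: "s \<in> {-1..1}" "sqrt (\<nu> n) * \<bar>s\<bar> = \<bar>v\<bar>" "\<nu> n * s\<^sup>2 = v\<^sup>2"
      using True sq[of n] \<nu>(2)[of n] by (auto simp: s_def I_def field_simps power_divide abs_mult less_imp_le)
    have "cmod (f n v) \<le> exp (- v\<^sup>2 / 2) * (M * exp (c * \<bar>v\<bar>))"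
      using True norm_kernel_le[of "\<nu> n" s] bound[OF s(1), of n] s \<nu>(2)[of n]
      unfolding f_def s_def[symmetric] by (auto simp: norm_mult abs_le_iff intro!: mult_mono)
    also have "... = M * exp (- v\<^sup>2 / 2 + c * \<bar>v\<bar>)" unfolding exp_add by (simp only: mult_ac)
    also have "... \<le> M * (4 * exp (c\<^sup>2) / (1 + v\<^sup>2))" using M by (intro mult_left_mono exp_gauss_linear_le)
    finally show ?thesis by simp
  qed (use M in \<open>auto simp: f_def add_nonneg_nonneg\<close>)
  have fl: "(\<lambda>n. f n v) \<longlonglongrightarrow> of_real (exp (- v\<^sup>2)) * G v" for v
  proof (rule Lim_transform_eventually)
    have sinf: "filterlim (\<lambda>n. sqrt (\<nu> n)) at_top sequentially" by (rule filterlim_compose[OF sqrt_at_top \<nu>(1)])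
    have "(\<lambda>n. v / sqrt (\<nu> n)) \<longlonglongrightarrow> 0" by (rule real_tendsto_divide_at_top[OF tendsto_const sinf])
    then have "(\<lambda>n. exp (- (of_real v)\<^sup>2 / (1 + \<i> * of_real (v / sqrt (\<nu> n))))) \<longlonglongrightarrow> exp (- (of_real v)\<^sup>2 / (1 + \<i> * of_real 0))"
      by (intro tendsto_intros) auto
    moreover have "- of_real (\<nu> n) * (of_real (v / sqrt (\<nu> n)))\<^sup>2 = - (of_real v :: complex)\<^sup>2" for n
    proof -
      have "\<nu> n * (v / sqrt (\<nu> n))\<^sup>2 = v\<^sup>2" using \<nu>(2)[of n] by (simp add: power_divide)
      then have "complex_of_real (\<nu> n * (v / sqrt (\<nu> n))\<^sup>2) = of_real (v\<^sup>2)" by (rule arg_cong)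
      then show ?thesis by simp
    qed
    ultimately have "(\<lambda>n. kernel (\<nu> n) (v / sqrt (\<nu> n))) \<longlonglongrightarrow> exp (- (of_real v)\<^sup>2)" by (simp add: kernel_def)
    moreover have "exp (- (complex_of_real v)\<^sup>2) = of_real (exp (- v\<^sup>2))" by (simp add: exp_of_real[symmetric])
    ultimately show "(\<lambda>n. kernel (\<nu> n) (v / sqrt (\<nu> n)) * F n (v / sqrt (\<nu> n))) \<longlonglongrightarrow> of_real (exp (- v\<^sup>2)) * G v"
      by (intro tendsto_mult lim) simp
    have "\<forall>\<^sub>F n in sequentially. \<bar>v\<bar> \<le> sqrt (\<nu> n)" using sinf by (simp add: filterlim_at_top)
    then show "\<forall>\<^sub>F n in sequentially. kernel (\<nu> n) (v / sqrt (\<nu> n)) * F n (v / sqrt (\<nu> n)) = f n v"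
      by eventually_elim (auto simp: f_def I_def abs_le_iff)
  qed
  have "(\<lambda>n. integral UNIV (f n)) \<longlonglongrightarrow> integral UNIV (\<lambda>v. of_real (exp (- v\<^sup>2)) * G v)"
  proof (rule Equivalence_Lebesgue_Henstock_Integration.dominated_convergence(2))
    show "f n integrable_on UNIV" for n using scale by blast
    show "(\<lambda>v. M * (4 * exp (c\<^sup>2)) * (1 / (1 + v\<^sup>2))) integrable_on (UNIV::real set)"
      by (intro integrable_on_mult_right integrable_inverse_one_plus_square_UNIV)
  qed (use fb fl in auto)
  moreover have "integral UNIV (f n) = of_real (sqrt (\<nu> n)) * integral {-1..1} (\<lambda>s. kernel (\<nu> n) s * F n s)" for n
    using scale by (rule integral_unique)
  ultimately show ?thesis by simp
qed

lemma laplace_limit: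
  fixes \<nu> :: "nat \<Rightarrow> real" and F :: "nat \<Rightarrow> real \<Rightarrow> complex"
  assumes \<nu>: "filterlim \<nu> at_top sequentially" and cont: "\<forall>\<^sub>F n in sequentially. continuous_on {-1..1} (F n)"
    and bound: "\<forall>\<^sub>F n in sequentially. \<forall>s\<in>{-1..1}. cmod (F n s) \<le> M * exp (c * (sqrt (\<nu> n) * \<bar>s\<bar>))" and M: "M \<ge> 0"
    and lim: "\<And>v. (\<lambda>n. F n (v / sqrt (\<nu> n))) \<longlonglongrightarrow> G v"
  shows "(\<lambda>n. of_real (sqrt (\<nu> n)) * integral {-1..1} (\<lambda>s. kernel (\<nu> n) s * F n s))
    \<longlonglongrightarrow> integral UNIV (\<lambda>v. of_real (exp (- v\<^sup>2)) * G v)"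
proof -
  have "\<forall>\<^sub>F n in sequentially. \<nu> n > 0" using \<nu> by (simp add: filterlim_at_top_dense)
  with cont bound have "\<forall>\<^sub>F n in sequentially. \<nu> n > 0 \<and> continuous_on {-1..1} (F n) \<and>
    (\<forall>s\<in>{-1..1}. cmod (F n s) \<le> M * exp (c * (sqrt (\<nu> n) * \<bar>s\<bar>)))" by eventually_elim simp
  then obtain N where N: "\<And>n. n \<ge> N \<Longrightarrow> \<nu> n > 0 \<and> continuous_on {-1..1} (F n) \<and>
    (\<forall>s\<in>{-1..1}. cmod (F n s) \<le> M * exp (c * (sqrt (\<nu> n) * \<bar>s\<bar>)))" by (auto simp: eventually_sequentially)
  have "(\<lambda>n. of_real (sqrt (\<nu> (n + N))) * integral {-1..1} (\<lambda>s. kernel (\<nu> (n + N)) s * F (n + N) s))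
    \<longlonglongrightarrow> integral UNIV (\<lambda>v. of_real (exp (- v\<^sup>2)) * G v)"
  proof (rule laplace_limit_all[where M = M and c = c])
    show "filterlim (\<lambda>n. \<nu> (n + N)) at_top sequentially"
      by (rule filterlim_compose[OF \<nu> filterlim_add_const_nat_at_top])
    show "(\<lambda>n. F (n + N) (v / sqrt (\<nu> (n + N)))) \<longlonglongrightarrow> G v" for v
      using LIMSEQ_ignore_initial_segment[OF lim] .
  qed (use N M in auto)
  then show ?thesis by (rule LIMSEQ_offset)
qed

text \<open>Completing the square: up to a constant the integrand is the normal density with mean
  l/2 and standard deviation 1 / sqrt 2.\<close>

lemma integral_gauss_linear:
  fixes l :: real
  shows "integral UNIV (\<lambda>v. complex_of_real (exp (- v\<^sup>2 + l * v))) = of_real (sqrt pi * exp (l\<^sup>2 / 4))"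
proof -
  let ?\<sigma> = "1 / sqrt 2 :: real"
  let ?g = "normal_density (l / 2) ?\<sigma>"
  have i: "integrable lborel ?g" "(\<integral>x. ?g x \<partial>lborel) = 1" by auto
  have "(?g has_integral 1) UNIV" using has_integral_integral_lborel[OF i(1)] i(2) by simp
  then have "((\<lambda>v. sqrt pi * exp (l\<^sup>2 / 4) * ?g v) has_integral (sqrt pi * exp (l\<^sup>2 / 4) * 1)) UNIV"
    by (rule has_integral_mult_right)
  moreover have "sqrt pi * exp (l\<^sup>2 / 4) * ?g v = exp (- v\<^sup>2 + l * v)" for v
  proof -
    have "?g v = exp (- (v - l / 2)\<^sup>2) / sqrt pi"
      by (simp add: normal_density_def power_divide)
    then have "sqrt pi * exp (l\<^sup>2 / 4) * ?g v = exp (l\<^sup>2 / 4) * exp (- (v - l / 2)\<^sup>2)" by simp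
    also have "... = exp (l\<^sup>2 / 4 + - (v - l / 2)\<^sup>2)" by (rule exp_add[symmetric])
    also have "l\<^sup>2 / 4 + - (v - l / 2)\<^sup>2 = - v\<^sup>2 + l * v" by (simp add: power2_eq_square field_simps)
    finally show ?thesis .
  qed
  ultimately have "((\<lambda>v. exp (- v\<^sup>2 + l * v)) has_integral (sqrt pi * exp (l\<^sup>2 / 4))) UNIV" by simp
  then have "((\<lambda>v. complex_of_real (exp (- v\<^sup>2 + l * v))) has_integral of_real (sqrt pi * exp (l\<^sup>2 / 4))) UNIV"
    by (rule has_integral_of_real)
  then show ?thesis by (rule integral_unique)
qed

lemma kmom_0_limit:
  assumes "filterlim \<nu> at_top sequentially"
  shows "(\<lambda>n. of_real (sqrt (\<nu> n)) * kmom (\<nu> n) 0) \<longlonglongrightarrow> of_real (sqrt pi)"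
  using laplace_limit[OF assms, of "\<lambda>_ _. 1" 1 0 "\<lambda>_. 1"] integral_gauss_linear[of 0]
  by (simp add: kmom_def)

abbreviation eventually_seq :: "(nat \<Rightarrow> bool) \<Rightarrow> bool" (binder "EV " 10) where
  "EV n. P n \<equiv> eventually P sequentially"

text \<open>Counting in half powers of \<nu> keeps the exponents natural numbers that add under
  products, although the a priori bounds for odd kernel moments involve odd powers of sqrt
  \<nu>.\<close>

definition half_order :: "(nat \<Rightarrow> real) \<Rightarrow> nat \<Rightarrow> (nat \<Rightarrow> complex) \<Rightarrow> bool" where
  "half_order \<nu> k f \<longleftrightarrow> (\<exists>C. EV n. cmod (f n) \<le> C / sqrt (\<nu> n) ^ k)"

lemma half_order_cong:
  assumes "half_order \<nu> k f" "EV n. f n = g n"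
  shows "half_order \<nu> k g"
proof -
  obtain C where "EV n. cmod (f n) \<le> C / sqrt (\<nu> n) ^ k"
    using assms(1) by (auto simp: half_order_def)
  with assms(2) have "EV n. cmod (g n) \<le> C / sqrt (\<nu> n) ^ k" by eventually_elim simp
  then show ?thesis unfolding half_order_def by blast
qed

lemma half_order_add:
  assumes "half_order \<nu> k f" "half_order \<nu> k g"
  shows "half_order \<nu> k (\<lambda>n. f n + g n)"
proof -
  obtain C D where "EV n. cmod (f n) \<le> C / sqrt (\<nu> n) ^ k" "EV n. cmod (g n) \<le> D / sqrt (\<nu> n) ^ k"
    using assms by (auto simp: half_order_def)
  then have "EV n. cmod (f n + g n) \<le> (C + D) / sqrt (\<nu> n) ^ k"
  proof eventually_elim
    case (elim n)
    then show ?case using norm_triangle_ineq[of "f n" "g n"] by (simp add: add_divide_distrib)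
  qed
  then show ?thesis unfolding half_order_def by blast
qed

lemma half_order_cmult:
  assumes "half_order \<nu> k f"
  shows "half_order \<nu> k (\<lambda>n. c * f n)"
proof -
  obtain C where "EV n. cmod (f n) \<le> C / sqrt (\<nu> n) ^ k"
    using assms(1) by (auto simp: half_order_def)
  then have "EV n. cmod (c * f n) \<le> (cmod c * C) / sqrt (\<nu> n) ^ k"
  proof eventually_elim
    case (elim n)
    then show ?case using mult_left_mono[OF elim, of "cmod c"] by (simp add: norm_mult)
  qed
  then show ?thesis unfolding half_order_def by blast
qed

lemma half_order_diff:
  assumes "half_order \<nu> k f" "half_order \<nu> k g"
  shows "half_order \<nu> k (\<lambda>n. f n - g n)"
  using half_order_add[OF assms(1) half_order_cmult[OF assms(2), of "- 1"]] by simp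

lemma half_order_mult:
  assumes "half_order \<nu> k f" "half_order \<nu> l g"
  shows "half_order \<nu> (k + l) (\<lambda>n. f n * g n)"
proof -
  obtain C D where "EV n. cmod (f n) \<le> C / sqrt (\<nu> n) ^ k" "EV n. cmod (g n) \<le> D / sqrt (\<nu> n) ^ l"
    using assms by (auto simp: half_order_def)
  then have "EV n. cmod (f n * g n) \<le> (C * D) / sqrt (\<nu> n) ^ (k + l)"
  proof eventually_elim
    case (elim n)
    have "cmod (f n) * cmod (g n) \<le> (C / sqrt (\<nu> n) ^ k) * (D / sqrt (\<nu> n) ^ l)"
      by (rule mult_mono[OF elim]) (auto intro: order.trans[OF norm_ge_zero elim(1)])
    then show ?case by (simp add: norm_mult power_add)
  qed
  then show ?thesis unfolding half_order_def by blast
qed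

lemma half_order_weaken:
  assumes \<nu>: "filterlim \<nu> at_top sequentially" and "half_order \<nu> l f" "k \<le> l"
  shows "half_order \<nu> k f"
proof -
  obtain C where C: "EV n. cmod (f n) \<le> C / sqrt (\<nu> n) ^ l"
    using assms(2) by (auto simp: half_order_def)
  have "EV n. 1 \<le> \<nu> n" using \<nu> by (simp add: filterlim_at_top)
  with C have "EV n. cmod (f n) \<le> \<bar>C\<bar> / sqrt (\<nu> n) ^ k"
  proof eventually_elim
    case (elim n)
    have "C / sqrt (\<nu> n) ^ l \<le> \<bar>C\<bar> / sqrt (\<nu> n) ^ k"
      using elim(2) assms(3) by (intro frac_le power_increasing) auto
    then show ?case using elim(1) by linarith
  qed
  then show ?thesis unfolding half_order_def by blast
qed

lemma half_order_inverse:
  assumes "filterlim \<nu> at_top sequentially"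
  shows "half_order \<nu> 2 (\<lambda>n. 1 / of_real (\<nu> n))"
proof -
  have "EV n. 1 \<le> \<nu> n" using assms by (simp add: filterlim_at_top)
  then have "EV n. cmod (1 / of_real (\<nu> n)) \<le> 1 / sqrt (\<nu> n) ^ 2"
    by eventually_elim (simp add: norm_divide)
  then show ?thesis unfolding half_order_def by blast
qed

lemma half_order_tendsto_0:
  assumes "filterlim \<nu> at_top sequentially" "half_order \<nu> (Suc k) f"
  shows "f \<longlonglongrightarrow> 0"
proof -
  obtain C where C: "EV n. cmod (f n) \<le> C / sqrt (\<nu> n) ^ 1"
    using half_order_weaken[OF assms, of 1] by (auto simp: half_order_def)
  have "filterlim (\<lambda>n. sqrt (\<nu> n)) at_top sequentially" by (rule filterlim_compose[OF sqrt_at_top assms(1)])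
  then have "(\<lambda>n. C / sqrt (\<nu> n)) \<longlonglongrightarrow> 0" by (rule real_tendsto_divide_at_top[OF tendsto_const])
  then show ?thesis by (rule Lim_null_comparison[rotated]) (use C in simp)
qed

section \<open>Asymptotics of the normalised kernel moments\<close>

context
  fixes \<nu> :: "nat \<Rightarrow> real"
  assumes \<nu>_lim: "filterlim \<nu> at_top sequentially"
begin

definition kratio :: "nat \<Rightarrow> nat \<Rightarrow> complex" where
  "kratio m n = kmom (\<nu> n) m / kmom (\<nu> n) 0"

lemma eventually_nu_ge: "EV n. c \<le> \<nu> n"
  using \<nu>_lim by (simp add: filterlim_at_top)

text \<open>After scaling by sqrt \<nu> the zeroth moment tends to sqrt pi > 1. The lower bound
  allows division by it, at the cost of one half power.\<close>

lemma eventually_norm_kmom_0_ge: "EV n. 1 / sqrt (\<nu> n) \<le> cmod (kmom (\<nu> n) 0)"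
proof -
  have "(\<lambda>n. cmod (of_real (sqrt (\<nu> n)) * kmom (\<nu> n) 0)) \<longlonglongrightarrow> cmod (of_real (sqrt pi))"
    by (intro tendsto_norm kmom_0_limit \<nu>_lim)
  moreover have "cmod (of_real (sqrt pi)) > 1"
  proof -
    have "1 < sqrt pi" using pi_gt3 by simp
    then show ?thesis by simp
  qed
  ultimately have "EV n. 1 < cmod (of_real (sqrt (\<nu> n)) * kmom (\<nu> n) 0)"
    by (rule order_tendstoD)
  with eventually_nu_ge[of 1] show ?thesis
    by eventually_elim (simp add: norm_mult divide_simps mult.commute)
qed

lemma half_order_integral_ratio:
  assumes "EV n. cmod (I n) \<le> C / sqrt (\<nu> n) ^ (k + 1)"
  shows "half_order \<nu> k (\<lambda>n. I n / kmom (\<nu> n) 0)"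
proof -
  have "EV n. cmod (I n / kmom (\<nu> n) 0) \<le> C / sqrt (\<nu> n) ^ k"
    using assms eventually_norm_kmom_0_ge eventually_nu_ge[of 1]
  proof eventually_elim
    case (elim n)
    have "cmod (I n / kmom (\<nu> n) 0) \<le> (C / sqrt (\<nu> n) ^ (k + 1)) / (1 / sqrt (\<nu> n))"
      unfolding norm_divide by (rule frac_le[OF order.trans[OF norm_ge_zero elim(1)] elim(1)]) (use elim in auto)
    also have "... = C / sqrt (\<nu> n) ^ k" using elim(3) by simp
    finally show ?case .
  qed
  then show ?thesis unfolding half_order_def by blast
qed

lemma half_order_kratio: "half_order \<nu> m (kratio m)"
proof -
  have "EV n. cmod (kmom (\<nu> n) m) \<le> kmom_const m / sqrt (\<nu> n) ^ (m + 1)"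
    using eventually_nu_ge[of 1] by eventually_elim (rule norm_kmom_le, simp)
  then show ?thesis unfolding kratio_def[abs_def] by (rule half_order_integral_ratio)
qed

definition kerr :: "nat \<Rightarrow> nat \<Rightarrow> complex" where
  "kerr m n = of_real (\<nu> n) * (kratio (m + 2) n + 2 * kratio (m + 1) n)
    + of_nat m * (kratio (m - 1) n + 2 * kratio m n + kratio (m + 1) n)"

lemma half_order_exp:
  assumes c: "c > 0"
  shows "EV n. exp (- c * \<nu> n) \<le> 1 / sqrt (\<nu> n) ^ k"
proof -
  have "((\<lambda>x::real. x ^ k * exp (- c * x)) \<longlongrightarrow> 0) at_top" using c by real_asymp
  then have "(\<lambda>n. \<nu> n ^ k * exp (- c * \<nu> n)) \<longlonglongrightarrow> 0" by (rule filterlim_compose[OF _ \<nu>_lim])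
  then have "EV n. \<nu> n ^ k * exp (- c * \<nu> n) < 1" by (rule order_tendstoD) simp
  with eventually_nu_ge[of 1] show ?thesis
  proof eventually_elim
    case (elim n)
    have "sqrt (\<nu> n) \<le> sqrt (\<nu> n) * sqrt (\<nu> n)" using elim(1) by (intro mult_le_cancel_left1[THEN iffD2]) auto
    then have "sqrt (\<nu> n) ^ k \<le> \<nu> n ^ k" using elim(1) by (intro power_mono) auto
    then have "sqrt (\<nu> n) ^ k * exp (- c * \<nu> n) \<le> \<nu> n ^ k * exp (- c * \<nu> n)" by (intro mult_right_mono) auto
    then have "sqrt (\<nu> n) ^ k * exp (- c * \<nu> n) \<le> 1" using elim(2) by linarith
    then have "exp (- c * \<nu> n) * sqrt (\<nu> n) ^ k \<le> 1" by (simp only: mult.commute)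
    moreover have "0 < sqrt (\<nu> n) ^ k" using elim(1) by simp
    ultimately show ?case by (simp only: pos_le_divide_eq)
  qed
qed

lemma half_order_kerr: "half_order \<nu> 6 (kerr m)"
proof -
  have "EV n. cmod (of_real (\<nu> n) * (kmom (\<nu> n) (m + 2) + 2 * kmom (\<nu> n) (m + 1))
    + of_nat m * (kmom (\<nu> n) (m - 1) + 2 * kmom (\<nu> n) m + kmom (\<nu> n) (m + 1))) \<le> 2 / sqrt (\<nu> n) ^ (6 + 1)"
    using eventually_nu_ge[of 1] half_order_exp[OF half_gt_zero[OF zero_less_one], of "6 + 1"]
  proof eventually_elim
    case (elim n)
    have "exp (- \<nu> n / 2) \<le> 1 / sqrt (\<nu> n) ^ (6 + 1)" using elim(2) by simp
    then show ?case using kmom_recursion[of "\<nu> n" m] elim(1) by simp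
  qed
  from half_order_integral_ratio[OF this] show ?thesis
    by (rule half_order_cong) (auto simp: kerr_def kratio_def add_divide_distrib distrib_left)
qed

text \<open>A priori the m-th ratio has m half orders. The recursion expresses an odd ratio through
  the next even one and through earlier ones divided by \<nu>, so ratios 1, 3 and 5 have 2, 4 and 6
  half orders. Ratio 6 is negligible at the required precision \<nu>^(-3). Working downwards from
  there yields 3/4 and 3/8 over \<nu>^2 for ratios 4 and 3, and then ratios 2 and 1.\<close>

lemma kratio_asymp:
  shows "half_order \<nu> 6 (\<lambda>n. kratio 1 n - (1 / (4 * of_real (\<nu> n)) + 3 / (32 * (of_real (\<nu> n))\<^sup>2)))"
    and "half_order \<nu> 6 (\<lambda>n. kratio 2 n - (- 1 / (2 * of_real (\<nu> n)) - 3 / (16 * (of_real (\<nu> n))\<^sup>2)))"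
proof -
  note W = half_order_weaken[OF \<nu>_lim]
  define x where "x n = (1 / of_real (\<nu> n) :: complex)" for n
  have x: "half_order \<nu> 2 x" using half_order_inverse[OF \<nu>_lim] by (simp add: x_def[abs_def])
  have xm: "half_order \<nu> (2 + k) (\<lambda>n. x n * f n)" if "half_order \<nu> k f" for k f
    by (rule half_order_mult[OF x that])
  have nz: "EV n. x n * of_real (\<nu> n) = 1 \<and> kratio 0 n = 1"
    using eventually_nu_ge[of 1] eventually_norm_kmom_0_ge
    by eventually_elim (auto simp: x_def kratio_def)
  have rec: "EV n. kratio (m + 2) n + 2 * kratio (m + 1) n =
     x n * kerr m n - x n * (of_nat m * (kratio (m - 1) n + 2 * kratio m n + kratio (m + 1) n))" for m
    using nz
  proof eventually_elim
    case (elim n)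
    have "x n * kerr m n = (x n * of_real (\<nu> n)) * (kratio (m + 2) n + 2 * kratio (m + 1) n)
       + x n * (of_nat m * (kratio (m - 1) n + 2 * kratio m n + kratio (m + 1) n))"
      unfolding kerr_def by (simp add: algebra_simps)
    then show ?case using elim by simp
  qed
  have E: "half_order \<nu> 6 (\<lambda>n. x n * kerr m n)" for m by (rule W[OF xm[OF half_order_kerr]]) simp
  note K = half_order_kratio
  have solve: "b = 1/2 * c - 1/2 * a" if "a + 2 * b = c" for a b c :: complex
    unfolding that[symmetric] by (simp add: algebra_simps)
  have r0: "EV n. kratio 1 n = 1/2 * (x n * kerr 0 n) - 1/2 * kratio 2 n"
    using rec[of 0]
  proof eventually_elim
    case (elim n)
    then show ?case using solve[of "kratio 2 n" "kratio 1 n"] by (simp add: numeral_2_eq_2)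
  qed
  \<comment> \<open>The recursion for m = 1 contains 2 k1 + k2, with k1 and k2 the first two ratios.
    By the recursion for m = 0 this combination is exponentially small, which leaves only the ratio
    0 with value 1.\<close>
  have r1: "EV n. kratio 2 n = 1/2 * (x n * kerr 1 n) - 1/2 * kratio 3 n - 1/2 * x n - 1/2 * (x n * (x n * kerr 0 n))"
    using rec[of 0] rec[of 1] nz
  proof eventually_elim
    case (elim n)
    have "2 * kratio 1 n + kratio 2 n = x n * kerr 0 n" using elim(1) by (simp add: numeral_2_eq_2 add.commute)
    moreover have "2 * kratio 2 n = x n * kerr 1 n - x n * (1 + (2 * kratio 1 n + kratio 2 n)) - kratio 3 n"
      using elim(2,3) by (simp add: numeral_2_eq_2 numeral_3_eq_3 algebra_simps)
    ultimately have "0 + 2 * kratio 2 n = x n * kerr 1 n - x n * (1 + x n * kerr 0 n) - kratio 3 n" by simp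
    from solve[OF this] show ?case by (simp add: algebra_simps)
  qed
  have r2: "EV n. kratio 3 n = 1/2 * (x n * kerr 2 n) - 1/2 * kratio 4 n - x n * (kratio 1 n + 2 * kratio 2 n + kratio 3 n)"
    using rec[of 2]
  proof eventually_elim
    case (elim n)
    from solve[OF elim] show ?case by (simp add: eval_nat_numeral algebra_simps)
  qed
  have r3: "EV n. kratio 4 n = 1/2 * (x n * kerr 3 n) - 1/2 * kratio 5 n - 3/2 * (x n * (kratio 2 n + 2 * kratio 3 n + kratio 4 n))"
    using rec[of 3]
  proof eventually_elim
    case (elim n)
    from solve[OF elim] show ?case by (simp add: eval_nat_numeral algebra_simps)
  qed
  have r4: "EV n. kratio 5 n = 1/2 * (x n * kerr 4 n) - 1/2 * kratio 6 n - 2 * (x n * (kratio 3 n + 2 * kratio 4 n + kratio 5 n))"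
    using rec[of 4]
  proof eventually_elim
    case (elim n)
    from solve[OF elim] show ?case by (simp add: eval_nat_numeral algebra_simps)
  qed
  note sym = eventually_mono[where P = "\<lambda>n. f n = g n" for f g, OF _ sym]
  have k1: "half_order \<nu> 2 (kratio 1)"
    by (rule half_order_cong[OF half_order_diff[OF half_order_cmult[OF W[OF E]] half_order_cmult[OF K[of 2]]] sym[OF r0]]) simp
  have k3: "half_order \<nu> 4 (kratio 3)"
  proof (rule half_order_cong[OF _ sym[OF r2]])
    have "half_order \<nu> (2 + 2) (\<lambda>n. x n * (kratio 1 n + 2 * kratio 2 n + kratio 3 n))"
      by (intro xm half_order_add half_order_cmult k1 K[of 2] W[OF K[of 3]]) simp
    then show "half_order \<nu> 4 (\<lambda>n. 1/2 * (x n * kerr 2 n) - 1/2 * kratio 4 n - x n * (kratio 1 n + 2 * kratio 2 n + kratio 3 n))"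
      by (intro half_order_diff half_order_cmult K[of 4] W[OF E]) simp_all
  qed
  have k5: "half_order \<nu> 6 (kratio 5)"
  proof (rule half_order_cong[OF _ sym[OF r4]])
    have "half_order \<nu> (2 + 4) (\<lambda>n. x n * (kratio 3 n + 2 * kratio 4 n + kratio 5 n))"
      by (intro xm half_order_add half_order_cmult k3 K[of 4] W[OF K[of 5]]) simp
    then show "half_order \<nu> 6 (\<lambda>n. 1/2 * (x n * kerr 4 n) - 1/2 * kratio 6 n - 2 * (x n * (kratio 3 n + 2 * kratio 4 n + kratio 5 n)))"
      by (intro half_order_diff half_order_cmult K[of 6] E) simp_all
  qed
  have d2: "half_order \<nu> 4 (\<lambda>n. kratio 2 n + 1/2 * x n)"
  proof (rule half_order_cong)
    show "half_order \<nu> 4 (\<lambda>n. 1/2 * (x n * kerr 1 n) - 1/2 * kratio 3 n - 1/2 * (x n * (x n * kerr 0 n)))"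
      by (intro half_order_diff half_order_cmult k3 W[OF E] W[OF xm[OF E]]) simp_all
    show "EV n. 1/2 * (x n * kerr 1 n) - 1/2 * kratio 3 n - 1/2 * (x n * (x n * kerr 0 n)) = kratio 2 n + 1/2 * x n"
      using r1 by eventually_elim simp
  qed
  have d4: "half_order \<nu> 6 (\<lambda>n. kratio 4 n - 3/4 * (x n * x n))"
  proof (rule half_order_cong)
    have "half_order \<nu> (2 + 4) (\<lambda>n. x n * ((kratio 2 n + 1/2 * x n) + 2 * kratio 3 n + kratio 4 n))"
      by (intro xm half_order_add half_order_cmult k3 K[of 4] d2)
    then show "half_order \<nu> 6 (\<lambda>n. 1/2 * (x n * kerr 3 n) - 1/2 * kratio 5 n - 3/2 * (x n * ((kratio 2 n + 1/2 * x n) + 2 * kratio 3 n + kratio 4 n)))"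
      by (intro half_order_diff half_order_cmult k5 E) simp_all
    show "EV n. 1/2 * (x n * kerr 3 n) - 1/2 * kratio 5 n - 3/2 * (x n * ((kratio 2 n + 1/2 * x n) + 2 * kratio 3 n + kratio 4 n))
       = kratio 4 n - 3/4 * (x n * x n)"
      using r3
    proof eventually_elim
      case (elim n)
      show ?case by (subst (2) elim) (simp add: algebra_simps)
    qed
  qed
  have d3: "half_order \<nu> 6 (\<lambda>n. kratio 3 n - 3/8 * (x n * x n))"
  proof (rule half_order_cong)
    have "half_order \<nu> (2 + 4) (\<lambda>n. x n * (1/2 * (x n * kerr 0 n) + 3/2 * (kratio 2 n + 1/2 * x n) + kratio 3 n))"
      by (intro xm half_order_add half_order_cmult k3 d2 W[OF E]) simp
    then show "half_order \<nu> 6 (\<lambda>n. 1/2 * (x n * kerr 2 n) - 1/2 * (kratio 4 n - 3/4 * (x n * x n))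
        - x n * (1/2 * (x n * kerr 0 n) + 3/2 * (kratio 2 n + 1/2 * x n) + kratio 3 n))"
      by (intro half_order_diff half_order_cmult d4 E) simp_all
    show "EV n. 1/2 * (x n * kerr 2 n) - 1/2 * (kratio 4 n - 3/4 * (x n * x n))
        - x n * (1/2 * (x n * kerr 0 n) + 3/2 * (kratio 2 n + 1/2 * x n) + kratio 3 n) = kratio 3 n - 3/8 * (x n * x n)"
      using r2 r0
    proof eventually_elim
      case (elim n)
      have e: "kratio 3 n = 1/2 * (x n * kerr 2 n) - 1/2 * kratio 4 n
         - x n * ((1/2 * (x n * kerr 0 n) - 1/2 * kratio 2 n) + 2 * kratio 2 n + kratio 3 n)"
        using elim by metis
      show ?case by (subst (2) e) (simp add: algebra_simps)
    qed
  qed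
  have main2: "half_order \<nu> 6 (\<lambda>n. kratio 2 n + 1/2 * x n + 3/16 * (x n * x n))"
  proof (rule half_order_cong)
    show "half_order \<nu> 6 (\<lambda>n. 1/2 * (x n * kerr 1 n) - 1/2 * (kratio 3 n - 3/8 * (x n * x n)) - 1/2 * (x n * (x n * kerr 0 n)))"
      by (intro half_order_diff half_order_cmult d3 E W[OF xm[OF E]]) simp_all
    show "EV n. 1/2 * (x n * kerr 1 n) - 1/2 * (kratio 3 n - 3/8 * (x n * x n)) - 1/2 * (x n * (x n * kerr 0 n))
       = kratio 2 n + 1/2 * x n + 3/16 * (x n * x n)"
      using r1 by eventually_elim (simp add: algebra_simps)
  qed
  then show "half_order \<nu> 6 (\<lambda>n. kratio 2 n - (- 1 / (2 * of_real (\<nu> n)) - 3 / (16 * (of_real (\<nu> n))\<^sup>2)))"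
    by (rule half_order_cong) (auto simp: x_def power2_eq_square)
  have "half_order \<nu> 6 (\<lambda>n. 1/2 * (x n * kerr 0 n) - 1/2 * (kratio 2 n + 1/2 * x n + 3/16 * (x n * x n)))"
    by (intro half_order_diff half_order_cmult main2 E)
  then show "half_order \<nu> 6 (\<lambda>n. kratio 1 n - (1 / (4 * of_real (\<nu> n)) + 3 / (32 * (of_real (\<nu> n))\<^sup>2)))"
  proof (rule half_order_cong)
    show "EV n. 1/2 * (x n * kerr 0 n) - 1/2 * (kratio 2 n + 1/2 * x n + 3/16 * (x n * x n)) =
       kratio 1 n - (1 / (4 * of_real (\<nu> n)) + 3 / (32 * (of_real (\<nu> n))\<^sup>2))"
      using r0 by eventually_elim (simp add: x_def power2_eq_square algebra_simps)
  qed
qed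

end

section \<open>The circle method\<close>

text \<open>The angle on the circle of radius exp (- \<eta>) is measured in units of \<eta>, so the
  circle is traversed once as s runs from - pi / \<eta> to pi / \<eta>.\<close>

definition zpt :: "real \<Rightarrow> real \<Rightarrow> complex" where
  "zpt \<eta> s = of_real \<eta> * (1 + \<i> * of_real s)"

definition arc_series :: "(nat \<Rightarrow> complex) \<Rightarrow> real \<Rightarrow> real \<Rightarrow> complex" where
  "arc_series c \<eta> s = (\<Sum>m. c m * exp (- zpt \<eta> s) ^ m)"

lemma Re_zpt [simp]: "Re (zpt \<eta> s) = \<eta>" and Im_zpt [simp]: "Im (zpt \<eta> s) = \<eta> * s"
  by (simp_all add: zpt_def)

lemma norm_exp_zpt [simp]: "cmod (exp (- zpt \<eta> s)) = exp (- \<eta>)"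
  by simp

lemma continuous_on_zpt [continuous_intros]: "continuous_on A (zpt \<eta>)"
  unfolding zpt_def[abs_def] by (intro continuous_intros)

lemma zpt_in_sector: "\<eta> > 0 \<Longrightarrow> s \<in> {-1..1} \<Longrightarrow> zpt \<eta> s \<in> sector"
  using mult_left_mono[of "\<bar>s\<bar>" 1 \<eta>] by (auto simp: sector_def abs_mult)

lemma zpt_neq_0: "\<eta> > 0 \<Longrightarrow> zpt \<eta> s \<noteq> 0"
  by (auto simp: complex_eq_iff)

lemma arc_series_uniform:
  assumes "summable (\<lambda>m. cmod (c m) * exp (- \<eta>) ^ m)"
  shows "uniform_limit A (\<lambda>N s. \<Sum>m<N. c m * exp (- zpt \<eta> s) ^ m * exp (of_nat n * zpt \<eta> s))
    (\<lambda>s. arc_series c \<eta> s * exp (of_nat n * zpt \<eta> s)) sequentially"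
proof -
  have sm: "summable (\<lambda>m. c m * exp (- zpt \<eta> s) ^ m)" for s
    by (rule summable_norm_cancel) (use assms in \<open>simp add: norm_mult norm_power\<close>)
  have "uniform_limit A (\<lambda>N s. \<Sum>m<N. c m * exp (- zpt \<eta> s) ^ m * exp (of_nat n * zpt \<eta> s))
    (\<lambda>s. \<Sum>m. c m * exp (- zpt \<eta> s) ^ m * exp (of_nat n * zpt \<eta> s)) sequentially"
  proof (rule Weierstrass_m_test)
    show "cmod (c m * exp (- zpt \<eta> s) ^ m * exp (of_nat n * zpt \<eta> s)) \<le> cmod (c m) * exp (- \<eta>) ^ m * exp (n * \<eta>)" for m s
      by (simp add: norm_mult norm_power)
    show "summable (\<lambda>m. cmod (c m) * exp (- \<eta>) ^ m * exp (n * \<eta>))" by (intro summable_mult2 assms)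
  qed
  moreover have "(\<Sum>m. c m * exp (- zpt \<eta> s) ^ m * exp (of_nat n * zpt \<eta> s)) = arc_series c \<eta> s * exp (of_nat n * zpt \<eta> s)" for s
    unfolding arc_series_def by (rule suminf_mult2[OF sm, symmetric])
  ultimately show ?thesis by simp
qed

lemma continuous_on_arc_series:
  assumes "summable (\<lambda>m. cmod (c m) * exp (- \<eta>) ^ m)"
  shows "continuous_on A (arc_series c \<eta>)"
proof -
  have C: "continuous_on A (\<lambda>s. \<Sum>m<N. c m * exp (- zpt \<eta> s) ^ m * exp (of_nat 0 * zpt \<eta> s))" for N
    by (intro continuous_intros)
  from uniform_limit_theorem[OF always_eventually[OF allI[OF C]] arc_series_uniform[OF assms]] show ?thesis by simp
qed

lemma integral_exp_zpt:
  assumes \<eta>: "\<eta> > 0"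
  shows "((\<lambda>s. exp (of_int k * zpt \<eta> s)) has_integral (if k = 0 then of_real (2 * pi / \<eta>) else 0)) {- pi / \<eta>..pi / \<eta>}"
proof (cases "k = 0")
  case True
  have "((\<lambda>s. 1 :: complex) has_integral (measure lborel {- pi / \<eta>..pi / \<eta>}) *\<^sub>R 1) {- pi / \<eta>..pi / \<eta>}"
    using has_integral_const[of "1::complex" "- pi / \<eta>" "pi / \<eta>"] by simp
  moreover have "measure lborel {- pi / \<eta>..pi / \<eta>} = 2 * pi / \<eta>"
    using \<eta> by (subst content_real) (auto simp: field_simps)
  ultimately show ?thesis using True by (simp add: scaleR_conv_of_real)
next
  case False
  define c where "c = of_int k * of_real \<eta> * \<i>"
  have c0: "c \<noteq> 0" using False \<eta> by (simp add: c_def)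
  let ?F = "\<lambda>s. exp (of_int k * zpt \<eta> s) / c"
  have "((\<lambda>s. exp (of_int k * zpt \<eta> s)) has_integral (?F (pi / \<eta>) - ?F (- pi / \<eta>))) {- pi / \<eta>..pi / \<eta>}"
  proof (rule fundamental_theorem_of_calculus)
    fix s
    have "((\<lambda>w. exp (of_int k * (of_real \<eta> * (1 + \<i> * w))) / c) has_field_derivative
        exp (of_int k * (of_real \<eta> * (1 + \<i> * of_real s))) * c / c) (at (of_real s))"
    proof (rule DERIV_cdivide[OF DERIV_chain2[OF DERIV_exp]])
      show "((\<lambda>w. of_int k * (of_real \<eta> * (1 + \<i> * w))) has_field_derivative c) (at (of_real s))"
        by (auto intro!: derivative_eq_intros simp: c_def)
    qed
    then have "((\<lambda>x. exp (of_int k * (of_real \<eta> * (1 + \<i> * of_real x))) / c) has_vector_derivative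
        exp (of_int k * (of_real \<eta> * (1 + \<i> * of_real s))) * c / c) (at s within {- pi / \<eta>..pi / \<eta>})"
      by (rule has_vector_derivative_real_field)
    then show "(?F has_vector_derivative exp (of_int k * zpt \<eta> s)) (at s within {- pi / \<eta>..pi / \<eta>})"
      using c0 by (simp add: zpt_def)
  qed (use \<eta> in \<open>simp add: divide_simps\<close>)
  moreover have "exp (of_int k * zpt \<eta> (pi / \<eta>)) = exp (of_int k * zpt \<eta> (- pi / \<eta>))"
  proof -
    have "of_int k * zpt \<eta> (pi / \<eta>) = of_int k * zpt \<eta> (- pi / \<eta>) + of_int k * (2 * of_real pi * \<i>)"
      using \<eta> by (simp add: zpt_def field_simps)
    moreover have "exp (of_int k * (2 * of_real pi * \<i>)) = 1"
      using exp_integer_2pi[of "of_int k"] by (simp add: mult_ac)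
    ultimately show ?thesis by (simp add: exp_add)
  qed
  ultimately show ?thesis using False by simp
qed

text \<open>Cauchy's coefficient formula: the series converges uniformly on the circle, and termwise
  integration leaves only the term m = n.\<close>

lemma coeff_integral:
  assumes \<eta>: "\<eta> > 0" and sm: "summable (\<lambda>m. cmod (c m) * exp (- \<eta>) ^ m)"
  shows "((\<lambda>s. arc_series c \<eta> s * exp (of_nat n * zpt \<eta> s)) has_integral c n * of_real (2 * pi / \<eta>)) {- pi / \<eta>..pi / \<eta>}"
proof -
  let ?g = "\<lambda>N s. \<Sum>m<N. c m * exp (- zpt \<eta> s) ^ m * exp (of_nat n * zpt \<eta> s)"
  have cont: "continuous_on {- pi / \<eta>..pi / \<eta>} (?g N)" for N by (intro continuous_intros)
  obtain I J where IJ: "\<And>N. (?g N has_integral I N) {- pi / \<eta>..pi / \<eta>}"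
      "((\<lambda>s. arc_series c \<eta> s * exp (of_nat n * zpt \<eta> s)) has_integral J) {- pi / \<eta>..pi / \<eta>}" "I \<longlonglongrightarrow> J"
    by (rule uniform_limit_integral[OF arc_series_uniform[OF sm] cont]) auto
  have term_eq: "c m * exp (- zpt \<eta> s) ^ m * exp (of_nat n * zpt \<eta> s) = c m * exp (of_int (int n - int m) * zpt \<eta> s)" for m s
  proof -
    have "exp (- zpt \<eta> s) ^ m * exp (of_nat n * zpt \<eta> s) = exp (of_nat m * (- zpt \<eta> s) + of_nat n * zpt \<eta> s)"
      by (simp only: exp_of_nat_mult[symmetric] exp_add)
    also have "of_nat m * (- zpt \<eta> s) + of_nat n * zpt \<eta> s = of_int (int n - int m) * zpt \<eta> s" by (simp add: algebra_simps)
    finally show ?thesis by (simp add: mult.assoc)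
  qed
  have "I N = c n * of_real (2 * pi / \<eta>)" if "N > n" for N
  proof -
    have "(?g N has_integral (\<Sum>m<N. c m * (if int n - int m = 0 then of_real (2 * pi / \<eta>) else 0))) {- pi / \<eta>..pi / \<eta>}"
      unfolding term_eq by (intro has_integral_sum has_integral_mult_right integral_exp_zpt \<eta>) auto
    also have "(\<Sum>m<N. c m * (if int n - int m = 0 then of_real (2 * pi / \<eta>) else 0)) = (\<Sum>m<N. if m = n then c n * of_real (2 * pi / \<eta>) else 0)"
      by (rule sum.cong) auto
    also have "... = c n * of_real (2 * pi / \<eta>)" using that by simp
    finally show ?thesis using IJ(1) has_integral_unique by blast
  qed
  then have "I \<longlonglongrightarrow> c n * of_real (2 * pi / \<eta>)"
    by (intro tendsto_eventually) (auto intro: eventually_mono[OF eventually_gt_at_top[of n]])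
  then have "J = c n * of_real (2 * pi / \<eta>)" using IJ(3) LIMSEQ_unique by blast
  then show ?thesis using IJ(2) by simp
qed

text \<open>With u = 1 + i s and \<nu> = pi^2 / (12 \<eta>), the pole and the linear term add up to
  \<nu> (1/u + u) = 2 \<nu> + \<nu> (u - 1)^2 / u, and (u - 1)^2 = - s^2. The term z/24 cancels
  against the shift of n by 1/24.\<close>

lemma saddle_identity:
  assumes \<eta>: "\<eta> > 0" and n: "real n + 1 / 24 = pi\<^sup>2 / 12 / \<eta>\<^sup>2"
  shows "exp (log_P_approx (zpt \<eta> s)) * exp (of_nat n * zpt \<eta> s)
    = of_real (exp (2 * (pi\<^sup>2 / 12 / \<eta>) - ln 2 / 2)) * kernel (pi\<^sup>2 / 12 / \<eta>) s"
proof -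
  define a where "a = complex_of_real (pi\<^sup>2 / 12)"
  define u where "u = 1 + \<i> * complex_of_real s"
  define h where "h = complex_of_real \<eta>"
  have nz: "u \<noteq> 0" "h \<noteq> 0" using \<eta> by (auto simp: u_def h_def)
  have "complex_of_real (real n + 1 / 24) = complex_of_real (pi\<^sup>2 / 12 / \<eta>\<^sup>2)" using n by (rule arg_cong)
  then have n': "of_nat n = a / h\<^sup>2 - 1 / 24" by (simp add: a_def h_def eq_diff_eq)
  have sq: "(complex_of_real s)\<^sup>2 = 2 * u - 1 - u\<^sup>2" by (simp add: u_def power2_eq_square algebra_simps)
  have "log_P_approx (zpt \<eta> s) + of_nat n * zpt \<eta> s = a / (h * u) - of_real (ln 2 / 2) + h * u / 24 + (a / h\<^sup>2 - 1 / 24) * (h * u)"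
    unfolding log_P_approx_def zpt_def n' a_def[symmetric] h_def[symmetric] u_def[symmetric] ..
  also have "... = (2 * (a / h) - of_real (ln 2 / 2)) + - (a / h) * (2 * u - 1 - u\<^sup>2) / u"
    using nz by (simp add: field_simps power2_eq_square)
  also have "... = of_real (2 * (pi\<^sup>2 / 12 / \<eta>) - ln 2 / 2) + - of_real (pi\<^sup>2 / 12 / \<eta>) * (of_real s)\<^sup>2 / (1 + \<i> * of_real s)"
    unfolding sq[symmetric] by (simp add: a_def h_def u_def)
  finally show ?thesis
    unfolding kernel_def exp_add[symmetric] exp_of_real[symmetric] by (simp only:)
qed

text \<open>For \<bar>s\<bar> \<ge> 1 the angle is at least \<eta>, so |1 - q|^2 exceeds (1 - r)^2
  by at least (18/25) \<eta>^2. As 1 - r \<le> \<eta>, it is at least 43/25 > (13/10)^2 times (1 -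
  r)^2. At least 3/13 of r / (1 - r) \<ge> (9/10) / \<eta> is then left over, which exceeds 1 / (5
  \<eta>).\<close>

lemma minor_arc_gap:
  "\<forall>\<^sub>F \<eta> in at_right 0. \<forall>s. 1 \<le> \<bar>s\<bar> \<and> \<bar>s\<bar> \<le> pi / \<eta> \<longrightarrow>
     1 / (5 * \<eta>) \<le> exp (- \<eta>) / (1 - exp (- \<eta>)) - Re (exp (- zpt \<eta> s) / (1 - exp (- zpt \<eta> s)))"
proof -
  have 1: "\<forall>\<^sub>F \<eta>::real in at_right 0. (2/5) * \<eta>\<^sup>2 \<le> 1 - cos \<eta>" by real_asymp
  have 2: "\<forall>\<^sub>F \<eta>::real in at_right 0. 9/10 \<le> exp (- \<eta>)" by real_asymp
  have 3: "\<forall>\<^sub>F \<eta>::real in at_right 0. (9/10) / \<eta> \<le> exp (- \<eta>) / (1 - exp (- \<eta>))" by real_asymp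
  have 4: "\<forall>\<^sub>F \<eta>::real in at_right 0. \<eta> < 1" by real_asymp
  show ?thesis using 1 2 3 4 eventually_at_right_less[of 0]
  proof eventually_elim
    case (elim \<eta>)
    define r where "r = exp (- \<eta>)"
    have r: "0 < r" "r < 1" "1 - r \<le> \<eta>" "9/10 \<le> r"
      using elim exp_ge_add_one_self[of "- \<eta>"] by (auto simp: r_def)
    show ?case
    proof (intro allI impI)
      fix s assume s: "1 \<le> \<bar>s\<bar> \<and> \<bar>s\<bar> \<le> pi / \<eta>"
      define q where "q = exp (- zpt \<eta> s)"
      have q: "cmod q = r" by (simp add: q_def r_def)
      have ReIm: "Re q = r * cos (\<eta> * s)" "Im q = - (r * sin (\<eta> * s))" by (simp_all add: q_def r_def Re_exp Im_exp)
      have "\<eta> * 1 \<le> \<eta> * \<bar>s\<bar>" "\<eta> * \<bar>s\<bar> \<le> \<eta> * (pi / \<eta>)" using s elim by (intro mult_left_mono; simp)+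
      then have range: "\<eta> \<le> \<bar>\<eta> * s\<bar>" "\<bar>\<eta> * s\<bar> \<le> pi" using elim by (auto simp: abs_mult)
      have "cos \<bar>\<eta> * s\<bar> \<le> cos \<eta>" by (rule cos_monotone_0_pi_le) (use range elim in auto)
      then have cs: "cos (\<eta> * s) \<le> 1 - (2/5) * \<eta>\<^sup>2" using elim by simp
      have "(cmod (1 - q))\<^sup>2 = (1 - r * cos (\<eta> * s))\<^sup>2 + (r * sin (\<eta> * s))\<^sup>2" by (simp add: cmod_power2 ReIm)
      also have "... = (1 - r)\<^sup>2 + 2 * r * (1 - cos (\<eta> * s))"
      proof -
        have "(r * sin (\<eta> * s))\<^sup>2 = r\<^sup>2 * (1 - (cos (\<eta> * s))\<^sup>2)" by (simp add: power_mult_distrib sin_squared_eq)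
        then show ?thesis by (simp add: power2_eq_square algebra_simps)
      qed
      also have "... \<ge> (1 - r)\<^sup>2 + 2 * (9/10) * ((2/5) * \<eta>\<^sup>2)"
        using r cs by (intro add_left_mono mult_mono) auto
      finally have "(1 - r)\<^sup>2 + (18/25) * \<eta>\<^sup>2 \<le> (cmod (1 - q))\<^sup>2" by simp
      moreover have "(1 - r)\<^sup>2 \<le> \<eta>\<^sup>2" using r by (intro power_mono) auto
      ultimately have "((13/10) * (1 - r))\<^sup>2 \<le> (cmod (1 - q))\<^sup>2" (is ?thesis)
      proof -
        assume *: "(1 - r)\<^sup>2 + (18/25) * \<eta>\<^sup>2 \<le> (cmod (1 - q))\<^sup>2" "(1 - r)\<^sup>2 \<le> \<eta>\<^sup>2"
        have "((13/10) * (1 - r))\<^sup>2 = (169/100) * (1 - r)\<^sup>2"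
          by (simp only: power_mult_distrib) (simp add: power2_eq_square)
        moreover have "0 \<le> (1 - r)\<^sup>2" by simp
        ultimately show ?thesis using * by linarith
      qed
      then have "(13/10) * (1 - r) \<le> cmod (1 - q)" by (rule power2_le_imp_le) simp
      then have le: "r / cmod (1 - q) \<le> r / ((13/10) * (1 - r))" using r by (intro divide_left_mono mult_pos_pos) auto
      have "Re (q / (1 - q)) \<le> r / cmod (1 - q)" using complex_Re_le_cmod[of "q / (1 - q)"] by (simp add: norm_divide q)
      also note le
      also have "r / ((13/10) * (1 - r)) = (10/13) * (r / (1 - r))" using r by (simp add: field_simps)
      finally have "Re (q / (1 - q)) \<le> (10/13) * (r / (1 - r))" .
      moreover have "(9/10) / \<eta> \<le> r / (1 - r)" using elim by (simp add: r_def)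
      moreover have "1 / (5 * \<eta>) \<le> (3/13) * ((9/10) / \<eta>)" using elim by (simp add: field_simps)
      ultimately show "1 / (5 * \<eta>) \<le> exp (- \<eta>) / (1 - exp (- \<eta>)) - Re (exp (- zpt \<eta> s) / (1 - exp (- zpt \<eta> s)))"
        unfolding q_def r_def by linarith
    qed
  qed
qed

text \<open>With \<open>eta n\<close> the linear terms \<open>n z\<close> and \<open>z / 24\<close> balance the pole of \<open>log P\<close>, and \<open>nu n = pi\<^sup>2 / (12 eta n)\<close>.\<close>

definition nu :: "nat \<Rightarrow> real" where "nu n = sqrt (pi\<^sup>2 / 12 * (real n + 1 / 24))"
definition eta :: "nat \<Rightarrow> real" where "eta n = pi\<^sup>2 / 12 / nu n"
text \<open>The value of exp (\<open>log_P_approx z\<close> + n z) at z = \<open>eta n\<close>, by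
  which all arc integrals are divided.\<close>

definition sp_W :: "nat \<Rightarrow> real" where "sp_W n = exp (2 * nu n - ln 2 / 2)"

lemma nu_pos: "nu n > 0" by (simp add: nu_def add_nonneg_pos)
lemma eta_pos: "eta n > 0" using nu_pos by (simp add: eta_def)
lemma sp_W_pos: "sp_W n > 0" by (simp add: sp_W_def)
lemma nu_eq: "pi\<^sup>2 / 12 / eta n = nu n" using nu_pos[of n] by (simp add: eta_def)

lemma nu_lim: "filterlim nu at_top sequentially"
  unfolding nu_def[abs_def] by real_asymp

lemma eta_lim: "filterlim eta (at_right 0) sequentially"
  unfolding eta_def[abs_def] nu_def[abs_def] by real_asymp

lemma sp_n_eq: "real n + 1 / 24 = pi\<^sup>2 / 12 / (eta n)\<^sup>2"
proof -
  have "(nu n)\<^sup>2 = pi\<^sup>2 / 12 * (real n + 1 / 24)" by (simp add: nu_def)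
  then show ?thesis using nu_pos[of n] by (simp add: eta_def power_divide field_simps power2_eq_square)
qed

lemma saddle_identity_sp:
  "exp (log_P_approx (zpt (eta n) s)) * exp (of_nat n * zpt (eta n) s) = of_real (sp_W n) * kernel (nu n) s"
  using saddle_identity[of "eta n" n s, OF eta_pos sp_n_eq] by (simp only: nu_eq sp_W_def)

definition saddle_ratio :: "nat \<Rightarrow> real \<Rightarrow> complex" where
  "saddle_ratio n s = strict_gf (exp (- zpt (eta n) s)) / exp (log_P_approx (zpt (eta n) s))"

lemma eventually_eta_small: "c > 0 \<Longrightarrow> EV n. eta n \<le> c"
proof -
  assume c: "c > 0"
  then have "\<forall>\<^sub>F \<eta> in at_right 0. \<eta> \<in> {0<..<c}" by (rule eventually_at_right_real)
  then have "EV n. eta n \<in> {0<..<c}" by (rule eventually_compose_filterlim[OF _ eta_lim])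
  then show ?thesis by eventually_elim auto
qed

lemma saddle_ratio_bound:
  assumes "eta n \<le> 1 / 100" "s \<in> {-1..1}"
  shows "cmod (saddle_ratio n s - 1) \<le> 800 * (eta n)\<^sup>2"
  using strict_gf_asymp[OF zpt_in_sector[OF eta_pos assms(2)], of n] assms(1) by (simp add: saddle_ratio_def)

text \<open>Since 25600 = 160^2, the bound on w makes \<delta> = 2 sqrt |w - 1| at most 1/80. The
  loss 2 \<delta> / \<eta> is then at most 1 / (40 \<eta>), against a gain of 1 / (20 \<eta>). The
  statement is uniform in w because w will move with n; w = 1 gives the bound for P itself.\<close>

lemma minor_arc:
  "EV n. \<forall>t w s. t > 0 \<and> cmod w = 1 \<and> cmod (w - 1) \<le> 1 / 25600 \<and> 1 \<le> \<bar>s\<bar> \<and> \<bar>s\<bar> \<le> pi / eta n \<longrightarrow>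
     cmod (arc_series (bar_gf t w) (eta n) s) * exp (real n * eta n)
       \<le> 3 * sp_W n * exp (- (1 / 40) / eta n)"
proof -
  have "EV n. \<forall>s. 1 \<le> \<bar>s\<bar> \<and> \<bar>s\<bar> \<le> pi / eta n \<longrightarrow>
     1 / (5 * eta n) \<le> exp (- eta n) / (1 - exp (- eta n)) - Re (exp (- zpt (eta n) s) / (1 - exp (- zpt (eta n) s)))"
    by (rule eventually_compose_filterlim[OF minor_arc_gap eta_lim])
  moreover have "EV n. eta n \<le> 1 / 100" by (rule eventually_eta_small) simp
  ultimately show ?thesis
  proof eventually_elim
    case (elim n)
    show ?case
    proof (intro allI impI)
      fix t :: nat and w :: complex and s :: real
      assume a: "t > 0 \<and> cmod w = 1 \<and> cmod (w - 1) \<le> 1 / 25600 \<and> 1 \<le> \<bar>s\<bar> \<and> \<bar>s\<bar> \<le> pi / eta n"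
      define \<eta> where "\<eta> = eta n"
      define r where "r = exp (- \<eta>)"
      define q where "q = exp (- zpt \<eta> s)"
      define \<delta> where "\<delta> = 2 * sqrt (cmod (w - 1))"
      have \<eta>: "0 < \<eta>" using eta_pos by (simp add: \<eta>_def)
      have r: "0 < r" "r < 1" using \<eta> by (auto simp: r_def)
      have q: "cmod q = r" "q \<noteq> 0" by (simp_all add: q_def r_def)
      have "sqrt (cmod (w - 1)) \<le> sqrt ((1 / 160)\<^sup>2)" using a by (intro real_sqrt_le_mono) (simp add: power2_eq_square)
      then have \<delta>: "0 \<le> \<delta>" "\<delta> \<le> 1 / 80" by (simp_all add: \<delta>_def)
      have rr: "r / (1 - r) \<le> 1 / \<eta>"
      proof -
        have "r * (1 + \<eta>) \<le> r * exp \<eta>" using r by (intro mult_left_mono exp_ge_add_one_self) auto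
        then have "r * (1 + \<eta>) \<le> 1" by (simp add: r_def exp_add[symmetric])
        then show ?thesis using r \<eta> by (simp add: field_simps)
      qed
      have gap: "1 / (5 * \<eta>) \<le> r / (1 - r) - Re (q / (1 - q))"
        using elim(1) a by (simp add: \<eta>_def r_def q_def)
      have "cmod (arc_series (bar_gf t w) \<eta> s)
        \<le> (1 + \<delta>) * cmod (strict_gf (of_real r)) * exp (2 * \<delta> * (r / (1 - r)) - (r / (1 - r) - Re (q / (1 - q))) / 4)"
        unfolding arc_series_def q_def[symmetric] \<delta>_def q(1)[symmetric]
        by (rule norm_bar_count_gf_le) (use a q r in auto)
      also have "... \<le> (1 + \<delta>) * cmod (strict_gf (of_real r)) * exp (- (1 / 40) / \<eta>)"
      proof (intro mult_left_mono)
        have "2 * \<delta> * (r / (1 - r)) \<le> 2 * (1 / 80) * (1 / \<eta>)" using \<delta> rr r by (intro mult_mono) auto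
        moreover have "1 / (5 * \<eta>) / 4 = (1 / 20) * (1 / \<eta>)" "- (1 / 40) / \<eta> = - (1 / 40) * (1 / \<eta>)" by simp_all
        moreover have "1 / (5 * \<eta>) / 4 \<le> (r / (1 - r) - Re (q / (1 - q))) / 4" using gap by (rule divide_right_mono) simp
        ultimately have "2 * \<delta> * (r / (1 - r)) - (r / (1 - r) - Re (q / (1 - q))) / 4 \<le> - (1 / 40) / \<eta>" by argo
        then show "exp (2 * \<delta> * (r / (1 - r)) - (r / (1 - r) - Re (q / (1 - q))) / 4) \<le> exp (- (1 / 40) / \<eta>)"
          by (simp only: exp_le_cancel_iff)
      qed (use \<delta> in auto)
      finally have Z: "cmod (arc_series (bar_gf t w) \<eta> s)
        \<le> (1 + \<delta>) * cmod (strict_gf (of_real r)) * exp (- (1 / 40) / \<eta>)" .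
      have P: "cmod (strict_gf (of_real r)) * exp (real n * \<eta>) \<le> sp_W n * (3 / 2)"
      proof -
        have "strict_gf (of_real r) = saddle_ratio n 0 * exp (log_P_approx (zpt \<eta> 0))"
          by (simp add: saddle_ratio_def zpt_def \<eta>_def r_def exp_of_real[symmetric])
        then have "strict_gf (of_real r) * exp (of_nat n * zpt \<eta> 0) = saddle_ratio n 0 * (of_real (sp_W n) * kernel (nu n) 0)"
          unfolding saddle_identity_sp[symmetric] \<eta>_def by (simp add: mult.assoc)
        then have "cmod (strict_gf (of_real r)) * cmod (exp (of_nat n * zpt \<eta> 0)) = cmod (saddle_ratio n 0) * sp_W n"
          using sp_W_pos[of n] by (metis abs_of_pos kernel_def mult.right_neutral exp_zero div_0 mult_zero_right norm_mult norm_of_real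
              of_real_0 zero_power2 mult_zero_left)
        moreover have "cmod (exp (of_nat n * zpt \<eta> 0)) = exp (real n * \<eta>)" by simp
        moreover have "cmod (saddle_ratio n 0) \<le> 3 / 2"
        proof -
          have "(eta n)\<^sup>2 \<le> (1 / 100)\<^sup>2" using elim(2) eta_pos[of n] by (intro power_mono) auto
          then have "800 * (eta n)\<^sup>2 \<le> 1 / 2" by (simp add: power2_eq_square)
          then show ?thesis
            using saddle_ratio_bound[OF elim(2), of 0] norm_triangle_ineq[of "saddle_ratio n 0 - 1" 1] by simp
        qed
        ultimately show ?thesis using sp_W_pos[of n] by (simp add: mult.commute mult_left_mono)
      qed
      have "cmod (arc_series (bar_gf t w) \<eta> s) * exp (real n * \<eta>)
         \<le> (1 + \<delta>) * cmod (strict_gf (of_real r)) * exp (- (1 / 40) / \<eta>) * exp (real n * \<eta>)"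
        using Z by (rule mult_right_mono) simp
      also have "... = (1 + \<delta>) * (cmod (strict_gf (of_real r)) * exp (real n * \<eta>)) * exp (- (1 / 40) / \<eta>)" by (simp only: mult_ac)
      also have "... \<le> 2 * (sp_W n * (3 / 2)) * exp (- (1 / 40) / \<eta>)"
      proof (rule mult_right_mono)
        show "(1 + \<delta>) * (cmod (strict_gf (of_real r)) * exp (real n * \<eta>)) \<le> 2 * (sp_W n * (3 / 2))"
          by (rule mult_mono[OF _ P]) (use \<delta> in auto)
      qed simp
      finally show "cmod (arc_series (bar_gf t w) (eta n) s) * exp (real n * eta n)
          \<le> 3 * sp_W n * exp (- (1 / 40) / eta n)" by (simp add: \<eta>_def mult_ac)
    qed
  qed
qed

text \<open>On the arc \<bar>s\<bar> \<le> 1 the integrand is exactly \<open>sp_W n\<close> times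
  the kernel times a slowly varying factor. The two outer arcs have length at most pi / \<eta> each,
  whence the error term.\<close>

lemma coeff_arc_split:
  assumes \<eta>: "eta n \<le> 1" and sm: "summable (\<lambda>m. cmod (c m) * exp (- eta n) ^ m)"
    and B: "\<And>s. 1 \<le> \<bar>s\<bar> \<Longrightarrow> \<bar>s\<bar> \<le> pi / eta n \<Longrightarrow> cmod (arc_series c (eta n) s) * exp (real n * eta n) \<le> sp_W n * B"
    and B0: "B \<ge> 0"
  shows "cmod (c n * of_real (2 * pi / eta n / sp_W n)
    - integral {-1..1} (\<lambda>s. kernel (nu n) s * (arc_series c (eta n) s / exp (log_P_approx (zpt (eta n) s)))))
    \<le> 2 * (pi / eta n) * B"
proof -
  let ?\<eta> = "eta n" and ?W = "sp_W n"
  define f where "f s = arc_series c ?\<eta> s * exp (of_nat n * zpt ?\<eta> s)" for s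
  define T where "T = pi / ?\<eta>"
  have T: "1 \<le> T" using \<eta> eta_pos[of n] pi_gt3 by (simp add: T_def field_simps)
  have cont: "continuous_on A f" for A unfolding f_def by (intro continuous_intros continuous_on_arc_series sm)
  have int: "f integrable_on {a..b}" for a b by (intro integrable_continuous_interval cont)
  have "integral {- T..T} f = c n * of_real (2 * pi / ?\<eta>)"
    using coeff_integral[OF eta_pos sm, of n] unfolding f_def T_def by (intro integral_unique) simp
  moreover have "integral {- T..T} f = integral {- T..-1} f + integral {-1..1} f + integral {1..T} f"
  proof -
    have "integral {- T..-1} f + integral {-1..T} f = integral {- T..T} f" "integral {-1..1} f + integral {1..T} f = integral {-1..T} f"
      by (rule Henstock_Kurzweil_Integration.integral_combine; use T int in simp)+
    then show ?thesis by (simp only: add.assoc)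
  qed
  ultimately have "c n * of_real (2 * pi / ?\<eta>) = integral {- T..-1} f + integral {-1..1} f + integral {1..T} f" by (simp only:)
  then have eq: "c n * of_real (2 * pi / ?\<eta>) - integral {-1..1} f = integral {- T..-1} f + integral {1..T} f"
    by (simp only:) simp
  have fb: "cmod (f s) \<le> ?W * B" if "1 \<le> \<bar>s\<bar>" "\<bar>s\<bar> \<le> T" for s
    using B[OF that[unfolded T_def]] by (simp add: f_def norm_mult)
  have outer: "cmod (integral {a..b} f) \<le> T * (?W * B)" if "a \<le> b" "b - a \<le> T" "\<And>s. s \<in> {a..b} \<Longrightarrow> 1 \<le> \<bar>s\<bar> \<and> \<bar>s\<bar> \<le> T" for a b
  proof -
    have "cmod (integral {a..b} f) \<le> integral {a..b} (\<lambda>_. ?W * B)"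
      by (rule Henstock_Kurzweil_Integration.integral_norm_bound_integral[OF int]) (use fb that in auto)
    also have "... = (b - a) * (?W * B)" using that(1) by (simp add: content_real)
    also have "... \<le> T * (?W * B)" using that(2) sp_W_pos[of n] B0 by (intro mult_right_mono) auto
    finally show ?thesis .
  qed
  have "cmod (integral {- T..-1} f + integral {1..T} f) \<le> T * (?W * B) + T * (?W * B)"
    by (rule order.trans[OF norm_triangle_ineq add_mono[OF outer outer]]) (use T in auto)
  then have 1: "cmod (c n * of_real (2 * pi / ?\<eta>) - integral {-1..1} f) \<le> ?W * (2 * T * B)"
    unfolding eq by (simp add: mult_ac)
  have 2: "integral {-1..1} f = of_real ?W * integral {-1..1} (\<lambda>s. kernel (nu n) s * (arc_series c ?\<eta> s / exp (log_P_approx (zpt ?\<eta> s))))"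
  proof -
    have "f s = of_real ?W * (kernel (nu n) s * (arc_series c ?\<eta> s / exp (log_P_approx (zpt ?\<eta> s))))" for s
    proof -
      have "of_real ?W * kernel (nu n) s * (arc_series c ?\<eta> s / exp (log_P_approx (zpt ?\<eta> s))) = f s"
        unfolding saddle_identity_sp[symmetric] f_def by simp
      then show ?thesis by (simp add: mult.assoc)
    qed
    then have "f = (\<lambda>s. of_real ?W * (kernel (nu n) s * (arc_series c ?\<eta> s / exp (log_P_approx (zpt ?\<eta> s)))))" by (rule ext)
    then show ?thesis by (simp only: integral_mult_right)
  qed
  let ?I = "integral {-1..1} (\<lambda>s. kernel (nu n) s * (arc_series c ?\<eta> s / exp (log_P_approx (zpt ?\<eta> s))))"
  have "c n * of_real (2 * pi / ?\<eta> / ?W) - ?I = (c n * of_real (2 * pi / ?\<eta>) - integral {-1..1} f) / of_real ?W"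
    unfolding 2 using sp_W_pos[of n] by (simp add: diff_divide_distrib)
  then have "cmod (c n * of_real (2 * pi / ?\<eta> / ?W) - ?I) = cmod (c n * of_real (2 * pi / ?\<eta>) - integral {-1..1} f) / ?W"
    using sp_W_pos[of n] by (simp add: norm_divide)
  also have "... \<le> ?W * (2 * T * B) / ?W" using 1 sp_W_pos[of n] by (intro divide_right_mono) auto
  also have "... = 2 * T * B" using sp_W_pos[of n] by simp
  finally show ?thesis by (simp add: T_def)
qed

section \<open>Averages over strict partitions as ratios of arc integrals\<close>

abbreviation "qpt n s \<equiv> exp (- zpt (eta n) s)"
abbreviation "rnu n \<equiv> sqrt (nu n)"
abbreviation "sp_kint n F \<equiv> integral {-1..1} (\<lambda>s. kernel (nu n) s * F s)"
abbreviation "sp_kratio \<equiv> kratio nu"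

lemma strict_gf_eq_arc_series:
  "strict_gf (exp (- zpt \<eta> s)) = arc_series (\<lambda>m. strict_count m) \<eta> s"
  by (simp add: strict_gf_def arc_series_def)

lemma summable_card_strict_sets_exp:
  "\<eta> > 0 \<Longrightarrow> summable (\<lambda>m. cmod (strict_count m) * exp (- \<eta>) ^ m)"
  using summable_card_strict_sets[of "exp (- \<eta>)"] by simp

lemma continuous_on_strict_gf_zpt [continuous_intros]:
  "\<eta> > 0 \<Longrightarrow> continuous_on A (\<lambda>s. strict_gf (exp (- zpt \<eta> s)))"
  unfolding strict_gf_eq_arc_series by (intro continuous_on_arc_series summable_card_strict_sets_exp)

lemma continuous_on_saddle_ratio [continuous_intros]: "continuous_on A (saddle_ratio n)"
  unfolding saddle_ratio_def[abs_def] log_P_approx_def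
  by (intro continuous_intros eta_pos) (simp_all add: zpt_neq_0[OF eta_pos])

lemma minor_arc_strict_gf:
  "EV n. \<forall>s. 1 \<le> \<bar>s\<bar> \<and> \<bar>s\<bar> \<le> pi / eta n \<longrightarrow>
     cmod (strict_gf (qpt n s)) * exp (real n * eta n) \<le> 3 * sp_W n * exp (- (1 / 40) / eta n)"
  using minor_arc
proof eventually_elim
  case (elim n)
  show ?case
  proof (intro allI impI)
    fix s assume "1 \<le> \<bar>s\<bar> \<and> \<bar>s\<bar> \<le> pi / eta n"
    with elim[rule_format, of 1 1 s]
    show "cmod (strict_gf (qpt n s)) * exp (real n * eta n) \<le> 3 * sp_W n * exp (- (1 / 40) / eta n)"
      by (simp add: strict_gf_eq_arc_series strict_sum_1[abs_def])
  qed
qed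

lemma exp_eta_le:
  "\<exists>K. EV n. 2 * (pi / eta n) * (D * nu n ^ k * exp (- (1 / 40) / eta n)) \<le> K / rnu n ^ j"
proof -
  define a where "a = pi\<^sup>2 / 12"
  have a: "a > 0" by (simp add: a_def)
  have "EV n. exp (- (1 / (40 * a)) * nu n) \<le> 1 / rnu n ^ (2 * (k + 1) + j)"
    by (rule half_order_exp[OF nu_lim]) (use a in simp)
  then have "EV n. 2 * (pi / eta n) * (D * nu n ^ k * exp (- (1 / 40) / eta n))
      \<le> (2 * pi * \<bar>D\<bar> / a) / rnu n ^ j"
  proof eventually_elim
    case (elim n)
    define x where "x = nu n"
    have x: "x > 0" by (simp add: x_def nu_pos)
    have eta: "eta n = a / x" by (simp add: eta_def a_def x_def)
    have "sqrt x ^ (2 * (k + 1) + j) = x ^ (k + 1) * sqrt x ^ j"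
      using x by (simp only: power_add power_mult) simp
    then have e: "exp (- (1 / (40 * a)) * x) \<le> 1 / (x ^ (k + 1) * sqrt x ^ j)" using elim by (simp add: x_def)
    have "2 * (pi / eta n) * (D * nu n ^ k * exp (- (1 / 40) / eta n))
        = D * (2 * pi / a * x ^ (k + 1) * exp (- (1 / (40 * a)) * x))"
      using a x by (simp add: eta x_def[symmetric] field_simps)
    also have "... \<le> \<bar>D\<bar> * (2 * pi / a * x ^ (k + 1) * exp (- (1 / (40 * a)) * x))"
      using a x by (intro mult_right_mono) auto
    also have "... \<le> \<bar>D\<bar> * (2 * pi / a * x ^ (k + 1) * (1 / (x ^ (k + 1) * sqrt x ^ j)))"
      using a x by (intro mult_left_mono e) auto
    also have "... = (2 * pi * \<bar>D\<bar> / a) / sqrt x ^ j" using x by (simp add: field_simps)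
    finally show ?case by (simp add: x_def)
  qed
  then show ?thesis by blast
qed

text \<open>A factor \<open>F\<close> of size \<bar>s\<bar>^m + \<nu>^(-m/2) makes the normalised
  integral of order m. Replacing P by its approximation costs a relative error \<eta>^2, worth four
  more half orders, and the minor arcs are smaller than any power. The sequence \<open>c\<close> may
  vary with n, as the coefficients of centred statistics do.\<close>

lemma half_order_arc_integral:
  fixes c :: "nat \<Rightarrow> nat \<Rightarrow> complex" and F :: "nat \<Rightarrow> real \<Rightarrow> complex"
  assumes sm: "EV n. summable (\<lambda>m. cmod (c n m) * exp (- eta n) ^ m)"
    and eq: "EV n. \<forall>s. arc_series (c n) (eta n) s = strict_gf (qpt n s) * F n s"
    and cont: "EV n. continuous_on {-1..1} (F n)"
    and bound: "EV n. \<forall>s\<in>{-1..1}. cmod (F n s) \<le> C * (\<bar>s\<bar> ^ m + 1 / rnu n ^ m)"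
    and minor: "EV n. \<forall>s. cmod (F n s) \<le> D * nu n ^ k"
    and C: "C \<ge> 0" and D: "D \<ge> 0"
  shows "half_order nu (m + 4) (\<lambda>n. (c n n * of_real (2 * pi / eta n / sp_W n) - sp_kint n (F n)) / kmom (nu n) 0)"
    and "half_order nu m (\<lambda>n. sp_kint n (F n) / kmom (nu n) 0)"
proof -
  define a where "a = pi\<^sup>2 / 12"
  obtain K where K: "EV n. 2 * (pi / eta n) * ((3 * D) * nu n ^ k * exp (- (1 / 40) / eta n)) \<le> K / rnu n ^ (m + 5)"
    using exp_eta_le by blast
  define L where "L = 800 * C * a\<^sup>2 * (kmom_const m + kmom_const 0)"
  have small: "EV n. eta n \<le> 1 / 100" by (rule eventually_eta_small) simp
  have "EV n. cmod (c n n * of_real (2 * pi / eta n / sp_W n) - sp_kint n (F n)) \<le> (K + L) / rnu n ^ (m + 4 + 1)"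
    using K sm eq cont bound minor minor_arc_strict_gf small
  proof eventually_elim
    case (elim n)
    define x where "x = nu n"
    have x: "x > 0" by (simp add: x_def nu_pos)
    have eta: "eta n = a / x" by (simp add: eta_def a_def x_def)
    let ?G = "saddle_ratio n"
    have GF: "arc_series (c n) (eta n) s / exp (log_P_approx (zpt (eta n) s)) = ?G s * F n s" for s
      using elim(3) by (simp add: saddle_ratio_def)
    have 1: "cmod (c n n * of_real (2 * pi / eta n / sp_W n) - sp_kint n (\<lambda>s. ?G s * F n s))
      \<le> 2 * (pi / eta n) * ((3 * D) * nu n ^ k * exp (- (1 / 40) / eta n))"
      unfolding GF[symmetric]
    proof (rule coeff_arc_split)
      fix s assume s: "1 \<le> \<bar>s\<bar>" "\<bar>s\<bar> \<le> pi / eta n"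
      have "cmod (arc_series (c n) (eta n) s) * exp (real n * eta n)
        = (cmod (strict_gf (qpt n s)) * exp (real n * eta n)) * cmod (F n s)"
        using elim(3) by (simp add: norm_mult)
      also have "... \<le> (3 * sp_W n * exp (- (1 / 40) / eta n)) * (D * nu n ^ k)"
      proof (rule mult_mono)
        show "cmod (strict_gf (qpt n s)) * exp (real n * eta n) \<le> 3 * sp_W n * exp (- (1 / 40) / eta n)"
          using elim(7) s by blast
      qed (use elim(6) sp_W_pos[of n] in auto)
      finally show "cmod (arc_series (c n) (eta n) s) * exp (real n * eta n)
        \<le> sp_W n * ((3 * D) * nu n ^ k * exp (- (1 / 40) / eta n))" by (simp add: mult_ac)
    qed (use elim nu_pos[of n] D in \<open>auto simp: less_imp_le\<close>)
    have i: "(\<lambda>s. kernel (nu n) s * (?G s * F n s)) integrable_on {-1..1}" "(\<lambda>s. kernel (nu n) s * F n s) integrable_on {-1..1}"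
      by (intro integrable_continuous_interval continuous_intros elim(4))+
    have "sp_kint n (\<lambda>s. ?G s * F n s) - sp_kint n (F n) = sp_kint n (\<lambda>s. (?G s - 1) * F n s)"
      unfolding Henstock_Kurzweil_Integration.integral_diff[OF i, symmetric] by (simp add: algebra_simps)
    also have "cmod ... \<le> ((800 * (eta n)\<^sup>2 * C) * kmom_const m + (800 * (eta n)\<^sup>2 * C) * kmom_const 0) / rnu n ^ (m + 1)"
    proof (rule norm_integral_kernel_le[OF nu_pos])
      show "continuous_on {-1..1} (\<lambda>s. (?G s - 1) * F n s)" by (intro continuous_intros elim(4))
      fix s :: real assume s: "s \<in> {-1..1}"
      have "cmod ((?G s - 1) * F n s) \<le> (800 * (eta n)\<^sup>2) * (C * (\<bar>s\<bar> ^ m + 1 / rnu n ^ m))"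
        unfolding norm_mult using saddle_ratio_bound[OF elim(8) s] elim(5) s by (intro mult_mono) auto
      then show "cmod ((?G s - 1) * F n s) \<le> (800 * (eta n)\<^sup>2 * C) * \<bar>s\<bar> ^ m + (800 * (eta n)\<^sup>2 * C) / rnu n ^ m"
        by (simp add: distrib_left mult_ac)
    qed (use C in auto)
    also have "... = L / sqrt x ^ (m + 5)"
    proof -
      have "sqrt x ^ (m + 5) = sqrt x ^ (m + 1) * x\<^sup>2"
      proof -
        have "sqrt x ^ (m + 5) = sqrt x ^ (m + 1) * ((sqrt x)\<^sup>2)\<^sup>2" by (simp only: power_add[symmetric] power_mult[symmetric]) (simp add: add.commute)
        then show ?thesis using x by simp
      qed
      then show ?thesis using x by (simp add: L_def eta x_def[symmetric] field_simps)
    qed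
    finally have 2: "cmod (sp_kint n (\<lambda>s. ?G s * F n s) - sp_kint n (F n)) \<le> L / rnu n ^ (m + 5)" by (simp add: x_def)
    have "cmod (c n n * of_real (2 * pi / eta n / sp_W n) - sp_kint n (F n))
      \<le> cmod (c n n * of_real (2 * pi / eta n / sp_W n) - sp_kint n (\<lambda>s. ?G s * F n s)) + cmod (sp_kint n (\<lambda>s. ?G s * F n s) - sp_kint n (F n))"
      by (rule norm_diff_triangle_le[OF order.refl order.refl])
    also have "... \<le> K / rnu n ^ (m + 5) + L / rnu n ^ (m + 5)"
      using 1 2 elim(1) by linarith
    also have "... = (K + L) / rnu n ^ (m + 4 + 1)" by (simp add: add_divide_distrib add.commute)
    finally show ?case .
  qed
  then show "half_order nu (m + 4) (\<lambda>n. (c n n * of_real (2 * pi / eta n / sp_W n) - sp_kint n (F n)) / kmom (nu n) 0)"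
    by (rule half_order_integral_ratio[OF nu_lim])
  have "EV n. cmod (sp_kint n (F n)) \<le> (C * kmom_const m + C * kmom_const 0) / rnu n ^ (m + 1)"
    using cont bound
  proof eventually_elim
    case (elim n)
    then show ?case by (intro norm_integral_kernel_le[OF nu_pos] C) (auto simp: distrib_left)
  qed
  then show "half_order nu m (\<lambda>n. sp_kint n (F n) / kmom (nu n) 0)"
    by (rule half_order_integral_ratio[OF nu_lim])
qed

lemma kmom_0_neq_0: "EV n. kmom (nu n) 0 \<noteq> 0"
  using eventually_norm_kmom_0_ge[OF nu_lim]
proof eventually_elim
  case (elim n)
  have "0 < 1 / rnu n" using nu_pos by simp
  with elim show ?case by auto
qed

lemma half_order_card_ratio:
  "half_order nu 4 (\<lambda>n. (strict_count n * of_real (2 * pi / eta n / sp_W n)) / kmom (nu n) 0 - 1)"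
proof -
  have "half_order nu (0 + 4) (\<lambda>n. (strict_count n * of_real (2 * pi / eta n / sp_W n) - sp_kint n (\<lambda>_. 1)) / kmom (nu n) 0)"
    by (rule half_order_arc_integral(1)[where C = 1 and D = 1 and k = 0])
       (auto simp: strict_gf_eq_arc_series summable_card_strict_sets_exp[OF eta_pos, simplified])
  moreover have "EV n. (strict_count n * of_real (2 * pi / eta n / sp_W n) - sp_kint n (\<lambda>_. 1)) / kmom (nu n) 0
     = (strict_count n * of_real (2 * pi / eta n / sp_W n)) / kmom (nu n) 0 - 1"
    using kmom_0_neq_0 by eventually_elim (simp add: diff_divide_distrib kmom_def)
  ultimately show ?thesis using half_order_cong by fastforce
qed

text \<open>Numerator and denominator carry the same scaling \<kappa>. With e the error of the
  numerator and \<tau> the relative error of the count, the difference is (e - Y \<tau>) / (1 +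
  \<tau>); here Y has m half orders and \<tau> has four, so the product is as small as e.\<close>

lemma half_order_expectation:
  fixes c :: "nat \<Rightarrow> nat \<Rightarrow> complex" and F :: "nat \<Rightarrow> real \<Rightarrow> complex"
  assumes sm: "EV n. summable (\<lambda>m. cmod (c n m) * exp (- eta n) ^ m)"
    and eq: "EV n. \<forall>s. arc_series (c n) (eta n) s = strict_gf (qpt n s) * F n s"
    and cont: "EV n. continuous_on {-1..1} (F n)"
    and bound: "EV n. \<forall>s\<in>{-1..1}. cmod (F n s) \<le> C * (\<bar>s\<bar> ^ m + 1 / rnu n ^ m)"
    and minor: "EV n. \<forall>s. cmod (F n s) \<le> D * nu n ^ k"
    and C: "C \<ge> 0" and D: "D \<ge> 0"
  shows "half_order nu (m + 4) (\<lambda>n. c n n / strict_count n - sp_kint n (F n) / kmom (nu n) 0)"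
proof -
  define Y where "Y n = sp_kint n (F n) / kmom (nu n) 0" for n
  define \<kappa> where "\<kappa> n = complex_of_real (2 * pi / eta n / sp_W n)" for n
  define e where "e n = (c n n * \<kappa> n - sp_kint n (F n)) / kmom (nu n) 0" for n
  define \<tau> where "\<tau> n = (strict_count n * \<kappa> n) / kmom (nu n) 0 - 1" for n
  have ho: "half_order nu (m + 4) e" "half_order nu m Y" "half_order nu 4 \<tau>"
    unfolding e_def Y_def \<tau>_def \<kappa>_def
    using half_order_arc_integral[OF assms] half_order_card_ratio by auto
  have \<tau>: "\<tau> \<longlonglongrightarrow> 0" using half_order_tendsto_0[OF nu_lim, of 3 \<tau>] ho(3) by simp
  then have "EV n. cmod (\<tau> n) < 1 / 2" using tendstoD[OF \<tau>, of "1 / 2"] by simp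
  then have half: "EV n. cmod (1 / (1 + \<tau> n)) \<le> 2 / rnu n ^ 0 \<and> 1 + \<tau> n \<noteq> 0"
  proof eventually_elim
    case (elim n)
    have "1 / 2 \<le> cmod (1 + \<tau> n)" using elim norm_triangle_ineq4[of "1 + \<tau> n" "\<tau> n"] by simp
    moreover have "1 / cmod (1 + \<tau> n) \<le> 1 / (1 / 2)" by (rule divide_left_mono) (use calculation in auto)
    ultimately show ?case by (auto simp: norm_divide)
  qed
  have "half_order nu 0 (\<lambda>n. 1 / (1 + \<tau> n))"
    unfolding half_order_def by (rule exI[of _ 2]) (use half in eventually_elim, simp)
  then have "half_order nu (m + 4 + 0) (\<lambda>n. (e n - Y n * \<tau> n) * (1 / (1 + \<tau> n)))"
    by (intro half_order_mult half_order_diff ho)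
  moreover have "EV n. (e n - Y n * \<tau> n) * (1 / (1 + \<tau> n)) = c n n / strict_count n - Y n"
    using half kmom_0_neq_0
  proof eventually_elim
    case (elim n)
    note k0 = elim(2)
    have card: "strict_count n \<noteq> (0 :: complex)" using card_strict_sets_pos[of n] by simp
    have \<kappa>: "\<kappa> n \<noteq> 0" using eta_pos[of n] sp_W_pos[of n] by (simp add: \<kappa>_def)
    have "c n n / strict_count n = (Y n + e n) / (1 + \<tau> n)"
      using k0 card \<kappa> by (simp add: Y_def e_def \<tau>_def add_divide_distrib[symmetric])
    then show ?case using elim(1) by (simp add: field_simps)
  qed
  ultimately show ?thesis unfolding Y_def using half_order_cong by fastforce
qed

lemma exp_minus_half_le:
  fixes x :: real
  assumes "0 < x" "x \<le> 1"
  shows "x / 2 \<le> 1 - exp (- x)"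
proof -
  have "1 + x \<le> exp x" by (rule exp_ge_add_one_self)
  then have "exp (- x) \<le> 1 / (1 + x)" using assms by (simp add: exp_minus field_simps)
  also have "... \<le> 1 - x / 2" using assms by (simp add: field_simps power2_eq_square)
  finally show ?thesis by simp
qed

section \<open>Mean and variance\<close>

lemma half_order_mult_nu:
  assumes \<nu>: "filterlim \<nu> at_top sequentially" and "half_order \<nu> (k + 2) f"
  shows "half_order \<nu> k (\<lambda>n. of_real (\<nu> n) * f n)"
proof -
  obtain C where C: "EV n. cmod (f n) \<le> C / sqrt (\<nu> n) ^ (k + 2)"
    using assms(2) by (auto simp: half_order_def)
  have "EV n. cmod (of_real (\<nu> n) * f n) \<le> C / sqrt (\<nu> n) ^ k"
    using C eventually_nu_ge[OF \<nu>, of 1]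
  proof eventually_elim
    case (elim n)
    have "\<nu> n * cmod (f n) \<le> \<nu> n * (C / sqrt (\<nu> n) ^ (k + 2))" using elim by (intro mult_left_mono) auto
    also have "sqrt (\<nu> n) ^ (k + 2) = sqrt (\<nu> n) ^ k * \<nu> n" using elim(2) by (simp only: power_add) simp
    also have "\<nu> n * (C / (sqrt (\<nu> n) ^ k * \<nu> n)) = C / sqrt (\<nu> n) ^ k" using elim(2) by simp
    finally show ?case using elim(2) by (simp add: norm_mult)
  qed
  then show ?thesis unfolding half_order_def by blast
qed

text \<open>An average against the complex weight \<open>kernel\<close>. By
  \<open>half_order_expectation\<close> it replaces averages over strict partitions.\<close>

definition sp_avg :: "nat \<Rightarrow> (real \<Rightarrow> complex) \<Rightarrow> complex" where
  "sp_avg n F = sp_kint n F / kmom (nu n) 0"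

lemma sp_avg_add:
  assumes "continuous_on {-1..1} F" "continuous_on {-1..1} G"
  shows "sp_avg n (\<lambda>s. F s + G s) = sp_avg n F + sp_avg n G"
proof -
  have "(\<lambda>s. kernel (nu n) s * F s) integrable_on {-1..1}" "(\<lambda>s. kernel (nu n) s * G s) integrable_on {-1..1}"
    by (intro integrable_continuous_interval continuous_intros assms)+
  then show ?thesis
    by (simp add: sp_avg_def distrib_left Henstock_Kurzweil_Integration.integral_add add_divide_distrib)
qed

lemma sp_avg_cmult: "sp_avg n (\<lambda>s. c * F s) = c * sp_avg n F"
  unfolding sp_avg_def mult.left_commute[of "kernel (nu n) _" c] by simp

lemma sp_avg_kern_b: "sp_avg n (\<lambda>s. kern_b s ^ m) = sp_kratio m n"
  by (simp add: sp_avg_def kratio_def[OF nu_lim] kmom_def)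

lemma sp_kratio_0: "EV n. sp_kratio 0 n = 1"
  using kmom_0_neq_0 by eventually_elim (simp add: kratio_def[OF nu_lim])

lemma half_order_sp_avg:
  assumes cont: "EV n. continuous_on {-1..1} (e n)"
    and le: "EV n. \<forall>s\<in>{-1..1}. cmod (e n s) \<le> C / rnu n ^ j * \<bar>s\<bar> ^ m" and C: "C \<ge> 0"
  shows "half_order nu (j + m) (\<lambda>n. sp_avg n (e n))"
proof -
  have "EV n. cmod (sp_kint n (e n)) \<le> C * kmom_const m / rnu n ^ (j + m + 1)"
    using assms(1,2)
  proof eventually_elim
    case (elim n)
    have "cmod (sp_kint n (e n)) \<le> (C / rnu n ^ j * kmom_const m + 0 * kmom_const 0) / rnu n ^ (m + 1)"
      by (rule norm_integral_kernel_le[OF nu_pos elim(1)]) (use elim(2) C nu_pos[of n] in auto)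
    also have "... = C * kmom_const m / rnu n ^ (j + m + 1)" by (simp add: power_add)
    finally show ?case .
  qed
  then show ?thesis unfolding sp_avg_def by (rule half_order_integral_ratio[OF nu_lim])
qed

text \<open>On the arc \<open>F\<close> is a quotient of two power series. The denominator has no
  zero there, because \<open>saddle_ratio\<close> is close to 1.\<close>

lemma continuous_on_arc_ratio:
  assumes "eta n \<le> 1 / 100" "summable (\<lambda>m. cmod (c m) * exp (- eta n) ^ m)"
    and "\<And>s. arc_series c (eta n) s = strict_gf (qpt n s) * F s"
  shows "continuous_on {-1..1} F"
proof -
  have nz: "strict_gf (qpt n s) \<noteq> 0" if "s \<in> {-1..1}" for s
  proof
    assume "strict_gf (qpt n s) = 0"
    then have "1 \<le> 800 * (eta n)\<^sup>2" using saddle_ratio_bound[OF assms(1) that] by (simp add: saddle_ratio_def)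
    moreover have "(eta n)\<^sup>2 \<le> (1 / 100)\<^sup>2" using assms(1) eta_pos[of n] by (intro power_mono) auto
    ultimately show False by (simp add: power2_eq_square)
  qed
  have "continuous_on {-1..1} (\<lambda>s. arc_series c (eta n) s / strict_gf (qpt n s))"
    using nz by (intro continuous_intros continuous_on_arc_series assms(2) eta_pos) auto
  then show ?thesis
    by (rule continuous_on_eq) (use nz assms(3) in simp)
qed

lemma bar_count_quadratic_bound:
  assumes "S \<in> strict_sets n"
  shows "cmod (of_nat (bar_count t S)) \<le> (2 * real n + 1)\<^sup>2"
    and "cmod (of_nat (bar_count t S) * (of_nat (bar_count t S) - 1)) \<le> (2 * real n + 1)\<^sup>2"
proof -
  define b where "b = real (bar_count t S)"
  have b: "0 \<le> b" "b \<le> 2 * real n" using bar_count_le[OF assms, of t] by (auto simp: b_def)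
  have "2 * real n + 1 \<le> (2 * real n + 1)\<^sup>2" by (rule self_le_power) auto
  then show "cmod (of_nat (bar_count t S)) \<le> (2 * real n + 1)\<^sup>2" using b by (simp add: b_def)
  have "\<bar>b\<bar> * \<bar>b - 1\<bar> \<le> (2 * real n + 1) * (2 * real n + 1)" using b by (intro mult_mono) auto
  moreover have "cmod (complex_of_real b * (complex_of_real b - 1)) = \<bar>b\<bar> * \<bar>b - 1\<bar>"
    by (metis norm_mult norm_of_real of_real_1 of_real_diff)
  ultimately show "cmod (of_nat (bar_count t S) * (of_nat (bar_count t S) - 1)) \<le> (2 * real n + 1)\<^sup>2"
    by (simp add: b_def power2_eq_square)
qed

section \<open>Coefficient sequences of the moments and their expansions on the arc\<close>

context
  fixes t :: nat assumes t_pos: "t > 0"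
begin

text \<open>Sums of a quadratic polynomial in the bar count, written with the falling factorial. The
  coefficients \<open>p\<close>, \<open>u\<close>, \<open>v\<close> stay free because centring and
  scaling will make them depend on n.\<close>

definition bar_sum :: "complex \<Rightarrow> complex \<Rightarrow> complex \<Rightarrow> nat \<Rightarrow> complex" where
  "bar_sum p u v m = p * bar_sum2 t m
     + u * bar_sum1 t m + v * strict_sum (\<lambda>_. 1) m"

lemma summable_strict_sums:
  assumes "0 \<le> r" "r < 1"
  shows "summable (\<lambda>m. cmod (bar_sum2 t m) * r ^ m)"
    and "summable (\<lambda>m. cmod (bar_sum1 t m) * r ^ m)"
    and "summable (\<lambda>m. cmod (strict_sum (\<lambda>_. 1) m) * r ^ m)"
  by (rule summable_strict_sum; use assms bar_count_quadratic_bound one_le_quadratic in simp)+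

lemma summable_bar_sum:
  assumes r: "0 \<le> r" "r < 1"
  shows "summable (\<lambda>m. cmod (bar_sum p u v m) * r ^ m)"
proof (rule summable_comparison_test'[where N = 0])
  note S = summable_strict_sums[OF r]
  show "summable (\<lambda>m. cmod p * (cmod (bar_sum2 t m) * r ^ m)
    + cmod u * (cmod (bar_sum1 t m) * r ^ m) + cmod v * (cmod (strict_sum (\<lambda>_. 1) m) * r ^ m))"
    by (intro summable_add summable_mult S)
  fix m
  have "cmod (bar_sum p u v m) \<le> cmod p * cmod (bar_sum2 t m)
    + cmod u * cmod (bar_sum1 t m) + cmod v * cmod (strict_sum (\<lambda>_. 1) m)"
    unfolding bar_sum_def norm_mult[symmetric] by (intro norm_triangle_le add_right_mono norm_triangle_ineq)
  then have "cmod (bar_sum p u v m) * r ^ m \<le> (cmod p * cmod (bar_sum2 t m)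
    + cmod u * cmod (bar_sum1 t m) + cmod v * cmod (strict_sum (\<lambda>_. 1) m)) * r ^ m"
    using r by (intro mult_right_mono) auto
  then show "norm (cmod (bar_sum p u v m) * r ^ m)
    \<le> cmod p * (cmod (bar_sum2 t m) * r ^ m)
    + cmod u * (cmod (bar_sum1 t m) * r ^ m) + cmod v * (cmod (strict_sum (\<lambda>_. 1) m) * r ^ m)"
    using r by (simp add: abs_mult distrib_right mult.assoc)
qed

abbreviation "A_arc n s \<equiv> hook_mean t (qpt n s)"
abbreviation "C_arc n s \<equiv> hook_corr t (qpt n s)"

lemma arc_series_bar_sum:
  "arc_series (bar_sum p u v) (eta n) s = strict_gf (qpt n s) * (p * ((A_arc n s)\<^sup>2 - C_arc n s) + u * A_arc n s + v)"
proof -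
  define q where "q = qpt n s"
  have q: "cmod q < 1" using eta_pos[of n] by (simp add: q_def)
  have S: "summable (\<lambda>m. strict_sum g m * q ^ m)" if "summable (\<lambda>m. cmod (strict_sum g m) * cmod q ^ m)" for g
    by (rule summable_norm_cancel) (use that in \<open>simp add: norm_mult norm_power\<close>)
  note sm = S[OF summable_strict_sums(1)[OF norm_ge_zero q]] S[OF summable_strict_sums(2)[OF norm_ge_zero q]]
    S[OF summable_strict_sums(3)[OF norm_ge_zero q]]
  have "arc_series (bar_sum p u v) (eta n) s = (\<Sum>m. p * (bar_sum2 t m * q ^ m)
    + u * (bar_sum1 t m * q ^ m) + v * (strict_sum (\<lambda>_. 1) m * q ^ m))"
    unfolding arc_series_def q_def[symmetric] bar_sum_def by (simp add: distrib_right mult.assoc)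
  also have "... = p * (\<Sum>m. bar_sum2 t m * q ^ m)
    + u * (\<Sum>m. bar_sum1 t m * q ^ m) + v * (\<Sum>m. strict_sum (\<lambda>_. 1) m * q ^ m)"
    by (simp only: suminf_add[OF summable_add[OF summable_mult[OF sm(1)] summable_mult[OF sm(2)]] summable_mult[OF sm(3)], symmetric]
      suminf_add[OF summable_mult[OF sm(1)] summable_mult[OF sm(2)], symmetric] suminf_mult[OF sm(1)] suminf_mult[OF sm(2)] suminf_mult[OF sm(3)])
  also have "(\<Sum>m. bar_sum2 t m * q ^ m) = strict_gf q * ((hook_mean t q)\<^sup>2 - hook_corr t q)"
    by (rule suminf_bar_count_factorial2[OF t_pos q tendsto_bead_sum1[OF t_pos q] tendsto_bead_sum2[OF t_pos q]])
  also have "(\<Sum>m. bar_sum1 t m * q ^ m) = strict_gf q * hook_mean t q"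
    by (rule suminf_bar_count[OF t_pos q tendsto_bead_sum1[OF t_pos q]])
  also have "(\<Sum>m. strict_sum (\<lambda>_. 1) m * q ^ m) = strict_gf q" by (simp add: strict_gf_def strict_sum_1)
  finally show ?thesis unfolding q_def by (simp add: algebra_simps)
qed

text \<open>The mean of the bar count at the saddle point serves as the centre. It differs from the
  exact mean by a bounded amount only.\<close>

definition sp_mean :: "nat \<Rightarrow> complex" where "sp_mean n = hook_mean t (exp (- of_real (eta n)))"

lemma sp_mean_eq: "sp_mean n = A_arc n 0"
  by (simp add: sp_mean_def zpt_def)

definition hook_mean_const :: complex where
  "hook_mean_const = - of_nat t / 4 + 1 / 4 - (if even t then 1 / 8 else 0)"

definition hook_corr_const :: complex where
  "hook_corr_const = (if even t then 1 / 32 else 0)"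

lemma norm_zpt_le: "s \<in> {-1..1} \<Longrightarrow> \<eta> > 0 \<Longrightarrow> cmod (zpt \<eta> s) \<le> 2 * \<eta>"
proof -
  assume s: "s \<in> {-1..1}" and \<eta>: "\<eta> > 0"
  have "cmod (1 + \<i> * of_real s) \<le> 2" using norm_triangle_ineq[of 1 "\<i> * of_real s"] s by (auto simp: norm_mult)
  then show ?thesis using \<eta> by (simp add: zpt_def norm_mult)
qed

text \<open>In the second estimate only a difference of values of A occurs. The constant of the pole
  expansion drops out, and the Lipschitz bound applied to z - \<eta> = i \<eta> s leaves \<eta>
  \<bar>s\<bar>; the prefactor \<eta> makes this \<eta>^2 \<bar>s\<bar>.\<close>

lemma sp_mean_expansion: "half_order nu 2 (\<lambda>n. sp_mean n - (1 / (2 * of_real (eta n)) + hook_mean_const))"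
  and hook_mean_arc_expansion: "\<exists>C\<ge>0. EV n. \<forall>s\<in>{-1..1}.
    cmod (of_real (eta n) * (A_arc n s - sp_mean n) - kern_b s / 2) \<le> C * (eta n)\<^sup>2 * \<bar>s\<bar>"
proof -
  from pole_expansion_hook_mean[OF t_pos, folded hook_mean_const_def]
  obtain C \<rho> where C: "\<rho> > 0" "C \<ge> 0"
    "\<And>z w. 0 < cmod z \<Longrightarrow> cmod z < \<rho> \<Longrightarrow> 0 < cmod w \<Longrightarrow> cmod w < \<rho> \<Longrightarrow>
      cmod ((hook_mean t (exp (- z)) - (1 / 2) / z) - (hook_mean t (exp (- w)) - (1 / 2) / w)) \<le> C * cmod (z - w)"
    "\<And>z. 0 < cmod z \<Longrightarrow> cmod z < \<rho> \<Longrightarrow> cmod (hook_mean t (exp (- z)) - (1 / 2) / z - hook_mean_const) \<le> C * cmod z"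
    by (rule pole_expansionE) (rule that; assumption)
  have small: "EV n. eta n \<le> \<rho> / 3" by (rule eventually_eta_small) (use C in simp)
  have "EV n. cmod (sp_mean n - (1 / (2 * of_real (eta n)) + hook_mean_const)) \<le> (C * (pi\<^sup>2 / 12)) / rnu n ^ 2"
    using small
  proof eventually_elim
    case (elim n)
    have "cmod (hook_mean t (exp (- of_real (eta n))) - (1 / 2) / of_real (eta n) - hook_mean_const) \<le> C * cmod (of_real (eta n))"
      by (rule C(4)) (use elim eta_pos[of n] C(1) in simp_all)
    then show ?case using eta_pos[of n] nu_pos[of n]
      by (simp add: sp_mean_def algebra_simps) (simp add: eta_def)
  qed
  then show "half_order nu 2 (\<lambda>n. sp_mean n - (1 / (2 * of_real (eta n)) + hook_mean_const))"
    unfolding half_order_def by blast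
  have "EV n. \<forall>s\<in>{-1..1}.
    cmod (of_real (eta n) * (A_arc n s - sp_mean n) - kern_b s / 2) \<le> C * (eta n)\<^sup>2 * \<bar>s\<bar>"
    using small
  proof eventually_elim
    case (elim n)
    show ?case
    proof
      fix s :: real assume s: "s \<in> {-1..1}"
      define h where "h = complex_of_real (eta n)"
      have h: "h \<noteq> 0" "cmod h = eta n" using eta_pos[of n] by (simp_all add: h_def)
      have z: "zpt (eta n) s = h * (1 + \<i> * of_real s)" by (simp add: zpt_def h_def)
      have "cmod ((A_arc n s - (1 / 2) / zpt (eta n) s) - (hook_mean t (exp (- h)) - (1 / 2) / h)) \<le> C * cmod (zpt (eta n) s - h)"
        by (rule C(3)) (use elim eta_pos[of n] C(1) zpt_neq_0[of "eta n" s] norm_zpt_le[OF s, of "eta n"] h in auto)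
      moreover have "zpt (eta n) s - h = h * (\<i> * of_real s)" by (simp add: z algebra_simps)
      ultimately have le: "cmod ((A_arc n s - (1 / 2) / zpt (eta n) s) - (sp_mean n - (1 / 2) / h)) \<le> C * (eta n * \<bar>s\<bar>)"
        by (simp add: norm_mult h sp_mean_def h_def[symmetric])
      have "h * (A_arc n s - sp_mean n) - kern_b s / 2
        = h * ((A_arc n s - (1 / 2) / zpt (eta n) s) - (sp_mean n - (1 / 2) / h))"
      proof -
        define u where "u = 1 + \<i> * complex_of_real s"
        have "u \<noteq> 0" by (simp add: u_def)
        then show ?thesis using h(1) unfolding z kern_b_def u_def[symmetric] by (simp add: field_simps)
      qed
      then have "cmod (h * (A_arc n s - sp_mean n) - kern_b s / 2)
        = eta n * cmod ((A_arc n s - (1 / 2) / zpt (eta n) s) - (sp_mean n - (1 / 2) / h))"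
        by (simp add: norm_mult h)
      also have "... \<le> eta n * (C * (eta n * \<bar>s\<bar>))" using le eta_pos[of n] by (intro mult_left_mono) auto
      finally show "cmod (of_real (eta n) * (A_arc n s - sp_mean n) - kern_b s / 2) \<le> C * (eta n)\<^sup>2 * \<bar>s\<bar>"
        by (simp add: h_def power2_eq_square mult_ac)
    qed
  qed
  then show "\<exists>C\<ge>0. EV n. \<forall>s\<in>{-1..1}.
    cmod (of_real (eta n) * (A_arc n s - sp_mean n) - kern_b s / 2) \<le> C * (eta n)\<^sup>2 * \<bar>s\<bar>"
    using C(2) by blast
qed

text \<open>No difference along the arc is taken here, so the constant of the expansion stays; it
  becomes the parity term of the variance.\<close>

lemma hook_corr_arc_expansion: "\<exists>C\<ge>0. EV n. \<forall>s\<in>{-1..1}.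
    cmod ((of_real (eta n))\<^sup>2 * (A_arc n s - C_arc n s)
      - (of_real (eta n) * (1 + kern_b s) / 4 + (of_real (eta n))\<^sup>2 * hook_corr_const)) \<le> C * (eta n) ^ 3"
proof -
  from pole_expansion_hook_mean_minus_corr[OF t_pos, folded hook_corr_const_def]
  obtain C \<rho> where C: "\<rho> > 0" "C \<ge> 0"
    "\<And>z. 0 < cmod z \<Longrightarrow> cmod z < \<rho> \<Longrightarrow> cmod (hook_mean t (exp (- z)) - hook_corr t (exp (- z)) - (1 / 4) / z - hook_corr_const) \<le> C * cmod z"
    by (rule pole_expansionE) (rule that; assumption)
  have small: "EV n. eta n \<le> \<rho> / 3" by (rule eventually_eta_small) (use C in simp)
  have "EV n. \<forall>s\<in>{-1..1}.
    cmod ((of_real (eta n))\<^sup>2 * (A_arc n s - C_arc n s)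
      - (of_real (eta n) * (1 + kern_b s) / 4 + (of_real (eta n))\<^sup>2 * hook_corr_const)) \<le> (2 * C) * (eta n) ^ 3"
    using small
  proof eventually_elim
    case (elim n)
    show ?case
    proof
      fix s :: real assume s: "s \<in> {-1..1}"
      define h where "h = complex_of_real (eta n)"
      have h: "h \<noteq> 0" "cmod h = eta n" using eta_pos[of n] by (simp_all add: h_def)
      have z: "zpt (eta n) s = h * (1 + \<i> * of_real s)" by (simp add: zpt_def h_def)
      have "cmod (A_arc n s - C_arc n s - (1 / 4) / zpt (eta n) s - hook_corr_const) \<le> C * cmod (zpt (eta n) s)"
        by (rule C(3)) (use elim eta_pos[of n] C(1) zpt_neq_0[of "eta n" s] norm_zpt_le[OF s, of "eta n"] h in auto)
      also have "... \<le> C * (2 * eta n)" using norm_zpt_le[OF s eta_pos] C(2) by (intro mult_left_mono) auto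
      finally have le: "cmod (A_arc n s - C_arc n s - (1 / 4) / zpt (eta n) s - hook_corr_const) \<le> C * (2 * eta n)" .
      have "h\<^sup>2 * (A_arc n s - C_arc n s) - (h * (1 + kern_b s) / 4 + h\<^sup>2 * hook_corr_const)
        = h\<^sup>2 * (A_arc n s - C_arc n s - (1 / 4) / zpt (eta n) s - hook_corr_const)"
      proof -
        define u where "u = 1 + \<i> * complex_of_real s"
        have "u \<noteq> 0" by (simp add: u_def)
        then show ?thesis using h(1) unfolding z kern_b_def u_def[symmetric] by (simp add: field_simps power2_eq_square)
      qed
      then have "cmod (h\<^sup>2 * (A_arc n s - C_arc n s) - (h * (1 + kern_b s) / 4 + h\<^sup>2 * hook_corr_const))
        = (eta n)\<^sup>2 * cmod (A_arc n s - C_arc n s - (1 / 4) / zpt (eta n) s - hook_corr_const)"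
        by (simp add: norm_mult norm_power h)
      also have "... \<le> (eta n)\<^sup>2 * (C * (2 * eta n))" using le by (intro mult_left_mono) auto
      finally show "cmod ((of_real (eta n))\<^sup>2 * (A_arc n s - C_arc n s)
          - (of_real (eta n) * (1 + kern_b s) / 4 + (of_real (eta n))\<^sup>2 * hook_corr_const)) \<le> (2 * C) * (eta n) ^ 3"
        by (simp add: h_def power2_eq_square power3_eq_cube mult_ac)
    qed
  qed
  then show ?thesis using C(2) by (intro exI[of _ "2 * C"]) auto
qed

lemma hook_arc_polynomial_bound:
  "\<exists>K\<ge>0. EV n. \<forall>s. cmod (A_arc n s) \<le> K * nu n ^ 6 \<and> cmod (C_arc n s) \<le> K * nu n ^ 6"
proof -
  define a where "a = pi\<^sup>2 / 12"
  have a: "a > 0" by (simp add: a_def)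
  have "EV n. eta n \<le> 1" by (rule eventually_eta_small) simp
  then have "EV n. \<forall>s. cmod (A_arc n s) \<le> (real t + 6) * (2 / a) ^ 6 * nu n ^ 6
      \<and> cmod (C_arc n s) \<le> (real t + 6) * (2 / a) ^ 6 * nu n ^ 6"
  proof eventually_elim
    case (elim n)
    have \<eta>: "0 < eta n" by (rule eta_pos)
    have r: "eta n / 2 \<le> 1 - exp (- eta n)" by (rule exp_minus_half_le[OF \<eta> elim])
    have "(real t + 6) / (1 - exp (- eta n)) ^ 6 \<le> (real t + 6) / (eta n / 2) ^ 6"
      using r \<eta> by (intro divide_left_mono power_mono mult_pos_pos zero_less_power) auto
    also have "... = (real t + 6) * (2 / a) ^ 6 * nu n ^ 6"
      using a nu_pos[of n] by (simp add: eta_def a_def[symmetric] power_divide)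
    finally have le: "(real t + 6) / (1 - exp (- eta n)) ^ 6 \<le> (real t + 6) * (2 / a) ^ 6 * nu n ^ 6" .
    show ?case
    proof
      fix s
      have "cmod (qpt n s) < 1" using \<eta> by simp
      from norm_hook_mean_corr_le[OF t_pos this] le
      show "cmod (A_arc n s) \<le> (real t + 6) * (2 / a) ^ 6 * nu n ^ 6
        \<and> cmod (C_arc n s) \<le> (real t + 6) * (2 / a) ^ 6 * nu n ^ 6"
        by (simp only: norm_exp_zpt) linarith
    qed
  qed
  then show ?thesis using a by (intro exI[of _ "(real t + 6) * (2 / a) ^ 6"]) auto
qed

end

lemma sp_avg_0: "EV n. sp_avg n (\<lambda>_. 1) = 1"
  using sp_kratio_0 sp_avg_kern_b[of _ 0] by simp

lemma eta_sq_eq: "(eta n)\<^sup>2 = (pi\<^sup>2 / 12)\<^sup>2 / rnu n ^ 4"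
proof -
  have "rnu n ^ 4 = ((rnu n)\<^sup>2)\<^sup>2" by (simp only: power_mult[symmetric]) simp
  then have "rnu n ^ 4 = (nu n)\<^sup>2" using nu_pos[of n] by simp
  then show ?thesis by (simp add: eta_def power_divide)
qed

lemma eta_eq: "eta n = (pi\<^sup>2 / 12) / rnu n ^ 2"
  using nu_pos[of n] by (simp add: eta_def)

context
  fixes t :: nat assumes t_pos: "t > 0"
begin

abbreviation "b_sum \<equiv> bar_sum t"
abbreviation "sp_M \<equiv> sp_mean t"

text \<open>Rescaled deviations whose averages are the first and second moments of the bar count about \<open>sp_M n\<close>.\<close>

definition dev1 :: "nat \<Rightarrow> real \<Rightarrow> complex" where
  "dev1 n s = of_real (eta n) * (A_arc t n s - sp_M n)"

definition dev2 :: "nat \<Rightarrow> real \<Rightarrow> complex" where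
  "dev2 n s = (dev1 n s)\<^sup>2 + (of_real (eta n))\<^sup>2 * (A_arc t n s - C_arc t n s)"

definition coeff1 :: "nat \<Rightarrow> nat \<Rightarrow> complex" where
  "coeff1 n = b_sum 0 (of_real (eta n)) (- of_real (eta n) * sp_M n)"

text \<open>With N the bar count and M the centre, N (N - 1) + (1 - 2 M) N + M^2 = (N -
  M)^2.\<close>

definition coeff2 :: "nat \<Rightarrow> nat \<Rightarrow> complex" where
  "coeff2 n = b_sum ((of_real (eta n))\<^sup>2) ((of_real (eta n))\<^sup>2 * (1 - 2 * sp_M n)) ((of_real (eta n))\<^sup>2 * (sp_M n)\<^sup>2)"

lemma arc_series_coeff1: "arc_series (coeff1 n) (eta n) s = strict_gf (qpt n s) * dev1 n s"
  unfolding coeff1_def dev1_def arc_series_bar_sum[OF t_pos] by (simp add: algebra_simps)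

lemma arc_series_coeff2: "arc_series (coeff2 n) (eta n) s = strict_gf (qpt n s) * dev2 n s"
  unfolding coeff2_def dev1_def dev2_def arc_series_bar_sum[OF t_pos] by (simp add: algebra_simps power2_eq_square)

lemma summable_coeff1: "summable (\<lambda>m. cmod (coeff1 n m) * exp (- eta n) ^ m)"
  and summable_coeff2: "summable (\<lambda>m. cmod (coeff2 n m) * exp (- eta n) ^ m)"
  unfolding coeff1_def coeff2_def using eta_pos[of n] by (simp_all add: summable_bar_sum[OF t_pos])

lemma eventually_eta_le: "EV n. eta n \<le> 1 / 100"
  by (rule eventually_eta_small) simp

lemma continuous_dev1: "EV n. continuous_on {-1..1} (dev1 n)"
  using eventually_eta_le by eventually_elim (rule continuous_on_arc_ratio[OF _ summable_coeff1 arc_series_coeff1])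

lemma continuous_dev2: "EV n. continuous_on {-1..1} (dev2 n)"
  using eventually_eta_le by eventually_elim (rule continuous_on_arc_ratio[OF _ summable_coeff2 arc_series_coeff2])

lemma norm_dev1_minor:
  "\<exists>D\<ge>0. EV n. \<forall>s. cmod (dev1 n s) \<le> D * nu n ^ 6 \<and> cmod (dev2 n s) \<le> D * nu n ^ 12"
proof -
  obtain K where K: "K \<ge> 0" "EV n. \<forall>s. cmod (A_arc t n s) \<le> K * nu n ^ 6 \<and> cmod (C_arc t n s) \<le> K * nu n ^ 6"
    using hook_arc_polynomial_bound[OF t_pos] by blast
  define D where "D = 2 * K + 4 * K\<^sup>2 + 2 * K"
  have D: "2 * K \<le> D" "D \<ge> 0" using K(1) by (auto simp: D_def)
  have "EV n. \<forall>s. cmod (dev1 n s) \<le> D * nu n ^ 6 \<and> cmod (dev2 n s) \<le> D * nu n ^ 12"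
    using K(2) eventually_eta_le eventually_nu_ge[OF nu_lim, of 1]
  proof eventually_elim
    case (elim n)
    define x where "x = nu n"
    have x: "x \<ge> 1" "x ^ 6 \<le> x ^ 12" using elim(3) by (auto simp: x_def intro: power_increasing)
    have \<eta>: "0 < eta n" "eta n \<le> 1" "(eta n)\<^sup>2 \<le> 1" using eta_pos[of n] elim(2) by (auto simp: power_le_one)
    show ?case
    proof
      fix s
      have A: "cmod (A_arc t n s) \<le> K * x ^ 6" "cmod (C_arc t n s) \<le> K * x ^ 6" "cmod (sp_M n) \<le> K * x ^ 6"
        using elim(1) by (auto simp: x_def sp_mean_eq[OF t_pos])
      have "cmod (dev1 n s) \<le> 1 * (K * x ^ 6 + K * x ^ 6)"
        unfolding dev1_def norm_mult using \<eta> A norm_triangle_ineq4[of "A_arc t n s" "sp_M n"]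
        by (intro mult_mono) auto
      then have 1: "cmod (dev1 n s) \<le> 2 * K * x ^ 6" by simp
      have "cmod ((of_real (eta n))\<^sup>2 * (A_arc t n s - C_arc t n s)) \<le> 1 * (K * x ^ 6 + K * x ^ 6)"
        unfolding norm_mult norm_power using \<eta> A norm_triangle_ineq4[of "A_arc t n s" "C_arc t n s"]
        by (intro mult_mono) auto
      also have "... \<le> 2 * K * x ^ 12" using x K(1) mult_left_mono[of "x ^ 6" "x ^ 12" "2 * K"] by simp
      finally have 2: "cmod ((of_real (eta n))\<^sup>2 * (A_arc t n s - C_arc t n s)) \<le> 2 * K * x ^ 12" .
      have "(cmod (dev1 n s))\<^sup>2 \<le> (2 * K * x ^ 6)\<^sup>2" using 1 by (intro power_mono) auto
      also have "... = 4 * K\<^sup>2 * x ^ 12" by (simp add: power_mult_distrib power_mult[symmetric])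
      finally have "cmod (dev2 n s) \<le> 4 * K\<^sup>2 * x ^ 12 + 2 * K * x ^ 12"
        unfolding dev2_def using 2 by (intro norm_triangle_le add_mono) (auto simp: norm_power)
      also have "... \<le> D * x ^ 12" using x K(1) by (simp add: D_def distrib_right)
      finally have 3: "cmod (dev2 n s) \<le> D * x ^ 12" .
      have "2 * K * x ^ 6 \<le> D * x ^ 6" using D x by (intro mult_right_mono) auto
      then show "cmod (dev1 n s) \<le> D * nu n ^ 6 \<and> cmod (dev2 n s) \<le> D * nu n ^ 12"
        using 1 3 by (simp add: x_def)
    qed
  qed
  then show ?thesis using D by blast
qed

text \<open>To leading order \<open>dev1\<close> is b/2. The error \<eta>^2 \<bar>s\<bar> is worth
  five half orders after averaging, of which four are kept.\<close>

lemma sp_avg_dev1: "half_order nu 4 (\<lambda>n. sp_avg n (dev1 n) - sp_kratio 1 n / 2)"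
  and norm_dev1_le: "\<exists>C\<ge>0. EV n. \<forall>s\<in>{-1..1}. cmod (dev1 n s - kern_b s / 2) \<le> C * (eta n)\<^sup>2 * \<bar>s\<bar> \<and> cmod (dev1 n s) \<le> (1 + C) * \<bar>s\<bar>"
proof -
  obtain C where C: "C \<ge> 0" "EV n. \<forall>s\<in>{-1..1}. cmod (dev1 n s - kern_b s / 2) \<le> C * (eta n)\<^sup>2 * \<bar>s\<bar>"
    using hook_mean_arc_expansion[OF t_pos] unfolding dev1_def by blast
  have "EV n. \<forall>s\<in>{-1..1}. cmod (dev1 n s - kern_b s / 2) \<le> C * (eta n)\<^sup>2 * \<bar>s\<bar> \<and> cmod (dev1 n s) \<le> (1 + C) * \<bar>s\<bar>"
    using C(2) eventually_eta_le
  proof eventually_elim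
    case (elim n)
    show ?case
    proof
      fix s :: real assume s: "s \<in> {-1..1}"
      have le: "cmod (dev1 n s - kern_b s / 2) \<le> C * (eta n)\<^sup>2 * \<bar>s\<bar>" using elim s by blast
      have "(eta n)\<^sup>2 \<le> 1" using eta_pos[of n] elim(2) by (auto simp: power_le_one)
      then have "C * (eta n)\<^sup>2 * \<bar>s\<bar> \<le> C * 1 * \<bar>s\<bar>" using C(1) by (intro mult_right_mono mult_left_mono) auto
      moreover have "cmod (dev1 n s) \<le> cmod (dev1 n s - kern_b s / 2) + cmod (kern_b s / 2)"
        using norm_triangle_ineq[of "dev1 n s - kern_b s / 2" "kern_b s / 2"] by simp
      moreover have "cmod (kern_b s / 2) \<le> \<bar>s\<bar>" using norm_kern_b_le[of s] by simp
      ultimately show "cmod (dev1 n s - kern_b s / 2) \<le> C * (eta n)\<^sup>2 * \<bar>s\<bar> \<and> cmod (dev1 n s) \<le> (1 + C) * \<bar>s\<bar>"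
        using le by (simp add: distrib_right)
    qed
  qed
  then show "\<exists>C\<ge>0. EV n. \<forall>s\<in>{-1..1}. cmod (dev1 n s - kern_b s / 2) \<le> C * (eta n)\<^sup>2 * \<bar>s\<bar> \<and> cmod (dev1 n s) \<le> (1 + C) * \<bar>s\<bar>"
    using C(1) by blast
  have "half_order nu (4 + 1) (\<lambda>n. sp_avg n (\<lambda>s. dev1 n s - kern_b s / 2))"
  proof (rule half_order_sp_avg)
    show "EV n. continuous_on {-1..1} (\<lambda>s. dev1 n s - kern_b s / 2)"
      using continuous_dev1 by eventually_elim (intro continuous_intros, auto)
    show "EV n. \<forall>s\<in>{-1..1}. cmod (dev1 n s - kern_b s / 2) \<le> C * (pi\<^sup>2 / 12)\<^sup>2 / rnu n ^ 4 * \<bar>s\<bar> ^ 1"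
      using C(2) unfolding eta_sq_eq by eventually_elim simp
  qed (use C(1) in simp)
  then have "half_order nu 4 (\<lambda>n. sp_avg n (\<lambda>s. dev1 n s - kern_b s / 2))"
    by (rule half_order_weaken[OF nu_lim]) simp
  then show "half_order nu 4 (\<lambda>n. sp_avg n (dev1 n) - sp_kratio 1 n / 2)"
  proof (rule half_order_cong)
    show "EV n. sp_avg n (\<lambda>s. dev1 n s - kern_b s / 2) = sp_avg n (dev1 n) - sp_kratio 1 n / 2"
      using continuous_dev1
    proof eventually_elim
      case (elim n)
      have "sp_avg n (\<lambda>s. dev1 n s + (- (1 / 2)) * kern_b s ^ 1) = sp_avg n (dev1 n) + (- (1 / 2)) * sp_kratio 1 n"
        unfolding sp_avg_kern_b[symmetric] sp_avg_cmult[symmetric]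
        by (intro sp_avg_add elim continuous_intros)
      then show ?case by simp
    qed
  qed
qed

text \<open>Writing \<open>dev1\<close> as b/2 + e1 splits its square into b^2/4 and the error e2 =
  b e1 + e1^2. The rest of \<open>dev2\<close> is \<eta> (1 + b)/4 plus a constant times \<eta>^2
  plus an error e3. As e2 is bounded by \<eta>^2 s^2 and e3 by \<eta>^3, both have six half orders
  after averaging.\<close>

lemma sp_avg_dev2: "half_order nu 6 (\<lambda>n. sp_avg n (dev2 n)
    - (sp_kratio 2 n / 4 + of_real (eta n) * (1 + sp_kratio 1 n) / 4 + (of_real (eta n))\<^sup>2 * hook_corr_const t))"
  and norm_dev2_le: "\<exists>C\<ge>0. EV n. \<forall>s\<in>{-1..1}. cmod (dev2 n s) \<le> C * (\<bar>s\<bar> ^ 2 + 1 / rnu n ^ 2)"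
proof -
  define a where "a = pi\<^sup>2 / 12"
  have a: "a > 0" by (simp add: a_def)
  define h where "h n = complex_of_real (eta n)" for n
  define \<beta> where "\<beta> = hook_corr_const t"
  define e1 where "e1 n s = dev1 n s - kern_b s / 2" for n s
  define e2 where "e2 n s = kern_b s * e1 n s + (e1 n s)\<^sup>2" for n s
  define e3 where "e3 n s = (h n)\<^sup>2 * (A_arc t n s - C_arc t n s) - (h n * (1 + kern_b s) / 4 + (h n)\<^sup>2 * \<beta>)" for n s
  have dev2_eq: "dev2 n s = (kern_b s)\<^sup>2 / 4 + h n * (1 + kern_b s) / 4 + (h n)\<^sup>2 * \<beta> + e2 n s + e3 n s" for n s
    by (simp add: dev2_def e1_def e2_def e3_def h_def field_simps power2_eq_square)
  obtain C where C: "C \<ge> 0" "EV n. \<forall>s\<in>{-1..1}. cmod (e1 n s) \<le> C * (eta n)\<^sup>2 * \<bar>s\<bar> \<and> cmod (dev1 n s) \<le> (1 + C) * \<bar>s\<bar>"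
    using norm_dev1_le unfolding e1_def by blast
  obtain D where D: "D \<ge> 0" "EV n. \<forall>s\<in>{-1..1}. cmod (e3 n s) \<le> D * eta n ^ 3"
    using hook_corr_arc_expansion[OF t_pos] unfolding e3_def h_def \<beta>_def by blast
  have cont: "EV n. continuous_on {-1..1} (e2 n) \<and> continuous_on {-1..1} (e3 n)"
    using continuous_dev1 continuous_dev2
  proof eventually_elim
    case (elim n)
    have e1: "continuous_on {-1..1} (e1 n)" unfolding e1_def[abs_def] by (intro continuous_intros elim) auto
    have e2: "continuous_on {-1..1} (e2 n)" unfolding e2_def[abs_def] by (intro continuous_intros e1)
    have e3: "e3 n = (\<lambda>s. dev2 n s - ((kern_b s)\<^sup>2 / 4 + h n * (1 + kern_b s) / 4 + (h n)\<^sup>2 * \<beta> + e2 n s))"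
      unfolding dev2_eq by (rule ext) simp
    have "continuous_on {-1..1} (e3 n)" unfolding e3 by (intro continuous_intros elim e2) auto
    with e2 show ?case by blast
  qed
  have ho2: "half_order nu (4 + 2) (\<lambda>n. sp_avg n (e2 n))"
  proof (rule half_order_sp_avg)
    show "EV n. continuous_on {-1..1} (e2 n)" using cont by eventually_elim blast
    show "EV n. \<forall>s\<in>{-1..1}. cmod (e2 n s) \<le> (C + C\<^sup>2) * a\<^sup>2 / rnu n ^ 4 * \<bar>s\<bar> ^ 2"
      using C(2) eventually_eta_le
    proof eventually_elim
      case (elim n)
      show ?case
      proof
        fix s :: real assume s: "s \<in> {-1..1}"
        have e1: "cmod (e1 n s) \<le> C * (eta n)\<^sup>2 * \<bar>s\<bar>" using elim s by blast
        have \<eta>: "(eta n)\<^sup>2 \<le> 1" using eta_pos[of n] elim(2) by (auto simp: power_le_one)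
        have "cmod (kern_b s * e1 n s) \<le> \<bar>s\<bar> * (C * (eta n)\<^sup>2 * \<bar>s\<bar>)"
          unfolding norm_mult by (intro mult_mono norm_kern_b_le e1) auto
        moreover have "cmod ((e1 n s)\<^sup>2) \<le> C\<^sup>2 * (eta n)\<^sup>2 * \<bar>s\<bar>\<^sup>2"
        proof -
          have "cmod ((e1 n s)\<^sup>2) \<le> (C * (eta n)\<^sup>2 * \<bar>s\<bar>)\<^sup>2" unfolding norm_power by (intro power_mono e1) auto
          also have "... = C\<^sup>2 * ((eta n)\<^sup>2 * (eta n)\<^sup>2) * \<bar>s\<bar>\<^sup>2" by (simp add: power2_eq_square mult_ac)
          also have "... \<le> C\<^sup>2 * ((eta n)\<^sup>2 * 1) * \<bar>s\<bar>\<^sup>2" by (intro mult_right_mono mult_left_mono \<eta>) auto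
          finally show ?thesis by simp
        qed
        ultimately have "cmod (e2 n s) \<le> \<bar>s\<bar> * (C * (eta n)\<^sup>2 * \<bar>s\<bar>) + C\<^sup>2 * (eta n)\<^sup>2 * \<bar>s\<bar>\<^sup>2"
          unfolding e2_def by (intro norm_triangle_le add_mono)
        also have "... = (C + C\<^sup>2) * (eta n)\<^sup>2 * \<bar>s\<bar>\<^sup>2" by (simp add: power2_eq_square algebra_simps)
        finally show "cmod (e2 n s) \<le> (C + C\<^sup>2) * a\<^sup>2 / rnu n ^ 4 * \<bar>s\<bar> ^ 2"
          unfolding eta_sq_eq a_def by simp
      qed
    qed
  qed (use C(1) in simp)
  have ho3: "half_order nu (6 + 0) (\<lambda>n. sp_avg n (e3 n))"
  proof (rule half_order_sp_avg)
    show "EV n. continuous_on {-1..1} (e3 n)" using cont by eventually_elim blast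
    show "EV n. \<forall>s\<in>{-1..1}. cmod (e3 n s) \<le> D * a ^ 3 / rnu n ^ 6 * \<bar>s\<bar> ^ 0"
      using D(2)
    proof eventually_elim
      case (elim n)
      have "eta n ^ 3 = a ^ 3 / rnu n ^ 6" unfolding eta_eq a_def power_divide by (simp only: power_mult[symmetric]) simp
      then show ?case using elim by simp
    qed
  qed (use D(1) a in simp)
  have "half_order nu 6 (\<lambda>n. sp_avg n (e2 n) + sp_avg n (e3 n))" using half_order_add[OF _ ho3] ho2 by simp
  then show "half_order nu 6 (\<lambda>n. sp_avg n (dev2 n)
    - (sp_kratio 2 n / 4 + of_real (eta n) * (1 + sp_kratio 1 n) / 4 + (of_real (eta n))\<^sup>2 * hook_corr_const t))"
  proof (rule half_order_cong)
    show "EV n. sp_avg n (e2 n) + sp_avg n (e3 n) = sp_avg n (dev2 n)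
      - (sp_kratio 2 n / 4 + of_real (eta n) * (1 + sp_kratio 1 n) / 4 + (of_real (eta n))\<^sup>2 * hook_corr_const t)"
      using cont sp_avg_0
    proof eventually_elim
      case (elim n)
      have c: "continuous_on {-1..1} (e2 n)" "continuous_on {-1..1} (e3 n)" using elim by auto
      have F2': "dev2 n = (\<lambda>s. ((1 / 4) * kern_b s ^ 2 + ((h n / 4) * kern_b s ^ 1 + (h n / 4 + (h n)\<^sup>2 * \<beta>) * 1)) + (e2 n s + e3 n s))"
        unfolding dev2_eq by (rule ext) (simp add: algebra_simps add_divide_distrib)
      have "sp_avg n (dev2 n) = (1 / 4) * sp_kratio 2 n + ((h n / 4) * sp_kratio 1 n + (h n / 4 + (h n)\<^sup>2 * \<beta>) * 1) + (sp_avg n (e2 n) + sp_avg n (e3 n))"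
      proof -
        have "sp_avg n (dev2 n) = sp_avg n (\<lambda>s. (1 / 4) * kern_b s ^ 2 + ((h n / 4) * kern_b s ^ 1 + (h n / 4 + (h n)\<^sup>2 * \<beta>) * 1))
            + sp_avg n (\<lambda>s. e2 n s + e3 n s)"
          unfolding F2' by (intro sp_avg_add continuous_intros c)
        also have "sp_avg n (\<lambda>s. e2 n s + e3 n s) = sp_avg n (e2 n) + sp_avg n (e3 n)" by (intro sp_avg_add c)
        also have "sp_avg n (\<lambda>s. (1 / 4) * kern_b s ^ 2 + ((h n / 4) * kern_b s ^ 1 + (h n / 4 + (h n)\<^sup>2 * \<beta>) * 1))
          = sp_avg n (\<lambda>s. (1 / 4) * kern_b s ^ 2) + sp_avg n (\<lambda>s. (h n / 4) * kern_b s ^ 1 + (h n / 4 + (h n)\<^sup>2 * \<beta>) * 1)"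
          by (intro sp_avg_add continuous_intros)
        also have "sp_avg n (\<lambda>s. (h n / 4) * kern_b s ^ 1 + (h n / 4 + (h n)\<^sup>2 * \<beta>) * 1)
          = sp_avg n (\<lambda>s. (h n / 4) * kern_b s ^ 1) + sp_avg n (\<lambda>s. (h n / 4 + (h n)\<^sup>2 * \<beta>) * 1)"
          by (intro sp_avg_add continuous_intros)
        finally show ?thesis by (simp only: sp_avg_cmult sp_avg_kern_b elim(2))
      qed
      then show ?case by (simp add: h_def \<beta>_def algebra_simps add_divide_distrib)
    qed
  qed
  have "EV n. \<forall>s\<in>{-1..1}. cmod (dev2 n s) \<le> ((1 + C)\<^sup>2 + (1 + cmod \<beta> + D) * a) * (\<bar>s\<bar> ^ 2 + 1 / rnu n ^ 2)"
    using C(2) D(2) eventually_eta_le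
  proof eventually_elim
    case (elim n)
    show ?case
    proof
      fix s :: real assume s: "s \<in> {-1..1}"
      have \<eta>: "0 < eta n" "eta n \<le> 1" using eta_pos[of n] elim(3) by auto
      have p: "eta n ^ 3 \<le> eta n" "(eta n)\<^sup>2 \<le> eta n"
        using \<eta> power_decreasing[of 1 3 "eta n"] power_decreasing[of 1 2 "eta n"] by auto
      have b: "cmod (1 + kern_b s) \<le> 2" using norm_triangle_ineq[of 1 "kern_b s"] norm_kern_b_le[of s] s by auto
      have "cmod (e3 n s + (h n * (1 + kern_b s) / 4 + (h n)\<^sup>2 * \<beta>)) \<le> D * eta n + (eta n * 2 / 4 + eta n * cmod \<beta>)"
      proof (intro norm_triangle_le add_mono)
        have "D * eta n ^ 3 \<le> D * eta n" using p D(1) by (intro mult_left_mono) auto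
        then show "cmod (e3 n s) \<le> D * eta n" using elim(2) s by fastforce
        show "cmod (h n * (1 + kern_b s) / 4) \<le> eta n * 2 / 4" using b \<eta> by (simp add: h_def norm_mult norm_divide)
        show "cmod ((h n)\<^sup>2 * \<beta>) \<le> eta n * cmod \<beta>" using p by (simp add: h_def norm_mult norm_power mult_right_mono)
      qed
      also have "... \<le> (1 + cmod \<beta> + D) * eta n" using \<eta> by (simp add: algebra_simps)
      finally have 1: "cmod (e3 n s + (h n * (1 + kern_b s) / 4 + (h n)\<^sup>2 * \<beta>)) \<le> (1 + cmod \<beta> + D) * eta n" .
      have dev2_eq': "dev2 n s = (dev1 n s)\<^sup>2 + (e3 n s + (h n * (1 + kern_b s) / 4 + (h n)\<^sup>2 * \<beta>))" by (simp add: dev2_def e3_def h_def)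
      have "cmod (dev1 n s) ^ 2 \<le> ((1 + C) * \<bar>s\<bar>) ^ 2" using elim(1) s by (intro power_mono) auto
      then have "cmod (dev2 n s) \<le> ((1 + C) * \<bar>s\<bar>) ^ 2 + (1 + cmod \<beta> + D) * eta n"
        unfolding dev2_eq' by (intro norm_triangle_le add_mono 1) (simp add: norm_power)
      also have "... = (1 + C)\<^sup>2 * \<bar>s\<bar> ^ 2 + ((1 + cmod \<beta> + D) * a) * (1 / rnu n ^ 2)"
        unfolding eta_eq a_def by (simp add: power_mult_distrib)
      also have "... \<le> ((1 + C)\<^sup>2 + (1 + cmod \<beta> + D) * a) * \<bar>s\<bar> ^ 2 + ((1 + C)\<^sup>2 + (1 + cmod \<beta> + D) * a) * (1 / rnu n ^ 2)"
        using a D(1) nu_pos[of n] by (intro add_mono mult_right_mono) auto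
      finally show "cmod (dev2 n s) \<le> ((1 + C)\<^sup>2 + (1 + cmod \<beta> + D) * a) * (\<bar>s\<bar> ^ 2 + 1 / rnu n ^ 2)"
        by (simp only: distrib_left)
    qed
  qed
  moreover have "(1 + C)\<^sup>2 + (1 + cmod \<beta> + D) * a \<ge> 0" using a D(1) by simp
  ultimately show "\<exists>C\<ge>0. EV n. \<forall>s\<in>{-1..1}. cmod (dev2 n s) \<le> C * (\<bar>s\<bar> ^ 2 + 1 / rnu n ^ 2)"
    by blast
qed

definition bar_avg1 :: "nat \<Rightarrow> complex" where
  "bar_avg1 n = bar_sum1 t n / strict_count n"

definition bar_avg2 :: "nat \<Rightarrow> complex" where
  "bar_avg2 n = bar_sum2 t n / strict_count n"

lemma bar_sum_avg: "b_sum p u v n / strict_count n = p * bar_avg2 n + u * bar_avg1 n + v"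
  using card_strict_sets_pos[of n] by (simp add: bar_sum_def[OF t_pos] bar_avg1_def bar_avg2_def strict_sum_1 add_divide_distrib)

lemma bar_avg1_expansion: "half_order nu 4 (\<lambda>n. of_real (eta n) * (bar_avg1 n - sp_M n) - sp_kratio 1 n / 2)"
proof -
  obtain C where C: "C \<ge> 0" "EV n. \<forall>s\<in>{-1..1}. cmod (dev1 n s - kern_b s / 2) \<le> C * (eta n)\<^sup>2 * \<bar>s\<bar> \<and> cmod (dev1 n s) \<le> (1 + C) * \<bar>s\<bar>"
    using norm_dev1_le by blast
  obtain D where D: "D \<ge> 0" "EV n. \<forall>s. cmod (dev1 n s) \<le> D * nu n ^ 6 \<and> cmod (dev2 n s) \<le> D * nu n ^ 12"
    using norm_dev1_minor by blast
  have "half_order nu (0 + 4) (\<lambda>n. coeff1 n n / strict_count n - sp_avg n (dev1 n))"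
    unfolding sp_avg_def
  proof (rule half_order_expectation[where c = coeff1 and F = dev1 and C = "1 + C" and D = D and k = 6])
    show "EV n. \<forall>s\<in>{-1..1}. cmod (dev1 n s) \<le> (1 + C) * (\<bar>s\<bar> ^ 0 + 1 / rnu n ^ 0)"
      using C(2)
    proof eventually_elim
      case (elim n)
      show ?case
      proof
        fix s :: real assume s: "s \<in> {-1..1}"
        have "cmod (dev1 n s) \<le> (1 + C) * \<bar>s\<bar>" using elim s by blast
        also have "... \<le> (1 + C) * (\<bar>s\<bar> ^ 0 + 1 / rnu n ^ 0)" using C(1) s by (intro mult_left_mono) auto
        finally show "cmod (dev1 n s) \<le> (1 + C) * (\<bar>s\<bar> ^ 0 + 1 / rnu n ^ 0)" .
      qed
    qed
    show "EV n. \<forall>s. cmod (dev1 n s) \<le> D * nu n ^ 6" using D(2) by eventually_elim blast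
  qed (use C D continuous_dev1 summable_coeff1 arc_series_coeff1 in auto)
  from half_order_add[OF this[simplified] sp_avg_dev1] show ?thesis
    by (simp add: coeff1_def bar_sum_avg algebra_simps)
qed

text \<open>The bound s^2 + 1/\<nu> on \<open>dev2\<close> counts as two half orders, so passing to
  strict partitions is accurate to six. Division by \<eta>^2 restores two powers of \<nu> and leaves
  an error O(1/\<nu>).\<close>

lemma bar_avg2_expansion: "half_order nu 6 (\<lambda>n. (of_real (eta n))\<^sup>2 * (bar_avg2 n + (1 - 2 * sp_M n) * bar_avg1 n + (sp_M n)\<^sup>2)
    - (sp_kratio 2 n / 4 + of_real (eta n) * (1 + sp_kratio 1 n) / 4 + (of_real (eta n))\<^sup>2 * hook_corr_const t))"
proof -
  obtain C where C: "C \<ge> 0" "EV n. \<forall>s\<in>{-1..1}. cmod (dev2 n s) \<le> C * (\<bar>s\<bar> ^ 2 + 1 / rnu n ^ 2)"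
    using norm_dev2_le by blast
  obtain D where D: "D \<ge> 0" "EV n. \<forall>s. cmod (dev1 n s) \<le> D * nu n ^ 6 \<and> cmod (dev2 n s) \<le> D * nu n ^ 12"
    using norm_dev1_minor by blast
  have "half_order nu (2 + 4) (\<lambda>n. coeff2 n n / strict_count n - sp_avg n (dev2 n))"
    unfolding sp_avg_def
  proof (rule half_order_expectation[where c = coeff2 and F = dev2 and C = C and D = D and k = 12])
    show "EV n. \<forall>s. cmod (dev2 n s) \<le> D * nu n ^ 12" using D(2) by eventually_elim blast
  qed (use C D continuous_dev2 summable_coeff2 arc_series_coeff2 in auto)
  then have "half_order nu 6 (\<lambda>n. coeff2 n n / strict_count n - sp_avg n (dev2 n))" by simp
  from half_order_add[OF this sp_avg_dev2] show ?thesis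
    by (simp add: coeff2_def bar_sum_avg algebra_simps)
qed

end

section \<open>Translation into expansions in n\<close>

lemma half_order_imp_bigo:
  assumes "half_order nu 2 (\<lambda>n. of_real (f n))"
  shows "f \<in> O(\<lambda>n. real n powr (- 1 / 2))"
proof -
  obtain C where "EV n. cmod (of_real (f n)) \<le> C / rnu n ^ 2"
    using assms unfolding half_order_def by blast
  then have "f \<in> O(\<lambda>n. 1 / nu n)"
    using nu_pos by (intro bigoI[of _ C]) (auto elim!: eventually_mono simp: less_imp_le)
  also have "(\<lambda>n. 1 / nu n) \<in> O(\<lambda>n. real n powr (- 1 / 2))"
    unfolding nu_def by real_asymp
  finally show ?thesis .
qed

lemma nu_sqrt: "nu n = pi * sqrt 3 / 6 * sqrt (real n + 1 / 24)"
proof -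
  have "(pi * sqrt 3 / 6)\<^sup>2 = pi\<^sup>2 / 12" by (simp add: power_divide power_mult_distrib)
  then have "sqrt (pi\<^sup>2 / 12) = pi * sqrt 3 / 6" by (intro real_sqrt_unique) auto
  then show ?thesis by (simp only: nu_def real_sqrt_mult)
qed

text \<open>Apart from the shift by 1/24 under the root, \<open>nu n\<close> is pi/6 times sqrt (3
  n), and the shift changes the root by O(n^(-1/2)).\<close>

lemma nu_bigo: "(\<lambda>n. c * nu n - c * (pi / 6) * sqrt (3 * real n)) \<in> O(\<lambda>n. real n powr (- 1 / 2))"
proof -
  have "(\<lambda>n. sqrt (real n + 1 / 24) - sqrt (real n)) \<in> O(\<lambda>n. real n powr (- 1 / 2))" by real_asymp
  then have "(\<lambda>n. c * (pi * sqrt 3 / 6) * (sqrt (real n + 1 / 24) - sqrt (real n))) \<in> O(\<lambda>n. real n powr (- 1 / 2))"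
    by (cases "c = 0") simp_all
  then show ?thesis by (simp add: nu_sqrt real_sqrt_mult algebra_simps)
qed

context
  fixes t :: nat assumes t_pos: "t > 0"
begin

lemma expectation_DD_unif:
  "measure_pmf.expectation (DD_unif (2 * n)) (\<lambda>\<mu>. f (num_hooks_above t \<mu>))
    = (\<Sum>S\<in>strict_sets n. f (bar_count t S) :: real) / strict_count n"
proof -
  have ne: "strict_sets n \<noteq> {}" using card_strict_sets_pos[of n] by auto
  have "measure_pmf.expectation (DD_unif (2 * n)) (\<lambda>\<mu>. f (num_hooks_above t \<mu>))
    = measure_pmf.expectation (map_pmf (num_hooks_above t) (DD_unif (2 * n))) f" by simp
  also have "... = measure_pmf.expectation (pmf_of_set (strict_sets n)) (\<lambda>S. f (bar_count t S))"
    unfolding map_pmf_DD_unif[OF t_pos] by simp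
  also have "... = (\<Sum>S\<in>strict_sets n. f (bar_count t S)) / strict_count n"
    by (rule integral_pmf_of_set[OF ne finite_strict_sets])
  finally show ?thesis .
qed

abbreviation "b_avg1 \<equiv> bar_avg1 t"
abbreviation "b_avg2 \<equiv> bar_avg2 t"

lemma DD_mean_eq: "of_real (DD_mean t (2 * n)) = b_avg1 n"
  unfolding DD_mean_def expectation_DD_unif bar_avg1_def[OF t_pos] strict_sum_def by simp

lemma DD_variance_eq: "of_real (DD_variance t (2 * n)) = b_avg2 n + b_avg1 n - (b_avg1 n)\<^sup>2"
proof -
  define K :: real where "K = strict_count n"
  define \<mu> where "\<mu> = DD_mean t (2 * n)"
  have K: "K > 0" using card_strict_sets_pos[of n] by (simp add: K_def)
  have mean: "(\<Sum>S\<in>strict_sets n. real (bar_count t S)) = \<mu> * K"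
    using K by (simp add: \<mu>_def DD_mean_def expectation_DD_unif K_def)
  have "DD_variance t (2 * n) = (\<Sum>S\<in>strict_sets n. (real (bar_count t S) - \<mu>)\<^sup>2) / K"
    unfolding DD_variance_def expectation_DD_unif[symmetric] K_def \<mu>_def DD_mean_def
    by (rule expectation_DD_unif[of n "\<lambda>x. (real x - _)\<^sup>2"])
  also have "(\<Sum>S\<in>strict_sets n. (real (bar_count t S) - \<mu>)\<^sup>2)
    = (\<Sum>S\<in>strict_sets n. real (bar_count t S) * (real (bar_count t S) - 1)) + (1 - 2 * \<mu>) * (\<Sum>S\<in>strict_sets n. real (bar_count t S)) + K * \<mu>\<^sup>2"
  proof -
    have sq: "(real (bar_count t S) - \<mu>)\<^sup>2 = real (bar_count t S) * (real (bar_count t S) - 1) + (1 - 2 * \<mu>) * real (bar_count t S) + \<mu>\<^sup>2" for S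
      by (simp add: power2_eq_square algebra_simps)
    show ?thesis unfolding sq sum.distrib sum_distrib_left K_def by simp
  qed
  also have "... / K = (\<Sum>S\<in>strict_sets n. real (bar_count t S) * (real (bar_count t S) - 1)) / K + \<mu> - \<mu>\<^sup>2"
    using K by (simp add: mean field_simps power2_eq_square)
  finally have "DD_variance t (2 * n) = (\<Sum>S\<in>strict_sets n. real (bar_count t S) * (real (bar_count t S) - 1)) / K + \<mu> - \<mu>\<^sup>2" .
  then have "complex_of_real (DD_variance t (2 * n))
    = of_real ((\<Sum>S\<in>strict_sets n. real (bar_count t S) * (real (bar_count t S) - 1)) / K) + b_avg1 n - (b_avg1 n)\<^sup>2"
    by (simp only: of_real_add of_real_diff of_real_power \<mu>_def DD_mean_eq)
  then show ?thesis by (simp add: bar_avg2_def[OF t_pos] strict_sum_def K_def)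
qed

lemma sp_kratio_1_asymp: "half_order nu 4 (\<lambda>n. sp_kratio 1 n - 1 / (4 * of_real (nu n)))" (is ?A)
  and half_order_sp_kratio_1: "half_order nu 2 (sp_kratio 1)" (is ?B)
proof -
  note W = half_order_weaken[OF nu_lim]
  note inv = half_order_inverse[OF nu_lim]
  have "half_order nu (2 + 2) (\<lambda>n. 3 / 32 * (1 / of_real (nu n) * (1 / of_real (nu n))))"
    by (intro half_order_cmult half_order_mult inv)
  then have "half_order nu 4 (\<lambda>n. (sp_kratio 1 n - (1 / (4 * of_real (nu n)) + 3 / (32 * (of_real (nu n))\<^sup>2)))
      + 3 / 32 * (1 / of_real (nu n) * (1 / of_real (nu n))))"
    by (intro half_order_add W[OF kratio_asymp(1)[OF nu_lim]]) simp_all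
  then show A: ?A by (simp add: power2_eq_square)
  have "half_order nu 2 (\<lambda>n. (sp_kratio 1 n - 1 / (4 * of_real (nu n))) + 1 / 4 * (1 / of_real (nu n)))"
    by (intro half_order_add half_order_cmult inv W[OF A]) simp
  then show ?B by simp
qed

definition sp_a :: complex where "sp_a = of_real (pi\<^sup>2 / 12)"

lemma sp_a_nz: "sp_a \<noteq> 0"
  by (simp only: sp_a_def of_real_eq_0_iff) simp

lemma eta_ca: "of_real (eta n) = sp_a / of_real (nu n)"
  by (simp add: eta_def sp_a_def)

text \<open>The term 1 / (8 a) with a = pi^2 / 12, that is 3 / (2 pi^2), is the effect of the
  fluctuation of z about the saddle point: the first kernel moment is 1 / (4 \<nu>), and half of it
  divided by \<eta> = a / \<nu> gives this constant.\<close>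

lemma b_avg1_asymp:
  "half_order nu 2 (\<lambda>n. b_avg1 n - (of_real (nu n) / (2 * sp_a) + hook_mean_const t + 1 / (8 * sp_a)))"
proof -
  have nz: "complex_of_real (nu n) \<noteq> 0" for n using nu_pos[of n] by simp
  have "half_order nu 4 (\<lambda>n. (of_real (eta n) * (b_avg1 n - sp_mean t n) - sp_kratio 1 n / 2) + 1 / 2 * (sp_kratio 1 n - 1 / (4 * of_real (nu n))))"
    by (intro half_order_add half_order_cmult sp_kratio_1_asymp bar_avg1_expansion[OF t_pos])
  then have "half_order nu (2 + 2) (\<lambda>n. of_real (eta n) * (b_avg1 n - sp_mean t n) - 1 / (8 * of_real (nu n)))"
    by (simp add: algebra_simps)
  from half_order_mult_nu[OF nu_lim this]
  have "half_order nu 2 (\<lambda>n. 1 / sp_a * (of_real (nu n) * (of_real (eta n) * (b_avg1 n - sp_mean t n) - 1 / (8 * of_real (nu n)))))"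
    by (rule half_order_cmult)
  from half_order_add[OF this sp_mean_expansion[OF t_pos]]
  have ho: "half_order nu 2 (\<lambda>n. 1 / sp_a * (of_real (nu n) * (of_real (eta n) * (b_avg1 n - sp_mean t n) - 1 / (8 * of_real (nu n))))
    + (sp_mean t n - (1 / (2 * of_real (eta n)) + hook_mean_const t)))" .
  have "1 / sp_a * (of_real (nu n) * (of_real (eta n) * (b_avg1 n - sp_mean t n) - 1 / (8 * of_real (nu n))))
    + (sp_mean t n - (1 / (2 * of_real (eta n)) + hook_mean_const t))
    = b_avg1 n - (of_real (nu n) / (2 * sp_a) + hook_mean_const t + 1 / (8 * sp_a))" for n
    using nz[of n] sp_a_nz by (simp add: eta_ca field_simps)
  then show ?thesis using ho by (simp only:)
qed

text \<open>The variance is the second moment about the centre minus the square of the deviation of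
  the mean from the centre. Everything is expanded for \<eta>^2 times the variance up to six half
  orders and divided by \<eta>^2 at the end.\<close>

lemma DD_variance_asymp_complex:
  "half_order nu 2 (\<lambda>n. (b_avg2 n + b_avg1 n - (b_avg1 n)\<^sup>2)
    - ((1 / (4 * sp_a) - 1 / (8 * sp_a\<^sup>2)) * of_real (nu n) + (1 / (16 * sp_a) - 1 / (16 * sp_a\<^sup>2) + hook_corr_const t)))"
proof -
  define x where "x n = complex_of_real (nu n)" for n
  define h where "h n = complex_of_real (eta n)" for n
  define u where "u n = h n * (b_avg1 n - sp_mean t n)" for n
  define V where "V n = b_avg2 n + b_avg1 n - (b_avg1 n)\<^sup>2" for n
  define k1 where "k1 n = sp_kratio 1 n" for n
  define k2 where "k2 n = sp_kratio 2 n" for n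
  define \<beta> where "\<beta> = hook_corr_const t"
  have nz: "x n \<noteq> 0" for n using nu_pos[of n] by (simp add: x_def)
  have hx: "h n = sp_a / x n" for n by (simp add: h_def x_def eta_ca)
  note inv = half_order_inverse[OF nu_lim, folded x_def]
  have h: "half_order nu 2 h" using half_order_cmult[OF inv, of sp_a] by (simp add: hx[abs_def])
  have u: "half_order nu 4 (\<lambda>n. u n - k1 n / 2)" using bar_avg1_expansion[OF t_pos] unfolding u_def h_def k1_def .
  have k1: "half_order nu 4 (\<lambda>n. k1 n - 1 / (4 * x n))" "half_order nu 2 k1"
    unfolding k1_def x_def by (fact sp_kratio_1_asymp half_order_sp_kratio_1)+
  have k2: "half_order nu 6 (\<lambda>n. k2 n - (- 1 / (2 * x n) - 3 / (16 * (x n)\<^sup>2)))"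
    unfolding k2_def x_def by (rule kratio_asymp(2)[OF nu_lim])
  \<comment> \<open>Both squares are replaced through a difference of two squares: u^2 - k1^2/4 and
    k1^2 - 1/(16 x^2) each factor into a term of four and a term of two half orders.\<close>
  have "half_order nu 2 (\<lambda>n. (u n - k1 n / 2) + k1 n)"
    by (intro half_order_add k1 half_order_weaken[OF nu_lim u]) simp
  then have u1: "half_order nu (4 + 2) (\<lambda>n. (u n - k1 n / 2) * ((u n - k1 n / 2) + k1 n))" by (rule half_order_mult[OF u])
  have "half_order nu 2 (\<lambda>n. k1 n + 1 / 4 * (1 / x n))" by (intro half_order_add half_order_cmult k1 inv)
  then have k1sq: "half_order nu (4 + 2) (\<lambda>n. (k1 n - 1 / (4 * x n)) * (k1 n + 1 / 4 * (1 / x n)))" by (rule half_order_mult[OF k1(1)])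
  have hk: "half_order nu (2 + 4) (\<lambda>n. h n * (k1 n - 1 / (4 * x n)))" by (rule half_order_mult[OF h k1(1)])
  have E: "half_order nu 6 (\<lambda>n. (h n)\<^sup>2 * (b_avg2 n + (1 - 2 * sp_mean t n) * b_avg1 n + (sp_mean t n)\<^sup>2)
    - (k2 n / 4 + h n * (1 + k1 n) / 4 + (h n)\<^sup>2 * \<beta>))"
    using bar_avg2_expansion[OF t_pos] unfolding h_def k1_def k2_def \<beta>_def .
  \<comment> \<open>The expansion of \<eta>^2 times the variance. Its terms come, in this order,
    from k2/4, \<eta>/4, \<eta> k1/4, the constant of A - C, and - k1^2/4.\<close>
  define R where "R n = 1 / 4 * (- 1 / (2 * x n) - 3 / (16 * (x n)\<^sup>2)) + h n / 4 + h n / (16 * x n) + (h n)\<^sup>2 * \<beta> - 1 / (64 * (x n)\<^sup>2)" for n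
  have "half_order nu 6 (\<lambda>n. ((h n)\<^sup>2 * (b_avg2 n + (1 - 2 * sp_mean t n) * b_avg1 n + (sp_mean t n)\<^sup>2)
      - (k2 n / 4 + h n * (1 + k1 n) / 4 + (h n)\<^sup>2 * \<beta>))
    - (u n - k1 n / 2) * ((u n - k1 n / 2) + k1 n)
    + 1 / 4 * (k2 n - (- 1 / (2 * x n) - 3 / (16 * (x n)\<^sup>2)))
    + 1 / 4 * (h n * (k1 n - 1 / (4 * x n)))
    - 1 / 4 * ((k1 n - 1 / (4 * x n)) * (k1 n + 1 / 4 * (1 / x n))))"
    using u1 k1sq hk by (intro half_order_add half_order_diff half_order_cmult E k2) simp_all
  moreover have "((h n)\<^sup>2 * (b_avg2 n + (1 - 2 * sp_mean t n) * b_avg1 n + (sp_mean t n)\<^sup>2)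
      - (k2 n / 4 + h n * (1 + k1 n) / 4 + (h n)\<^sup>2 * \<beta>))
    - (u n - k1 n / 2) * ((u n - k1 n / 2) + k1 n)
    + 1 / 4 * (k2 n - (- 1 / (2 * x n) - 3 / (16 * (x n)\<^sup>2)))
    + 1 / 4 * (h n * (k1 n - 1 / (4 * x n)))
    - 1 / 4 * ((k1 n - 1 / (4 * x n)) * (k1 n + 1 / 4 * (1 / x n))) = (h n)\<^sup>2 * V n - R n" for n
    using nz[of n] unfolding u_def V_def R_def by (simp add: field_simps power2_eq_square)
  ultimately have "half_order nu 6 (\<lambda>n. (h n)\<^sup>2 * V n - R n)" by simp
  then have "half_order nu 2 (\<lambda>n. x n * (x n * ((h n)\<^sup>2 * V n - R n)))"
    unfolding x_def by (intro half_order_mult_nu[OF nu_lim]) simp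
  from half_order_cmult[OF this, of "1 / sp_a\<^sup>2"]
  have "half_order nu 2 (\<lambda>n. 1 / sp_a\<^sup>2 * (x n * (x n * ((h n)\<^sup>2 * V n - R n))))" .
  moreover have "1 / sp_a\<^sup>2 * (x n * (x n * ((h n)\<^sup>2 * V n - R n)))
    = V n - ((1 / (4 * sp_a) - 1 / (8 * sp_a\<^sup>2)) * x n + (1 / (16 * sp_a) - 1 / (16 * sp_a\<^sup>2) + \<beta>))" for n
    using nz[of n] sp_a_nz unfolding R_def hx by (simp add: field_simps power2_eq_square)
  ultimately show ?thesis by (simp add: V_def x_def \<beta>_def)
qed

lemma DD_mean_half_order: "half_order nu 2 (\<lambda>n. of_real (DD_mean t (2 * n) - (6 / pi\<^sup>2 * nu n
    + (3 / (2 * pi\<^sup>2) - real t / 4 + 1 / 4 - (if even t then 1 else 0) / 8))))"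
proof -
  have "complex_of_real (DD_mean t (2 * n) - (6 / pi\<^sup>2 * nu n + (3 / (2 * pi\<^sup>2) - real t / 4 + 1 / 4 - (if even t then 1 else 0) / 8)))
    = b_avg1 n - (of_real (nu n) / (2 * sp_a) + hook_mean_const t + 1 / (8 * sp_a))" for n
    by (simp add: DD_mean_eq[symmetric] sp_a_def hook_mean_const_def[OF t_pos] field_simps)
  then show ?thesis using b_avg1_asymp by simp
qed

lemma DD_variance_half_order: "half_order nu 2 (\<lambda>n. of_real (DD_variance t (2 * n) - ((3 / pi\<^sup>2 - 18 / pi ^ 4) * nu n
    + (- 9 / pi ^ 4 + 3 / (4 * pi\<^sup>2) + (if even t then 1 else 0) / 32))))"
proof -
  have "complex_of_real (DD_variance t (2 * n) - ((3 / pi\<^sup>2 - 18 / pi ^ 4) * nu n + (- 9 / pi ^ 4 + 3 / (4 * pi\<^sup>2) + (if even t then 1 else 0) / 32)))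
    = (b_avg2 n + b_avg1 n - (b_avg1 n)\<^sup>2)
    - ((1 / (4 * sp_a) - 1 / (8 * sp_a\<^sup>2)) * of_real (nu n) + (1 / (16 * sp_a) - 1 / (16 * sp_a\<^sup>2) + hook_corr_const t))" for n
    unfolding DD_variance_eq[symmetric] by (simp add: sp_a_def hook_corr_const_def[OF t_pos] power_divide power_mult[symmetric] field_simps)
  then show ?thesis using DD_variance_asymp_complex by simp
qed

lemma DD_mean_bigo:
  "(\<lambda>n::nat. DD_mean t (2 * n) - (sqrt (3 * real n) / pi + 3 / (2 * pi ^ 2) - real t / 4 + 1 / 4 - (if even t then 1 else 0) / 8))
    \<in> O(\<lambda>n. real n powr (- 1 / 2))"
proof -
  have "(\<lambda>n. (DD_mean t (2 * n) - (6 / pi\<^sup>2 * nu n + (3 / (2 * pi\<^sup>2) - real t / 4 + 1 / 4 - (if even t then 1 else 0) / 8)))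
    + (6 / pi\<^sup>2 * nu n - 6 / pi\<^sup>2 * (pi / 6) * sqrt (3 * real n))) \<in> O(\<lambda>n. real n powr (- 1 / 2))"
    by (intro sum_in_bigo half_order_imp_bigo DD_mean_half_order nu_bigo)
  then show ?thesis by (simp add: power2_eq_square algebra_simps)
qed

lemma DD_variance_bigo:
  "(\<lambda>n::nat. DD_variance t (2 * n) - ((pi ^ 2 - 6) / (2 * pi ^ 3) * sqrt (3 * real n) - 9 / pi ^ 4 + 3 / (4 * pi ^ 2)
      + (if even t then 1 else 0) / 32)) \<in> O(\<lambda>n. real n powr (- 1 / 2))"
proof -
  have c: "(3 / pi\<^sup>2 - 18 / pi ^ 4) * (pi / 6) = (pi ^ 2 - 6) / (2 * pi ^ 3)"
    by (simp add: field_simps power2_eq_square power3_eq_cube power4_eq_xxxx)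
  have "(\<lambda>n. (DD_variance t (2 * n) - ((3 / pi\<^sup>2 - 18 / pi ^ 4) * nu n + (- 9 / pi ^ 4 + 3 / (4 * pi\<^sup>2) + (if even t then 1 else 0) / 32)))
    + ((3 / pi\<^sup>2 - 18 / pi ^ 4) * nu n - (3 / pi\<^sup>2 - 18 / pi ^ 4) * (pi / 6) * sqrt (3 * real n))) \<in> O(\<lambda>n. real n powr (- 1 / 2))"
    by (intro sum_in_bigo half_order_imp_bigo DD_variance_half_order nu_bigo)
  then show ?thesis unfolding c by (simp only: add_diff_eq diff_diff_eq2) (simp add: algebra_simps)
qed

end

section \<open>The central limit theorem\<close>

lemma iexp_minus_1_bound: "cmod (exp (\<i> * of_real x) - 1 - \<i> * of_real x + (of_real x)\<^sup>2 / 2) \<le> \<bar>x\<bar> ^ 3"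
proof -
  have "(\<Sum>k\<le>2. (\<i> * of_real x) ^ k / fact k) = 1 + \<i> * of_real x - (of_real x :: complex)\<^sup>2 / 2"
    by (simp add: numeral_2_eq_2 power_mult_distrib)
  then have "cmod (exp (\<i> * of_real x) - (1 + \<i> * of_real x - (of_real x)\<^sup>2 / 2)) \<le> \<bar>x\<bar> ^ 3 / fact 3"
    using iexp_approx1[of x 2] by (simp add: eval_nat_numeral)
  also have "... \<le> \<bar>x\<bar> ^ 3 / 1" by (intro divide_left_mono) (auto simp: fact_numeral)
  finally show ?thesis by (simp add: algebra_simps)
qed

lemma half_order_sp_tendsto_0: "half_order nu 2 f \<Longrightarrow> f \<longlonglongrightarrow> 0"
  using half_order_tendsto_0[OF nu_lim, of 1 f] by (simp add: numeral_2_eq_2)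

lemma inverse_sqrt_nu_lim: "(\<lambda>n. 1 / rnu n) \<longlonglongrightarrow> 0"
  and inverse_nu_lim: "(\<lambda>n. 1 / nu n) \<longlonglongrightarrow> 0"
  unfolding nu_def by real_asymp+

lemma eta_tendsto_0: "eta \<longlonglongrightarrow> 0"
  using eta_lim unfolding filterlim_at by auto

text \<open>The limit of the variance divided by \<open>nu n\<close>. With a = pi^2 / 12 it is 1/(4
  a) - 1/(8 a^2); that it is positive amounts to pi^2 > 6.\<close>

definition var_rate :: real where "var_rate = 3 / pi\<^sup>2 - 18 / pi ^ 4"

lemma var_rate_pos: "var_rate > 0"
proof -
  have "3\<^sup>2 \<le> pi\<^sup>2" using pi_gt3 by (intro power_mono) auto
  then have "0 < 3 * (pi\<^sup>2 - 6) / pi ^ 4" by (intro divide_pos_pos mult_pos_pos) auto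
  also have "3 * (pi\<^sup>2 - 6) / pi ^ 4 = var_rate" by (simp add: var_rate_def field_simps power2_eq_square power4_eq_xxxx)
  finally show ?thesis .
qed

lemma sv_lim: "(\<lambda>n. v / rnu n) \<longlonglongrightarrow> 0"
  and eventually_sv: "EV n. v / rnu n \<in> {-1..1}"
proof -
  show s0: "(\<lambda>n. v / rnu n) \<longlonglongrightarrow> 0" using tendsto_mult_left[OF inverse_sqrt_nu_lim, of v] by simp
  show "EV n. v / rnu n \<in> {-1..1}"
    using order_tendstoD(2)[OF s0, of 1] order_tendstoD(1)[OF s0, of "- 1"] by (auto elim: eventually_elim2)
qed

section \<open>The exponent on the scale of the standard deviation\<close>

context
  fixes t :: nat and \<tau> :: real assumes t_pos: "t > 0"
begin

definition angle :: "nat \<Rightarrow> real" where "angle n = \<tau> / sqrt (DD_variance t (2 * n))"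
definition char_pt :: "nat \<Rightarrow> complex" where "char_pt n = exp (\<i> * of_real (angle n))"
definition DD_mu :: "nat \<Rightarrow> complex" where "DD_mu n = of_real (DD_mean t (2 * n))"
abbreviation "ysc n \<equiv> of_real (rnu n) * (char_pt n - 1)"
abbreviation "y2 n \<equiv> of_real (nu n) * (char_pt n - 1 - \<i> * of_real (angle n))"
abbreviation "spM \<equiv> sp_mean t"
abbreviation "hook_gap n s \<equiv> (of_real (eta n))\<^sup>2 * (hook_mean t (qpt n s) - hook_corr t (qpt n s))"
abbreviation "f1 \<equiv> dev1 t"
abbreviation "hM n \<equiv> of_real (eta n) * spM n"

lemma variance_ratio_lim: "(\<lambda>n. DD_variance t (2 * n) / nu n) \<longlonglongrightarrow> var_rate"
proof -
  define k where "k = (- 9 / pi ^ 4 + 3 / (4 * pi\<^sup>2) + (if even t then 1 else 0) / 32)"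
  have "(\<lambda>n. complex_of_real (DD_variance t (2 * n) - (var_rate * nu n + k))) \<longlonglongrightarrow> 0"
    by (rule half_order_sp_tendsto_0) (use DD_variance_half_order[OF t_pos] in \<open>simp only: var_rate_def k_def\<close>)
  then have "(\<lambda>n. DD_variance t (2 * n) - (var_rate * nu n + k)) \<longlonglongrightarrow> 0" using tendsto_of_real_iff[of _ 0] by fastforce
  then have "(\<lambda>n. var_rate + (k + (DD_variance t (2 * n) - (var_rate * nu n + k))) * (1 / nu n)) \<longlonglongrightarrow> var_rate + (k + 0) * 0"
    by (intro tendsto_intros inverse_nu_lim)
  moreover have "var_rate + (k + (DD_variance t (2 * n) - (var_rate * nu n + k))) * (1 / nu n) = DD_variance t (2 * n) / nu n" for n
    using nu_pos[of n] by (simp add: field_simps)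
  ultimately show ?thesis by simp
qed

lemma psi_lim: "(\<lambda>n. rnu n * angle n) \<longlonglongrightarrow> \<tau> / sqrt var_rate"
proof -
  have "(\<lambda>n. \<tau> / sqrt (DD_variance t (2 * n) / nu n)) \<longlonglongrightarrow> \<tau> / sqrt var_rate"
    using var_rate_pos by (intro tendsto_intros variance_ratio_lim) auto
  then show ?thesis by (simp add: angle_def real_sqrt_divide mult.commute)
qed

lemma psi_tendsto_0: "angle \<longlonglongrightarrow> 0"
proof -
  have "(\<lambda>n. rnu n * angle n * (1 / rnu n)) \<longlonglongrightarrow> \<tau> / sqrt var_rate * 0"
    by (intro tendsto_intros psi_lim inverse_sqrt_nu_lim)
  moreover have "rnu n * angle n * (1 / rnu n) = angle n" for n using nu_pos[of n] by simp
  ultimately show ?thesis by simp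
qed

text \<open>The second order part of w - 1 must be kept, because it will be multiplied by the
  centre, which is of order \<nu>.\<close>

lemma y2_lim: "y2 \<longlonglongrightarrow> - of_real (\<tau>\<^sup>2 / (2 * var_rate))"
proof -
  define r where "r n = y2 n + of_real ((rnu n * angle n)\<^sup>2 / 2)" for n
  have "cmod (r n) \<le> (rnu n * angle n)\<^sup>2 * \<bar>angle n\<bar>" for n
  proof -
    have sq: "(rnu n * angle n)\<^sup>2 = nu n * (angle n)\<^sup>2" using nu_pos[of n] by (simp add: power_mult_distrib)
    have "r n = of_real (nu n) * (exp (\<i> * of_real (angle n)) - 1 - \<i> * of_real (angle n) + (of_real (angle n))\<^sup>2 / 2)"
      unfolding r_def sq char_pt_def by (simp add: algebra_simps)
    then have "cmod (r n) \<le> nu n * \<bar>angle n\<bar> ^ 3"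
      using iexp_minus_1_bound[of "angle n"] nu_pos[of n] by (simp add: norm_mult)
    then show ?thesis unfolding sq by (simp add: power2_eq_square power3_eq_cube mult.assoc)
  qed
  moreover have "(\<lambda>n. (rnu n * angle n)\<^sup>2 * \<bar>angle n\<bar>) \<longlonglongrightarrow> (\<tau> / sqrt var_rate)\<^sup>2 * \<bar>0\<bar>"
    by (intro tendsto_intros psi_lim psi_tendsto_0)
  ultimately have r: "r \<longlonglongrightarrow> 0"
    by (intro Lim_null_comparison[of r "\<lambda>n. (rnu n * angle n)\<^sup>2 * \<bar>angle n\<bar>"]) auto
  have "(\<lambda>n. r n - of_real ((rnu n * angle n)\<^sup>2 / 2)) \<longlonglongrightarrow> 0 - of_real ((\<tau> / sqrt var_rate)\<^sup>2 / 2)"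
    by (intro tendsto_intros r psi_lim) simp
  moreover have "(\<tau> / sqrt var_rate)\<^sup>2 / 2 = \<tau>\<^sup>2 / (2 * var_rate)" using var_rate_pos by (simp add: power_divide)
  ultimately show ?thesis by (simp add: r_def)
qed

lemma ysc_lim: "ysc \<longlonglongrightarrow> \<i> * of_real (\<tau> / sqrt var_rate)"
proof -
  have "(\<lambda>n. \<i> * of_real (rnu n * angle n) + of_real (1 / rnu n) * y2 n)
    \<longlonglongrightarrow> \<i> * of_real (\<tau> / sqrt var_rate) + of_real 0 * (- of_real (\<tau>\<^sup>2 / (2 * var_rate)))"
    by (intro tendsto_intros psi_lim inverse_sqrt_nu_lim y2_lim)
  moreover have "\<i> * of_real (rnu n * angle n) + of_real (1 / rnu n) * y2 n = ysc n" for n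
  proof -
    have "complex_of_real (1 / rnu n) * of_real (nu n) = of_real (rnu n)"
      using nu_pos[of n] by (simp only: of_real_mult[symmetric]) (simp add: real_div_sqrt)
    then show ?thesis by (simp only: mult.assoc[symmetric]) (simp add: algebra_simps)
  qed
  ultimately show ?thesis by simp
qed

lemma char_pt_minus_1_lim: "(\<lambda>n. cmod (char_pt n - 1)) \<longlonglongrightarrow> 0"
proof -
  have "(\<lambda>n. cmod (of_real (1 / rnu n) * ysc n)) \<longlonglongrightarrow> cmod (of_real 0 * (\<i> * of_real (\<tau> / sqrt var_rate)))"
    by (intro tendsto_intros inverse_sqrt_nu_lim ysc_lim)
  moreover have "of_real (1 / rnu n) * ysc n = char_pt n - 1" for n using nu_pos[of n] by simp
  ultimately show ?thesis by simp
qed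

lemma hM_lim: "hM \<longlonglongrightarrow> 1 / 2"
proof -
  define e where "e n = spM n - (1 / (2 * of_real (eta n)) + hook_mean_const t)" for n
  have e: "e \<longlonglongrightarrow> 0" unfolding e_def by (rule half_order_sp_tendsto_0[OF sp_mean_expansion[OF t_pos]])
  have "(\<lambda>n. 1 / 2 + of_real (eta n) * (hook_mean_const t + e n)) \<longlonglongrightarrow> 1 / 2 + of_real 0 * (hook_mean_const t + 0)"
    by (intro tendsto_intros e eta_tendsto_0)
  moreover have "1 / 2 + of_real (eta n) * (hook_mean_const t + e n) = hM n" for n
    using eta_pos[of n] by (simp add: e_def field_simps)
  ultimately show ?thesis by simp
qed

text \<open>The exact mean and the centre have the same term of order \<nu> and differ by a bounded
  amount, while the angle tends to 0.\<close>

lemma mean_diff_lim: "(\<lambda>n. of_real (angle n) * (spM n - DD_mu n)) \<longlonglongrightarrow> 0"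
proof -
  define e where "e n = spM n - (1 / (2 * of_real (eta n)) + hook_mean_const t)" for n
  define e' where "e' n = DD_mu n - (of_real (nu n) / (2 * sp_a) + hook_mean_const t + 1 / (8 * sp_a))" for n
  have e: "e \<longlonglongrightarrow> 0" unfolding e_def by (rule half_order_sp_tendsto_0[OF sp_mean_expansion[OF t_pos]])
  have e': "e' \<longlonglongrightarrow> 0" unfolding e'_def DD_mu_def DD_mean_eq[OF t_pos]
    by (rule half_order_sp_tendsto_0[OF b_avg1_asymp[OF t_pos]])
  have "(\<lambda>n. of_real (angle n) * (e n - e' n - 1 / (8 * sp_a))) \<longlonglongrightarrow> of_real 0 * (0 - 0 - 1 / (8 * sp_a))"
    by (intro tendsto_intros e e' psi_tendsto_0)
  moreover have "e n - e' n - 1 / (8 * sp_a) = spM n - DD_mu n" for n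
    using sp_a_nz[OF t_pos] nu_pos[of n] by (simp add: e_def e'_def eta_ca[OF t_pos] field_simps)
  ultimately show ?thesis by simp
qed

definition arc_exponent :: "nat \<Rightarrow> real \<Rightarrow> complex" where
  "arc_exponent n s = (char_pt n - 1) * hook_mean t (qpt n s) - (char_pt n - 1)\<^sup>2 * hook_corr t (qpt n s) / 2
     - \<i> * of_real (angle n) * DD_mu n"

text \<open>With M the centre and \<mu> the exact mean, (w - 1) A - i \<psi> \<mu> is regrouped as
  (w - 1)(A - M) + (w - 1 - i \<psi>) M + i \<psi> (M - \<mu>), \<psi> being the angle, and C is
  written as A - (A - C). Factors sqrt \<nu> and \<eta> are distributed so that each product
  consists of factors with limits at s = v / sqrt \<nu>.\<close>

lemma arc_exponent_eq:
  "arc_exponent n s = ysc n * of_real (rnu n) * f1 n s / sp_a + y2 n * hM n / sp_a + \<i> * (of_real (angle n) * (spM n - DD_mu n))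
    - (ysc n)\<^sup>2 * (f1 n s + hM n - hook_gap n s / of_real (eta n)) / (2 * sp_a)"
proof -
  define x where "x = complex_of_real (rnu n)"
  have x0: "x \<noteq> 0" using nu_pos[of n] by (simp add: x_def)
  have nu: "complex_of_real (nu n) = x\<^sup>2" using nu_pos[of n] by (simp add: x_def of_real_power[symmetric] del: of_real_power)
  have eta: "complex_of_real (eta n) = sp_a / x\<^sup>2" by (simp add: eta_ca[OF t_pos] nu)
  show ?thesis
    unfolding arc_exponent_def dev1_def[OF t_pos] x_def[symmetric] nu eta
    using x0 sp_a_nz[OF t_pos] by (simp add: field_simps power2_eq_square)
qed

lemma f1_lim: "(\<lambda>n. of_real (rnu n) * f1 n (v / rnu n)) \<longlonglongrightarrow> - \<i> * of_real v / 2"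
  and f1_tendsto_0: "(\<lambda>n. f1 n (v / rnu n)) \<longlonglongrightarrow> 0"
proof -
  note s0 = sv_lim[of v] and ev = eventually_sv[of v]
  obtain C where C: "C \<ge> 0" "EV n. \<forall>s\<in>{-1..1}. cmod (f1 n s - kern_b s / 2) \<le> C * (eta n)\<^sup>2 * \<bar>s\<bar> \<and> cmod (f1 n s) \<le> (1 + C) * \<bar>s\<bar>"
    using norm_dev1_le[OF t_pos] by blast
  define r where "r n = of_real (rnu n) * (f1 n (v / rnu n) - kern_b (v / rnu n) / 2)" for n
  have "r \<longlonglongrightarrow> 0"
  proof (rule Lim_null_comparison)
    show "EV n. cmod (r n) \<le> C * (eta n)\<^sup>2 * \<bar>v\<bar>"
      using C(2) ev
    proof eventually_elim
      case (elim n)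
      have "cmod (r n) \<le> rnu n * (C * (eta n)\<^sup>2 * \<bar>v / rnu n\<bar>)"
        unfolding r_def norm_mult using elim(1)[rule_format, OF elim(2)] nu_pos[of n] by (intro mult_mono) auto
      then show ?case using nu_pos[of n] by simp
    qed
    have "(\<lambda>n. C * (eta n)\<^sup>2 * \<bar>v\<bar>) \<longlonglongrightarrow> C * 0\<^sup>2 * \<bar>v\<bar>" by (intro tendsto_intros eta_tendsto_0)
    then show "(\<lambda>n. C * (eta n)\<^sup>2 * \<bar>v\<bar>) \<longlonglongrightarrow> 0" by simp
  qed
  moreover have "(\<lambda>n. - \<i> * of_real v / (1 + \<i> * of_real (v / rnu n)) / 2) \<longlonglongrightarrow> - \<i> * of_real v / (1 + \<i> * of_real 0) / 2"
    by (intro tendsto_intros s0) auto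
  ultimately have "(\<lambda>n. r n + - \<i> * of_real v / (1 + \<i> * of_real (v / rnu n)) / 2) \<longlonglongrightarrow> 0 + - \<i> * of_real v / (1 + \<i> * of_real 0) / 2"
    by (rule tendsto_add)
  moreover have "r n + - \<i> * of_real v / (1 + \<i> * of_real (v / rnu n)) / 2 = of_real (rnu n) * f1 n (v / rnu n)" for n
  proof -
    define s where "s = v / rnu n"
    have v: "of_real v = of_real (rnu n) * complex_of_real s" using nu_pos[of n] by (simp add: s_def)
    have "kern_b s = - \<i> * of_real s / (1 + \<i> * of_real s)" by (simp add: kern_b_def field_simps)
    then show ?thesis unfolding r_def s_def[symmetric] v by (simp add: algebra_simps)
  qed
  ultimately show 1: "(\<lambda>n. of_real (rnu n) * f1 n (v / rnu n)) \<longlonglongrightarrow> - \<i> * of_real v / 2" by simp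
  have "(\<lambda>n. of_real (1 / rnu n) * (of_real (rnu n) * f1 n (v / rnu n))) \<longlonglongrightarrow> of_real 0 * (- \<i> * of_real v / 2)"
    by (intro tendsto_mult tendsto_of_real inverse_sqrt_nu_lim 1)
  moreover have "of_real (1 / rnu n) * (of_real (rnu n) * f1 n (v / rnu n)) = f1 n (v / rnu n)" for n
    using nu_pos[of n] by simp
  ultimately show "(\<lambda>n. f1 n (v / rnu n)) \<longlonglongrightarrow> 0" by simp
qed

lemma hook_gap_bound: "\<exists>C\<ge>0. EV n. \<forall>s\<in>{-1..1}.
    cmod (hook_gap n s / of_real (eta n) - (1 + kern_b s) / 4) \<le> C * eta n"
proof -
  define \<beta> where "\<beta> = hook_corr_const t"
  obtain C where C: "C \<ge> 0" "EV n. \<forall>s\<in>{-1..1}.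
      cmod (hook_gap n s - (of_real (eta n) * (1 + kern_b s) / 4 + (of_real (eta n))\<^sup>2 * \<beta>)) \<le> C * eta n ^ 3"
    using hook_corr_arc_expansion[OF t_pos, folded \<beta>_def] by (elim exE conjE) (rule that; assumption)
  have "0 \<le> C + cmod \<beta>" using C(1) by simp
  moreover have "EV n. \<forall>s\<in>{-1..1}. cmod (hook_gap n s / of_real (eta n) - (1 + kern_b s) / 4) \<le> (C + cmod \<beta>) * eta n"
    using C(2) eventually_eta_small[of 1, simplified]
  proof eventually_elim
    case (elim n)
    show ?case
    proof
      fix s :: real assume s: "s \<in> {-1..1}"
      define h where "h = complex_of_real (eta n)"
      have h: "h \<noteq> 0" "cmod h = eta n" using eta_pos[of n] by (simp_all add: h_def)
      define d where "d = hook_mean t (qpt n s) - hook_corr t (qpt n s)"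
      have eq: "h\<^sup>2 * d / h - (1 + kern_b s) / 4 = (h\<^sup>2 * d - (h * (1 + kern_b s) / 4 + h\<^sup>2 * \<beta>)) / h + h * \<beta>"
        using h(1) by (simp add: field_simps power2_eq_square)
      have "cmod ((h\<^sup>2 * d - (h * (1 + kern_b s) / 4 + h\<^sup>2 * \<beta>)) / h) \<le> C * eta n ^ 3 / eta n"
        unfolding norm_divide h(2) using elim(1)[rule_format, OF s, folded d_def h_def] eta_pos[of n]
        by (intro divide_right_mono) auto
      also have "... = C * eta n * eta n" using eta_pos[of n] by (simp add: power3_eq_cube)
      also have "... \<le> C * eta n * 1" using elim(2) C(1) eta_pos[of n] by (intro mult_left_mono) auto
      finally show "cmod (hook_gap n s / of_real (eta n) - (1 + kern_b s) / 4) \<le> (C + cmod \<beta>) * eta n"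
        unfolding h_def[symmetric] d_def[symmetric] eq by (intro norm_triangle_le) (simp add: norm_mult h algebra_simps)
    qed
  qed
  ultimately show ?thesis by (intro exI[of _ "C + cmod \<beta>"] conjI)
qed

lemma hook_gap_lim: "(\<lambda>n. hook_gap n (v / rnu n) / of_real (eta n)) \<longlonglongrightarrow> 1 / 4"
proof -
  obtain C where C: "C \<ge> 0" "EV n. \<forall>s\<in>{-1..1}.
    cmod (hook_gap n s / of_real (eta n) - (1 + kern_b s) / 4) \<le> C * eta n" using hook_gap_bound by (elim exE conjE) (rule that; assumption)
  have "EV n. cmod (hook_gap n (v / rnu n) / of_real (eta n) - (1 + kern_b (v / rnu n)) / 4) \<le> C * eta n"
    using C(2) eventually_sv[of v] by eventually_elim (drule (1) bspec)
  then have 1: "(\<lambda>n. hook_gap n (v / rnu n) / of_real (eta n) - (1 + kern_b (v / rnu n)) / 4) \<longlonglongrightarrow> 0"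
    by (rule Lim_null_comparison) (rule tendsto_mult_right_zero[OF eta_tendsto_0])
  have "(\<lambda>n. kern_b (v / rnu n)) \<longlonglongrightarrow> 1 / (1 + \<i> * of_real 0) - 1"
    unfolding kern_b_def by (intro tendsto_intros sv_lim) auto
  then have "(\<lambda>n. kern_b (v / rnu n)) \<longlonglongrightarrow> 0" by simp
  with 1 have "(\<lambda>n. (hook_gap n (v / rnu n) / of_real (eta n) - (1 + kern_b (v / rnu n)) / 4) + (1 + kern_b (v / rnu n)) / 4)
    \<longlonglongrightarrow> 0 + (1 + 0) / 4" by (intro tendsto_intros) auto
  then show ?thesis by simp
qed

definition lin_coeff :: real where "lin_coeff = \<tau> / (2 * (pi\<^sup>2 / 12) * sqrt var_rate)"
definition const_coeff :: real where "const_coeff = \<tau>\<^sup>2 / (8 * (pi\<^sup>2 / 12) * var_rate)"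

text \<open>To first order w - 1 and b are both imaginary, so their product tilts the Gaussian by a
  real exponent linear in v. With V = \<open>var_rate\<close> and a = pi^2 / 12, the constant is -
  \<tau>^2/(4 a V) from the second order part of w - 1 times the centre, plus \<tau>^2/(8 a V) from
  the term with C.\<close>

lemma arc_exponent_lim: "(\<lambda>n. arc_exponent n (v / rnu n)) \<longlonglongrightarrow> of_real (lin_coeff * v - const_coeff)"
proof -
  have nz: "sp_a \<noteq> 0" and nz2: "2 * sp_a \<noteq> 0" using sp_a_nz[OF t_pos] by simp_all
  let ?L = "(\<i> * of_real (\<tau> / sqrt var_rate)) * (- \<i> * of_real v / 2) / sp_a + (- of_real (\<tau>\<^sup>2 / (2 * var_rate))) * (1 / 2) / sp_a + \<i> * 0
      - (\<i> * of_real (\<tau> / sqrt var_rate))\<^sup>2 * (0 + 1 / 2 - 1 / 4) / (2 * sp_a)"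
  have 1: "(\<lambda>n. arc_exponent n (v / rnu n)) \<longlonglongrightarrow> ?L"
    unfolding arc_exponent_eq mult.assoc[of "ysc _" "of_real (rnu _)" "f1 _ _"]
    by (rule tendsto_diff[OF tendsto_add[OF tendsto_add[OF
          tendsto_divide[OF tendsto_mult[OF ysc_lim f1_lim[of v]] tendsto_const nz]
          tendsto_divide[OF tendsto_mult[OF y2_lim hM_lim] tendsto_const nz]]
          tendsto_mult[OF tendsto_const mean_diff_lim]]
          tendsto_divide[OF tendsto_mult[OF tendsto_power[OF ysc_lim] tendsto_diff[OF tendsto_add[OF f1_tendsto_0[of v] hM_lim] hook_gap_lim[of v]]] tendsto_const nz2]])
  have 2: "?L = of_real (lin_coeff * v - const_coeff)"
  proof -
    have sq: "(\<i> * complex_of_real (\<tau> / sqrt var_rate))\<^sup>2 = - of_real (\<tau>\<^sup>2 / var_rate)"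
      using var_rate_pos by (simp add: power_mult_distrib power_divide of_real_power[symmetric] del: of_real_power)
    have "(\<i> * of_real (\<tau> / sqrt var_rate)) * (- \<i> * of_real v / 2) = complex_of_real (\<tau> / sqrt var_rate * v / 2)" by (simp add: complex_eq_iff)
    then show ?thesis unfolding sq by (simp add: lin_coeff_def const_coeff_def sp_a_def[OF t_pos] field_simps)
  qed
  show ?thesis using 1 unfolding 2 .
qed

text \<open>The domination for Laplace's method. The deviation of A from the centre is the only
  factor multiplied by sqrt \<nu>, and after scaling it is at most a constant times \<bar>s\<bar>;
  everything else is bounded.\<close>

lemma arc_exponent_bound:
  "\<exists>K. EV n. \<forall>s\<in>{-1..1}. cmod (arc_exponent n s) \<le> K + K * (rnu n * \<bar>s\<bar>)"
proof -
  obtain C where C: "C \<ge> 0" "EV n. \<forall>s\<in>{-1..1}. cmod (f1 n s - kern_b s / 2) \<le> C * (eta n)\<^sup>2 * \<bar>s\<bar> \<and> cmod (f1 n s) \<le> (1 + C) * \<bar>s\<bar>"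
    using norm_dev1_le[OF t_pos] by blast
  obtain D where D: "D \<ge> 0" "EV n. \<forall>s\<in>{-1..1}.
    cmod (hook_gap n s / of_real (eta n) - (1 + kern_b s) / 4) \<le> D * eta n" using hook_gap_bound by (elim exE conjE) (rule that; assumption)
  have ev: "\<exists>B\<ge>0. EV n. cmod (f n) \<le> B" if "f \<longlonglongrightarrow> l" for f :: "nat \<Rightarrow> complex" and l
  proof -
    have "EV n. cmod (f n) < cmod l + 1" by (rule order_tendstoD(2)[OF tendsto_norm[OF that]]) simp
    then have "EV n. cmod (f n) \<le> cmod l + 1" by eventually_elim simp
    then show ?thesis by (intro exI[of _ "cmod l + 1"]) simp
  qed
  obtain Y where Y: "Y \<ge> 0" "EV n. cmod (ysc n) \<le> Y" using ev[OF ysc_lim] by blast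
  obtain Y2 where Y2: "Y2 \<ge> 0" "EV n. cmod (y2 n) \<le> Y2" using ev[OF y2_lim] by blast
  obtain m where m: "m \<ge> 0" "EV n. cmod (hM n) \<le> m" using ev[OF hM_lim] by blast
  obtain d where d: "d \<ge> 0" "EV n. cmod (of_real (angle n) * (spM n - DD_mu n)) \<le> d" using ev[OF mean_diff_lim] by blast
  have tri: "cmod (z1 + z2 + z3 - z4) \<le> e1 + e2 + e3 + e4"
    if "cmod z1 \<le> e1" "cmod z2 \<le> e2" "cmod z3 \<le> e3" "cmod z4 \<le> e4" for z1 z2 z3 z4 and e1 e2 e3 e4 :: real
    using that norm_triangle_ineq4[of "z1 + z2 + z3" z4] norm_triangle_ineq[of "z1 + z2" z3] norm_triangle_ineq[of z1 z2] by linarith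
  define a where "a = cmod sp_a"
  have a: "a > 0" using sp_a_nz[OF t_pos] by (simp add: a_def)
  define K1 where "K1 = Y * (1 + C) / a"
  define K2 where "K2 = Y2 * m / a + d + Y\<^sup>2 * ((1 + C) + m + (1 + D)) / (2 * a)"
  have K: "K1 \<ge> 0" "K2 \<ge> 0" using a Y(1) Y2(1) C(1) D(1) m(1) d(1) by (auto simp: K1_def K2_def)
  have "EV n. \<forall>s\<in>{-1..1}. cmod (arc_exponent n s) \<le> (K1 + K2) + (K1 + K2) * (rnu n * \<bar>s\<bar>)"
    using C(2) D(2) Y(2) Y2(2) m(2) d(2) eventually_eta_small[of 1, simplified]
  proof eventually_elim
    case (elim n)
    show ?case
    proof
      fix s :: real assume s: "s \<in> {-1..1}"
      have f: "cmod (f1 n s) \<le> (1 + C) * \<bar>s\<bar>" "(1 + C) * \<bar>s\<bar> \<le> 1 + C"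
        using elim(1) s C(1) mult_left_mono[of "\<bar>s\<bar>" 1 "1 + C"] by auto
      have b: "cmod (1 + kern_b s) \<le> 2" using norm_triangle_ineq[of 1 "kern_b s"] norm_kern_b_le[of s] s by auto
      have "cmod (hook_gap n s / of_real (eta n)) \<le> cmod (hook_gap n s / of_real (eta n) - (1 + kern_b s) / 4) + cmod ((1 + kern_b s) / 4)"
        using norm_triangle_ineq[of "hook_gap n s / of_real (eta n) - (1 + kern_b s) / 4" "(1 + kern_b s) / 4"] by simp
      also have "... \<le> D * 1 + 1"
      proof (rule add_mono)
        have "cmod (hook_gap n s / of_real (eta n) - (1 + kern_b s) / 4) \<le> D * eta n" using elim(2) s by blast
        also have "... \<le> D * 1" using elim(7) D(1) by (intro mult_left_mono) auto
        finally show "cmod (hook_gap n s / of_real (eta n) - (1 + kern_b s) / 4) \<le> D * 1" .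
        show "cmod ((1 + kern_b s) / 4) \<le> 1" using b by (simp add: norm_divide)
      qed
      finally have Hb: "cmod (hook_gap n s / of_real (eta n)) \<le> 1 + D" by simp
      have 1: "cmod (ysc n * of_real (rnu n) * f1 n s / sp_a) \<le> K1 * (rnu n * \<bar>s\<bar>)"
      proof -
        have "cmod (ysc n) * rnu n * cmod (f1 n s) \<le> Y * rnu n * ((1 + C) * \<bar>s\<bar>)"
          using elim(3) f Y(1) nu_pos[of n] by (intro mult_mono) auto
        then have "cmod (ysc n) * rnu n * cmod (f1 n s) / a \<le> Y * rnu n * ((1 + C) * \<bar>s\<bar>) / a"
          using a by (intro divide_right_mono) auto
        then show ?thesis using nu_pos[of n] by (simp add: norm_mult norm_divide K1_def a_def mult_ac)
      qed
      have 2: "cmod (y2 n * hM n / sp_a) \<le> Y2 * m / a"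
        unfolding norm_divide norm_mult[of "y2 n" "hM n"] a_def[symmetric] using elim(4,5) a Y2(1) by (intro divide_right_mono mult_mono) auto
      have 3: "cmod (\<i> * (of_real (angle n) * (spM n - DD_mu n))) \<le> d"
        using elim(6) by (simp only: norm_mult norm_ii mult_1)
      have 4: "cmod ((ysc n)\<^sup>2 * (f1 n s + hM n - hook_gap n s / of_real (eta n)) / (2 * sp_a)) \<le> Y\<^sup>2 * ((1 + C) + m + (1 + D)) / (2 * a)"
      proof -
        have "cmod (f1 n s + hM n - hook_gap n s / of_real (eta n)) \<le> (1 + C) + m + (1 + D)"
          using norm_triangle_ineq4[of "f1 n s + hM n" "hook_gap n s / of_real (eta n)"] norm_triangle_ineq[of "f1 n s" "hM n"] f Hb elim(5) by linarith
        then have "(cmod (ysc n))\<^sup>2 * cmod (f1 n s + hM n - hook_gap n s / of_real (eta n)) \<le> Y\<^sup>2 * ((1 + C) + m + (1 + D))"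
          using elim(3) by (intro mult_mono power_mono) auto
        then have "(cmod (ysc n))\<^sup>2 * cmod (f1 n s + hM n - hook_gap n s / of_real (eta n)) / (2 * a) \<le> Y\<^sup>2 * ((1 + C) + m + (1 + D)) / (2 * a)"
          using a by (intro divide_right_mono) auto
        moreover have "cmod ((ysc n)\<^sup>2 * (f1 n s + hM n - hook_gap n s / of_real (eta n)) / (2 * sp_a))
          = (cmod (ysc n))\<^sup>2 * cmod (f1 n s + hM n - hook_gap n s / of_real (eta n)) / (2 * a)"
          unfolding norm_divide norm_mult[of "(ysc n)\<^sup>2"] norm_power a_def by (simp only: norm_mult norm_numeral)
        ultimately show ?thesis by simp
      qed
      have "cmod (arc_exponent n s) \<le> K1 * (rnu n * \<bar>s\<bar>) + Y2 * m / a + d + Y\<^sup>2 * ((1 + C) + m + (1 + D)) / (2 * a)"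
        unfolding arc_exponent_eq
        by (rule tri[OF 1 2 3 4])
      also have "... = K1 * (rnu n * \<bar>s\<bar>) + K2" by (simp add: K2_def)
      also have "... \<le> (K1 + K2) + (K1 + K2) * (rnu n * \<bar>s\<bar>)"
      proof -
        have "0 \<le> K2 * (rnu n * \<bar>s\<bar>)" using K nu_pos[of n] by simp
        then show ?thesis using K by (simp add: distrib_right)
      qed
      finally show "cmod (arc_exponent n s) \<le> (K1 + K2) + (K1 + K2) * (rnu n * \<bar>s\<bar>)" .
    qed
  qed
  then show ?thesis by (rule exI)
qed

end

abbreviation DD_normalized :: "nat \<Rightarrow> nat \<Rightarrow> real measure" where
  "DD_normalized t n \<equiv> distr (measure_pmf (DD_unif (2 * n))) borel
    (\<lambda>\<mu>. (real (num_hooks_above t \<mu>) - DD_mean t (2 * n)) / sqrt (DD_variance t (2 * n)))"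

section \<open>Convergence of the characteristic functions\<close>

context
  fixes t :: nat and \<tau> :: real assumes t_pos: "t > 0"
begin

abbreviation "w \<equiv> char_pt t \<tau>"
abbreviation "E_arc \<equiv> arc_exponent t \<tau>"

definition phase :: "nat \<Rightarrow> complex" where "phase n = exp (- (\<i> * of_real (angle t \<tau> n) * DD_mu t n))"
definition Zarc :: "nat \<Rightarrow> real \<Rightarrow> complex" where
  "Zarc n s = arc_series (bar_gf t (w n)) (eta n) s / exp (log_P_approx (zpt (eta n) s))"
text \<open>The relative error of the exponential approximation of the generating function, for the
  lower bound 1/2 of |1 + q^m| that holds on the sector.\<close>

definition eps :: "nat \<Rightarrow> real" where
  "eps n = 240 * cmod (w n - 1) ^ 3 / ((1 / 2) ^ 6 * (1 - exp (- eta n)))"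

lemma norm_char_pt [simp]: "cmod (w n) = 1"
  by (simp add: char_pt_def[OF t_pos] norm_exp_i_times)

lemma norm_phase: "cmod (phase n) = 1"
proof -
  have "- (\<i> * of_real (angle t \<tau> n) * DD_mu t n) = \<i> * of_real (- (angle t \<tau> n * DD_mean t (2 * n)))" by (simp add: DD_mu_def[OF t_pos])
  then show ?thesis unfolding phase_def by (simp only: norm_exp_i_times)
qed

lemma eventually_eta_le_1: "EV n. eta n \<le> 1"
  by (rule eventually_eta_small) simp

text \<open>As |w - 1| is O(\<nu>^(-1/2)) and 1 - exp (- \<eta>) has exact order 1/\<nu>, the cube
  divided by the latter is O(\<nu>^(-1/2)).\<close>

lemma eps_lim: "eps \<longlonglongrightarrow> 0"
proof (rule Lim_null_comparison)
  let ?y = "\<lambda>n. of_real (rnu n) * (w n - 1)"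
  define a where "a = pi\<^sup>2 / 12"
  have a: "a > 0" by (simp add: a_def)
  show "EV n. norm (eps n) \<le> 30720 / a * cmod (?y n) ^ 3 * (1 / rnu n)"
    using eventually_eta_le_1
  proof eventually_elim
    case (elim n)
    define x where "x = rnu n"
    have x: "x > 0" "nu n = x\<^sup>2" using nu_pos[of n] by (simp_all add: x_def less_imp_le)
    have r: "eta n / 2 \<le> 1 - exp (- eta n)" by (rule exp_minus_half_le[OF eta_pos elim])
    have pos: "0 < 1 - exp (- eta n)" using eta_pos[of n] by simp
    have "norm (eps n) = 240 * cmod (w n - 1) ^ 3 / ((1 / 2) ^ 6 * (1 - exp (- eta n)))"
      unfolding eps_def using pos by simp
    also have "... \<le> 240 * cmod (w n - 1) ^ 3 / ((1 / 2) ^ 6 * (eta n / 2))"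
      using r eta_pos[of n] pos by (intro divide_left_mono mult_left_mono mult_pos_pos) auto
    also have "... = 30720 * cmod (w n - 1) ^ 3 / eta n" by (simp add: power_divide)
    also have "... = 30720 / a * cmod (?y n) ^ 3 * (1 / x)"
      unfolding norm_mult norm_of_real x_def[symmetric] eta_def a_def[symmetric] x(2)
      using x(1) a by (simp add: field_simps power2_eq_square power3_eq_cube)
    finally show ?case by (simp add: x_def)
  qed
  have "(\<lambda>n. 30720 / a * cmod (?y n) ^ 3 * (1 / rnu n)) \<longlonglongrightarrow> 30720 / a * cmod (\<i> * of_real (\<tau> / sqrt var_rate)) ^ 3 * 0"
    by (intro tendsto_intros ysc_lim[OF t_pos] inverse_sqrt_nu_lim)
  then show "(\<lambda>n. 30720 / a * cmod (?y n) ^ 3 * (1 / rnu n)) \<longlonglongrightarrow> 0" by simp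
qed

lemma eventually_eps_le: "EV n. eps n \<le> 1"
  using order_tendstoD(2)[OF eps_lim, of 1] by (auto elim: eventually_mono)

lemma eventually_wn_close: "e > 0 \<Longrightarrow> EV n. cmod (w n - 1) \<le> e"
  using order_tendstoD(2)[OF char_pt_minus_1_lim[OF t_pos, of \<tau>], of e] by (auto elim: eventually_mono)

lemma Zarc_approx:
  "EV n. \<forall>s\<in>{-1..1}. cmod (phase n * Zarc n s - saddle_ratio n s * exp (E_arc n s))
     \<le> cmod (saddle_ratio n s * exp (E_arc n s)) * eps n"
  using eventually_eps_le eventually_wn_close[of "1 / 16", simplified]
proof eventually_elim
  case (elim n)
  show ?case
  proof
    fix s :: real assume s: "s \<in> {-1..1}"
    define q where "q = qpt n s"
    define X where "X = (w n - 1) * hook_mean t q - (w n - 1)\<^sup>2 * hook_corr t q / 2"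
    define L where "L = exp (log_P_approx (zpt (eta n) s))"
    have q: "cmod q < 1" "cmod q = exp (- eta n)" using eta_pos[of n] by (simp_all add: q_def)
    have half: "1 / 2 \<le> cmod (1 + q ^ m)" if "m > 0" for m
      unfolding q_def exp_power_eq using that s
      by (intro one_plus_exp_sector_ge sector_scale zpt_in_sector eta_pos) auto
    have e: "eps n = 240 * cmod (w n - 1) ^ 3 / ((1 / 2) ^ 6 * (1 - cmod q))" by (simp add: eps_def q(2))
    have e3: "80 * cmod (w n - 1) ^ 3 / ((1 / 2) ^ 6 * (1 - cmod q)) = eps n / 3" by (simp add: e)
    have "cmod ((\<Sum>n'. bar_gf t (w n) n' * q ^ n') - strict_gf q * exp X) \<le> cmod (strict_gf q * exp X) * eps n"
      unfolding X_def e
    proof (rule norm_bar_count_gf_diff_le[OF t_pos q(1)])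
      show "80 * cmod (w n - 1) ^ 3 / ((1 / 2) ^ 6 * (1 - cmod q)) \<le> 1" unfolding e3 using elim(1) by simp
      show "cmod (w n - 1) / (1 / 2)\<^sup>2 \<le> 1 / 4" using elim(2) by (simp add: power2_eq_square)
    qed (use half in auto)
    then have "cmod (phase n / L) * cmod ((\<Sum>n'. bar_gf t (w n) n' * q ^ n') - strict_gf q * exp X)
      \<le> cmod (phase n / L) * (cmod (strict_gf q * exp X) * eps n)" by (intro mult_left_mono) auto
    moreover have "phase n / L * ((\<Sum>n'. bar_gf t (w n) n' * q ^ n') - strict_gf q * exp X)
      = phase n * Zarc n s - saddle_ratio n s * exp (E_arc n s)"
      and "phase n / L * (strict_gf q * exp X) = saddle_ratio n s * exp (E_arc n s)"
    proof -
      have "exp (E_arc n s) = exp X * phase n"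
        unfolding arc_exponent_def[OF t_pos] phase_def X_def q_def exp_add[symmetric] by simp
      then show "phase n / L * (strict_gf q * exp X) = saddle_ratio n s * exp (E_arc n s)"
        by (simp add: saddle_ratio_def L_def q_def)
      then show "phase n / L * ((\<Sum>n'. bar_gf t (w n) n' * q ^ n') - strict_gf q * exp X)
        = phase n * Zarc n s - saddle_ratio n s * exp (E_arc n s)"
        unfolding right_diff_distrib by (simp add: Zarc_def arc_series_def L_def q_def)
    qed
    ultimately show "cmod (phase n * Zarc n s - saddle_ratio n s * exp (E_arc n s)) \<le> cmod (saddle_ratio n s * exp (E_arc n s)) * eps n"
      by (simp only: norm_mult[symmetric] mult.assoc[symmetric])
  qed
qed

lemma summable_w: "summable (\<lambda>m. cmod (bar_gf t (w n) m) * exp (- eta n) ^ m)"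
  by (rule summable_strict_sum) (use one_le_quadratic eta_pos in \<open>auto simp: norm_power\<close>)

lemma continuous_on_Zarc: "continuous_on {-1..1} (Zarc n)"
  unfolding Zarc_def[abs_def] log_P_approx_def
  by (intro continuous_intros continuous_on_arc_series summable_w) (simp_all add: zpt_neq_0[OF eta_pos])

lemma saddle_ratio_lim: "(\<lambda>n. saddle_ratio n (v / rnu n)) \<longlonglongrightarrow> 1"
proof -
  have "EV n. cmod (saddle_ratio n (v / rnu n) - 1) \<le> 800 * (eta n)\<^sup>2"
    using eventually_sv[of v] eventually_eta_le[OF t_pos] by eventually_elim (rule saddle_ratio_bound; simp)
  moreover have "(\<lambda>n. 800 * (eta n)\<^sup>2) \<longlonglongrightarrow> 800 * 0\<^sup>2" by (intro tendsto_intros eta_tendsto_0)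
  then have "(\<lambda>n. 800 * (eta n)\<^sup>2) \<longlonglongrightarrow> 0" by simp
  ultimately have "(\<lambda>n. saddle_ratio n (v / rnu n) - 1) \<longlonglongrightarrow> 0" by (rule Lim_null_comparison)
  then show ?thesis by (simp add: LIM_zero_iff)
qed

lemma Zarc_lim: "(\<lambda>n. phase n * Zarc n (v / rnu n)) \<longlonglongrightarrow> exp (of_real (lin_coeff \<tau> * v - const_coeff \<tau>))"
proof -
  let ?g = "\<lambda>n. saddle_ratio n (v / rnu n) * exp (E_arc n (v / rnu n))"
  have g: "?g \<longlonglongrightarrow> 1 * exp (of_real (lin_coeff \<tau> * v - const_coeff \<tau>))"
    by (intro tendsto_mult saddle_ratio_lim tendsto_exp arc_exponent_lim[OF t_pos])
  have "EV n. cmod (phase n * Zarc n (v / rnu n) - ?g n) \<le> cmod (?g n) * eps n"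
    using Zarc_approx eventually_sv[of v] by eventually_elim (drule (1) bspec)
  moreover have "(\<lambda>n. cmod (?g n) * eps n) \<longlonglongrightarrow> 0"
    using tendsto_mult[OF tendsto_norm[OF g] eps_lim] by simp
  ultimately have "(\<lambda>n. phase n * Zarc n (v / rnu n) - ?g n) \<longlonglongrightarrow> 0" by (rule Lim_null_comparison)
  from tendsto_add[OF this g] show ?thesis by simp
qed

text \<open>In the constant 4 one factor 2 bounds the saddle ratio and the other bounds 1 plus the
  relative error.\<close>

lemma Zarc_bound:
  "\<exists>K. EV n. \<forall>s\<in>{-1..1}. cmod (phase n * Zarc n s) \<le> (4 * exp K) * exp (K * (rnu n * \<bar>s\<bar>))"
proof -
  obtain K where K: "EV n. \<forall>s\<in>{-1..1}. cmod (E_arc n s) \<le> K + K * (rnu n * \<bar>s\<bar>)"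
    using arc_exponent_bound[OF t_pos, of \<tau>] by (elim exE) (rule that; assumption)
  have "EV n. \<forall>s\<in>{-1..1}. cmod (phase n * Zarc n s) \<le> (4 * exp K) * exp (K * (rnu n * \<bar>s\<bar>))"
    using K Zarc_approx eventually_eps_le eventually_eta_le[OF t_pos]
  proof eventually_elim
    case (elim n)
    show ?case
    proof
      fix s :: real assume s: "s \<in> {-1..1}"
      let ?g = "saddle_ratio n s * exp (E_arc n s)"
      have "(eta n)\<^sup>2 \<le> (1 / 100)\<^sup>2" using elim(4) eta_pos[of n] by (intro power_mono) auto
      then have "800 * (eta n)\<^sup>2 \<le> 1" by (simp add: power2_eq_square)
      then have "cmod (saddle_ratio n s) \<le> 2"
        using saddle_ratio_bound[OF elim(4) s] norm_triangle_ineq[of "saddle_ratio n s - 1" 1] by simp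
      moreover have "cmod (exp (E_arc n s)) \<le> exp (K + K * (rnu n * \<bar>s\<bar>))"
        using norm_exp[of "E_arc n s"] elim(1)[rule_format, OF s] by (meson exp_le_cancel_iff order.trans)
      ultimately have g: "cmod ?g \<le> 2 * exp (K + K * (rnu n * \<bar>s\<bar>))" unfolding norm_mult by (intro mult_mono) auto
      have "cmod (phase n * Zarc n s) \<le> cmod ?g + cmod ?g * eps n"
        using elim(2)[rule_format, OF s] norm_triangle_ineq[of "phase n * Zarc n s - ?g" ?g] by simp
      also have "... \<le> cmod ?g + cmod ?g * 1" using elim(3) by (intro add_left_mono mult_left_mono) auto
      also have "... \<le> 2 * (2 * exp (K + K * (rnu n * \<bar>s\<bar>)))" using g by simp
      finally show "cmod (phase n * Zarc n s) \<le> (4 * exp K) * exp (K * (rnu n * \<bar>s\<bar>))" by (simp add: exp_add)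
    qed
  qed
  then show ?thesis by (rule exI)
qed

text \<open>Reduces to V = 1/(4 a) - 1/(8 a^2) for V = \<open>var_rate\<close> and a = pi^2 / 12.
  The limit of the integral thus agrees with the variance found from the moments, which makes the
  limit law exactly standard.\<close>

lemma gaussian_exponent: "(lin_coeff \<tau>)\<^sup>2 / 4 - const_coeff \<tau> = - \<tau>\<^sup>2 / 2"
proof -
  define p where "p = pi\<^sup>2"
  have p: "p > 6" using power_mono[of 3 pi 2] pi_gt3 by (simp add: p_def)
  have var_rate: "var_rate = 3 * (p - 6) / p\<^sup>2"
  proof -
    have "pi ^ 4 = p\<^sup>2" by (simp add: p_def power_mult[symmetric])
    then have "var_rate = 3 / p - 18 / p\<^sup>2" by (simp add: var_rate_def p_def)
    then show ?thesis using p by (simp add: field_simps power2_eq_square)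
  qed
  have "(sqrt var_rate)\<^sup>2 = var_rate" using var_rate_pos by simp
  then have "(lin_coeff \<tau>)\<^sup>2 = \<tau>\<^sup>2 / ((p / 6)\<^sup>2 * var_rate)" by (simp add: lin_coeff_def[OF t_pos] p_def power_divide power_mult_distrib)
  then have "(lin_coeff \<tau>)\<^sup>2 / 4 - const_coeff \<tau> = \<tau>\<^sup>2 / ((p / 6)\<^sup>2 * var_rate) / 4 - \<tau>\<^sup>2 / (2 * p / 3 * var_rate)"
    by (simp add: const_coeff_def[OF t_pos] p_def)
  also have "... = - \<tau>\<^sup>2 / 2" unfolding var_rate using p by (simp add: divide_simps power2_eq_square) algebra
  finally show ?thesis .
qed

abbreviation "\<kappa> n \<equiv> complex_of_real (2 * pi / eta n / sp_W n)"

lemma card_scaled_lim: "(\<lambda>n. of_real (rnu n) * (strict_count n * \<kappa> n)) \<longlonglongrightarrow> of_real (sqrt pi)"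
proof -
  have "(\<lambda>n. (strict_count n * \<kappa> n) / kmom (nu n) 0 - 1) \<longlonglongrightarrow> 0"
    using half_order_tendsto_0[OF nu_lim, of 3] half_order_card_ratio by simp
  from tendsto_mult[OF tendsto_add[OF this tendsto_const[of 1]] kmom_0_limit[OF nu_lim]]
  have "(\<lambda>n. ((strict_count n * \<kappa> n) / kmom (nu n) 0 - 1 + 1) * (of_real (rnu n) * kmom (nu n) 0)) \<longlonglongrightarrow> of_real (sqrt pi)"
    by simp
  moreover have "EV n. ((strict_count n * \<kappa> n) / kmom (nu n) 0 - 1 + 1) * (of_real (rnu n) * kmom (nu n) 0)
    = of_real (rnu n) * (strict_count n * \<kappa> n)"
    using kmom_0_neq_0 by eventually_elim simp
  ultimately show ?thesis by (rule Lim_transform_eventually)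
qed

text \<open>The arc around the saddle point gives the tilted Gaussian integral. The minor arcs are
  taken with error O(1/\<nu>), which still tends to 0 after multiplication by sqrt \<nu>; they apply
  because w is eventually within 1/25600 of 1.\<close>

lemma numerator_scaled_lim:
  "(\<lambda>n. of_real (rnu n) * (phase n * bar_gf t (w n) n * \<kappa> n)) \<longlonglongrightarrow> of_real (sqrt pi * exp (- \<tau>\<^sup>2 / 2))"
proof -
  obtain K where K: "EV n. \<forall>s\<in>{-1..1}. cmod (phase n * Zarc n s) \<le> (4 * exp K) * exp (K * (rnu n * \<bar>s\<bar>))"
    using Zarc_bound by (elim exE) (rule that; assumption)
  have "(\<lambda>n. of_real (rnu n) * sp_kint n (\<lambda>s. phase n * Zarc n s))
    \<longlonglongrightarrow> integral UNIV (\<lambda>v. of_real (exp (- v\<^sup>2)) * exp (of_real (lin_coeff \<tau> * v - const_coeff \<tau>)))"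
    by (rule laplace_limit[OF nu_lim _ K _ Zarc_lim]) (auto intro!: always_eventually continuous_intros continuous_on_Zarc)
  moreover have "integral UNIV (\<lambda>v. of_real (exp (- v\<^sup>2)) * exp (of_real (lin_coeff \<tau> * v - const_coeff \<tau>))) = complex_of_real (sqrt pi * exp (- \<tau>\<^sup>2 / 2))"
  proof -
    have eq: "of_real (exp (- v\<^sup>2)) * exp (of_real (lin_coeff \<tau> * v - const_coeff \<tau>))
      = of_real (exp (- const_coeff \<tau>)) * complex_of_real (exp (- v\<^sup>2 + lin_coeff \<tau> * v))" for v
      unfolding exp_of_real of_real_mult[symmetric] exp_add[symmetric] by (simp add: algebra_simps)
    have "integral UNIV (\<lambda>v. of_real (exp (- const_coeff \<tau>)) * complex_of_real (exp (- v\<^sup>2 + lin_coeff \<tau> * v)))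
      = complex_of_real (exp (- const_coeff \<tau>) * (sqrt pi * exp ((lin_coeff \<tau>)\<^sup>2 / 4)))"
      by (simp only: integral_mult_right integral_gauss_linear of_real_mult)
    also have "exp (- const_coeff \<tau>) * (sqrt pi * exp ((lin_coeff \<tau>)\<^sup>2 / 4)) = sqrt pi * exp ((lin_coeff \<tau>)\<^sup>2 / 4 - const_coeff \<tau>)"
    proof -
      have "exp (l / 4 - c) = exp (l / 4) * exp (- c)" for l c :: real by (simp only: exp_add[symmetric]) simp
      then show ?thesis by (simp only: mult_ac)
    qed
    finally show ?thesis unfolding eq gaussian_exponent .
  qed
  ultimately have main: "(\<lambda>n. of_real (rnu n) * sp_kint n (\<lambda>s. phase n * Zarc n s)) \<longlonglongrightarrow> of_real (sqrt pi * exp (- \<tau>\<^sup>2 / 2))"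
    by simp
  obtain M where M: "EV n. 2 * (pi / eta n) * (3 * nu n ^ 0 * exp (- (1 / 40) / eta n)) \<le> M / rnu n ^ 2"
    using exp_eta_le[of 3 0 2] by (elim exE) (rule that; assumption)
  define d where "d n = of_real (rnu n) * (phase n * bar_gf t (w n) n * \<kappa> n)
    - of_real (rnu n) * sp_kint n (\<lambda>s. phase n * Zarc n s)" for n
  have "EV n. cmod (d n) \<le> M * (1 / rnu n)"
    using M minor_arc eventually_eta_le_1 eventually_wn_close[of "1 / 25600", simplified]
  proof eventually_elim
    case (elim n)
    have "cmod (bar_gf t (w n) n * \<kappa> n - sp_kint n (Zarc n)) \<le> 2 * (pi / eta n) * (3 * exp (- (1 / 40) / eta n))"
      unfolding Zarc_def
    proof (rule coeff_arc_split[OF elim(3) summable_w])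
      fix s assume s: "1 \<le> \<bar>s\<bar>" "\<bar>s\<bar> \<le> pi / eta n"
      have "cmod (arc_series (bar_gf t (w n)) (eta n) s) * exp (real n * eta n) \<le> 3 * sp_W n * exp (- (1 / 40) / eta n)"
        by (rule elim(2)[rule_format]) (use s elim(4) t_pos in simp)
      then show "cmod (arc_series (bar_gf t (w n)) (eta n) s) * exp (real n * eta n)
        \<le> sp_W n * (3 * exp (- (1 / 40) / eta n))" by (simp only: mult_ac)
    qed simp
    also have "... \<le> M / rnu n ^ 2" using elim(1) by simp
    finally have le: "cmod (bar_gf t (w n) n * \<kappa> n - sp_kint n (Zarc n)) \<le> M / rnu n ^ 2" .
    have "sp_kint n (\<lambda>s. phase n * Zarc n s) = phase n * sp_kint n (Zarc n)"
      unfolding mult.left_commute[of "kernel (nu n) _" "phase n"] by simp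
    then have "d n = of_real (rnu n) * phase n * (bar_gf t (w n) n * \<kappa> n - sp_kint n (Zarc n))"
      unfolding d_def by (simp only: right_diff_distrib mult.assoc)
    then have "cmod (d n) = rnu n * cmod (bar_gf t (w n) n * \<kappa> n - sp_kint n (Zarc n))"
      using nu_pos[of n] by (simp add: norm_mult norm_phase)
    also have "... \<le> rnu n * (M / rnu n ^ 2)" using le nu_pos[of n] by (intro mult_left_mono) auto
    also have "... = M * (1 / rnu n)"
    proof -
      have "x * (M / x ^ 2) = M * (1 / x)" for x :: real by (simp add: power2_eq_square)
      then show ?thesis .
    qed
    finally show ?case .
  qed
  then have "d \<longlonglongrightarrow> 0"
    by (rule Lim_null_comparison) (rule tendsto_mult_right_zero[OF inverse_sqrt_nu_lim])
  from tendsto_add[OF this main] show ?thesis by (simp add: d_def)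
qed

lemma normalized_bar_sum_lim:
  "(\<lambda>n. phase n * bar_gf t (w n) n / strict_count n) \<longlonglongrightarrow> of_real (exp (- \<tau>\<^sup>2 / 2))"
proof -
  have "(\<lambda>n. of_real (rnu n) * (phase n * bar_gf t (w n) n * \<kappa> n)
      / (of_real (rnu n) * (strict_count n * \<kappa> n))) \<longlonglongrightarrow> of_real (sqrt pi * exp (- \<tau>\<^sup>2 / 2)) / of_real (sqrt pi)"
    by (intro tendsto_divide numerator_scaled_lim card_scaled_lim) simp
  moreover have "of_real (rnu n) * (phase n * bar_gf t (w n) n * \<kappa> n)
      / (of_real (rnu n) * (strict_count n * \<kappa> n))
    = phase n * bar_gf t (w n) n / strict_count n" for n
    using nu_pos[of n] eta_pos[of n] sp_W_pos[of n] by simp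
  ultimately show ?thesis by simp
qed

text \<open>With \<psi> = \<tau>/\<sigma> the exponent i \<tau> (N - \<mu>)/\<sigma> is i \<psi> N -
  i \<psi> \<mu>, so every summand is the phase times a power of w, and the average is a coefficient
  of the generating function divided by the count.\<close>

lemma char_DD:
  "char (DD_normalized t n) \<tau>
    = phase n * bar_gf t (w n) n / strict_count n"
proof -
  let ?f = "\<lambda>k. (real k - DD_mean t (2 * n)) / sqrt (DD_variance t (2 * n))"
  have ne: "strict_sets n \<noteq> {}" using card_strict_sets_pos[of n] by auto
  have "char (distr (measure_pmf (DD_unif (2 * n))) borel (\<lambda>\<mu>. ?f (num_hooks_above t \<mu>))) \<tau>
    = measure_pmf.expectation (DD_unif (2 * n)) (\<lambda>\<mu>. iexp (\<tau> * ?f (num_hooks_above t \<mu>)))"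
    unfolding char_def by (rule integral_distr) auto
  also have "... = measure_pmf.expectation (map_pmf (num_hooks_above t) (DD_unif (2 * n))) (\<lambda>k. iexp (\<tau> * ?f k))" by simp
  also have "... = measure_pmf.expectation (pmf_of_set (strict_sets n)) (\<lambda>S. iexp (\<tau> * ?f (bar_count t S)))"
    unfolding map_pmf_DD_unif[OF t_pos] by simp
  also have "... = (\<Sum>S\<in>strict_sets n. pmf (pmf_of_set (strict_sets n)) S *\<^sub>R iexp (\<tau> * ?f (bar_count t S)))"
    by (rule integral_measure_pmf[OF finite_strict_sets]) (use ne finite_strict_sets in simp)
  also have "... = (\<Sum>S\<in>strict_sets n. phase n * w n ^ bar_count t S / strict_count n)"
  proof (rule sum.cong[OF refl])
    fix S assume S: "S \<in> strict_sets n"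
    have "iexp (\<tau> * ?f (bar_count t S)) = phase n * w n ^ bar_count t S"
      unfolding phase_def char_pt_def[OF t_pos] DD_mu_def[OF t_pos] exp_of_nat_mult[symmetric] exp_add[symmetric] angle_def[OF t_pos]
      by (simp add: diff_divide_distrib algebra_simps)
    then show "pmf (pmf_of_set (strict_sets n)) S *\<^sub>R iexp (\<tau> * ?f (bar_count t S)) = phase n * w n ^ bar_count t S / strict_count n"
      using S ne finite_strict_sets by (simp add: scaleR_conv_of_real)
  qed
  also have "... = phase n * bar_gf t (w n) n / strict_count n"
    by (simp add: strict_sum_def sum_distrib_left sum_divide_distrib)
  finally show ?thesis .
qed

end

lemma DD_weak_conv:
  assumes "t > 0"
  shows "weak_conv_m (DD_normalized t) std_normal_distribution"
proof (rule levy_continuity)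
  fix n
  show "real_distribution (DD_normalized t n)"
    by (rule prob_space.real_distribution_distr[OF prob_space_measure_pmf]) simp
next
  show "real_distribution std_normal_distribution" by (rule real_dist_normal_dist)
next
  fix \<tau> :: real
  show "(\<lambda>n. char (DD_normalized t n) \<tau>)
      \<longlonglongrightarrow> char std_normal_distribution \<tau>"
    unfolding char_DD[OF assms] char_std_normal_distribution by (rule normalized_bar_sum_lim[OF assms])
qed

theorem theorem1p4:
  fixes t :: nat
  assumes "t > 0"
  shows
        "(\<lambda>n::nat. DD_mean t (2 * n)
            - (sqrt (3 * real n) / pi + 3 / (2 * pi ^ 2) - real t / 4 + 1 / 4
               - (if even t then 1 else 0) / 8))
          \<in> O(\<lambda>n. real n powr (- 1 / 2)) \<and>
         (\<lambda>n::nat. DD_variance t (2 * n)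
            - ((pi ^ 2 - 6) / (2 * pi ^ 3) * sqrt (3 * real n) - 9 / pi ^ 4 + 3 / (4 * pi ^ 2)
               + (if even t then 1 else 0) / 32))
          \<in> O(\<lambda>n. real n powr (- 1 / 2)) \<and>
         weak_conv_m
          (\<lambda>n::nat. distr (measure_pmf (DD_unif (2 * n))) borel
            (\<lambda>\<mu>. (real (num_hooks_above t \<mu>) - DD_mean t (2 * n)) / sqrt (DD_variance t (2 * n))))
          std_normal_distribution"
  using DD_mean_bigo[OF assms] DD_variance_bigo[OF assms] DD_weak_conv[OF assms] by blast

end
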